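(* Let $F$ be an inner function with $F(0)=0$ that is not a rotation. Let $m$ be the normalized Lebesgue measure on $\partial\mathbb{D}$. Then the Central Limit Theorem holds with respect to $m$ for (1) every real-valued Sobolev multiplier $h \in \mathcal{M}(W^{1/2,2}(\partial\mathbb{D}))$, and (2) every real-valued Hölder continuous function $h \in C^\alpha(\partial\mathbb{D})$ with $\alpha>0$. Furthermore, if $F$ is not a finite Blaschke product and $h$ (as in (1) or (2)) is non-constant, then the limiting variance satisfies $\sigma^2(h)\neq 0$.
   Context: $\mathbb{D}$ is the open unit disk and $m=d\theta/2\pi$ on $\partial\mathbb{D}$. An inner function is a holomorphic map $F:\mathbb{D}\to\mathbb{D}$ such that for a.e. $\theta$ the radial boundary value $F(e^{i\theta}):=\lim_{r\to1}F(re^{i\theta})$ exists and has absolute value 1; this defines $F$ a.e. on $\partial\mathbb{D}$, and $m$ is $F$-invariant when $F(0)=0$. For $h:\partial\mathbb{D}\to\mathbb{R}$ put $S_nh(x)=\sum_{k=0}^{n-1}h(F^{\circ k}(x))$ and $\overline h=\int_{\partial\mathbb{D}}h\,dm$. The Central Limit Theorem holds for $h$ with respect to $m$ if there is a constant $\sigma^2=\sigma^2(h)\ge0$ such that the random variables $\frac{S_nh-n\overline h}{\sqrt n}$ on $(\partial\mathbb{D},m)$ converge in distribution, as $n\to\infty$, to the Gaussian $\mathcal{N}(0,\sigma^2)$ (the point mass at $0$ if $\sigma^2=0$). $W^{1/2,2}(\partial\mathbb{D})$ is the space of $g\in L^2(\partial\mathbb{D})$ with $\sum_{n\in\mathbb{Z}}|n|\,|\hat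 g(n)|^2<\infty$, with its natural norm $\|g\|^2=\sum_n(1+|n|)|\hat g(n)|^2$. A function $\gamma$ belongs to the multiplier space $\mathcal{M}(W^{1/2,2}(\partial\mathbb{D}))$ if $g\gamma\in W^{1/2,2}$ for every $g\in W^{1/2,2}$ (in which case $\|g\gamma\|\le C\|g\|$ for some $C>0$). *)

theory Defs
  imports "HOL-Probability.Probability" "HOL-Complex_Analysis.Complex_Analysis"
begin

text \<open>
  Normalized Lebesgue measure on the unit circle. It is completed, so that all Lebesgue measurable
  functions on the circle are measurable and measurability is insensitive to null sets; the
  underlying space is the circle itself, so functions on the complex plane are only seen through
  their values there.
\<close>

definition circle_measure :: "complex measure" where
  "circle_measure =
     completion (distr (uniform_measure lborel {0..<2 * pi}) (restrict_space borel (sphere 0 1)) cis)"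

definition inner_function :: "(complex \<Rightarrow> complex) \<Rightarrow> bool" where
  "inner_function F \<longleftrightarrow>
     F holomorphic_on ball 0 1 \<and> F \<in> ball 0 1 \<rightarrow> ball 0 1 \<and>
     (AE x in circle_measure. \<exists>l. norm l = 1 \<and> ((\<lambda>r::real. F (of_real r * x)) \<longlongrightarrow> l) (at_left 1))"

text \<open>
  For an inner function the value is arbitrary only on the null set of those points of the circle
  at which the radial limit does not exist.
\<close>

definition boundary_map :: "(complex \<Rightarrow> complex) \<Rightarrow> complex \<Rightarrow> complex" where
  "boundary_map F x = Lim (at_left 1) (\<lambda>r::real. F (of_real r * x))"

definition disk_rotation :: "(complex \<Rightarrow> complex) \<Rightarrow> bool" where
  "disk_rotation F \<longleftrightarrow> (\<exists>c. norm c = 1 \<and> (\<forall>z\<in>ball 0 1. F z = c * z))"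

text \<open>The zeros are listed with multiplicity.\<close>

definition finite_blaschke_product :: "(complex \<Rightarrow> complex) \<Rightarrow> bool" where
  "finite_blaschke_product F \<longleftrightarrow>
     (\<exists>c as. norm c = 1 \<and> set as \<subseteq> ball 0 1 \<and>
        (\<forall>z\<in>ball 0 1. F z = c * (\<Prod>a\<leftarrow>as. (z - a) / (1 - cnj a * z))))"

definition birkhoff_sum :: "(complex \<Rightarrow> complex) \<Rightarrow> (complex \<Rightarrow> real) \<Rightarrow> nat \<Rightarrow> complex \<Rightarrow> real" where
  "birkhoff_sum F h n x = (\<Sum>k<n. h ((boundary_map F ^^ k) x))"

definition centered_gaussian :: "real \<Rightarrow> real measure" where
  "centered_gaussian v =
     (if v = 0 then return borel 0 else density lborel (\<lambda>x. ennreal (normal_density 0 (sqrt v) x)))"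

text \<open>
  The first two conjuncts say that the mean of \<open>h\<close> and the laws of the Birkhoff sums make sense
  (otherwise the integral and \<open>distr\<close> would be junk values).
\<close>

definition CLT_with_variance :: "(complex \<Rightarrow> complex) \<Rightarrow> (complex \<Rightarrow> real) \<Rightarrow> real \<Rightarrow> bool" where
  "CLT_with_variance F h v \<longleftrightarrow>
     integrable circle_measure h \<and>
     (\<forall>n. birkhoff_sum F h n \<in> borel_measurable circle_measure) \<and>
     v \<ge> 0 \<and>
     weak_conv_m
       (\<lambda>n. distr circle_measure borel
          (\<lambda>x. (birkhoff_sum F h n x - real n * (LINT y|circle_measure. h y)) / sqrt (real n)))
       (centered_gaussian v)"

definition CLT_holds :: "(complex \<Rightarrow> complex) \<Rightarrow> (complex \<Rightarrow> real) \<Rightarrow> bool" where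
  "CLT_holds F h \<longleftrightarrow> (\<exists>v. CLT_with_variance F h v)"

definition circle_L2 :: "(complex \<Rightarrow> complex) set" where
  "circle_L2 = {g \<in> borel_measurable circle_measure. integrable circle_measure (\<lambda>x. (norm (g x))\<^sup>2)}"

definition fourier_coefficient :: "(complex \<Rightarrow> complex) \<Rightarrow> int \<Rightarrow> complex" where
  "fourier_coefficient g n = (LINT x|circle_measure. g x * x powi (- n))"

text \<open>Elements are functions rather than almost everywhere classes.\<close>

definition sobolev_half :: "(complex \<Rightarrow> complex) set" where
  "sobolev_half =
     {g \<in> circle_L2. (\<lambda>n::int. \<bar>of_int n\<bar> * (norm (fourier_coefficient g n))\<^sup>2) summable_on UNIV}"

definition sobolev_multipliers :: "(complex \<Rightarrow> complex) set" where
  "sobolev_multipliers = {\<gamma>. \<forall>g\<in>sobolev_half. (\<lambda>x. g x * \<gamma> x) \<in> sobolev_half}"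

definition holder_on :: "real \<Rightarrow> complex set \<Rightarrow> (complex \<Rightarrow> real) \<Rightarrow> bool" where
  "holder_on \<alpha> S h \<longleftrightarrow> (\<exists>C. \<forall>x\<in>S. \<forall>y\<in>S. \<bar>h x - h y\<bar> \<le> C * dist x y powr \<alpha>)"

end

theory Submission
  imports Defs
begin

text \<open>
  Radial limits turn \<open>F\<close> into a measure preserving map \<open>T\<close> of the circle, and harmonic measure at a point \<open>z\<close>
  of the disk is carried by \<open>T\<close> to harmonic measure at \<open>F z\<close> (\<open>distr_poisson_measure\<close>). Everything is read off from
  the motion in the disk through this identity.

  The limit theorem is Gordin's martingale method. Let the transfer operator be the adjoint of composition
  with \<open>T\<close>. If the norms of the transfers of \<open>h\<close> are summable, then \<open>h\<close> differs from a reversed martingale difference by a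
  coboundary, up to errors that are negligible at the scale \<open>sqrt n\<close>, and martingale differences satisfy the
  central limit theorem (\<open>gordin_CLT\<close>).

  Summability comes from the Schwarz lemma. A self-map of the disk that fixes \<open>0\<close> and is not a rotation
  contracts \<open>norm z / (1 - norm z)\<close> by a constant factor on the whole disk (\<open>contraction\<close>). By Littlewood
  subordination, composition with \<open>T ^^ n\<close> therefore shrinks the norm dual to the Dirichlet energy
  geometrically, and so the Dirichlet energy of the transfers decays geometrically
  (\<open>dirichlet_le_transfer\<close>). By Douglas' formula the energy controls the mean oscillation with respect to all harmonic
  measures at once (\<open>osc_le_dirichlet\<close>). A multiplier has finite Dirichlet energy, because constants belong to the
  Sobolev space. A Hoelder function need not have finite energy, but it is the sum of a Poisson average of
  moderate energy and a uniformly small function, and the transfer operator preserves uniform bounds; choosing the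
  scale according to the number of steps again gives geometric decay (\<open>osc_transfer_holder\<close>).

  Suppose that the variance vanishes, for \<open>h\<close> with mean zero. Then \<open>h = v \<circ> T - v\<close>, where \<open>v\<close> is the sum of the transfers
  of \<open>h\<close>. The oscillations of \<open>h\<close> and \<open>v\<close> at \<open>z\<close> tend to zero as \<open>z\<close> approaches the circle, and the oscillation of \<open>v \<circ> T\<close> at \<open>z\<close>
  is the oscillation of \<open>v\<close> at \<open>F z\<close> (\<open>osc_compose_T\<close>). If \<open>F\<close> is not a finite Blaschke product, then points \<open>z\<close> arbitrarily close
  to the circle have images in a fixed compact subset of the disk (\<open>finite_blaschke_productI\<close>), and there a
  small oscillation forces \<open>v\<close> to be constant. Hence \<open>h\<close> is zero (\<open>gordin_tendsto_zero_imp_zero\<close>).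
\<close>

section \<open>Square integrable functions\<close>

definition square_integrable :: "'a measure \<Rightarrow> ('a \<Rightarrow> 'b::{real_normed_field,banach,second_countable_topology}) \<Rightarrow> bool" where
  "square_integrable M f \<longleftrightarrow> f \<in> borel_measurable M \<and> integrable M (\<lambda>x. (norm (f x))\<^sup>2)"

text \<open>A seminorm on functions: nothing is identified almost everywhere, because the transfer operator below is
  applied to representatives. The scalars are the reals and the complex numbers at once.\<close>

definition l2_norm :: "'a measure \<Rightarrow> ('a \<Rightarrow> 'b::{real_normed_field,banach,second_countable_topology}) \<Rightarrow> real" where
  "l2_norm M f = sqrt (LINT x|M. (norm (f x))\<^sup>2)"

lemma square_integrable_measurable [measurable_dest]:
  "square_integrable M f \<Longrightarrow> f \<in> borel_measurable M"
  by (simp add: square_integrable_def)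

lemma square_integrable_sq: "square_integrable M f \<Longrightarrow> integrable M (\<lambda>x. (norm (f x))\<^sup>2)"
  by (simp add: square_integrable_def)

lemma l2_norm_nonneg [simp]: "0 \<le> l2_norm M f"
  by (simp add: l2_norm_def)

lemma l2_norm_sq: "(l2_norm M f)\<^sup>2 = (LINT x|M. (norm (f x))\<^sup>2)"
  by (simp add: l2_norm_def)

lemma integrable_mult_square_integrable:
  assumes "square_integrable M f" "square_integrable M g"
  shows "integrable M (\<lambda>x. f x * g x)"
proof -
  note [measurable] = square_integrable_measurable[OF assms(1)] square_integrable_measurable[OF assms(2)]
  have "integrable M (\<lambda>x. (norm (f x))\<^sup>2 + (norm (g x))\<^sup>2)"
    using assms by (auto simp: square_integrable_def)
  then show ?thesis
  proof (rule Bochner_Integration.integrable_bound)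
    show "AE x in M. norm (f x * g x) \<le> norm ((norm (f x))\<^sup>2 + (norm (g x))\<^sup>2)"
    proof (rule AE_I2)
      fix x
      have "2 * (norm (f x) * norm (g x)) \<le> (norm (f x))\<^sup>2 + (norm (g x))\<^sup>2"
        using sum_squares_bound[of "norm (f x)" "norm (g x)"] by simp
      moreover have "0 \<le> norm (f x) * norm (g x)" by simp
      ultimately have "norm (f x) * norm (g x) \<le> (norm (f x))\<^sup>2 + (norm (g x))\<^sup>2" by linarith
      then show "norm (f x * g x) \<le> norm ((norm (f x))\<^sup>2 + (norm (g x))\<^sup>2)"
        by (simp add: norm_mult)
    qed
  qed simp
qed

lemma square_integrable_norm:
  "square_integrable M f \<Longrightarrow> square_integrable M (\<lambda>x. norm (f x))"
  by (auto simp: square_integrable_def)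

lemma l2_norm_norm [simp]: "l2_norm M (\<lambda>x. norm (f x)) = l2_norm M f"
  by (simp add: l2_norm_def)

lemma square_integrable_of_real:
  fixes f :: "'a \<Rightarrow> real"
  shows "square_integrable M (\<lambda>x. complex_of_real (f x)) \<longleftrightarrow> square_integrable M f"
proof -
  have "(\<lambda>x. complex_of_real (f x)) \<in> borel_measurable M \<longleftrightarrow> f \<in> borel_measurable M"
  proof
    assume "(\<lambda>x. complex_of_real (f x)) \<in> borel_measurable M"
    from measurable_compose[OF this borel_measurable_Re]
    show "f \<in> borel_measurable M" by (simp only: Re_complex_of_real)
  qed simp
  then show ?thesis by (simp only: square_integrable_def norm_of_real real_norm_def)
qed

lemma l2_norm_of_real [simp]: "l2_norm M (\<lambda>x. complex_of_real (f x)) = l2_norm M f"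
  by (simp add: l2_norm_def)

lemma Cauchy_Schwarz_real:
  fixes f g :: "'a \<Rightarrow> real"
  assumes "square_integrable M f" "square_integrable M g"
  shows "(LINT x|M. f x * g x) \<le> l2_norm M f * l2_norm M g"
proof -
  let ?a = "LINT x|M. (f x)\<^sup>2" and ?b = "LINT x|M. f x * g x" and ?c = "LINT x|M. (g x)\<^sup>2"
  have i: "integrable M (\<lambda>x. (f x)\<^sup>2)" "integrable M (\<lambda>x. (g x)\<^sup>2)" "integrable M (\<lambda>x. f x * g x)"
    using assms integrable_mult_square_integrable[OF assms] by (auto simp: square_integrable_def)
  have "0 \<le> (LINT x|M. (?c * f x - ?b * g x)\<^sup>2)" by simp
  also have "(\<lambda>x. (?c * f x - ?b * g x)\<^sup>2) =
     (\<lambda>x. ?c\<^sup>2 * (f x)\<^sup>2 - 2 * ?c * ?b * (f x * g x) + ?b\<^sup>2 * (g x)\<^sup>2)"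
    by (simp add: power2_eq_square algebra_simps)
  also have "(LINT x|M. (?c\<^sup>2 * (f x)\<^sup>2 - 2 * ?c * ?b * (f x * g x) + ?b\<^sup>2 * (g x)\<^sup>2)) =
     ?c\<^sup>2 * ?a - 2 * ?c * ?b * ?b + ?b\<^sup>2 * ?c"
    using i by simp
  also have "\<dots> = ?c * (?c * ?a - ?b\<^sup>2)" by (simp add: power2_eq_square algebra_simps)
  finally have *: "0 \<le> ?c * (?c * ?a - ?b\<^sup>2)" .
  have c: "0 \<le> ?c" "0 \<le> ?a" by simp_all
  show ?thesis
  proof (cases "?c = 0")
    case True
    then have "AE x in M. (g x)\<^sup>2 = 0"
      using integral_nonneg_eq_0_iff_AE[OF i(2)] by simp
    then have "AE x in M. f x * g x = 0" by eventually_elim simp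
    then have "?b = 0" by (subst integral_eq_zero_AE) auto
    then show ?thesis by simp
  next
    case False
    with c have "0 < ?c" by linarith
    have cancel: "0 \<le> y" if "0 < r" "0 \<le> r * y" for r y :: real
      using that by (simp add: zero_le_mult_iff)
    from cancel[OF \<open>0 < ?c\<close> *] have "?b\<^sup>2 \<le> ?a * ?c"
      unfolding mult.commute[of ?a ?c] by linarith
    also have "\<dots> = (l2_norm M f * l2_norm M g)\<^sup>2"
      by (simp add: power_mult_distrib l2_norm_sq)
    finally show ?thesis by (rule power2_le_imp_le) simp
  qed
qed

lemma Cauchy_Schwarz:
  fixes f g :: "'a \<Rightarrow> 'b::{real_normed_field,banach,second_countable_topology}"
  assumes "square_integrable M f" "square_integrable M g"
  shows "norm (LINT x|M. f x * g x) \<le> l2_norm M f * l2_norm M g"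
proof -
  have "norm (LINT x|M. f x * g x) \<le> (LINT x|M. norm (f x * g x))" by (rule integral_norm_bound)
  also have "\<dots> = (LINT x|M. norm (f x) * norm (g x))" by (simp add: norm_mult)
  also have "\<dots> \<le> l2_norm M (\<lambda>x. norm (f x)) * l2_norm M (\<lambda>x. norm (g x))"
    by (intro Cauchy_Schwarz_real square_integrable_norm assms)
  finally show ?thesis by simp
qed

lemma square_integrable_add:
  assumes "square_integrable M f" "square_integrable M g"
  shows "square_integrable M (\<lambda>x. f x + g x)"
  unfolding square_integrable_def
proof safe
  note [measurable] = square_integrable_measurable[OF assms(1)] square_integrable_measurable[OF assms(2)]
  show "(\<lambda>x. f x + g x) \<in> borel_measurable M" by measurable
  have "integrable M (\<lambda>x. 2 * (norm (f x))\<^sup>2 + 2 * (norm (g x))\<^sup>2)"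
    using assms by (auto simp: square_integrable_def)
  then show "integrable M (\<lambda>x. (norm (f x + g x))\<^sup>2)"
  proof (rule Bochner_Integration.integrable_bound)
    show "AE x in M. norm ((norm (f x + g x))\<^sup>2) \<le> norm (2 * (norm (f x))\<^sup>2 + 2 * (norm (g x))\<^sup>2)"
    proof (rule AE_I2)
      fix x
      have "(norm (f x + g x))\<^sup>2 \<le> (norm (f x) + norm (g x))\<^sup>2"
        by (intro power_mono norm_triangle_ineq) simp
      also have "\<dots> \<le> 2 * (norm (f x))\<^sup>2 + 2 * (norm (g x))\<^sup>2"
        using sum_squares_bound[of "norm (f x)" "norm (g x)"] by (simp add: power2_sum)
      finally show "norm ((norm (f x + g x))\<^sup>2) \<le> norm (2 * (norm (f x))\<^sup>2 + 2 * (norm (g x))\<^sup>2)"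
        by simp
    qed
  qed simp
qed

lemma square_integrable_cmult:
  assumes "square_integrable M f"
  shows "square_integrable M (\<lambda>x. c * f x)"
  using assms by (auto simp: square_integrable_def norm_mult power_mult_distrib)

lemma square_integrable_minus:
  "square_integrable M f \<Longrightarrow> square_integrable M (\<lambda>x. - f x)"
  by (auto simp: square_integrable_def)

lemma square_integrable_diff:
  assumes "square_integrable M f" "square_integrable M g"
  shows "square_integrable M (\<lambda>x. f x - g x)"
  using square_integrable_add[OF assms(1) square_integrable_minus[OF assms(2)]] by simp

lemma square_integrable_zero [simp]: "square_integrable M (\<lambda>x. 0)"
  by (simp add: square_integrable_def)

lemma square_integrable_sum:
  assumes "\<And>i. i \<in> I \<Longrightarrow> square_integrable M (f i)"
  shows "square_integrable M (\<lambda>x. \<Sum>i\<in>I. f i x)"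
  using assms by (induction I rule: infinite_finite_induct) (auto intro!: square_integrable_add)

lemma (in finite_measure) square_integrable_bounded:
  fixes f :: "'a \<Rightarrow> 'b::{real_normed_field,banach,second_countable_topology}"
  assumes "f \<in> borel_measurable M" "\<And>x. x \<in> space M \<Longrightarrow> norm (f x) \<le> c"
  shows "square_integrable M f"
  unfolding square_integrable_def
proof safe
  show "integrable M (\<lambda>x. (norm (f x))\<^sup>2)"
  proof (rule integrable_const_bound[where B = "c\<^sup>2"])
    show "AE x in M. norm ((norm (f x))\<^sup>2) \<le> c\<^sup>2"
      using assms(2) by (auto intro!: AE_I2 power_mono)
  qed (use assms(1) in simp)
qed fact

lemma (in finite_measure) square_integrable_const [simp]: "square_integrable M (\<lambda>x. c)"
  by (simp add: square_integrable_def)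

lemma (in finite_measure) integrable_square_integrable:
  "square_integrable M f \<Longrightarrow> integrable M f"
  using integrable_mult_square_integrable[of M f "\<lambda>x. 1"] by simp

lemma (in prob_space) norm_integral_le_l2_norm:
  assumes "square_integrable M f"
  shows "norm (LINT x|M. f x) \<le> l2_norm M f"
  using Cauchy_Schwarz[OF assms square_integrable_const[of 1]] by (simp add: l2_norm_def prob_space)

lemma (in prob_space) integral_norm_le_l2_norm:
  assumes "square_integrable M f"
  shows "(LINT x|M. norm (f x)) \<le> l2_norm M f"
  using norm_integral_le_l2_norm[OF square_integrable_norm[OF assms]] by simp

lemma l2_norm_triangle:
  assumes "square_integrable M f" "square_integrable M g"
  shows "l2_norm M (\<lambda>x. f x + g x) \<le> l2_norm M f + l2_norm M g"
proof (rule power2_le_imp_le)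
  note s = square_integrable_sq[OF assms(1)] square_integrable_sq[OF assms(2)]
    square_integrable_sq[OF square_integrable_add[OF assms]]
    integrable_mult_square_integrable[OF square_integrable_norm square_integrable_norm, OF assms]
  have "(l2_norm M (\<lambda>x. f x + g x))\<^sup>2 \<le>
      (LINT x|M. ((norm (f x))\<^sup>2 + (norm (g x))\<^sup>2 + 2 * (norm (f x) * norm (g x))))"
    unfolding l2_norm_sq
  proof (rule integral_mono)
    fix x
    have "(norm (f x + g x))\<^sup>2 \<le> (norm (f x) + norm (g x))\<^sup>2"
      by (intro power_mono norm_triangle_ineq) simp
    then show "(norm (f x + g x))\<^sup>2 \<le> (norm (f x))\<^sup>2 + (norm (g x))\<^sup>2 + 2 * (norm (f x) * norm (g x))"
      by (simp add: power2_sum algebra_simps)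
  qed (use s in auto)
  also have "\<dots> = (l2_norm M f)\<^sup>2 + (l2_norm M g)\<^sup>2 + 2 * (LINT x|M. norm (f x) * norm (g x))"
    unfolding l2_norm_sq using s by simp
  also have "(LINT x|M. norm (f x) * norm (g x)) \<le> l2_norm M f * l2_norm M g"
    using Cauchy_Schwarz_real[OF square_integrable_norm square_integrable_norm, OF assms] by simp
  finally show "(l2_norm M (\<lambda>x. f x + g x))\<^sup>2 \<le> (l2_norm M f + l2_norm M g)\<^sup>2"
    by (simp add: power2_sum)
qed simp

lemma l2_norm_cmult: "l2_norm M (\<lambda>x. c * f x) = norm c * l2_norm M f"
  by (simp add: l2_norm_def norm_mult power_mult_distrib real_sqrt_mult)

lemma l2_norm_minus: "l2_norm M (\<lambda>x. - f x) = l2_norm M f"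
  by (simp add: l2_norm_def)

lemma l2_norm_minus_commute: "l2_norm M (\<lambda>x. f x - g x) = l2_norm M (\<lambda>x. g x - f x)"
  by (simp add: l2_norm_def norm_minus_commute)

lemma l2_norm_diff_triangle:
  assumes "square_integrable M f" "square_integrable M g"
  shows "l2_norm M (\<lambda>x. f x - g x) \<le> l2_norm M f + l2_norm M g"
  using l2_norm_triangle[OF assms(1) square_integrable_minus[OF assms(2)]] by (simp add: l2_norm_minus)

lemma l2_norm_diff_ge:
  assumes "square_integrable M f" "square_integrable M g"
  shows "\<bar>l2_norm M f - l2_norm M g\<bar> \<le> l2_norm M (\<lambda>x. f x - g x)"
  using l2_norm_triangle[OF square_integrable_diff[OF assms] assms(2)]
    l2_norm_triangle[OF square_integrable_diff[OF assms(2) assms(1)] assms(1)]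
    l2_norm_minus_commute[of M f g]
  by simp

lemma l2_norm_sum:
  assumes "\<And>i. i \<in> I \<Longrightarrow> square_integrable M (f i)"
  shows "l2_norm M (\<lambda>x. \<Sum>i\<in>I. f i x) \<le> (\<Sum>i\<in>I. l2_norm M (f i))"
  using assms
proof (induction I rule: infinite_finite_induct)
  case (insert i I)
  have "l2_norm M (\<lambda>x. f i x + (\<Sum>i\<in>I. f i x)) \<le> l2_norm M (f i) + l2_norm M (\<lambda>x. \<Sum>i\<in>I. f i x)"
    by (intro l2_norm_triangle square_integrable_sum insert) auto
  then show ?case using insert by fastforce
qed (auto simp: l2_norm_def)

lemma l2_norm_cong:
  assumes "\<And>x. x \<in> space M \<Longrightarrow> f x = g x"
  shows "l2_norm M f = l2_norm M g"
  unfolding l2_norm_def using assms by (intro arg_cong[where f = sqrt] Bochner_Integration.integral_cong) auto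

lemma square_integrable_cong_AE:
  assumes "AE x in M. f x = g x" "g \<in> borel_measurable M" "square_integrable M f"
  shows "square_integrable M g"
proof -
  have "integrable M (\<lambda>x. (norm (g x))\<^sup>2) \<longleftrightarrow> integrable M (\<lambda>x. (norm (f x))\<^sup>2)"
    using assms by (intro integrable_cong_AE) (auto simp: square_integrable_def)
  then show ?thesis using assms by (auto simp: square_integrable_def)
qed

lemma square_integrable_distr:
  assumes [measurable]: "T \<in> measurable M N" "f \<in> borel_measurable N"
  shows "square_integrable M (\<lambda>x. f (T x)) \<longleftrightarrow> square_integrable (distr M N T) f"
  unfolding square_integrable_def using integrable_distr_eq[of T M N "\<lambda>x. (norm (f x))\<^sup>2"] by auto

lemma l2_norm_distr:
  assumes [measurable]: "T \<in> measurable M N" "f \<in> borel_measurable N"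
  shows "l2_norm (distr M N T) f = l2_norm M (\<lambda>x. f (T x))"
  unfolding l2_norm_def by (subst integral_distr) auto

lemma (in prob_space) l2_norm_bound:
  assumes "f \<in> borel_measurable M" "\<And>x. x \<in> space M \<Longrightarrow> norm (f x) \<le> c" "0 \<le> c"
  shows "l2_norm M f \<le> c"
proof -
  have "(LINT x|M. (norm (f x))\<^sup>2) \<le> (LINT x|M. c\<^sup>2)"
    using square_integrable_sq[OF square_integrable_bounded[OF assms(1,2)]] assms
    by (intro integral_mono) (auto intro!: power_mono)
  then show ?thesis using assms(3) by (simp add: l2_norm_def prob_space real_le_lsqrt)
qed

text \<open>Bounded functions are dense: this is truncation and dominated convergence.\<close>

lemma truncation_tendsto:
  fixes f :: "'a \<Rightarrow> real"
  assumes "square_integrable M f"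
  shows "(\<lambda>m. l2_norm M (\<lambda>x. f x - max (- real m) (min (real m) (f x)))) \<longlonglongrightarrow> 0"
proof -
  note [measurable] = square_integrable_measurable[OF assms]
  have "(\<lambda>m. LINT x|M. (f x - max (- real m) (min (real m) (f x)))\<^sup>2) \<longlonglongrightarrow> (LINT x|M. 0)"
  proof (rule integral_dominated_convergence[where w = "\<lambda>x. (f x)\<^sup>2"])
    show "integrable M (\<lambda>x. (f x)\<^sup>2)" using square_integrable_sq[OF assms] by simp
    show "AE x in M. (\<lambda>m. (f x - max (- real m) (min (real m) (f x)))\<^sup>2) \<longlonglongrightarrow> 0"
    proof (rule AE_I2, rule tendsto_eventually)
      fix x
      obtain m0 :: nat where "\<bar>f x\<bar> \<le> real m0" using real_arch_simple by blast
      then have "\<forall>m\<ge>m0. (f x - max (- real m) (min (real m) (f x)))\<^sup>2 = 0" by auto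
      then show "\<forall>\<^sub>F m in sequentially. (f x - max (- real m) (min (real m) (f x)))\<^sup>2 = 0"
        by (auto simp: eventually_sequentially)
    qed
    fix m :: nat
    show "AE x in M. norm ((f x - max (- real m) (min (real m) (f x)))\<^sup>2) \<le> (f x)\<^sup>2"
      by (rule AE_I2) (auto simp: abs_le_square_iff[symmetric])
  qed auto
  from tendsto_real_sqrt[OF this] show ?thesis by (simp add: l2_norm_def)
qed

section \<open>Measure preserving maps and their transfer operators\<close>

locale measure_preserving = prob_space +
  fixes T :: "'a \<Rightarrow> 'a"
  assumes T_measurable [measurable]: "T \<in> measurable M M"
    and distr_T: "distr M M T = M"
begin

lemma iterate_measurable [measurable]: "T ^^ n \<in> measurable M M"
  by (induction n) (auto simp: id_def[symmetric])

lemma distr_iterate: "distr M M (T ^^ n) = M"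
proof (induction n)
  case 0
  then show ?case by (simp add: id_def)
next
  case (Suc n)
  have "distr M M (T ^^ Suc n) = distr (distr M M (T ^^ n)) M T"
    by (subst distr_distr) auto
  then show ?case by (simp only: Suc distr_T)
qed

lemma integral_iterate:
  fixes f :: "'a \<Rightarrow> 'b::{banach,second_countable_topology}"
  assumes "f \<in> borel_measurable M"
  shows "(LINT x|M. f ((T ^^ n) x)) = (LINT x|M. f x)"
  using integral_distr[OF iterate_measurable assms, of n] distr_iterate by simp

lemma square_integrable_iterate:
  "square_integrable M f \<Longrightarrow> square_integrable M (\<lambda>x. f ((T ^^ n) x))"
  using square_integrable_distr[OF iterate_measurable, of f n] distr_iterate
  by (auto simp: square_integrable_def)

lemma l2_norm_iterate:
  "f \<in> borel_measurable M \<Longrightarrow> l2_norm M (\<lambda>x. f ((T ^^ n) x)) = l2_norm M f"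
  using l2_norm_distr[OF iterate_measurable, of f n] distr_iterate by simp

lemma AE_iterate:
  assumes "AE x in M. Q x"
  shows "AE x in M. Q ((T ^^ n) x)"
proof -
  have "AE x in distr M M (T ^^ n). Q x" by (subst distr_iterate) (rule assms)
  then show ?thesis by (rule AE_distrD[OF iterate_measurable])
qed

lemmas integral_T = integral_iterate[where n = 1, simplified]
  and square_integrable_T = square_integrable_iterate[where n = 1, simplified]
  and l2_norm_T = l2_norm_iterate[where n = 1, simplified]

text \<open>The adjoint of composition with the \<open>n\<close>-th iterate. It is a relation because \<open>u\<close> is determined only almost
  everywhere.\<close>

definition is_transfer :: "nat \<Rightarrow> ('a \<Rightarrow> real) \<Rightarrow> ('a \<Rightarrow> real) \<Rightarrow> bool" where
  "is_transfer n f u \<longleftrightarrow> square_integrable M u \<and>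
     (\<forall>g. square_integrable M g \<longrightarrow> (LINT x|M. f x * g ((T ^^ n) x)) = (LINT x|M. u x * g x))"

lemma is_transferD:
  assumes "is_transfer n f u"
  shows "square_integrable M u"
    and "square_integrable M g \<Longrightarrow> (LINT x|M. f x * g ((T ^^ n) x)) = (LINT x|M. u x * g x)"
  using assms by (auto simp: is_transfer_def)

text \<open>The image under \<open>T ^^ n\<close> of the measure with density \<open>f\<close> is absolutely continuous, since preimages of null
  sets are null; its Radon-Nikodym derivative is the transfer of \<open>f\<close>.\<close>

lemma RN_transfer:
  assumes [measurable]: "f \<in> borel_measurable M" and f: "integrable M f" "\<And>x. 0 \<le> f x"
  obtains u where "u \<in> borel_measurable M" "\<And>x. 0 \<le> (u x :: real)" "integrable M u"
    "\<And>g::'a \<Rightarrow> real. g \<in> borel_measurable M \<Longrightarrow>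
        (LINT x|M. f x * g ((T ^^ n) x)) = (LINT x|M. u x * g x)"
proof -
  let ?N = "density M (\<lambda>x. ennreal (f x))"
  let ?nu = "distr ?N M (T ^^ n)"
  have Tn [measurable]: "T ^^ n \<in> measurable ?N M" by simp
  have ac: "absolutely_continuous M ?nu"
    unfolding absolutely_continuous_def
  proof
    fix A assume A: "A \<in> null_sets M"
    then have [measurable]: "A \<in> sets M" by auto
    have "emeasure M ((T ^^ n) -` A \<inter> space M) = emeasure (distr M M (T ^^ n)) A"
      by (subst emeasure_distr) auto
    then have "(T ^^ n) -` A \<inter> space M \<in> null_sets M"
      using A distr_iterate by (auto simp: null_sets_def)
    moreover have "absolutely_continuous M ?N"
      by (rule absolutely_continuousI_density) measurable
    ultimately have "(T ^^ n) -` A \<inter> space M \<in> null_sets ?N"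
      by (auto simp: absolutely_continuous_def)
    then show "A \<in> null_sets ?nu"
      by (auto simp: null_sets_def emeasure_distr)
  qed
  define l where "l = RN_deriv M ?nu"
  have l [measurable]: "l \<in> borel_measurable M" by (simp add: l_def)
  have dl: "density M l = ?nu"
    unfolding l_def using ac by (intro density_RN_deriv) auto
  have int_f: "(\<integral>\<^sup>+x. ennreal (f x) \<partial>M) < \<infinity>"
    using f integrable_iff_bounded[of M f] by auto
  have "(\<integral>\<^sup>+x. l x \<partial>M) = emeasure (density M l) (space M)"
    by (subst emeasure_density) (auto intro!: nn_integral_cong)
  also have "\<dots> = emeasure ?N (space M)"
    unfolding dl by (subst emeasure_distr) (auto simp: measurable_space[OF iterate_measurable] intro!: arg_cong[where f="emeasure _"])
  also have "\<dots> = (\<integral>\<^sup>+x. ennreal (f x) \<partial>M)"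
    by (subst emeasure_density) (auto intro!: nn_integral_cong)
  finally have int_l: "(\<integral>\<^sup>+x. l x \<partial>M) < \<infinity>" using int_f by simp
  then have fin: "AE x in M. l x \<noteq> \<infinity>"
    by (intro nn_integral_PInf_AE) auto
  define u where "u x = enn2real (l x)" for x
  have u [measurable]: "u \<in> borel_measurable M" unfolding u_def by measurable
  have lu: "AE x in M. l x = ennreal (u x)"
    using fin by eventually_elim (simp add: u_def less_top)
  have du: "density M (\<lambda>x. ennreal (u x)) = ?nu"
    unfolding dl[symmetric] using lu by (intro density_cong) (auto elim: eventually_mono)
  show ?thesis
  proof
    show "u \<in> borel_measurable M" by fact
    show "0 \<le> u x" for x by (simp add: u_def)
    have "(\<integral>\<^sup>+x. ennreal (u x) \<partial>M) = (\<integral>\<^sup>+x. l x \<partial>M)"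
      using lu by (intro nn_integral_cong_AE) (auto elim: eventually_mono)
    then show "integrable M u"
      using int_l by (intro integrableI_nonneg) (auto simp: u_def)
    fix g :: "'a \<Rightarrow> real" assume [measurable]: "g \<in> borel_measurable M"
    have "(LINT x|M. f x * g ((T ^^ n) x)) = (LINT x|?N. g ((T ^^ n) x))"
      using f by (subst integral_density) auto
    also have "\<dots> = (LINT x|?nu. g x)"
      by (subst integral_distr) auto
    also have "\<dots> = (LINT x|M. u x * g x)"
      unfolding du[symmetric] by (subst integral_density) (auto simp: u_def)
    finally show "(LINT x|M. f x * g ((T ^^ n) x)) = (LINT x|M. u x * g x)" .
  qed
qed

text \<open>Positive and negative parts reduce this to densities of finite measures. The test functions are bounded
  because \<open>u\<close> is so far only known to be integrable.\<close>

lemma transfer_exists_bounded_tests: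
  assumes f: "square_integrable M f"
  obtains u where "integrable M u"
    "\<And>(g::'a \<Rightarrow> real) c. g \<in> borel_measurable M \<Longrightarrow> (\<And>x. x \<in> space M \<Longrightarrow> \<bar>g x\<bar> \<le> c) \<Longrightarrow>
        (LINT x|M. f x * g ((T ^^ n) x)) = (LINT x|M. u x * g x)"
proof -
  note [measurable] = square_integrable_measurable[OF f]
  have i: "integrable M f" using integrable_square_integrable[OF f] .
  then have i1: "integrable M (\<lambda>x. max 0 (f x))" and i2: "integrable M (\<lambda>x. max 0 (- f x))" by auto
  note m1 = borel_measurable_integrable[OF i1] and m2 = borel_measurable_integrable[OF i2]
  obtain u where u: "integrable M u"
    "\<And>g::'a \<Rightarrow> real. g \<in> borel_measurable M \<Longrightarrow>
        (LINT x|M. max 0 (f x) * g ((T ^^ n) x)) = (LINT x|M. u x * g x)"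
    by (rule RN_transfer[of "\<lambda>x. max 0 (f x)" n, OF m1 i1 max.cobounded1]) (rule that, assumption+)
  obtain v where v: "integrable M v"
    "\<And>g::'a \<Rightarrow> real. g \<in> borel_measurable M \<Longrightarrow>
        (LINT x|M. max 0 (- f x) * g ((T ^^ n) x)) = (LINT x|M. v x * g x)"
    by (rule RN_transfer[of "\<lambda>x. max 0 (- f x)" n, OF m2 i2 max.cobounded1]) (rule that, assumption+)
  show ?thesis
  proof
    show "integrable M (\<lambda>x. u x - v x)" using u v by auto
    fix g :: "'a \<Rightarrow> real" and c assume g [measurable]: "g \<in> borel_measurable M" and b: "\<And>x. x \<in> space M \<Longrightarrow> \<bar>g x\<bar> \<le> c"
    have bi: "integrable M (\<lambda>x. w x * g' x)" if "integrable M w" "g' \<in> borel_measurable M" "\<And>x. x \<in> space M \<Longrightarrow> \<bar>g' x\<bar> \<le> c" for w g' :: "'a \<Rightarrow> real"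
    proof (rule Bochner_Integration.integrable_bound[OF integrable_mult_right[OF that(1), of c]])
      show "(\<lambda>x. w x * g' x) \<in> borel_measurable M" using that by measurable
      show "AE x in M. norm (w x * g' x) \<le> norm (c * w x)"
      proof (rule AE_I2)
        fix x assume "x \<in> space M"
        then have "\<bar>g' x\<bar> * \<bar>w x\<bar> \<le> \<bar>c\<bar> * \<bar>w x\<bar>" using that(3)[of x] by (intro mult_right_mono) auto
        then show "norm (w x * g' x) \<le> norm (c * w x)" by (simp add: abs_mult mult.commute)
      qed
    qed
    have bT: "\<bar>g ((T ^^ n) x)\<bar> \<le> c" if "x \<in> space M" for x
      using b measurable_space[OF iterate_measurable that] by auto
    have "(LINT x|M. f x * g ((T ^^ n) x)) = (LINT x|M. max 0 (f x) * g ((T ^^ n) x) - max 0 (- f x) * g ((T ^^ n) x))"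
      by (intro Bochner_Integration.integral_cong) (auto simp: max_def)
    also have "\<dots> = (LINT x|M. max 0 (f x) * g ((T ^^ n) x)) - (LINT x|M. max 0 (- f x) * g ((T ^^ n) x))"
      using i bT by (intro Bochner_Integration.integral_diff bi) auto
    also have "\<dots> = (LINT x|M. u x * g x) - (LINT x|M. v x * g x)"
      using u(2)[OF g] v(2)[OF g] by simp
    also have "\<dots> = (LINT x|M. (u x - v x) * g x)"
      using bi[OF u(1) g b] bi[OF v(1) g b] by (simp add: left_diff_distrib)
    finally show "(LINT x|M. f x * g ((T ^^ n) x)) = (LINT x|M. (u x - v x) * g x)" .
  qed
qed

end

lemma square_integrable_Re:
  "square_integrable M (g :: 'a \<Rightarrow> complex) \<Longrightarrow> square_integrable M (\<lambda>x. Re (g x))"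
  unfolding square_integrable_def
proof safe
  assume [measurable]: "g \<in> borel_measurable M" and i: "integrable M (\<lambda>x. (norm (g x))\<^sup>2)"
  show "(\<lambda>x. Re (g x)) \<in> borel_measurable M" by measurable
  show "integrable M (\<lambda>x. (norm (Re (g x)))\<^sup>2)"
    by (rule Bochner_Integration.integrable_bound[OF i])
      (auto intro!: AE_I2 simp: abs_le_square_iff[symmetric] abs_Re_le_cmod simp del: power2_abs)
qed

lemma square_integrable_Im:
  "square_integrable M (g :: 'a \<Rightarrow> complex) \<Longrightarrow> square_integrable M (\<lambda>x. Im (g x))"
  unfolding square_integrable_def
proof safe
  assume [measurable]: "g \<in> borel_measurable M" and i: "integrable M (\<lambda>x. (norm (g x))\<^sup>2)"
  show "(\<lambda>x. Im (g x)) \<in> borel_measurable M" by measurable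
  show "integrable M (\<lambda>x. (norm (Im (g x)))\<^sup>2)"
    by (rule Bochner_Integration.integrable_bound[OF i])
      (auto intro!: AE_I2 simp: abs_le_square_iff[symmetric] abs_Im_le_cmod simp del: power2_abs)
qed

text \<open>Serves to upgrade an integrable density to a square integrable one: its truncations are bounded in norm.\<close>

lemma square_integrable_Fatou:
  fixes g :: "nat \<Rightarrow> 'a \<Rightarrow> 'b::{real_normed_field,banach,second_countable_topology}"
  assumes g: "\<And>m. square_integrable M (g m)" and C: "\<And>m. l2_norm M (g m) \<le> C"
    and lim: "AE x in M. (\<lambda>m. g m x) \<longlonglongrightarrow> f x" and [measurable]: "f \<in> borel_measurable M"
  shows "square_integrable M f" "l2_norm M f \<le> C"
proof -
  note [measurable] = square_integrable_measurable[OF g]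
  have C0: "0 \<le> C" using C[of 0] l2_norm_nonneg[of M "g 0"] by linarith
  have *: "(\<integral>\<^sup>+x. ennreal ((norm (g m x))\<^sup>2) \<partial>M) \<le> ennreal (C\<^sup>2)" for m
  proof -
    have "(\<integral>\<^sup>+x. ennreal ((norm (g m x))\<^sup>2) \<partial>M) = ennreal ((l2_norm M (g m))\<^sup>2)"
      unfolding l2_norm_sq by (intro nn_integral_eq_integral square_integrable_sq g) auto
    also have "\<dots> \<le> ennreal (C\<^sup>2)" using C[of m] by (intro ennreal_leI power_mono) auto
    finally show ?thesis .
  qed
  have "(\<integral>\<^sup>+x. ennreal ((norm (f x))\<^sup>2) \<partial>M) = (\<integral>\<^sup>+x. liminf (\<lambda>m. ennreal ((norm (g m x))\<^sup>2)) \<partial>M)"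
  proof (rule nn_integral_cong_AE)
    show "AE x in M. ennreal ((norm (f x))\<^sup>2) = liminf (\<lambda>m. ennreal ((norm (g m x))\<^sup>2))"
      using lim
    proof eventually_elim
      fix x assume "(\<lambda>m. g m x) \<longlonglongrightarrow> f x"
      then have "(\<lambda>m. ennreal ((norm (g m x))\<^sup>2)) \<longlonglongrightarrow> ennreal ((norm (f x))\<^sup>2)"
        by (intro tendsto_ennrealI tendsto_power tendsto_norm)
      from lim_imp_Liminf[OF _ this]
      show "ennreal ((norm (f x))\<^sup>2) = liminf (\<lambda>m. ennreal ((norm (g m x))\<^sup>2))" by simp
    qed
  qed
  also have "\<dots> \<le> liminf (\<lambda>m. \<integral>\<^sup>+x. ennreal ((norm (g m x))\<^sup>2) \<partial>M)"
    by (rule nn_integral_liminf) measurable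
  also have "\<dots> \<le> liminf (\<lambda>m. ennreal (C\<^sup>2))"
    by (intro Liminf_mono always_eventually allI *)
  also have "\<dots> = ennreal (C\<^sup>2)" by (simp add: Liminf_const)
  finally have le: "(\<integral>\<^sup>+x. ennreal ((norm (f x))\<^sup>2) \<partial>M) \<le> ennreal (C\<^sup>2)" .
  then have i: "integrable M (\<lambda>x. (norm (f x))\<^sup>2)"
    by (intro integrableI_bounded) (auto simp: le_less_trans)
  then show s: "square_integrable M f" by (auto simp: square_integrable_def)
  have "ennreal ((l2_norm M f)\<^sup>2) \<le> ennreal (C\<^sup>2)"
    unfolding l2_norm_sq using le i by (subst (asm) nn_integral_eq_integral) auto
  then show "l2_norm M f \<le> C"
    using C0 by (auto simp: ennreal_le_iff intro: power2_le_imp_le)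
qed

context measure_preserving
begin

lemma integral_truncation_tendsto:
  fixes u g :: "'a \<Rightarrow> real"
  assumes u: "square_integrable M u" and g: "square_integrable M g"
  shows "(\<lambda>m. LINT x|M. u x * max (- real m) (min (real m) (g ((T ^^ n) x)))) \<longlonglongrightarrow> (LINT x|M. u x * g ((T ^^ n) x))"
proof -
  note [measurable] = square_integrable_measurable[OF g] square_integrable_measurable[OF u]
  let ?g = "\<lambda>x. g ((T ^^ n) x)"
  have g': "square_integrable M ?g" using square_integrable_iterate[OF g] .
  have t: "square_integrable M (\<lambda>x. max (- real m) (min (real m) (?g x)))" for m :: nat
    by (rule square_integrable_bounded[where c = m]) auto
  show ?thesis
  proof (rule Lim_null_comparison[THEN Lim_null[THEN iffD2]])
    show "(\<lambda>m. l2_norm M u * l2_norm M (\<lambda>x. ?g x - max (- real m) (min (real m) (?g x)))) \<longlonglongrightarrow> 0"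
      using tendsto_mult[OF tendsto_const truncation_tendsto[OF g']] by fastforce
    show "\<forall>\<^sub>F m in sequentially. norm ((LINT x|M. u x * max (- real m) (min (real m) (?g x))) - (LINT x|M. u x * ?g x))
        \<le> l2_norm M u * l2_norm M (\<lambda>x. ?g x - max (- real m) (min (real m) (?g x)))"
    proof (intro always_eventually allI)
      fix m :: nat
      have "(LINT x|M. u x * max (- real m) (min (real m) (?g x))) - (LINT x|M. u x * ?g x) =
          - (LINT x|M. u x * (?g x - max (- real m) (min (real m) (?g x))))"
        using integrable_mult_square_integrable[OF u g'] integrable_mult_square_integrable[OF u t[of m]]
        by (simp add: right_diff_distrib)
      then show "norm ((LINT x|M. u x * max (- real m) (min (real m) (?g x))) - (LINT x|M. u x * ?g x))
        \<le> l2_norm M u * l2_norm M (\<lambda>x. ?g x - max (- real m) (min (real m) (?g x)))"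
        using Cauchy_Schwarz[OF u square_integrable_diff[OF g' t[of m]]] by simp
    qed
  qed
qed

text \<open>Testing against truncations of \<open>u\<close> itself bounds their norms by the norm of \<open>f\<close>.\<close>

lemma transfer_exists:
  assumes f: "square_integrable M f"
  shows "\<exists>u. is_transfer n f u"
proof -
  note [measurable] = square_integrable_measurable[OF f]
  obtain u where u: "integrable M u"
    "\<And>(g::'a \<Rightarrow> real) c. g \<in> borel_measurable M \<Longrightarrow> (\<And>x. x \<in> space M \<Longrightarrow> \<bar>g x\<bar> \<le> c) \<Longrightarrow>
        (LINT x|M. f x * g ((T ^^ n) x)) = (LINT x|M. u x * g x)"
    using transfer_exists_bounded_tests[OF f, of n] by blast
  have [measurable]: "u \<in> borel_measurable M" using u(1) by auto
  define g where "g m x = (if \<bar>u x\<bar> \<le> real m then u x else 0)" for m x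
  have [measurable]: "g m \<in> borel_measurable M" for m unfolding g_def by measurable
  have gb: "\<bar>g m x\<bar> \<le> real m" for m x by (auto simp: g_def)
  have gs: "square_integrable M (g m)" for m
    by (rule square_integrable_bounded[where c = m]) (use gb in auto)
  have gn: "l2_norm M (g m) \<le> l2_norm M f" for m
  proof -
    have "(l2_norm M (g m))\<^sup>2 = (LINT x|M. u x * g m x)"
      unfolding l2_norm_sq by (intro Bochner_Integration.integral_cong) (auto simp: g_def power2_eq_square)
    also have "\<dots> = (LINT x|M. f x * g m ((T ^^ n) x))"
      by (rule u(2)[of _ "real m", symmetric]) (use gb in auto)
    also have "\<dots> \<le> l2_norm M f * l2_norm M (\<lambda>x. g m ((T ^^ n) x))"
      by (intro Cauchy_Schwarz_real f square_integrable_iterate gs)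
    also have "\<dots> = l2_norm M f * l2_norm M (g m)" by (simp add: l2_norm_iterate)
    finally have "l2_norm M (g m) * l2_norm M (g m) \<le> l2_norm M f * l2_norm M (g m)"
      by (simp add: power2_eq_square)
    then show ?thesis
      using l2_norm_nonneg[of M "g m"] l2_norm_nonneg[of M f] by (cases "l2_norm M (g m) = 0") auto
  qed
  have lim: "AE x in M. (\<lambda>m. g m x) \<longlonglongrightarrow> u x"
  proof (rule AE_I2, rule tendsto_eventually)
    fix x
    obtain m0 :: nat where "\<bar>u x\<bar> \<le> real m0" using real_arch_simple by blast
    then have "\<forall>m\<ge>m0. g m x = u x" by (auto simp: g_def)
    then show "\<forall>\<^sub>F m in sequentially. g m x = u x" by (auto simp: eventually_sequentially)
  qed
  have us: "square_integrable M u"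
    by (rule square_integrable_Fatou(1)[OF gs gn lim]) auto
  have "is_transfer n f u"
    unfolding is_transfer_def
  proof (intro conjI allI impI us)
    fix g :: "'a \<Rightarrow> real" assume g: "square_integrable M g"
    note [measurable] = square_integrable_measurable[OF g]
    have "(\<lambda>m. LINT x|M. f x * max (- real m) (min (real m) (g ((T ^^ n) x)))) \<longlonglongrightarrow> (LINT x|M. f x * g ((T ^^ n) x))"
      by (rule integral_truncation_tendsto[OF f g])
    moreover have "(LINT x|M. f x * max (- real m) (min (real m) (g ((T ^^ n) x)))) =
        (LINT x|M. u x * max (- real m) (min (real m) (g x)))" for m
      by (rule u(2)[of _ "real m"]) auto
    moreover have "(\<lambda>m. LINT x|M. u x * max (- real m) (min (real m) (g x))) \<longlonglongrightarrow> (LINT x|M. u x * g x)"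
      using integral_truncation_tendsto[OF us g, of 0] by simp
    ultimately show "(LINT x|M. f x * g ((T ^^ n) x)) = (LINT x|M. u x * g x)"
      by (auto intro: LIMSEQ_unique)
  qed
  then show ?thesis by blast
qed

lemma is_transfer_norm:
  assumes t: "is_transfer n f u" and f: "square_integrable M f"
  shows "l2_norm M u \<le> l2_norm M f"
proof -
  note u = is_transferD(1)[OF t]
  note [measurable] = square_integrable_measurable[OF u]
  have "(l2_norm M u)\<^sup>2 = (LINT x|M. f x * u ((T ^^ n) x))"
    unfolding is_transferD(2)[OF t u] l2_norm_sq by (simp add: power2_eq_square)
  also have "\<dots> \<le> l2_norm M f * l2_norm M (\<lambda>x. u ((T ^^ n) x))"
    by (intro Cauchy_Schwarz_real f square_integrable_iterate u)
  also have "\<dots> = l2_norm M f * l2_norm M u" by (simp add: l2_norm_iterate)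
  finally have "l2_norm M u * l2_norm M u \<le> l2_norm M f * l2_norm M u"
    by (simp add: power2_eq_square)
  then show ?thesis
    using l2_norm_nonneg[of M u] l2_norm_nonneg[of M f] by (cases "l2_norm M u = 0") auto
qed

lemma is_transfer_cong:
  assumes t: "is_transfer n f u" and e: "AE x in M. u x = w x" and [measurable]: "w \<in> borel_measurable M"
  shows "is_transfer n f w"
  unfolding is_transfer_def
proof (intro conjI allI impI)
  note u = is_transferD(1)[OF t]
  note [measurable] = square_integrable_measurable[OF u]
  show "square_integrable M w" by (rule square_integrable_cong_AE[OF e _ u]) simp
  fix g :: "'a \<Rightarrow> real" assume g: "square_integrable M g"
  note [measurable] = square_integrable_measurable[OF g]
  have "(LINT x|M. u x * g x) = (LINT x|M. w x * g x)"
    using e by (intro integral_cong_AE) (auto elim: eventually_mono)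
  then show "(LINT x|M. f x * g ((T ^^ n) x)) = (LINT x|M. w x * g x)"
    using is_transferD(2)[OF t g] by simp
qed

lemma is_transfer_add:
  assumes f: "square_integrable M f" "square_integrable M f'"
    and t: "is_transfer n f u" "is_transfer n f' u'"
  shows "is_transfer n (\<lambda>x. f x + f' x) (\<lambda>x. u x + u' x)"
  unfolding is_transfer_def
proof (intro conjI allI impI)
  note u = is_transferD(1)[OF t(1)] is_transferD(1)[OF t(2)]
  show "square_integrable M (\<lambda>x. u x + u' x)" by (intro square_integrable_add u)
  fix g :: "'a \<Rightarrow> real" assume g: "square_integrable M g"
  then show "(LINT x|M. (f x + f' x) * g ((T ^^ n) x)) = (LINT x|M. (u x + u' x) * g x)"
    using integrable_mult_square_integrable[OF f(1) square_integrable_iterate[OF g]]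
      integrable_mult_square_integrable[OF f(2) square_integrable_iterate[OF g]]
      integrable_mult_square_integrable[OF u(1) g] integrable_mult_square_integrable[OF u(2) g]
      is_transferD(2)[OF t(1) g] is_transferD(2)[OF t(2) g]
    by (simp add: distrib_right)
qed

lemma is_transfer_minus:
  assumes "is_transfer n f u"
  shows "is_transfer n (\<lambda>x. - f x) (\<lambda>x. - u x)"
  using assms by (auto simp: is_transfer_def square_integrable_minus)

lemma is_transfer_diff:
  assumes "square_integrable M f" "square_integrable M f'" "is_transfer n f u" "is_transfer n f' u'"
  shows "is_transfer n (\<lambda>x. f x - f' x) (\<lambda>x. u x - u' x)"
  using is_transfer_add[OF assms(1) square_integrable_minus[OF assms(2)] assms(3) is_transfer_minus[OF assms(4)]]
  by simp

text \<open>Test against the sign of \<open>u\<close> on the set where \<open>u\<close> exceeds the bound.\<close>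

lemma is_transfer_bounded_AE:
  assumes t: "is_transfer n f u" and f: "square_integrable M f" and b: "\<And>x. x \<in> space M \<Longrightarrow> \<bar>f x\<bar> \<le> c"
  shows "AE x in M. \<bar>u x\<bar> \<le> c"
proof -
  note u = is_transferD(1)[OF t]
  note [measurable] = square_integrable_measurable[OF u] square_integrable_measurable[OF f]
  define g where "g x = (if \<bar>u x\<bar> > c then sgn (u x) else 0)" for x
  have [measurable]: "g \<in> borel_measurable M" unfolding g_def by measurable
  have gs: "square_integrable M g"
    by (rule square_integrable_bounded[where c = 1]) (auto simp: g_def sgn_real_def)
  have ga: "square_integrable M (\<lambda>x. \<bar>g x\<bar>)" using square_integrable_norm[OF gs] by simp
  have "(LINT x|M. u x * g x) = (LINT x|M. f x * g ((T ^^ n) x))"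
    using is_transferD(2)[OF t gs] by simp
  also have "\<dots> \<le> (LINT x|M. c * \<bar>g ((T ^^ n) x)\<bar>)"
  proof (rule integral_mono)
    show "integrable M (\<lambda>x. f x * g ((T ^^ n) x))"
      by (intro integrable_mult_square_integrable f square_integrable_iterate gs)
    show "integrable M (\<lambda>x. c * \<bar>g ((T ^^ n) x)\<bar>)"
      using integrable_square_integrable[OF square_integrable_iterate[OF ga]] by simp
    fix x assume "x \<in> space M"
    have "f x * g ((T ^^ n) x) \<le> \<bar>f x\<bar> * \<bar>g ((T ^^ n) x)\<bar>" by (simp add: abs_mult[symmetric])
    also have "\<dots> \<le> c * \<bar>g ((T ^^ n) x)\<bar>" using b[OF \<open>x \<in> space M\<close>] by (intro mult_right_mono) auto
    finally show "f x * g ((T ^^ n) x) \<le> c * \<bar>g ((T ^^ n) x)\<bar>" .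
  qed
  also have "\<dots> = (LINT x|M. c * \<bar>g x\<bar>)"
    using integral_iterate[of "\<lambda>x. c * \<bar>g x\<bar>" n] by simp
  finally have *: "(LINT x|M. u x * g x - c * \<bar>g x\<bar>) \<le> 0"
    using integrable_mult_square_integrable[OF u gs] integrable_square_integrable[OF ga] by simp
  have c: "0 \<le> c"
  proof -
    obtain x where "x \<in> space M" using not_empty by auto
    then show ?thesis using b[of x] by linarith
  qed
  have eq: "u x * g x - c * \<bar>g x\<bar> = (if \<bar>u x\<bar> > c then \<bar>u x\<bar> - c else 0)" for x
    using c by (auto simp: g_def sgn_real_def)
  have "AE x in M. u x * g x - c * \<bar>g x\<bar> = 0"
  proof (subst integral_nonneg_eq_0_iff_AE[symmetric])
    show "integrable M (\<lambda>x. u x * g x - c * \<bar>g x\<bar>)"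
      using integrable_mult_square_integrable[OF u gs] integrable_square_integrable[OF ga] by simp
    show nn: "AE x in M. 0 \<le> u x * g x - c * \<bar>g x\<bar>" by (rule AE_I2) (simp add: eq)
    show "(LINT x|M. u x * g x - c * \<bar>g x\<bar>) = 0"
      using * integral_nonneg_AE[OF nn] by linarith
  qed
  then show ?thesis
  proof eventually_elim
    fix x assume "u x * g x - c * \<bar>g x\<bar> = 0"
    then show "\<bar>u x\<bar> \<le> c" unfolding eq by (auto split: if_splits)
  qed
qed

lemma is_transfer_complex:
  assumes t: "is_transfer n f u" and f: "square_integrable M f" and g: "square_integrable M g"
  shows "(LINT x|M. complex_of_real (f x) * g ((T ^^ n) x)) = (LINT x|M. complex_of_real (u x) * g x)"
proof (rule complex_eqI)
  note i = integrable_mult_square_integrable[OF f[folded square_integrable_of_real] square_integrable_iterate[OF g], of n]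
    integrable_mult_square_integrable[OF is_transferD(1)[OF t, folded square_integrable_of_real] g]
  show "Re (LINT x|M. complex_of_real (f x) * g ((T ^^ n) x)) = Re (LINT x|M. complex_of_real (u x) * g x)"
    using is_transferD(2)[OF t square_integrable_Re[OF g]] i by (simp add: integral_Re[symmetric])
  show "Im (LINT x|M. complex_of_real (f x) * g ((T ^^ n) x)) = Im (LINT x|M. complex_of_real (u x) * g x)"
    using is_transferD(2)[OF t square_integrable_Im[OF g]] i by (simp add: integral_Im[symmetric])
qed

text \<open>A choice of representatives. For \<open>n = 0\<close> the choice is \<open>f\<close> itself, so that identities between functions
  that involve the zeroth transfer hold at every point.\<close>

definition transfer :: "nat \<Rightarrow> ('a \<Rightarrow> real) \<Rightarrow> 'a \<Rightarrow> real" where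
  "transfer n f = (if n = 0 then f else (SOME u. is_transfer n f u))"

lemma transfer_0 [simp]: "transfer 0 f = f"
  by (simp add: transfer_def)

lemma is_transfer_transfer:
  assumes "square_integrable M f"
  shows "is_transfer n f (transfer n f)"
proof (cases "n = 0")
  case True
  then show ?thesis using assms by (simp add: is_transfer_def)
next
  case False
  then show ?thesis using someI_ex[OF transfer_exists[OF assms, of n]] by (simp only: transfer_def if_False)
qed

lemma square_integrable_transfer:
  "square_integrable M f \<Longrightarrow> square_integrable M (transfer n f)"
  by (rule is_transferD(1)[OF is_transfer_transfer])

text \<open>Turns correlations along the orbit into pairings with transfers, so that summability of the transfers gives
  summability of correlations.\<close>

lemma integral_transfer_iterate:
  assumes f: "square_integrable M f" and g: "square_integrable M g"
  shows "(LINT x|M. transfer n f x * g ((T ^^ k) x)) = (LINT x|M. transfer (n + k) f x * g x)"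
proof -
  have "(LINT x|M. transfer n f x * g ((T ^^ k) x)) = (LINT x|M. f x * g ((T ^^ k) ((T ^^ n) x)))"
    using is_transferD(2)[OF is_transfer_transfer[OF f] square_integrable_iterate[OF g], where n = n] by simp
  also have "\<dots> = (LINT x|M. f x * g ((T ^^ (n + k)) x))"
    by (subst add.commute) (simp add: funpow_add)
  also have "\<dots> = (LINT x|M. transfer (n + k) f x * g x)"
    by (rule is_transferD(2)[OF is_transfer_transfer[OF f] g])
  finally show ?thesis .
qed

end

section \<open>The martingale central limit theorem\<close>

lemma l2_norm_add_sq:
  fixes f g :: "'a \<Rightarrow> real"
  assumes "square_integrable M f" "square_integrable M g"
  shows "(l2_norm M (\<lambda>x. f x + g x))\<^sup>2 = (l2_norm M f)\<^sup>2 + 2 * (LINT x|M. f x * g x) + (l2_norm M g)\<^sup>2"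
proof -
  have "(LINT x|M. (f x + g x)\<^sup>2) = (LINT x|M. (f x)\<^sup>2 + 2 * (f x * g x) + (g x)\<^sup>2)"
    by (simp add: power2_sum algebra_simps)
  also have "\<dots> = (LINT x|M. (f x)\<^sup>2) + 2 * (LINT x|M. f x * g x) + (LINT x|M. (g x)\<^sup>2)"
    using square_integrable_sq[OF assms(1)] square_integrable_sq[OF assms(2)]
      integrable_mult_square_integrable[OF assms] by simp
  finally show ?thesis by (simp add: l2_norm_sq)
qed

lemma abs_exp_neg_diff_le:
  fixes a b :: real
  assumes "0 \<le> a" "0 \<le> b"
  shows "\<bar>exp (- a) - exp (- b)\<bar> \<le> \<bar>a - b\<bar>"
proof -
  have *: "exp (- a) - exp (- b) \<le> b - a" if "0 \<le> a" "a \<le> b" for a b :: real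
  proof -
    have "exp (- a) - exp (- b) = exp (- a) * (1 - exp (a - b))"
      by (simp add: right_diff_distrib flip: exp_add)
    also have "\<dots> \<le> 1 * (1 - exp (a - b))"
      using that by (intro mult_right_mono) auto
    also have "\<dots> \<le> b - a" using exp_ge_add_one_self[of "a - b"] unfolding mult_1 by linarith
    finally show ?thesis .
  qed
  show ?thesis
    using *[of a b] *[of b a] assms by (cases "a \<le> b") auto
qed

lemma norm_one_plus_imaginary_le: "cmod (1 + \<i> * complex_of_real y) \<le> exp (y\<^sup>2 / 2)"
proof (rule power2_le_imp_le)
  have "(cmod (1 + \<i> * complex_of_real y))\<^sup>2 = 1 + y\<^sup>2"
    by (simp add: cmod_power2)
  also have "\<dots> \<le> exp (y\<^sup>2)" by (rule exp_ge_add_one_self)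
  also have "\<dots> = (exp (y\<^sup>2 / 2))\<^sup>2" by (simp add: power2_eq_square flip: exp_add)
  finally show "(cmod (1 + \<i> * complex_of_real y))\<^sup>2 \<le> (exp (y\<^sup>2 / 2))\<^sup>2" .
qed simp

lemma exp_neg_taylor1: "0 \<le> u \<Longrightarrow> \<bar>1 - u - exp (- u)\<bar> \<le> u\<^sup>2" for u :: real
proof -
  assume u: "0 \<le> u"
  have 1: "1 - u \<le> exp (- u)" using exp_ge_add_one_self[of "- u"] by simp
  have "exp (- u) \<le> 1 / (1 + u)"
    using exp_ge_add_one_self[of u] u by (simp add: exp_minus field_simps)
  also have "\<dots> \<le> 1 - u + u\<^sup>2"
    using u by (simp add: field_simps power2_eq_square)
  finally show ?thesis using 1 by simp
qed

text \<open>The first order term stays outside the exponential: products of the factors \<open>1 + \<i> * y\<close> along the orbit of a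
  martingale difference have integral one.\<close>

lemma iexp_second_order:
  assumes y: "\<bar>y\<bar> \<le> 1"
  shows "cmod (iexp y - (1 + \<i> * complex_of_real y) * complex_of_real (exp (- (y\<^sup>2 / 2)))) \<le> \<bar>y\<bar> ^ 3"
proof -
  let ?u = "y\<^sup>2 / 2"
  have e: "\<bar>1 - ?u - exp (- ?u)\<bar> \<le> ?u\<^sup>2" by (rule exp_neg_taylor1) simp
  have e1: "\<bar>1 - exp (- ?u)\<bar> \<le> ?u"
    using exp_ge_add_one_self[of "- ?u"] by simp
  have s: "(\<Sum>k\<le>2. (\<i> * complex_of_real y) ^ k / fact k) = 1 + \<i> * y - complex_of_real ?u"
    by (simp add: numeral_2_eq_2 power_mult_distrib)
  have a: "cmod (iexp y - (1 + \<i> * y - complex_of_real ?u)) \<le> \<bar>y\<bar> ^ 3 / 6"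
    using iexp_approx1[of y 2] unfolding s by (simp add: fact_numeral eval_nat_numeral)
  have eq: "iexp y - (1 + \<i> * complex_of_real y) * complex_of_real (exp (- ?u)) =
     (iexp y - (1 + \<i> * y - complex_of_real ?u)) + (complex_of_real (1 - ?u - exp (- ?u))
       + \<i> * y * complex_of_real (1 - exp (- ?u)))"
    by (simp add: algebra_simps)
  have "cmod (iexp y - (1 + \<i> * complex_of_real y) * complex_of_real (exp (- ?u))) \<le>
     cmod (iexp y - (1 + \<i> * y - complex_of_real ?u)) + (cmod (complex_of_real (1 - ?u - exp (- ?u)))
       + cmod (\<i> * y * complex_of_real (1 - exp (- ?u))))"
    unfolding eq by (intro norm_triangle_mono order_refl)
  also have "\<dots> \<le> \<bar>y\<bar> ^ 3 / 6 + (?u\<^sup>2 + \<bar>y\<bar> * ?u)"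
  proof (intro add_mono a)
    show "cmod (complex_of_real (1 - ?u - exp (- ?u))) \<le> ?u\<^sup>2"
      unfolding norm_of_real by (rule e)
    have "cmod (\<i> * y * complex_of_real (1 - exp (- ?u))) = \<bar>y\<bar> * \<bar>1 - exp (- ?u)\<bar>"
      unfolding norm_mult norm_of_real by simp
    also have "\<dots> \<le> \<bar>y\<bar> * ?u" by (rule mult_left_mono[OF e1 abs_ge_zero])
    finally show "cmod (\<i> * y * complex_of_real (1 - exp (- ?u))) \<le> \<bar>y\<bar> * ?u" .
  qed
  also have "?u\<^sup>2 = \<bar>y\<bar> ^ 3 * \<bar>y\<bar> / 4"
    by (simp add: power2_eq_square power3_eq_cube)
  also have "\<bar>y\<bar> * ?u = \<bar>y\<bar> ^ 3 / 2"
    by (simp add: power2_eq_square power3_eq_cube)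
  also have "\<bar>y\<bar> ^ 3 * \<bar>y\<bar> / 4 \<le> \<bar>y\<bar> ^ 3 / 4"
    using y by (simp add: mult_left_le)
  finally show ?thesis using zero_le_power[OF abs_ge_zero, of y 3] by linarith
qed

lemma norm_integral_le_integral:
  fixes f :: "'a \<Rightarrow> 'b::{banach,second_countable_topology}"
  assumes "integrable M f" "integrable M g" "\<And>x. x \<in> space M \<Longrightarrow> norm (f x) \<le> g x"
  shows "norm (LINT x|M. f x) \<le> (LINT x|M. g x)"
proof -
  have "norm (LINT x|M. f x) \<le> (LINT x|M. norm (f x))" by (rule integral_norm_bound)
  also have "\<dots> \<le> (LINT x|M. g x)" using assms by (intro integral_mono) auto
  finally show ?thesis .
qed

context measure_preserving
begin

definition birkhoff :: "('a \<Rightarrow> real) \<Rightarrow> nat \<Rightarrow> 'a \<Rightarrow> real" where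
  "birkhoff f n x = (\<Sum>k<n. f ((T ^^ k) x))"

lemma birkhoff_Suc: "birkhoff f (Suc n) x = f x + birkhoff f n (T x)"
  unfolding birkhoff_def sum.lessThan_Suc_shift by (simp add: funpow_swap1)

lemma square_integrable_birkhoff:
  "square_integrable M f \<Longrightarrow> square_integrable M (birkhoff f n)"
  unfolding birkhoff_def by (intro square_integrable_sum square_integrable_iterate)

lemma birkhoff_measurable [measurable (raw)]:
  "f \<in> borel_measurable M \<Longrightarrow> birkhoff f n \<in> borel_measurable M"
  unfolding birkhoff_def by (intro borel_measurable_sum measurable_compose[OF iterate_measurable])

lemma birkhoff_diff: "birkhoff (\<lambda>x. f x - g x) n x = birkhoff f n x - birkhoff g n x"
  by (simp add: birkhoff_def sum_subtractf)

lemma integral_mult_birkhoff_T: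
  assumes f: "square_integrable M f" and g: "square_integrable M g"
  shows "(LINT x|M. f x * birkhoff g n (T x)) = (\<Sum>k<n. LINT x|M. f x * g ((T ^^ Suc k) x))"
proof -
  have "(LINT x|M. f x * birkhoff g n (T x)) = (LINT x|M. (\<Sum>k<n. f x * g ((T ^^ Suc k) x)))"
    by (simp add: birkhoff_def sum_distrib_left funpow_swap1)
  also have "\<dots> = (\<Sum>k<n. LINT x|M. f x * g ((T ^^ Suc k) x))"
    by (intro Bochner_Integration.integral_sum integrable_mult_square_integrable f square_integrable_iterate g)
  finally show ?thesis .
qed

lemma l2_norm_birkhoff_Suc_sq:
  assumes f: "square_integrable M f"
  shows "(l2_norm M (birkhoff f (Suc n)))\<^sup>2 =
    (l2_norm M f)\<^sup>2 + 2 * (\<Sum>k<n. LINT x|M. f x * f ((T ^^ Suc k) x)) + (l2_norm M (birkhoff f n))\<^sup>2"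
proof -
  have "birkhoff f (Suc n) = (\<lambda>x. f x + birkhoff f n (T x))" by (simp add: fun_eq_iff birkhoff_Suc)
  then show ?thesis
    using l2_norm_add_sq[OF f square_integrable_T[OF square_integrable_birkhoff[OF f]], of n]
      integral_mult_birkhoff_T[OF f f, of n]
      l2_norm_T[OF square_integrable_measurable[OF square_integrable_birkhoff[OF f, of n]]]
    by simp
qed

text \<open>The hypothesis bounds the sums of correlations of every length, so each step adds a bounded amount.\<close>

lemma l2_norm_birkhoff_sq_le:
  assumes f: "square_integrable M f" and B: "\<And>n. (\<Sum>k<n. LINT x|M. f x * f ((T ^^ Suc k) x)) \<le> B"
  shows "(l2_norm M (birkhoff f n))\<^sup>2 \<le> real n * ((l2_norm M f)\<^sup>2 + 2 * B)"
proof (induction n)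
  case 0
  then show ?case by (simp add: birkhoff_def l2_norm_def)
next
  case (Suc n)
  then show ?case unfolding l2_norm_birkhoff_Suc_sq[OF f] using B[of n] by (simp add: algebra_simps)
qed

lemma l2_norm_birkhoff_le:
  assumes f: "square_integrable M f"
  shows "l2_norm M (birkhoff f n) \<le> real n * l2_norm M f"
proof -
  have "l2_norm M (birkhoff f n) \<le> (\<Sum>k<n. l2_norm M (\<lambda>x. f ((T ^^ k) x)))"
    unfolding birkhoff_def by (intro l2_norm_sum square_integrable_iterate f)
  also have "\<dots> = real n * l2_norm M f"
    using f by (simp add: l2_norm_iterate square_integrable_measurable)
  finally show ?thesis .
qed

text \<open>
  A function is a reverse martingale difference when its transfer vanishes: its compositions
  with the iterates of the map are then orthogonal.
\<close>

abbreviation martingale_difference :: "('a \<Rightarrow> real) \<Rightarrow> bool" where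
  "martingale_difference f \<equiv> is_transfer 1 f (\<lambda>_. 0)"

lemma martingale_differenceD:
  assumes "martingale_difference f" "square_integrable M g"
  shows "(LINT x|M. f x * g (T x)) = 0"
  using is_transferD(2)[OF assms] by simp

lemma l2_norm_birkhoff_martingale:
  assumes f: "square_integrable M f" and m: "martingale_difference f"
  shows "l2_norm M (birkhoff f n) = sqrt (real n) * l2_norm M f"
proof -
  have 0: "(LINT x|M. f x * f ((T ^^ Suc k) x)) = 0" for k
    using martingale_differenceD[OF m square_integrable_iterate[OF f], of k] by (simp add: funpow_swap1)
  have "(l2_norm M (birkhoff f n))\<^sup>2 = real n * (l2_norm M f)\<^sup>2"
  proof (induction n)
    case 0
    then show ?case by (simp add: birkhoff_def l2_norm_def)
  next
    case (Suc n)
    then show ?case unfolding l2_norm_birkhoff_Suc_sq[OF f] 0 by (simp add: algebra_simps)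
  qed
  then have "l2_norm M (birkhoff f n) = sqrt (real n * (l2_norm M f)\<^sup>2)"
    by (metis l2_norm_nonneg real_sqrt_unique)
  then show ?thesis by (simp add: real_sqrt_mult)
qed

text \<open>McLeish's argument. The characteristic function of the Birkhoff sum is compared with the integral of
  \<open>\<Prod>k<n. 1 + \<i> * s * f (T^k x)\<close> times \<open>exp (- s^2 / 2 * \<Sum> f^2)\<close>; the product has integral one, and the sum of squares
  is \<open>n * v\<close> up to a Birkhoff sum of \<open>f^2 - v\<close>.\<close>

lemma clt_bounded_estimate:
  assumes [measurable]: "f \<in> borel_measurable M" and K: "\<And>x. x \<in> space M \<Longrightarrow> \<bar>f x\<bar> \<le> K"
    and m: "martingale_difference f" and sK: "\<bar>s\<bar> * K \<le> 1" and v: "0 \<le> v"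
  shows "cmod ((LINT x|M. iexp (s * birkhoff f n x)) - exp (- (real n * s\<^sup>2 * v / 2))) \<le>
     real n * (\<bar>s\<bar> * K) ^ 3 + exp (real n * (s * K)\<^sup>2 / 2) * (s\<^sup>2 / 2) * l2_norm M (birkhoff (\<lambda>x. (f x)\<^sup>2 - v) n)"
proof -
  define Z where "Z n x = (\<Prod>k<n. 1 + \<i> * complex_of_real (s * f ((T ^^ k) x)))" for n x
  have Zm [measurable]: "Z n \<in> borel_measurable M" for n unfolding Z_def by measurable
  have Tk: "(T ^^ k) x \<in> space M" if "x \<in> space M" for k x
    using measurable_space[OF iterate_measurable that] .
  have fK: "(s * f ((T ^^ k) x))\<^sup>2 \<le> (s * K)\<^sup>2" if "x \<in> space M" for k x
  proof -
    have "\<bar>s * f ((T ^^ k) x)\<bar> \<le> \<bar>s * K\<bar>"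
      using K[OF Tk[OF that, of k]] by (auto simp: abs_mult intro!: mult_left_mono)
    then show ?thesis by (rule abs_le_square_iff[THEN iffD1])
  qed
  have Zb: "cmod (Z n x) \<le> exp (real n * (s * K)\<^sup>2 / 2)" if "x \<in> space M" for n x
  proof -
    have "cmod (Z n x) = (\<Prod>k<n. cmod (1 + \<i> * complex_of_real (s * f ((T ^^ k) x))))"
      by (simp add: Z_def prod_norm)
    also have "\<dots> \<le> (\<Prod>k<n. exp ((s * K)\<^sup>2 / 2))"
    proof (intro prod_mono conjI norm_ge_zero)
      fix k
      show "cmod (1 + \<i> * complex_of_real (s * f ((T ^^ k) x))) \<le> exp ((s * K)\<^sup>2 / 2)"
        by (rule order_trans[OF norm_one_plus_imaginary_le]) (use fK[OF that] in auto)
    qed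
    also have "\<dots> = exp (real n * (s * K)\<^sup>2 / 2)"
      by (simp add: exp_of_nat_mult[symmetric])
    finally show ?thesis .
  qed
  have Zs: "square_integrable M (Z n)" for n
    by (rule square_integrable_bounded[OF Zm Zb])
  have fs: "square_integrable M f"
    by (rule square_integrable_bounded[where c = K]) (use K in auto)
  \<comment> \<open>Every factor but the first is a function of \<open>T x\<close>, so the martingale property removes the first one.\<close>
  have Zint: "(LINT x|M. Z n x) = 1" for n
  proof (induction n)
    case 0
    then show ?case by (simp add: Z_def prob_space)
  next
    case (Suc n)
    have "Z (Suc n) x = Z n (T x) + \<i> * s * (complex_of_real (f x) * Z n (T x))" for x
      unfolding Z_def prod.lessThan_Suc_shift by (simp add: funpow_swap1 algebra_simps)
    then have "(LINT x|M. Z (Suc n) x) = (LINT x|M. Z n (T x) + \<i> * s * (complex_of_real (f x) * Z n (T x)))"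
      by simp
    also have "\<dots> = (LINT x|M. Z n (T x)) + \<i> * s * (LINT x|M. complex_of_real (f x) * Z n (T x))"
      using integrable_square_integrable[OF square_integrable_T[OF Zs[of n]]]
        integrable_mult_square_integrable[OF fs[folded square_integrable_of_real] square_integrable_T[OF Zs[of n]]]
      by simp
    also have "(LINT x|M. complex_of_real (f x) * Z n (T x)) = 0"
      using is_transfer_complex[OF m fs Zs[of n]] by simp
    finally show ?case using integral_T[OF Zm[of n]] Suc by simp
  qed
  let ?E = "\<lambda>x. complex_of_real (exp (- (s\<^sup>2 * birkhoff (\<lambda>x. (f x)\<^sup>2) n x / 2)))"
  let ?c = "complex_of_real (exp (- (real n * s\<^sup>2 * v / 2)))"
  have Qnn: "0 \<le> birkhoff (\<lambda>x. (f x)\<^sup>2) n x" for x by (simp add: birkhoff_def sum_nonneg)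
  have 1: "cmod (iexp (s * birkhoff f n x) - Z n x * ?E x) \<le> real n * (\<bar>s\<bar> * K) ^ 3" if "x \<in> space M" for x
  proof -
    let ?y = "\<lambda>k. s * f ((T ^^ k) x)"
    have y: "\<bar>?y k\<bar> \<le> \<bar>s\<bar> * K" for k
      using K[OF Tk[OF that, of k]] by (auto simp: abs_mult intro!: mult_left_mono)
    have a: "iexp (s * birkhoff f n x) = (\<Prod>k<n. iexp (?y k))"
      by (simp add: birkhoff_def sum_distrib_left exp_sum[symmetric])
    have b: "Z n x * ?E x = (\<Prod>k<n. (1 + \<i> * complex_of_real (?y k)) * complex_of_real (exp (- ((?y k)\<^sup>2 / 2))))"
      by (simp add: Z_def prod.distrib birkhoff_def exp_sum[symmetric] sum_distrib_left sum_negf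
        power_mult_distrib sum_divide_distrib flip: of_real_prod)
    have "cmod (iexp (s * birkhoff f n x) - Z n x * ?E x) \<le>
      (\<Sum>k<n. cmod (iexp (?y k) - (1 + \<i> * complex_of_real (?y k)) * complex_of_real (exp (- ((?y k)\<^sup>2 / 2)))))"
      unfolding a b
    proof (rule norm_prod_diff)
      fix k
      show "cmod (iexp (?y k)) \<le> 1" by simp
      have "cmod ((1 + \<i> * complex_of_real (?y k)) * complex_of_real (exp (- ((?y k)\<^sup>2 / 2)))) \<le>
         exp ((?y k)\<^sup>2 / 2) * exp (- ((?y k)\<^sup>2 / 2))"
        unfolding norm_mult by (intro mult_mono norm_one_plus_imaginary_le) auto
      then show "cmod ((1 + \<i> * complex_of_real (?y k)) * complex_of_real (exp (- ((?y k)\<^sup>2 / 2)))) \<le> 1"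
        by (simp flip: exp_add)
    qed
    also have "\<dots> \<le> (\<Sum>k<n. \<bar>?y k\<bar> ^ 3)"
      by (intro sum_mono iexp_second_order order_trans[OF y sK])
    also have "\<dots> \<le> (\<Sum>k<n. (\<bar>s\<bar> * K) ^ 3)"
      by (intro sum_mono power_mono y) auto
    finally show ?thesis by simp
  qed
  have 2: "cmod (Z n x * (?E x - ?c)) \<le>
      exp (real n * (s * K)\<^sup>2 / 2) * (s\<^sup>2 / 2) * \<bar>birkhoff (\<lambda>x. (f x)\<^sup>2 - v) n x\<bar>" if "x \<in> space M" for x
  proof -
    have "cmod (?E x - ?c) = \<bar>exp (- (s\<^sup>2 * birkhoff (\<lambda>x. (f x)\<^sup>2) n x / 2)) - exp (- (real n * s\<^sup>2 * v / 2))\<bar>"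
      by (metis norm_of_real of_real_diff)
    also have "\<dots> \<le> \<bar>s\<^sup>2 * birkhoff (\<lambda>x. (f x)\<^sup>2) n x / 2 - real n * s\<^sup>2 * v / 2\<bar>"
      using v Qnn by (intro abs_exp_neg_diff_le) auto
    also have "s\<^sup>2 * birkhoff (\<lambda>x. (f x)\<^sup>2) n x / 2 - real n * s\<^sup>2 * v / 2 = (s\<^sup>2 / 2) * birkhoff (\<lambda>x. (f x)\<^sup>2 - v) n x"
      by (simp add: birkhoff_diff) (simp add: birkhoff_def algebra_simps diff_divide_distrib)
    finally have "cmod (?E x - ?c) \<le> (s\<^sup>2 / 2) * \<bar>birkhoff (\<lambda>x. (f x)\<^sup>2 - v) n x\<bar>"
      by (simp add: abs_mult)
    then show ?thesis
      unfolding norm_mult mult.assoc by (intro mult_mono Zb that) auto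
  qed
  have gs: "square_integrable M (birkhoff (\<lambda>x. (f x)\<^sup>2 - v) n)"
  proof (intro square_integrable_birkhoff square_integrable_diff square_integrable_const)
    show "square_integrable M (\<lambda>x. (f x)\<^sup>2)"
      by (rule square_integrable_bounded[where c = "K\<^sup>2"]) (auto simp: abs_le_square_iff[symmetric] intro: order_trans[OF K abs_ge_self])
  qed
  have i1: "integrable M (\<lambda>x. iexp (s * birkhoff f n x))"
    by (rule integrable_const_bound[where B = 1]) auto
  have i2: "integrable M (\<lambda>x. Z n x * ?E x)"
  proof (rule integrable_const_bound[where B = "exp (real n * (s * K)\<^sup>2 / 2) * 1"])
    show "AE x in M. cmod (Z n x * ?E x) \<le> exp (real n * (s * K)\<^sup>2 / 2) * 1"
      using Zb Qnn unfolding norm_mult by (intro AE_I2 mult_mono) auto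
  qed simp
  have i3: "integrable M (Z n)" by (rule integrable_square_integrable[OF Zs])
  let ?I1 = "LINT x|M. iexp (s * birkhoff f n x) - Z n x * ?E x" and ?I2 = "LINT x|M. Z n x * (?E x - ?c)"
  have I1: "cmod ?I1 \<le> real n * (\<bar>s\<bar> * K) ^ 3"
  proof -
    have "cmod ?I1 \<le> (LINT x|M. real n * (\<bar>s\<bar> * K) ^ 3)"
    proof (rule norm_integral_le_integral)
      show "integrable M (\<lambda>x. iexp (s * birkhoff f n x) - Z n x * ?E x)"
        by (rule Bochner_Integration.integrable_diff[OF i1 i2])
    qed (rule integrable_const, rule 1)
    then show ?thesis by (simp add: prob_space)
  qed
  have I2: "cmod ?I2 \<le> exp (real n * (s * K)\<^sup>2 / 2) * (s\<^sup>2 / 2) * l2_norm M (birkhoff (\<lambda>x. (f x)\<^sup>2 - v) n)"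
  proof -
    have "cmod ?I2 \<le> (LINT x|M. exp (real n * (s * K)\<^sup>2 / 2) * (s\<^sup>2 / 2) * \<bar>birkhoff (\<lambda>x. (f x)\<^sup>2 - v) n x\<bar>)"
    proof (rule norm_integral_le_integral)
      show "integrable M (\<lambda>x. exp (real n * (s * K)\<^sup>2 / 2) * (s\<^sup>2 / 2) * \<bar>birkhoff (\<lambda>x. (f x)\<^sup>2 - v) n x\<bar>)"
        by (intro integrable_mult_right integrable_abs integrable_square_integrable gs)
      show "integrable M (\<lambda>x. Z n x * (?E x - ?c))"
        unfolding right_diff_distrib by (intro Bochner_Integration.integrable_diff i2 integrable_mult_left i3)
    qed (rule 2)
    also have "\<dots> = exp (real n * (s * K)\<^sup>2 / 2) * (s\<^sup>2 / 2) * (LINT x|M. \<bar>birkhoff (\<lambda>x. (f x)\<^sup>2 - v) n x\<bar>)"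
      by (rule integral_mult_right_zero)
    also have "\<dots> \<le> exp (real n * (s * K)\<^sup>2 / 2) * (s\<^sup>2 / 2) * l2_norm M (birkhoff (\<lambda>x. (f x)\<^sup>2 - v) n)"
      using integral_norm_le_l2_norm[OF gs] by (intro mult_left_mono) auto
    finally show ?thesis .
  qed
  have "?I1 = (LINT x|M. iexp (s * birkhoff f n x)) - (LINT x|M. Z n x * ?E x)"
    by (rule Bochner_Integration.integral_diff[OF i1 i2])
  moreover have "?I2 = (LINT x|M. Z n x * ?E x) - (LINT x|M. Z n x * ?c)"
    unfolding right_diff_distrib by (rule Bochner_Integration.integral_diff[OF i2 integrable_mult_left[OF i3]])
  moreover have "(LINT x|M. Z n x * ?c) = ?c"
    using Zint[of n] by (simp only: integral_mult_left_zero mult_1)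
  ultimately have "(LINT x|M. iexp (s * birkhoff f n x)) - ?c = ?I1 + ?I2"
    by (simp only: diff_add_cancel add_diff_eq)
  then have "cmod ((LINT x|M. iexp (s * birkhoff f n x)) - ?c) \<le> cmod ?I1 + cmod ?I2"
    by (simp only: norm_triangle_ineq)
  with I1 I2 show ?thesis by linarith
qed

text \<open>With \<open>s = t / sqrt n\<close> the cubic error is of order \<open>1 / sqrt n\<close>, and the other error is an average that tends
  to zero by hypothesis.\<close>

lemma clt_bounded:
  assumes f [measurable]: "f \<in> borel_measurable M" and K: "\<And>x. x \<in> space M \<Longrightarrow> \<bar>f x\<bar> \<le> K"
    and m: "martingale_difference f" and v: "0 \<le> v"
    and erg: "(\<lambda>n. l2_norm M (birkhoff (\<lambda>x. (f x)\<^sup>2 - v) n) / real n) \<longlonglongrightarrow> 0"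
  shows "(\<lambda>n. LINT x|M. iexp (t / sqrt (real n) * birkhoff f n x)) \<longlonglongrightarrow> exp (- (t\<^sup>2 * v / 2))"
proof -
  have K0: "0 \<le> K" using not_empty K by fastforce
  let ?b = "\<lambda>n. (\<bar>t\<bar> * K) ^ 3 / sqrt (real n) + exp ((t * K)\<^sup>2 / 2) * (t\<^sup>2 / 2) * (l2_norm M (birkhoff (\<lambda>x. (f x)\<^sup>2 - v) n) / real n)"
  have "(\<lambda>n. (\<bar>t\<bar> * K) ^ 3 / sqrt (real n)) \<longlonglongrightarrow> 0"
    by (rule real_tendsto_divide_at_top[OF tendsto_const filterlim_compose[OF sqrt_at_top filterlim_real_sequentially]])
  from tendsto_add[OF this tendsto_mult[OF tendsto_const erg]]
  have lim: "?b \<longlonglongrightarrow> 0 + exp ((t * K)\<^sup>2 / 2) * (t\<^sup>2 / 2) * 0" .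
  have "\<forall>\<^sub>F n in sequentially. cmod ((LINT x|M. iexp (t / sqrt (real n) * birkhoff f n x)) - exp (- (t\<^sup>2 * v / 2))) \<le> ?b n"
    using eventually_ge_at_top[of "nat \<lceil>(\<bar>t\<bar> * K)\<^sup>2\<rceil> + 1"]
  proof eventually_elim
    fix n assume n: "nat \<lceil>(\<bar>t\<bar> * K)\<^sup>2\<rceil> + 1 \<le> n"
    then have n0: "0 < real n" by simp
    have "(\<bar>t\<bar> * K)\<^sup>2 \<le> real n" using n by linarith
    then have "\<bar>t\<bar> * K \<le> sqrt (real n)" by (rule real_le_rsqrt)
    then have sK: "\<bar>t / sqrt (real n)\<bar> * K \<le> 1" using n0 by (simp add: field_simps)
    have s2: "(t / sqrt (real n))\<^sup>2 = t\<^sup>2 / real n" using n0 by (simp add: power_divide)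
    have "real n * (\<bar>t / sqrt (real n)\<bar> * K) ^ 3 = (\<bar>t\<bar> * K) ^ 3 * (real n / sqrt (real n) ^ 3)"
      using n0 by (simp add: power_mult_distrib power_divide)
    also have "real n / sqrt (real n) ^ 3 = 1 / sqrt (real n)"
      using n0 by (simp add: power3_eq_cube field_simps)
    finally have c: "real n * (\<bar>t / sqrt (real n)\<bar> * K) ^ 3 = (\<bar>t\<bar> * K) ^ 3 / sqrt (real n)" by simp
    have d: "real n * (t / sqrt (real n))\<^sup>2 * v / 2 = t\<^sup>2 * v / 2"
      unfolding s2 using n0 by simp
    have "real n * (t / sqrt (real n) * K)\<^sup>2 / 2 = (t * K)\<^sup>2 / 2"
      unfolding power_mult_distrib s2 using n0 by simp
    then have e: "exp (real n * (t / sqrt (real n) * K)\<^sup>2 / 2) * ((t / sqrt (real n))\<^sup>2 / 2) * L =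
        exp ((t * K)\<^sup>2 / 2) * (t\<^sup>2 / 2) * (L / real n)" for L
      unfolding s2 by simp
    show "cmod ((LINT x|M. iexp (t / sqrt (real n) * birkhoff f n x)) - exp (- (t\<^sup>2 * v / 2))) \<le> ?b n"
      using clt_bounded_estimate[OF f K m sK v, of n] unfolding c d e .
  qed
  from Lim_null_comparison[OF this] lim show ?thesis by (simp add: Lim_null[symmetric])
qed

section \<open>Gordin's martingale approximation\<close>

text \<open>Truncation destroys the martingale property. Subtracting the transfer of the truncation, composed with the
  map, restores it, and this correction is bounded because transfer operators preserve bounds.\<close>

lemma truncated_martingale_difference:
  assumes f: "square_integrable M f" and m: "martingale_difference f" and e: "0 < e"
  obtains f' K where "f' \<in> borel_measurable M" "\<And>x. x \<in> space M \<Longrightarrow> \<bar>f' x\<bar> \<le> K"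
    "martingale_difference f'" "l2_norm M (\<lambda>x. f x - f' x) < e"
proof -
  note [measurable] = square_integrable_measurable[OF f]
  define g where "g m x = max (- real m) (min (real m) (f x))" for m x
  have gm [measurable]: "g m \<in> borel_measurable M" for m unfolding g_def by measurable
  have gb: "\<bar>g m x\<bar> \<le> real m" for m x unfolding g_def by auto
  have gs: "square_integrable M (g m)" for m
    by (rule square_integrable_bounded[where c = m]) (use gb in auto)
  have "(\<lambda>m. l2_norm M (\<lambda>x. f x - g m x)) \<longlonglongrightarrow> 0"
    unfolding g_def by (rule truncation_tendsto[OF f])
  then have "\<forall>\<^sub>F m in sequentially. l2_norm M (\<lambda>x. f x - g m x) < e / 2"
    using e by (intro order_tendstoD(2)) auto
  then obtain N where N: "l2_norm M (\<lambda>x. f x - g N x) < e / 2"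
    by (auto simp: eventually_sequentially)
  define u where "u = transfer 1 (g N)"
  have u: "is_transfer 1 (g N) u" unfolding u_def by (rule is_transfer_transfer[OF gs])
  note [measurable] = square_integrable_measurable[OF is_transferD(1)[OF u]]
  define w where "w x = max (- real N) (min (real N) (u x))" for x
  have wm [measurable]: "w \<in> borel_measurable M" unfolding w_def by measurable
  have wb: "\<bar>w x\<bar> \<le> real N" for x unfolding w_def by auto
  have "AE x in M. u x = w x"
    using is_transfer_bounded_AE[OF u gs gb]
  proof eventually_elim
    fix x assume "\<bar>u x\<bar> \<le> real N"
    then show "u x = w x" by (auto simp: w_def)
  qed
  then have w: "is_transfer 1 (g N) w" by (rule is_transfer_cong[OF u _ wm])
  note ws = is_transferD(1)[OF w]
  let ?f' = "\<lambda>x. g N x - w (T x)"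
  have fs': "square_integrable M ?f'" by (intro square_integrable_diff gs square_integrable_T ws)
  show ?thesis
  proof
    show "?f' \<in> borel_measurable M" by measurable
    show "\<bar>?f' x\<bar> \<le> real N + real N" for x
      using gb[of N x] wb[of "T x"] by linarith
    show "martingale_difference ?f'"
      unfolding is_transfer_def
    proof (intro conjI allI impI square_integrable_zero)
      fix h :: "'a \<Rightarrow> real" assume h: "square_integrable M h"
      note [measurable] = square_integrable_measurable[OF h]
      have "(LINT x|M. ?f' x * h (T x)) = (LINT x|M. g N x * h (T x)) - (LINT x|M. w (T x) * h (T x))"
        using integrable_mult_square_integrable[OF gs[of N] square_integrable_T[OF h]]
          integrable_mult_square_integrable[OF square_integrable_T[OF ws] square_integrable_T[OF h]]
        by (simp add: left_diff_distrib)
      also have "(LINT x|M. w (T x) * h (T x)) = (LINT x|M. w x * h x)"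
        by (rule integral_T[of "\<lambda>x. w x * h x"]) measurable
      also have "(LINT x|M. g N x * h (T x)) = (LINT x|M. w x * h x)"
        using is_transferD(2)[OF w h] by simp
      finally show "(LINT x|M. ?f' x * h ((T ^^ 1) x)) = (LINT x|M. 0 * h x)" by simp
    qed
    have "is_transfer 1 (\<lambda>x. f x - g N x) (\<lambda>x. 0 - w x)"
      by (rule is_transfer_diff[OF f gs m w])
    from is_transfer_norm[OF this square_integrable_diff[OF f gs]]
    have "l2_norm M w \<le> l2_norm M (\<lambda>x. f x - g N x)" by (simp add: l2_norm_minus)
    moreover have "l2_norm M (\<lambda>x. f x - ?f' x) \<le> l2_norm M (\<lambda>x. f x - g N x) + l2_norm M (\<lambda>x. w (T x))"
      using l2_norm_triangle[OF square_integrable_diff[OF f gs] square_integrable_T[OF ws], of N]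
      by (simp add: algebra_simps)
    ultimately show "l2_norm M (\<lambda>x. f x - ?f' x) < e"
      using N l2_norm_T[OF wm] by linarith
  qed
qed

text \<open>The constant in front of \<open>n\<close> tends to zero with \<open>m\<close>: remainders of the martingale approximation are negligible
  at the scale \<open>sqrt n\<close>.\<close>

lemma l2_norm_birkhoff_transfer_le:
  assumes h: "square_integrable M h" and s: "summable (\<lambda>n. l2_norm M (transfer n h))"
  shows "(l2_norm M (birkhoff (transfer m h) n))\<^sup>2 \<le>
    real n * (3 * (\<Sum>n. l2_norm M (transfer n h)) * l2_norm M (transfer m h))"
proof -
  let ?a = "\<lambda>n. l2_norm M (transfer n h)"
  let ?w = "transfer m h"
  have w: "square_integrable M ?w" by (rule square_integrable_transfer[OF h])
  have B: "(\<Sum>k<n. LINT x|M. ?w x * ?w ((T ^^ Suc k) x)) \<le> suminf ?a * ?a m" for n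
  proof -
    have "(\<Sum>k<n. LINT x|M. ?w x * ?w ((T ^^ Suc k) x)) \<le> (\<Sum>k<n. ?a (m + Suc k) * ?a m)"
    proof (rule sum_mono)
      fix k
      have "(LINT x|M. ?w x * ?w ((T ^^ Suc k) x)) = (LINT x|M. transfer (m + Suc k) h x * ?w x)"
        by (rule integral_transfer_iterate[OF h w])
      also have "\<dots> \<le> ?a (m + Suc k) * ?a m"
        by (intro Cauchy_Schwarz_real square_integrable_transfer h)
      finally show "(LINT x|M. ?w x * ?w ((T ^^ Suc k) x)) \<le> ?a (m + Suc k) * ?a m" .
    qed
    also have "\<dots> = (\<Sum>j\<in>(\<lambda>k. m + Suc k) ` {..<n}. ?a j) * ?a m"
      by (subst sum.reindex) (auto simp: inj_on_def sum_distrib_right)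
    also have "\<dots> \<le> suminf ?a * ?a m"
      by (intro mult_right_mono sum_le_suminf s) auto
    finally show ?thesis .
  qed
  have am: "?a m \<le> suminf ?a"
    using sum_le_suminf[OF s, of "{m}"] by simp
  have "(l2_norm M (birkhoff ?w n))\<^sup>2 \<le> real n * ((?a m)\<^sup>2 + 2 * (suminf ?a * ?a m))"
    by (rule l2_norm_birkhoff_sq_le[OF w B])
  also have "\<dots> \<le> real n * (suminf ?a * ?a m + 2 * (suminf ?a * ?a m))"
    using am by (intro mult_left_mono add_right_mono) (auto simp: power2_eq_square intro!: mult_right_mono)
  finally show ?thesis by (simp add: algebra_simps)
qed

text \<open>Functions with summable transfers have Birkhoff sums of order \<open>sqrt n\<close>, and approximation carries the
  vanishing of the averages over to their closure. Once mean zero functions lie in that closure, this is the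
  mean ergodic theorem with a constant limit.\<close>

lemma birkhoff_average_tendsto_0:
  assumes f: "square_integrable M f"
    and dense: "\<And>e. 0 < e \<Longrightarrow> \<exists>p. square_integrable M p \<and> l2_norm M (\<lambda>x. f x - p x) < e \<and>
      summable (\<lambda>n. l2_norm M (transfer n p))"
  shows "(\<lambda>n. l2_norm M (birkhoff f n) / real n) \<longlonglongrightarrow> 0"
proof (rule LIMSEQ_I)
  fix e :: real assume e: "0 < e"
  obtain p where p: "square_integrable M p" "l2_norm M (\<lambda>x. f x - p x) < e / 2"
    "summable (\<lambda>n. l2_norm M (transfer n p))"
    using dense[of "e / 2"] e by auto
  let ?C = "3 * (\<Sum>n. l2_norm M (transfer n p)) * l2_norm M (transfer 0 p)"
  have C: "0 \<le> ?C" by (intro mult_nonneg_nonneg suminf_nonneg p) auto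
  have lim: "(\<lambda>n. sqrt ?C / sqrt (real n)) \<longlonglongrightarrow> 0"
    by (rule real_tendsto_divide_at_top[OF tendsto_const filterlim_compose[OF sqrt_at_top filterlim_real_sequentially]])
  have "\<forall>\<^sub>F n in sequentially. sqrt ?C / sqrt (real n) < e / 2"
    by (rule order_tendstoD(2)[OF lim]) (use e in auto)
  then have "\<forall>\<^sub>F n in sequentially. norm (l2_norm M (birkhoff f n) / real n - 0) < e"
    using eventually_gt_at_top[of 0]
  proof eventually_elim
    fix n :: nat assume n: "sqrt ?C / sqrt (real n) < e / 2" "0 < n"
    have "l2_norm M (birkhoff f n) = l2_norm M (\<lambda>x. birkhoff (\<lambda>x. f x - p x) n x + birkhoff p n x)"
      by (intro l2_norm_cong) (simp add: birkhoff_diff)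
    also have "\<dots> \<le> l2_norm M (birkhoff (\<lambda>x. f x - p x) n) + l2_norm M (birkhoff p n)"
      by (intro l2_norm_triangle square_integrable_birkhoff square_integrable_diff f p)
    also have "l2_norm M (birkhoff (\<lambda>x. f x - p x) n) \<le> real n * l2_norm M (\<lambda>x. f x - p x)"
      by (intro l2_norm_birkhoff_le square_integrable_diff f p)
    also have "l2_norm M (birkhoff p n) \<le> sqrt (real n * ?C)"
      using l2_norm_birkhoff_transfer_le[OF p(1) p(3), of 0 n] by (intro real_le_rsqrt) simp
    finally have "l2_norm M (birkhoff f n) / real n \<le> l2_norm M (\<lambda>x. f x - p x) + sqrt (real n * ?C) / real n"
      using n(2) by (simp add: field_simps)
    also have "sqrt (real n * ?C) / real n = sqrt ?C / sqrt (real n)"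
      using n(2) C by (simp add: real_sqrt_mult real_div_sqrt field_simps)
    also have "l2_norm M (\<lambda>x. f x - p x) + sqrt ?C / sqrt (real n) < e" using n(1) p(2) by linarith
    finally show "norm (l2_norm M (birkhoff f n) / real n - 0) < e" by simp
  qed
  then show "\<exists>no. \<forall>n\<ge>no. norm (l2_norm M (birkhoff f n) / real n - 0) < e"
    by (simp add: eventually_sequentially)
qed

definition transfer_sum :: "('a \<Rightarrow> real) \<Rightarrow> nat \<Rightarrow> 'a \<Rightarrow> real" where
  "transfer_sum h N x = (\<Sum>j<N. transfer (Suc j) h x)"

text \<open>Partial sums of Gordin's martingale difference \<open>w - (transfer 1 w) \<circ> T\<close>, where \<open>w\<close> is the sum of all transfers
  of \<open>h\<close>. Staying with partial sums avoids summing a series of almost everywhere defined functions.\<close>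

definition gordin :: "('a \<Rightarrow> real) \<Rightarrow> nat \<Rightarrow> 'a \<Rightarrow> real" where
  "gordin h N x = (\<Sum>j<Suc N. transfer j h x - transfer (Suc j) h (T x))"

lemma gordin_decomposition:
  "h x = gordin h N x + transfer_sum h N (T x) - transfer_sum h N x + transfer (Suc N) h (T x)"
proof -
  have "gordin h N x = (\<Sum>j<Suc N. transfer j h x) - (\<Sum>j<Suc N. transfer (Suc j) h (T x))"
    by (simp only: gordin_def sum_subtractf)
  also have "(\<Sum>j<Suc N. transfer j h x) = h x + transfer_sum h N x"
    unfolding sum.lessThan_Suc_shift by (simp add: transfer_sum_def)
  also have "(\<Sum>j<Suc N. transfer (Suc j) h (T x)) = transfer_sum h N (T x) + transfer (Suc N) h (T x)"
    by (simp add: transfer_sum_def)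
  finally show ?thesis by simp
qed

lemma square_integrable_transfer_sum:
  "square_integrable M h \<Longrightarrow> square_integrable M (transfer_sum h N)"
  unfolding transfer_sum_def by (intro square_integrable_sum square_integrable_transfer)

lemma square_integrable_gordin:
  "square_integrable M h \<Longrightarrow> square_integrable M (gordin h N)"
  unfolding gordin_def
  by (intro square_integrable_sum square_integrable_diff square_integrable_transfer square_integrable_T)

lemma martingale_difference_gordin:
  assumes h: "square_integrable M h"
  shows "martingale_difference (gordin h N)"
  unfolding is_transfer_def
proof (intro conjI allI impI square_integrable_zero)
  fix g :: "'a \<Rightarrow> real" assume g: "square_integrable M g"
  note t = square_integrable_transfer[OF h]
  note [measurable] = square_integrable_measurable[OF g] square_integrable_measurable[OF t]
  have i: "integrable M (\<lambda>x. transfer j h x * g (T x))" "integrable M (\<lambda>x. transfer (Suc j) h (T x) * g (T x))" for j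
    by (intro integrable_mult_square_integrable square_integrable_T g t)+
  have "(LINT x|M. gordin h N x * g ((T ^^ 1) x)) =
      (LINT x|M. (\<Sum>j<Suc N. transfer j h x * g (T x) - transfer (Suc j) h (T x) * g (T x)))"
    by (simp add: gordin_def sum_distrib_right left_diff_distrib del: sum.lessThan_Suc)
  also have "\<dots> = (\<Sum>j<Suc N. (LINT x|M. transfer j h x * g (T x)) - (LINT x|M. transfer (Suc j) h (T x) * g (T x)))"
    using i by (simp add: Bochner_Integration.integral_sum del: sum.lessThan_Suc)
  also have "\<dots> = (\<Sum>j<Suc N. 0)"
  proof (intro sum.cong refl)
    fix j
    have "(LINT x|M. transfer (Suc j) h (T x) * g (T x)) = (LINT x|M. transfer (Suc j) h x * g x)"
      by (rule integral_T[of "\<lambda>x. transfer (Suc j) h x * g x"]) measurable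
    then show "(LINT x|M. transfer j h x * g (T x)) - (LINT x|M. transfer (Suc j) h (T x) * g (T x)) = 0"
      using integral_transfer_iterate[OF h g, of j 1] by simp
  qed
  finally show "(LINT x|M. gordin h N x * g ((T ^^ 1) x)) = (LINT x|M. 0 * g x)" by simp
qed

lemma birkhoff_coboundary: "birkhoff (\<lambda>x. f (T x) - f x) n x = f ((T ^^ n) x) - f x"
  by (induction n) (auto simp: birkhoff_def)

text \<open>The coboundary in the decomposition contributes a bounded amount, the last transfer a small multiple
  of \<open>sqrt n\<close>.\<close>

lemma gordin_error:
  assumes h: "square_integrable M h" and s: "summable (\<lambda>n. l2_norm M (transfer n h))"
  shows "l2_norm M (\<lambda>x. birkhoff h n x - birkhoff (gordin h N) n x) \<le>
    sqrt (real n) * sqrt (3 * (\<Sum>n. l2_norm M (transfer n h)) * l2_norm M (transfer (Suc N) h))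
      + 2 * l2_norm M (transfer_sum h N)"
proof -
  let ?v = "transfer_sum h N" and ?w = "transfer (Suc N) h"
  have v: "square_integrable M ?v" by (rule square_integrable_transfer_sum[OF h])
  have w: "square_integrable M ?w" by (rule square_integrable_transfer[OF h])
  have "birkhoff h n x - birkhoff (gordin h N) n x = birkhoff ?w n (T x) + (?v ((T ^^ n) x) - ?v x)" for x
  proof -
    have "birkhoff h n x - birkhoff (gordin h N) n x = birkhoff (\<lambda>x. h x - gordin h N x) n x"
      by (simp add: birkhoff_diff)
    also have "(\<lambda>x. h x - gordin h N x) = (\<lambda>x. ?w (T x) + (?v (T x) - ?v x))"
      using gordin_decomposition[of h _ N] by (auto simp: fun_eq_iff)
    also have "birkhoff \<dots> n x = birkhoff (\<lambda>x. ?w (T x)) n x + birkhoff (\<lambda>x. ?v (T x) - ?v x) n x"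
      by (simp add: birkhoff_def sum.distrib)
    also have "birkhoff (\<lambda>x. ?w (T x)) n x = birkhoff ?w n (T x)"
      by (simp add: birkhoff_def funpow_swap1)
    finally show ?thesis by (simp only: birkhoff_coboundary)
  qed
  then have "l2_norm M (\<lambda>x. birkhoff h n x - birkhoff (gordin h N) n x) =
      l2_norm M (\<lambda>x. birkhoff ?w n (T x) + (?v ((T ^^ n) x) - ?v x))" by simp
  also have "\<dots> \<le> l2_norm M (\<lambda>x. birkhoff ?w n (T x)) + l2_norm M (\<lambda>x. ?v ((T ^^ n) x) - ?v x)"
    by (intro l2_norm_triangle square_integrable_diff square_integrable_T square_integrable_birkhoff
        square_integrable_iterate v w)
  also have "l2_norm M (\<lambda>x. ?v ((T ^^ n) x) - ?v x) \<le> l2_norm M (\<lambda>x. ?v ((T ^^ n) x)) + l2_norm M ?v"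
    by (intro l2_norm_diff_triangle square_integrable_iterate v)
  also have "l2_norm M (\<lambda>x. ?v ((T ^^ n) x)) = l2_norm M ?v"
    by (rule l2_norm_iterate[OF square_integrable_measurable[OF v]])
  also have "l2_norm M (\<lambda>x. birkhoff ?w n (T x)) = l2_norm M (birkhoff ?w n)"
    by (rule l2_norm_T[OF square_integrable_measurable[OF square_integrable_birkhoff[OF w]]])
  also have "\<dots> \<le> sqrt (real n * (3 * (\<Sum>n. l2_norm M (transfer n h)) * l2_norm M ?w))"
    by (intro real_le_rsqrt l2_norm_birkhoff_transfer_le h s)
  finally show ?thesis by (simp add: real_sqrt_mult algebra_simps)
qed

text \<open>Bounded martingale differences approximate \<open>h\<close> with an error of \<open>e * sqrt n\<close> in the norm of the Birkhoff sums,
  for every \<open>e\<close>. Hence the norms of the Birkhoff sums divided by \<open>sqrt n\<close> converge; the limit is \<open>\<sigma>\<close>, and the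
  limit theorem passes from the approximations to \<open>h\<close>. The density hypothesis stands in for ergodicity: it makes
  the averages of \<open>f^2\<close> converge to a constant.\<close>

theorem gordin_CLT:
  assumes h: "square_integrable M h" and s: "summable (\<lambda>n. l2_norm M (transfer n h))"
    and dense: "\<And>f e. square_integrable M f \<Longrightarrow> (LINT x|M. f x) = 0 \<Longrightarrow> 0 < e \<Longrightarrow>
      \<exists>p. square_integrable M p \<and> l2_norm M (\<lambda>x. f x - p x) < e \<and> summable (\<lambda>n. l2_norm M (transfer n p))"
  obtains \<sigma> where "0 \<le> \<sigma>"
    "\<And>t. (\<lambda>n. LINT x|M. iexp (t / sqrt (real n) * birkhoff h n x)) \<longlonglongrightarrow> exp (- (t\<^sup>2 * \<sigma>\<^sup>2 / 2))"
    "\<sigma> = 0 \<Longrightarrow> (\<lambda>N. l2_norm M (gordin h N)) \<longlonglongrightarrow> 0"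
proof -
  define A where "A = (\<Sum>n. l2_norm M (transfer n h))"
  define r where "r N = sqrt (3 * A * l2_norm M (transfer (Suc N) h))" for N
  define b where "b n = l2_norm M (birkhoff h n) / sqrt (real n)" for n
  have r: "r \<longlonglongrightarrow> 0"
  proof -
    have "(\<lambda>N. l2_norm M (transfer (Suc N) h)) \<longlonglongrightarrow> 0"
      using summable_LIMSEQ_zero[OF s] by (rule LIMSEQ_Suc)
    from tendsto_real_sqrt[OF tendsto_mult[OF tendsto_const[of "3 * A"] this]]
    show ?thesis by (simp add: r_def[abs_def])
  qed
  have S: "square_integrable M (birkhoff h n)" for n by (rule square_integrable_birkhoff[OF h])
  \<comment> \<open>Error of the martingale approximation, with the bounded part of the coboundary hidden in \<open>e\<close>.\<close>
  have gerr: "\<forall>\<^sub>F n in sequentially. l2_norm M (\<lambda>x. birkhoff h n x - birkhoff (gordin h N) n x) \<le> sqrt (real n) * (r N + e)"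
    if e: "0 < e" for N e
  proof -
    have "(\<lambda>n. 2 * l2_norm M (transfer_sum h N) / sqrt (real n)) \<longlonglongrightarrow> 0"
      by (rule real_tendsto_divide_at_top[OF tendsto_const filterlim_compose[OF sqrt_at_top filterlim_real_sequentially]])
    then have "\<forall>\<^sub>F n in sequentially. 2 * l2_norm M (transfer_sum h N) / sqrt (real n) < e"
      by (rule order_tendstoD(2)) (rule e)
    then show ?thesis using eventually_gt_at_top[of 0]
    proof eventually_elim
      fix n :: nat assume n: "2 * l2_norm M (transfer_sum h N) / sqrt (real n) < e" "0 < n"
      then have "2 * l2_norm M (transfer_sum h N) \<le> sqrt (real n) * e" by (simp add: field_simps)
      then show "l2_norm M (\<lambda>x. birkhoff h n x - birkhoff (gordin h N) n x) \<le> sqrt (real n) * (r N + e)"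
        using gordin_error[OF h s, of n N] by (simp add: r_def A_def distrib_left)
    qed
  qed
  \<comment> \<open>Truncating Gordin's martingale difference makes it bounded at the cost of another small error.\<close>
  have approx: "\<exists>f K. f \<in> borel_measurable M \<and> (\<forall>x\<in>space M. \<bar>f x\<bar> \<le> K) \<and> martingale_difference f \<and>
    (\<forall>\<^sub>F n in sequentially. l2_norm M (\<lambda>x. birkhoff h n x - birkhoff f n x) \<le> sqrt (real n) * e)" if e: "0 < e" for e
  proof -
    have "\<forall>\<^sub>F N in sequentially. r N < e / 3"
      by (rule order_tendstoD(2)[OF r]) (use e in auto)
    then obtain N where N: "r N < e / 3" by (auto simp: eventually_sequentially)
    have gs: "square_integrable M (gordin h N)" by (rule square_integrable_gordin[OF h])
    obtain f K where f: "f \<in> borel_measurable M" "\<And>x. x \<in> space M \<Longrightarrow> \<bar>f x\<bar> \<le> K"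
      "martingale_difference f" "l2_norm M (\<lambda>x. gordin h N x - f x) < e / 3"
      by (rule truncated_martingale_difference[OF gs martingale_difference_gordin[OF h] divide_pos_pos[OF e zero_less_numeral]])
        (rule that, assumption+)
    have fs: "square_integrable M f" by (rule square_integrable_bounded[OF f(1)]) (use f(2) in auto)
    have md: "martingale_difference (\<lambda>x. gordin h N x - f x)"
      using is_transfer_diff[OF gs fs martingale_difference_gordin[OF h] f(3)] by simp
    have "\<forall>\<^sub>F n in sequentially. l2_norm M (\<lambda>x. birkhoff h n x - birkhoff f n x) \<le> sqrt (real n) * e"
      using gerr[of "e / 3" N, OF divide_pos_pos[OF e zero_less_numeral]]
    proof eventually_elim
      case (elim n)
      have "l2_norm M (\<lambda>x. birkhoff h n x - birkhoff f n x) =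
        l2_norm M (\<lambda>x. (birkhoff h n x - birkhoff (gordin h N) n x) + birkhoff (\<lambda>x. gordin h N x - f x) n x)"
        by (intro l2_norm_cong) (simp add: birkhoff_diff)
      also have "\<dots> \<le> l2_norm M (\<lambda>x. birkhoff h n x - birkhoff (gordin h N) n x) + l2_norm M (birkhoff (\<lambda>x. gordin h N x - f x) n)"
        by (intro l2_norm_triangle square_integrable_diff square_integrable_birkhoff h gs fs)
      also have "l2_norm M (birkhoff (\<lambda>x. gordin h N x - f x) n) = sqrt (real n) * l2_norm M (\<lambda>x. gordin h N x - f x)"
        by (intro l2_norm_birkhoff_martingale md square_integrable_diff gs fs)
      also have "l2_norm M (\<lambda>x. birkhoff h n x - birkhoff (gordin h N) n x) \<le> sqrt (real n) * (r N + e / 3)"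
        using elim by simp
      also have "sqrt (real n) * (r N + e / 3) + sqrt (real n) * l2_norm M (\<lambda>x. gordin h N x - f x) =
          sqrt (real n) * (r N + e / 3 + l2_norm M (\<lambda>x. gordin h N x - f x))"
        by (simp add: algebra_simps)
      also have "\<dots> \<le> sqrt (real n) * e"
        using N f(4) by (intro mult_left_mono) auto
      finally show ?case by simp
    qed
    then show ?thesis using f(1-3) by blast
  qed
  define good where "good j f K \<longleftrightarrow> f \<in> borel_measurable M \<and> (\<forall>x\<in>space M. \<bar>f x\<bar> \<le> K) \<and> martingale_difference f \<and>
    (\<forall>\<^sub>F n in sequentially. l2_norm M (\<lambda>x. birkhoff h n x - birkhoff f n x) \<le> sqrt (real n) * inverse (real (Suc j)))"
    for j :: nat and f :: "'a \<Rightarrow> real" and K :: real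
  have "\<forall>j. \<exists>f K. good j f K"
    unfolding good_def by (intro allI approx) simp
  from choice[OF this] obtain f where "\<forall>j. \<exists>K. good j (f j) K" ..
  from choice[OF this] obtain K where "\<forall>j. good j (f j) (K j)" ..
  then have f: "f j \<in> borel_measurable M" and K: "x \<in> space M \<Longrightarrow> \<bar>f j x\<bar> \<le> K j"
    and md: "martingale_difference (f j)"
    and err: "\<forall>\<^sub>F n in sequentially. l2_norm M (\<lambda>x. birkhoff h n x - birkhoff (f j) n x) \<le> sqrt (real n) * inverse (real (Suc j))"
    for j x by (simp_all only: good_def)
  have fs: "square_integrable M (f j)" for j by (rule square_integrable_bounded[OF f]) (use K in auto)
  define s where "s j = l2_norm M (f j)" for j
  \<comment> \<open>For a martingale difference the norm of the Birkhoff sum is exactly \<open>sqrt n\<close> times its norm.\<close>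
  have bs: "\<forall>\<^sub>F n in sequentially. \<bar>b n - s j\<bar> \<le> inverse (real (Suc j))" for j
    using err[of j] eventually_gt_at_top[of 0]
  proof eventually_elim
    case (elim n)
    have "\<bar>l2_norm M (birkhoff h n) - l2_norm M (birkhoff (f j) n)\<bar> \<le> sqrt (real n) * inverse (real (Suc j))"
      using l2_norm_diff_ge[OF S square_integrable_birkhoff[OF fs], of n j n] elim(1) by linarith
    moreover have "l2_norm M (birkhoff h n) - l2_norm M (birkhoff (f j) n) = sqrt (real n) * (b n - s j)"
      using elim(2) l2_norm_birkhoff_martingale[OF fs md, of j n] by (simp add: b_def s_def right_diff_distrib)
    ultimately show ?case using elim(2) by (simp add: abs_mult)
  qed
  have inv0: "(\<lambda>j. inverse (real (Suc j))) \<longlonglongrightarrow> 0" by (rule LIMSEQ_inverse_real_of_nat)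
  have "Cauchy s"
  proof (rule metric_CauchyI)
    fix e :: real assume e: "0 < e"
    have "\<forall>\<^sub>F j in sequentially. inverse (real (Suc j)) < e / 2"
      by (rule order_tendstoD(2)[OF inv0]) (use e in auto)
    then obtain J where J: "\<And>j. j \<ge> J \<Longrightarrow> inverse (real (Suc j)) < e / 2"
      by (auto simp: eventually_sequentially)
    have "dist (s i) (s j) < e" if "J \<le> i" "J \<le> j" for i j
    proof -
      obtain n where "\<bar>b n - s i\<bar> \<le> inverse (real (Suc i))" "\<bar>b n - s j\<bar> \<le> inverse (real (Suc j))"
        using eventually_conj[OF bs[of i] bs[of j]] by (auto simp: eventually_sequentially)
      then show ?thesis using J[OF that(1)] J[OF that(2)] by (simp add: dist_real_def)
    qed
    then show "\<exists>M. \<forall>m\<ge>M. \<forall>n\<ge>M. dist (s m) (s n) < e" by blast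
  qed
  then obtain \<sigma> where \<sigma>: "s \<longlonglongrightarrow> \<sigma>" by (auto simp: Cauchy_convergent_iff convergent_def)
  have \<sigma>0: "0 \<le> \<sigma>" by (rule LIMSEQ_le_const[OF \<sigma>]) (auto simp: s_def)
  have b\<sigma>: "b \<longlonglongrightarrow> \<sigma>"
  proof (rule LIMSEQ_I)
    fix e :: real assume e: "0 < e"
    have "\<forall>\<^sub>F j in sequentially. inverse (real (Suc j)) < e / 2 \<and> dist (s j) \<sigma> < e / 2"
      using e by (intro eventually_conj order_tendstoD(2)[OF inv0] tendstoD[OF \<sigma>]) auto
    then obtain j where j: "inverse (real (Suc j)) < e / 2" "dist (s j) \<sigma> < e / 2"
      by (auto simp: eventually_sequentially)
    have "\<forall>\<^sub>F n in sequentially. norm (b n - \<sigma>) < e"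
      using bs[of j]
    proof eventually_elim
      case (elim n)
      then show ?case using j unfolding dist_real_def real_norm_def by linarith
    qed
    then show "\<exists>no. \<forall>n\<ge>no. norm (b n - \<sigma>) < e" by (simp add: eventually_sequentially)
  qed
  have clt: "(\<lambda>n. LINT x|M. iexp (t / sqrt (real n) * birkhoff (f j) n x)) \<longlonglongrightarrow> exp (- (t\<^sup>2 * (s j)\<^sup>2 / 2))" for t j
  proof (rule clt_bounded[OF f K md])
    have f2: "square_integrable M (\<lambda>x. (f j x)\<^sup>2)"
      by (rule square_integrable_bounded[where c = "(K j)\<^sup>2"])
        (use f in \<open>auto simp: abs_le_square_iff[symmetric] intro: order_trans[OF K abs_ge_self]\<close>)
    have "(LINT x|M. (f j x)\<^sup>2 - (s j)\<^sup>2) = 0"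
      using integrable_square_integrable[OF f2] l2_norm_sq[of M "f j"] by (simp add: s_def prob_space)
    then show "(\<lambda>n. l2_norm M (birkhoff (\<lambda>x. (f j x)\<^sup>2 - (s j)\<^sup>2) n) / real n) \<longlonglongrightarrow> 0"
      by (intro birkhoff_average_tendsto_0 dense square_integrable_diff f2 square_integrable_const)
  qed auto
  show ?thesis
  proof
    show "0 \<le> \<sigma>" by fact
    fix t :: real
    show "(\<lambda>n. LINT x|M. iexp (t / sqrt (real n) * birkhoff h n x)) \<longlonglongrightarrow> exp (- (t\<^sup>2 * \<sigma>\<^sup>2 / 2))"
    proof (rule metric_LIMSEQ_I)
      fix e :: real assume e: "0 < e"
      have l1: "(\<lambda>j. complex_of_real (exp (- (t\<^sup>2 * (s j)\<^sup>2 / 2)))) \<longlonglongrightarrow> exp (- (t\<^sup>2 * \<sigma>\<^sup>2 / 2))"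
        by (intro tendsto_of_real tendsto_exp tendsto_minus tendsto_divide tendsto_mult tendsto_power tendsto_const \<sigma>) simp
      have l2: "(\<lambda>j. \<bar>t\<bar> * inverse (real (Suc j))) \<longlonglongrightarrow> 0"
        using tendsto_mult[OF tendsto_const inv0, of "\<bar>t\<bar>"] by simp
      have "\<forall>\<^sub>F j in sequentially. dist (complex_of_real (exp (- (t\<^sup>2 * (s j)\<^sup>2 / 2)))) (exp (- (t\<^sup>2 * \<sigma>\<^sup>2 / 2))) < e / 3
          \<and> \<bar>t\<bar> * inverse (real (Suc j)) < e / 3"
        using e by (intro eventually_conj order_tendstoD(2)[OF l2] tendstoD[OF l1]) auto
      then obtain j where j: "dist (complex_of_real (exp (- (t\<^sup>2 * (s j)\<^sup>2 / 2)))) (exp (- (t\<^sup>2 * \<sigma>\<^sup>2 / 2))) < e / 3"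
          "\<bar>t\<bar> * inverse (real (Suc j)) < e / 3"
        by (auto simp: eventually_sequentially)
      have "\<forall>\<^sub>F n in sequentially. dist (LINT x|M. iexp (t / sqrt (real n) * birkhoff (f j) n x)) (exp (- (t\<^sup>2 * (s j)\<^sup>2 / 2))) < e / 3"
        by (rule tendstoD[OF clt]) (use e in simp)
      then have "\<forall>\<^sub>F n in sequentially. dist (LINT x|M. iexp (t / sqrt (real n) * birkhoff h n x)) (exp (- (t\<^sup>2 * \<sigma>\<^sup>2 / 2))) < e"
        using err[of j] eventually_gt_at_top[of 0]
      proof eventually_elim
        case (elim n)
        let ?d = "\<lambda>x. birkhoff h n x - birkhoff (f j) n x"
        have ds: "square_integrable M ?d" by (intro square_integrable_diff S square_integrable_birkhoff fs)
        note [measurable] = square_integrable_measurable[OF S] square_integrable_measurable[OF square_integrable_birkhoff[OF fs]]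
        have i: "integrable M (\<lambda>x. iexp (t / sqrt (real n) * birkhoff h n x))"
          "integrable M (\<lambda>x. iexp (t / sqrt (real n) * birkhoff (f j) n x))"
          by (rule integrable_const_bound[where B = 1]; simp)+
        have "dist (LINT x|M. iexp (t / sqrt (real n) * birkhoff h n x)) (LINT x|M. iexp (t / sqrt (real n) * birkhoff (f j) n x)) =
          cmod (LINT x|M. iexp (t / sqrt (real n) * birkhoff h n x) - iexp (t / sqrt (real n) * birkhoff (f j) n x))"
          using i by (simp add: dist_norm)
        also have "\<dots> \<le> (LINT x|M. \<bar>t\<bar> / sqrt (real n) * \<bar>?d x\<bar>)"
        proof (rule norm_integral_le_integral)
          show "integrable M (\<lambda>x. \<bar>t\<bar> / sqrt (real n) * \<bar>?d x\<bar>)"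
            using integrable_square_integrable[OF ds] by simp
          fix x
          have "cmod (iexp a - iexp b) \<le> \<bar>a - b\<bar>" for a b :: real
          proof -
            have "iexp a - iexp b = iexp b * (iexp (a - b) - 1)"
              by (simp add: right_diff_distrib mult_exp_exp algebra_simps)
            then have "cmod (iexp a - iexp b) = cmod (iexp (a - b) - 1)" by (simp add: norm_mult)
            also have "\<dots> \<le> \<bar>a - b\<bar>" using iexp_approx1[of "a - b" 0] by simp
            finally show ?thesis .
          qed
          from this[of "t / sqrt (real n) * birkhoff h n x" "t / sqrt (real n) * birkhoff (f j) n x"]
          show "cmod (iexp (t / sqrt (real n) * birkhoff h n x) - iexp (t / sqrt (real n) * birkhoff (f j) n x)) \<le> \<bar>t\<bar> / sqrt (real n) * \<bar>?d x\<bar>"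
            unfolding right_diff_distrib[symmetric] abs_mult abs_divide by simp
        qed (use i in auto)
        also have "\<dots> = \<bar>t\<bar> / sqrt (real n) * (LINT x|M. \<bar>?d x\<bar>)" by simp
        also have "\<dots> \<le> \<bar>t\<bar> / sqrt (real n) * (sqrt (real n) * inverse (real (Suc j)))"
          using integral_norm_le_l2_norm[OF ds] elim(2) by (intro mult_left_mono) auto
        also have "\<dots> = \<bar>t\<bar> * inverse (real (Suc j))" using elim(3) by simp
        finally have "dist (LINT x|M. iexp (t / sqrt (real n) * birkhoff h n x)) (LINT x|M. iexp (t / sqrt (real n) * birkhoff (f j) n x)) < e / 3"
          using j(2) by linarith
        from dist_triangle_third[OF this elim(1) j(1)] show ?case .
      qed
      then show "\<exists>no. \<forall>n\<ge>no. dist (LINT x|M. iexp (t / sqrt (real n) * birkhoff h n x)) (exp (- (t\<^sup>2 * \<sigma>\<^sup>2 / 2))) < e"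
        by (simp add: eventually_sequentially)
    qed
  next
    assume "\<sigma> = 0"
    then have b0: "b \<longlonglongrightarrow> 0" using b\<sigma> by simp
    \<comment> \<open>By orthogonality the norm of Gordin's martingale difference is the normalised norm of its Birkhoff sums, which differ by at most \<open>r N\<close> from those of \<open>h\<close>.\<close>
    have "l2_norm M (gordin h N) \<le> r N" for N
    proof (rule field_le_epsilon)
      fix e :: real assume e: "0 < e"
      have "\<forall>\<^sub>F n in sequentially. b n < e / 2" by (rule order_tendstoD(2)[OF b0]) (use e in auto)
      then have "\<forall>\<^sub>F n in sequentially. l2_norm M (gordin h N) \<le> r N + e"
        using gerr[of "e / 2" N, OF divide_pos_pos[OF e zero_less_numeral]] eventually_gt_at_top[of 0]
      proof eventually_elim
        case (elim n)
        have gs: "square_integrable M (gordin h N)" by (rule square_integrable_gordin[OF h])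
        have "sqrt (real n) * l2_norm M (gordin h N) = l2_norm M (birkhoff (gordin h N) n)"
          using l2_norm_birkhoff_martingale[OF gs martingale_difference_gordin[OF h]] by simp
        also have "\<dots> \<le> l2_norm M (birkhoff h n) + l2_norm M (\<lambda>x. birkhoff h n x - birkhoff (gordin h N) n x)"
          using l2_norm_diff_ge[OF S square_integrable_birkhoff[OF gs], of n n] by linarith
        also have "\<dots> \<le> sqrt (real n) * (e / 2) + sqrt (real n) * (r N + e / 2)"
          using elim by (intro add_mono) (auto simp: b_def field_simps)
        also have "\<dots> = sqrt (real n) * (r N + e)" by (simp add: algebra_simps)
        finally show ?case using elim(3) by simp
      qed
      then show "l2_norm M (gordin h N) \<le> r N + e" by (auto simp: eventually_sequentially)
    qed
    then show "(\<lambda>N. l2_norm M (gordin h N)) \<longlonglongrightarrow> 0"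
      by (intro tendsto_sandwich[OF _ _ tendsto_const r]) auto
  qed
qed

end

section \<open>The circle, Poisson kernels and trigonometric polynomials\<close>

text \<open>The Borel version of the normalised arc length. All analysis is done here, and the completion is dealt with
  at the end.\<close>

definition circ :: "complex measure" where
  "circ = distr (uniform_measure lborel {0..<2 * pi}) (restrict_space borel (sphere 0 1)) cis"

lemma circle_measure_eq: "circle_measure = completion circ"
  by (simp add: circle_measure_def circ_def)

lemma sets_circ [measurable_cong, simp]: "sets circ = sets (restrict_space borel (sphere 0 1))"
  by (simp add: circ_def)

lemma space_circ [simp]: "space circ = sphere 0 1"
  by (simp add: circ_def space_restrict_space)

lemma cis_measurable [measurable]: "cis \<in> borel \<rightarrow>\<^sub>M restrict_space borel (sphere 0 1)"
proof (rule measurable_restrict_space2)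
  show "cis \<in> borel_measurable borel"
    by (intro borel_measurable_continuous_onI continuous_on_cis continuous_on_id)
qed simp

lemma sphere_sets [simp]: "sphere 0 1 \<in> sets (restrict_space borel (sphere (0::complex) 1))"
  using sets.top[of circ] by simp

lemma prob_space_circ: "prob_space circ"
  unfolding circ_def
proof (rule prob_space.prob_space_distr)
  show "prob_space (uniform_measure lborel {0..<2 * pi})"
    by (rule prob_space_uniform_measure) auto
qed (simp add: measurable_cong_sets[OF sets_uniform_measure refl] del: sets_circ)

interpretation circ: prob_space circ
  by (rule prob_space_circ)

lemma borel_measurable_circ [measurable (raw)]:
  "f \<in> borel_measurable borel \<Longrightarrow> f \<in> borel_measurable circ"
  by (simp add: measurable_cong_sets[OF sets_circ refl] measurable_restrict_space1)

lemma borel_measurable_circ_continuous: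
  "continuous_on (sphere 0 1) f \<Longrightarrow> f \<in> borel_measurable circ"
  by (simp add: measurable_cong_sets[OF sets_circ refl] borel_measurable_continuous_on_restrict)

lemma integral_circ:
  fixes f :: "complex \<Rightarrow> complex"
  assumes f: "continuous_on (sphere 0 1) f"
  shows "(LINT x|circ. f x) = integral {0..2 * pi} (\<lambda>t. f (cis t)) / (2 * pi)"
proof -
  let ?A = "{0..<2 * pi}"
  have fm [measurable]: "f \<in> borel_measurable (restrict_space borel (sphere 0 1))"
    by (rule borel_measurable_continuous_on_restrict[OF f])
  have c: "continuous_on {0..2 * pi} (\<lambda>t. f (cis t))"
    by (rule continuous_on_compose2[OF f]) (auto intro!: continuous_intros)
  have e: "1 / ennreal (2 * pi) = ennreal (1 / (2 * pi))"
    using divide_ennreal[of 1 "2 * pi"] by simp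
  have d: "uniform_measure lborel ?A = density lborel (\<lambda>t. ennreal (indicator ?A t / (2 * pi)))"
    unfolding uniform_measure_def
    by (intro density_cong) (auto simp: e split: split_indicator)
  have "(LINT x|circ. f x) = (LINT t|uniform_measure lborel ?A. f (cis t))"
    unfolding circ_def by (subst integral_distr) (auto simp: measurable_cong_sets[OF sets_uniform_measure refl])
  also have "\<dots> = (LINT t|lborel. (indicator ?A t / (2 * pi)) *\<^sub>R f (cis t))"
    unfolding d by (rule integral_density) (auto intro!: measurable_compose[OF cis_measurable fm])
  also have "\<dots> = (LINT t|lborel. (indicator ?A t *\<^sub>R f (cis t)) / (2 * pi))"
    by (intro Bochner_Integration.integral_cong refl) (auto simp: scaleR_conv_of_real split: split_indicator)
  also have "\<dots> = (LINT t:?A|lborel. f (cis t)) / (2 * pi)"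
    unfolding set_lebesgue_integral_def by (rule integral_divide_zero)
  also have "(LINT t:?A|lborel. f (cis t)) = integral ?A (\<lambda>t. f (cis t))"
  proof (rule set_borel_integral_eq_integral(2))
    show "set_integrable lborel ?A (\<lambda>t. f (cis t))"
      by (rule set_integrable_subset[OF borel_integrable_atLeastAtMost'[OF c]]) auto
  qed
  also have "\<dots> = integral {0..2 * pi} (\<lambda>t. f (cis t))"
  proof (rule integral_subset_negligible)
    have "{0..2 * pi} - ?A \<subseteq> {2 * pi}" by auto
    then show "negligible ({0..2 * pi} - ?A)" by (rule negligible_subset[rotated]) auto
  qed auto
  finally show ?thesis .
qed

text \<open>Cauchy's integral formula on the unit circle itself, for functions that are merely continuous on the closed
  disk.\<close>

lemma circ_Cauchy:
  assumes q: "continuous_on (cball 0 1) q" "q holomorphic_on ball 0 1" and z: "norm z < 1"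
  shows "(LINT x|circ. x * q x / (x - z)) = q z"
proof -
  have ne: "x \<noteq> z" if "x \<in> sphere 0 1" for x using that z by auto
  have "((\<lambda>u. q u / (u - z)) has_contour_integral (2 * of_real pi * \<i> * q z)) (circlepath 0 1)"
    using q z by (intro Cauchy_integral_circlepath) auto
  then have "((\<lambda>t. q (0 + of_real 1 * cis t) / (0 + of_real 1 * cis t - z) * of_real 1 * \<i> * cis t) has_integral (2 * of_real pi * \<i> * q z)) {0..2 * pi}"
    unfolding circlepath_def by (subst (asm) has_contour_integral_part_circlepath_iff) auto
  from has_integral_mult_right[OF this, of "- \<i>"]
  have "((\<lambda>t. cis t * q (cis t) / (cis t - z)) has_integral (2 * of_real pi * q z)) {0..2 * pi}"
    by (simp add: algebra_simps)
  then have "integral {0..2 * pi} (\<lambda>t. cis t * q (cis t) / (cis t - z)) = 2 * of_real pi * q z"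
    by (rule integral_unique)
  moreover have "continuous_on (sphere 0 1) (\<lambda>x. x * q x / (x - z))"
    using ne by (intro continuous_intros continuous_on_subset[OF q(1)]) auto
  ultimately show ?thesis using integral_circ by simp
qed

definition poisson :: "complex \<Rightarrow> complex \<Rightarrow> real" where
  "poisson z x = (1 - (norm z)\<^sup>2) / (norm (x - z))\<^sup>2"

lemma poisson_measurable [measurable]: "(\<lambda>(z, x). poisson z x) \<in> borel_measurable (borel \<Otimes>\<^sub>M borel)"
  unfolding poisson_def case_prod_beta by measurable

lemma poisson_bounds:
  assumes x: "norm x = 1" and z: "norm z < 1"
  shows "(1 - norm z) / (1 + norm z) \<le> poisson z x" "poisson z x \<le> (1 + norm z) / (1 - norm z)" "0 < poisson z x"
proof -
  let ?r = "norm z"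
  have r: "0 \<le> ?r" "?r < 1" "0 < 1 + ?r" "0 < 1 - ?r" using z norm_ge_zero[of z] by linarith+
  have lo: "1 - ?r \<le> norm (x - z)" using x norm_triangle_ineq2[of x z] by simp
  have hi: "norm (x - z) \<le> 1 + ?r" using x norm_triangle_ineq4[of x z] by simp
  have f: "1 - ?r\<^sup>2 = (1 - ?r) * (1 + ?r)" by (simp add: power2_eq_square algebra_simps)
  have n0: "0 < norm (x - z)" using lo r by linarith
  have pp1: "0 \<le> (1 - ?r) * (1 + ?r)" by (intro mult_nonneg_nonneg less_imp_le r)
  have pp2: "0 < (norm (x - z))\<^sup>2" by (intro zero_less_power n0)
  have pp3: "0 < (1 + ?r)\<^sup>2" and pp4: "0 < (1 - ?r)\<^sup>2" by (intro zero_less_power r)+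
  have h2: "(norm (x - z))\<^sup>2 \<le> (1 + ?r)\<^sup>2" using hi by (intro power_mono) auto
  have "(1 - ?r\<^sup>2) / (1 + ?r)\<^sup>2 \<le> poisson z x"
    unfolding poisson_def f by (rule divide_left_mono[OF h2 pp1 mult_pos_pos[OF pp3 pp2]])
  also have "(1 - ?r\<^sup>2) / (1 + ?r)\<^sup>2 = (1 - ?r) / (1 + ?r)"
    unfolding f using r by (simp add: power2_eq_square)
  finally show 1: "(1 - ?r) / (1 + ?r) \<le> poisson z x" .
  have l2: "(1 - ?r)\<^sup>2 \<le> (norm (x - z))\<^sup>2" using lo r by (intro power_mono) auto
  have "poisson z x \<le> (1 - ?r\<^sup>2) / (1 - ?r)\<^sup>2"
    unfolding poisson_def f by (rule divide_left_mono[OF l2 pp1 mult_pos_pos[OF pp2 pp4]])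
  also have "\<dots> = (1 + ?r) / (1 - ?r)"
    unfolding f using r by (simp add: power2_eq_square)
  finally show "poisson z x \<le> (1 + ?r) / (1 - ?r)" .
  have "0 < (1 - ?r) / (1 + ?r)" using r by auto
  with 1 show "0 < poisson z x" by linarith
qed

lemma poisson_nonneg: "norm z < 1 \<Longrightarrow> 0 \<le> poisson z x"
  by (simp add: poisson_def power_le_one)

lemma cnj_circle: "norm x = 1 \<Longrightarrow> cnj x = inverse x"
  using divide_conv_cnj[of x 1] by (simp add: inverse_eq_divide)

text \<open>On the circle the conjugate of \<open>x\<close> is its inverse, so the kernel is a rational function to which Cauchy's
  formula applies.\<close>

lemma poisson_complex:
  assumes x: "norm x = 1" and z: "norm z < 1"
  shows "complex_of_real (poisson z x) = x * (1 - (norm z)\<^sup>2) / ((x - z) * (1 - cnj z * x))"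
proof -
  have xx: "x * cnj x = 1" using x complex_norm_square[of x] by simp
  have x0: "x \<noteq> 0" and xz: "x \<noteq> z" using x z by auto
  have "1 - cnj z * x = x * cnj (x - z)" using xx by (simp add: algebra_simps)
  then have "(x - z) * (1 - cnj z * x) = x * ((x - z) * cnj (x - z))"
    by (simp only: mult.left_commute)
  then have d: "(x - z) * (1 - cnj z * x) = x * complex_of_real ((norm (x - z))\<^sup>2)"
    by (simp only: complex_norm_square)
  show ?thesis unfolding d using x0 by (simp add: poisson_def)
qed

lemma integral_poisson:
  assumes f: "continuous_on (cball 0 1) f" "f holomorphic_on ball 0 1" and z: "norm z < 1"
  shows "(LINT x|circ. complex_of_real (poisson z x) * f x) = f z"
proof -
  let ?q = "\<lambda>w. f w * (1 - (norm z)\<^sup>2) / (1 - cnj z * w)"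
  have ne: "1 - cnj z * w \<noteq> 0" if "norm w \<le> 1" for w
  proof
    assume "1 - cnj z * w = 0"
    then have "norm z * norm w = 1"
      by (metis complex_mod_cnj eq_iff_diff_eq_0 norm_mult norm_one)
    moreover have "norm z * norm w < 1" using that z by (metis mult_left_le norm_ge_zero order_le_less_trans)
    ultimately show False by simp
  qed
  have "(LINT x|circ. x * ?q x / (x - z)) = ?q z"
  proof (rule circ_Cauchy[OF _ _ z])
    show "continuous_on (cball 0 1) ?q" using ne by (intro continuous_intros f) auto
    show "?q holomorphic_on ball 0 1" using ne by (intro holomorphic_intros f) auto
  qed
  also have "?q z = f z"
    using ne[of z] z complex_norm_square[of z] by (simp add: mult.commute)
  also have "(LINT x|circ. x * ?q x / (x - z)) = (LINT x|circ. complex_of_real (poisson z x) * f x)"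
    using z by (intro Bochner_Integration.integral_cong) (auto simp: poisson_complex field_simps)
  finally show ?thesis .
qed

text \<open>The harmonic monomials: characters on the circle, and their own Poisson integrals inside the disk.\<close>

definition zpow :: "complex \<Rightarrow> int \<Rightarrow> complex" where
  "zpow z k = (if 0 \<le> k then z ^ nat k else cnj z ^ nat (- k))"

lemma zpow_0 [simp]: "zpow z 0 = 1"
  by (simp add: zpow_def)

lemma cnj_zpow: "cnj (zpow z k) = zpow z (- k)"
  by (auto simp: zpow_def)

lemma norm_zpow: "norm (zpow z k) = norm z ^ nat \<bar>k\<bar>"
  by (auto simp: zpow_def norm_power)

lemma norm_zpow_circle [simp]: "norm x = 1 \<Longrightarrow> norm (zpow x k) = 1"
  by (simp add: norm_zpow)

lemma zpow_of_real_mult: "zpow (of_real r * x) k = of_real (r ^ nat \<bar>k\<bar>) * zpow x k"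
  by (auto simp: zpow_def power_mult_distrib)

lemma zpow_circle: "norm x = 1 \<Longrightarrow> zpow x k = x powi k"
  by (simp add: zpow_def power_int_def cnj_circle)

lemma zpow_add:
  assumes "norm x = 1"
  shows "zpow x (j + k) = zpow x j * zpow x k"
proof -
  have "x \<noteq> 0" using assms by auto
  then show ?thesis using power_int_add[of x j k] assms by (simp add: zpow_circle)
qed

lemma continuous_on_zpow [continuous_intros]: "continuous_on A (\<lambda>x. zpow x k)"
  unfolding zpow_def by (cases "0 \<le> k") (auto intro!: continuous_intros)

lemma zpow_measurable [measurable]: "(\<lambda>x. zpow x k) \<in> borel_measurable borel"
  by (rule borel_measurable_continuous_onI[OF continuous_on_zpow])

lemma integral_poisson_zpow:
  assumes z: "norm z < 1"
  shows "(LINT x|circ. complex_of_real (poisson z x) * zpow x k) = zpow z k"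
proof -
  have *: "(LINT x|circ. complex_of_real (poisson z x) * x ^ n) = z ^ n" for n
    by (rule integral_poisson[OF _ _ z]) (auto intro!: continuous_intros holomorphic_intros)
  show ?thesis
  proof (cases "0 \<le> k")
    case False
    have "(LINT x|circ. complex_of_real (poisson z x) * zpow x k) =
      (LINT x|circ. cnj (complex_of_real (poisson z x) * x ^ nat (- k)))"
      using False by (simp add: zpow_def)
    also have "\<dots> = cnj (z ^ nat (- k))" unfolding Bochner_Integration.integral_cnj * by (rule refl)
    finally show ?thesis using False by (simp add: zpow_def)
  qed (simp add: zpow_def *)
qed

text \<open>Harmonic measure of the disk, seen from \<open>z\<close>.\<close>

definition poisson_measure :: "complex \<Rightarrow> complex measure" where
  "poisson_measure z = density circ (\<lambda>x. ennreal (poisson z x))"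

lemma sets_poisson_measure [measurable_cong, simp]: "sets (poisson_measure z) = sets (restrict_space borel (sphere 0 1))"
  by (simp add: poisson_measure_def)

lemma space_poisson_measure [simp]: "space (poisson_measure z) = sphere 0 1"
  by (simp add: poisson_measure_def)

lemma poisson_measure_0: "poisson_measure 0 = circ"
proof -
  have "density circ (\<lambda>x. ennreal (poisson 0 x)) = density circ (\<lambda>_. 1)"
    by (rule density_cong) (auto simp: poisson_def)
  then show ?thesis by (simp add: poisson_measure_def density_1)
qed

lemma integral_poisson_measure:
  fixes f :: "complex \<Rightarrow> 'b::{banach,second_countable_topology}"
  assumes "f \<in> borel_measurable circ" "norm z < 1"
  shows "(LINT x|poisson_measure z. f x) = (LINT x|circ. poisson z x *\<^sub>R f x)"
  unfolding poisson_measure_def using assms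
  by (intro integral_density) (auto simp: poisson_nonneg)

lemma integrable_poisson_measure:
  fixes f :: "complex \<Rightarrow> 'b::{banach,second_countable_topology}"
  assumes "f \<in> borel_measurable circ" "norm z < 1"
  shows "integrable (poisson_measure z) f \<longleftrightarrow> integrable circ (\<lambda>x. poisson z x *\<^sub>R f x)"
  unfolding poisson_measure_def using assms
  by (intro integrable_density) (auto simp: poisson_nonneg)

lemma integral_poisson_1: "norm z < 1 \<Longrightarrow> (LINT x|circ. poisson z x) = 1"
  using integral_poisson_zpow[of z 0] by (simp del: of_real_eq_1_iff add: of_real_eq_1_iff[where 'a = complex])

lemma integrable_poisson: "norm z < 1 \<Longrightarrow> integrable circ (poisson z)"
proof (rule circ.integrable_const_bound)
  assume z: "norm z < 1"
  show "AE x in circ. norm (poisson z x) \<le> (1 + norm z) / (1 - norm z)"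
    using poisson_bounds(2,3)[OF _ z] by (intro AE_I2) (auto simp: abs_of_pos)
qed measurable

lemma prob_space_poisson_measure:
  assumes z: "norm z < 1"
  shows "prob_space (poisson_measure z)"
proof
  have "emeasure (poisson_measure z) (space (poisson_measure z)) = (\<integral>\<^sup>+x. ennreal (poisson z x) \<partial>circ)"
    unfolding poisson_measure_def by (subst emeasure_density) (auto intro!: nn_integral_cong)
  also have "\<dots> = ennreal (LINT x|circ. poisson z x)"
    by (rule nn_integral_eq_integral[OF integrable_poisson[OF z]]) (simp add: poisson_nonneg[OF z])
  finally show "emeasure (poisson_measure z) (space (poisson_measure z)) = 1"
    by (simp add: integral_poisson_1[OF z])
qed

text \<open>Only the values on the circle count: there products of harmonic monomials are again monomials, while
  inside the disk they are not even harmonic.\<close>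

definition trig :: "(complex \<Rightarrow> complex) \<Rightarrow> bool" where
  "trig p \<longleftrightarrow> (\<exists>N c. \<forall>x\<in>sphere 0 1. p x = (\<Sum>k\<in>{- int N..int N}. c k * zpow x k))"

lemma trig_finite_sum:
  assumes K: "finite K" and p: "\<And>x. norm x = 1 \<Longrightarrow> p x = (\<Sum>k\<in>K. c k * zpow x k)"
  shows "trig p"
proof -
  define N where "N = Max (insert 0 ((\<lambda>k. nat \<bar>k\<bar>) ` K))"
  have "K \<subseteq> {- int N..int N}"
  proof
    fix k assume "k \<in> K"
    then have "nat \<bar>k\<bar> \<le> N" unfolding N_def using K by (intro Max_ge) auto
    then show "k \<in> {- int N..int N}" by auto
  qed
  then have "(\<Sum>k\<in>{- int N..int N}. (if k \<in> K then c k else 0) * zpow x k) = (\<Sum>k\<in>K. c k * zpow x k)" for x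
    by (intro sum.mono_neutral_cong_right) auto
  then show ?thesis unfolding trig_def using p by (intro exI[of _ N] exI[of _ "\<lambda>k. if k \<in> K then c k else 0"]) auto
qed

lemma trig_cong: "trig p \<Longrightarrow> (\<And>x. norm x = 1 \<Longrightarrow> p x = q x) \<Longrightarrow> trig q"
  unfolding trig_def by (metis mem_sphere_0)

lemma trig_monomial: "trig (\<lambda>x. c * zpow x k)"
  by (rule trig_finite_sum[of "{k}" _ "\<lambda>_. c"]) auto

lemma trig_const: "trig (\<lambda>x. c)"
  using trig_monomial[of c 0] by simp

lemma trig_add:
  assumes "trig p" "trig q"
  shows "trig (\<lambda>x. p x + q x)"
proof -
  obtain N c where p: "\<And>x. norm x = 1 \<Longrightarrow> p x = (\<Sum>k\<in>{- int N..int N}. c k * zpow x k)"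
    using assms(1) by (auto simp: trig_def)
  obtain M d where q: "\<And>x. norm x = 1 \<Longrightarrow> q x = (\<Sum>k\<in>{- int M..int M}. d k * zpow x k)"
    using assms(2) by (auto simp: trig_def)
  let ?K = "{- int N..int N}" and ?J = "{- int M..int M}"
  show ?thesis
  proof (rule trig_finite_sum[of "?K \<union> ?J"])
    fix x :: complex assume x: "norm x = 1"
    have "(\<Sum>k\<in>?K \<union> ?J. (if k \<in> ?K then c k else 0) * zpow x k) = p x"
      unfolding p[OF x] by (intro sum.mono_neutral_cong_right) auto
    moreover have "(\<Sum>k\<in>?K \<union> ?J. (if k \<in> ?J then d k else 0) * zpow x k) = q x"
      unfolding q[OF x] by (intro sum.mono_neutral_cong_right) auto
    ultimately show "p x + q x = (\<Sum>k\<in>?K \<union> ?J. ((if k \<in> ?K then c k else 0) + (if k \<in> ?J then d k else 0)) * zpow x k)"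
      by (simp add: sum.distrib distrib_right)
  qed simp
qed

lemma trig_sum: "(\<And>i. i \<in> I \<Longrightarrow> trig (f i)) \<Longrightarrow> trig (\<lambda>x. \<Sum>i\<in>I. f i x)"
  by (induction I rule: infinite_finite_induct) (auto intro: trig_add trig_const)

lemma trig_mult:
  assumes "trig p" "trig q"
  shows "trig (\<lambda>x. p x * q x)"
proof -
  obtain N c where p: "\<And>x. norm x = 1 \<Longrightarrow> p x = (\<Sum>k\<in>{- int N..int N}. c k * zpow x k)"
    using assms(1) by (auto simp: trig_def)
  obtain M d where q: "\<And>x. norm x = 1 \<Longrightarrow> q x = (\<Sum>k\<in>{- int M..int M}. d k * zpow x k)"
    using assms(2) by (auto simp: trig_def)
  have "trig (\<lambda>x. \<Sum>j\<in>{- int N..int N}. \<Sum>k\<in>{- int M..int M}. (c j * d k) * zpow x (j + k))"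
    by (intro trig_sum trig_monomial)
  then show ?thesis
    by (rule trig_cong) (simp add: p q sum_product zpow_add mult_ac)
qed

lemma trig_cmult: "trig p \<Longrightarrow> trig (\<lambda>x. c * p x)"
  by (intro trig_mult trig_const)

lemma trig_diff: "trig p \<Longrightarrow> trig q \<Longrightarrow> trig (\<lambda>x. p x - q x)"
  using trig_add[of p "\<lambda>x. -1 * q x"] trig_cmult[of q "-1"] by simp

lemma trig_cnj:
  assumes "trig p"
  shows "trig (\<lambda>x. cnj (p x))"
proof -
  obtain N c where p: "\<And>x. norm x = 1 \<Longrightarrow> p x = (\<Sum>k\<in>{- int N..int N}. c k * zpow x k)"
    using assms by (auto simp: trig_def)
  have "trig (\<lambda>x. \<Sum>k\<in>{- int N..int N}. cnj (c k) * zpow x (- k))"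
    by (intro trig_sum trig_monomial)
  then show ?thesis by (rule trig_cong) (simp add: p cnj_zpow)
qed

lemma trig_Re:
  assumes "trig p"
  shows "trig (\<lambda>x. complex_of_real (Re (p x)))"
proof (rule trig_cong)
  show "trig (\<lambda>x. (1 / 2) * (p x + cnj (p x)))"
    by (intro trig_cmult trig_add trig_cnj assms)
  show "(1 / 2) * (p x + cnj (p x)) = complex_of_real (Re (p x))" for x
    by (simp add: complex_add_cnj)
qed

lemma trig_ident: "trig (\<lambda>x. x)"
  using trig_monomial[of 1 1] by (simp add: zpow_def)

lemma trig_real_polynomial_function:
  assumes "real_polynomial_function g"
  shows "trig (\<lambda>x. complex_of_real (g x))"
  using assms
proof induction
  case (linear f)
  interpret bounded_linear f by fact
  have f: "f x = Re x * f 1 + Im x * f \<i>" for x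
  proof -
    have "f x = f (Re x *\<^sub>R 1 + Im x *\<^sub>R \<i>)"
      by (rule arg_cong[where f = f]) (simp add: complex_eq_iff)
    then show ?thesis by (simp only: add scaleR real_scaleR_def)
  qed
  have "trig (\<lambda>x. complex_of_real (Re x) * of_real (f 1) + complex_of_real (Re (- \<i> * x)) * of_real (f \<i>))"
    by (intro trig_add trig_mult trig_Re trig_const trig_ident)
  then show ?case
  proof (rule trig_cong)
    fix x
    show "complex_of_real (Re x) * of_real (f 1) + complex_of_real (Re (- \<i> * x)) * of_real (f \<i>) = of_real (f x)"
      unfolding f[of x] by simp
  qed
next
  case (add f g)
  then show ?case by (simp add: trig_add)
next
  case (mult f g)
  then show ?case by (simp add: trig_mult)
qed (rule trig_const)

lemma trig_bounded_measurable:
  assumes "trig p"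
  shows "p \<in> borel_measurable circ" and "\<exists>B. \<forall>x\<in>sphere 0 1. norm (p x) \<le> B"
proof -
  obtain N c where p: "\<And>x. norm x = 1 \<Longrightarrow> p x = (\<Sum>k\<in>{- int N..int N}. c k * zpow x k)"
    using assms by (auto simp: trig_def)
  have "(\<lambda>x. \<Sum>k\<in>{- int N..int N}. c k * zpow x k) \<in> borel_measurable circ" by measurable
  then show "p \<in> borel_measurable circ"
    by (rule measurable_cong[THEN iffD1, rotated]) (simp add: p)
  have "norm (p x) \<le> (\<Sum>k\<in>{- int N..int N}. norm (c k))" if "norm x = 1" for x
    unfolding p[OF that] by (rule sum_norm_le) (simp add: norm_mult that)
  then show "\<exists>B. \<forall>x\<in>sphere 0 1. norm (p x) \<le> B" by (intro exI) auto
qed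

lemma square_integrable_trig: "trig p \<Longrightarrow> square_integrable circ p"
  using trig_bounded_measurable[of p] by (auto intro!: circ.square_integrable_bounded)

text \<open>Stone-Weierstrass approximates continuous functions that decrease to the indicator; the bound \<open>2\<close> leaves room
  for the error of approximation.\<close>

lemma trig_approx_indicator:
  fixes C :: "complex set"
  assumes C: "closed C"
  obtains p :: "nat \<Rightarrow> complex \<Rightarrow> real" where "\<And>n. trig (\<lambda>x. complex_of_real (p n x))"
    "\<And>n x. norm x = 1 \<Longrightarrow> \<bar>p n x\<bar> \<le> 2"
    "\<And>x. norm x = 1 \<Longrightarrow> (\<lambda>n. p n x) \<longlonglongrightarrow> indicator C x"
proof -
  define g where "g n x = (if C = {} then 0 else max 0 (1 - real n * infdist x C))" for n and x :: complex
  have g01: "0 \<le> g n x" "g n x \<le> 1" for n x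
    by (auto simp: g_def infdist_nonneg)
  have gc: "continuous_on (sphere 0 1) (g n)" for n
    unfolding g_def by (cases "C = {}") (auto intro!: continuous_intros)
  have glim: "(\<lambda>n. g n x) \<longlonglongrightarrow> indicator C x" for x
  proof (rule tendsto_eventually, cases "x \<in> C")
    case True
    then show "\<forall>\<^sub>F n in sequentially. g n x = indicator C x" by (auto simp: g_def)
  next
    case False
    show "\<forall>\<^sub>F n in sequentially. g n x = indicator C x"
    proof (cases "C = {}")
      case True
      then show ?thesis by (simp add: g_def)
    next
      case ne: False
      have d: "0 < infdist x C"
        using in_closed_iff_infdist_zero[OF C ne, of x] False infdist_nonneg[of x C] by linarith
      obtain n0 :: nat where n0: "1 < real n0 * infdist x C" using reals_Archimedean3[OF d] by blast
      have "g n x = indicator C x" if "n0 \<le> n" for n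
      proof -
        have "real n0 * infdist x C \<le> real n * infdist x C" using that d by (intro mult_right_mono) auto
        then show ?thesis using n0 False ne by (simp add: g_def)
      qed
      then show ?thesis by (auto simp: eventually_sequentially)
    qed
  qed
  have "\<exists>p. real_polynomial_function p \<and> (\<forall>x\<in>sphere 0 1. \<bar>g n x - p x\<bar> < inverse (real (Suc n)))" for n
    by (rule Stone_Weierstrass_real_polynomial_function[OF compact_sphere gc[of n], of "inverse (real (Suc n))"]) auto
  then have "\<forall>n. \<exists>p. real_polynomial_function p \<and> (\<forall>x\<in>sphere 0 1. \<bar>g n x - p x\<bar> < inverse (real (Suc n)))" ..
  from choice[OF this] obtain p where "\<forall>n. real_polynomial_function (p n) \<and> (\<forall>x\<in>sphere 0 1. \<bar>g n x - p n x\<bar> < inverse (real (Suc n)))" ..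
  then have p: "real_polynomial_function (p n)" and pg: "x \<in> sphere 0 1 \<Longrightarrow> \<bar>g n x - p n x\<bar> < inverse (real (Suc n))" for n x
    by simp_all
  show ?thesis
  proof
    show "trig (\<lambda>x. complex_of_real (p n x))" for n by (rule trig_real_polynomial_function[OF p])
    fix x :: complex assume x: "norm x = 1"
    have inv1: "inverse (real (Suc n)) \<le> 1" for n by (simp add: field_simps)
    show "\<bar>p n x\<bar> \<le> 2" for n
      using pg[of x n] g01[of n x] inv1[of n] x by (simp del: of_nat_Suc)
    have "(\<lambda>n. p n x - g n x) \<longlonglongrightarrow> 0"
    proof (rule Lim_null_comparison[OF _ LIMSEQ_inverse_real_of_nat])
      show "\<forall>\<^sub>F n in sequentially. norm (p n x - g n x) \<le> inverse (real (Suc n))"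
      proof (intro always_eventually allI)
        fix n
        show "norm (p n x - g n x) \<le> inverse (real (Suc n))"
          using pg[of x n] x unfolding real_norm_def by (subst abs_minus_commute) (simp del: of_nat_Suc)
      qed
    qed
    from tendsto_add[OF this glim[of x]] show "(\<lambda>n. p n x) \<longlonglongrightarrow> indicator C x" by simp
  qed
qed

lemma measurable_complex_indicator:
  assumes [measurable]: "B \<in> sets borel"
  shows "(\<lambda>x. complex_of_real (indicator B x)) \<in> borel_measurable borel"
  by measurable

lemma sphere_measurable:
  assumes "sets M = sets (restrict_space borel (sphere (0::complex) 1))"
  shows "f \<in> borel_measurable borel \<Longrightarrow> f \<in> borel_measurable M"
    and "space M = sphere 0 1"
    and "(\<lambda>x. x) \<in> M \<rightarrow>\<^sub>M borel"
proof -
  show a: "f \<in> borel_measurable borel \<Longrightarrow> f \<in> borel_measurable M" for f :: "complex \<Rightarrow> 'b::topological_space"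
    by (simp add: measurable_cong_sets[OF assms refl] measurable_restrict_space1)
  show "space M = sphere 0 1" using sets_eq_imp_space_eq[OF assms] by (simp add: space_restrict_space)
  show "(\<lambda>x. x) \<in> M \<rightarrow>\<^sub>M borel" by (simp add: measurable_cong_sets[OF assms refl] measurable_restrict_space1)
qed

text \<open>Closed sets generate the Borel sets, and their indicators are bounded pointwise limits of trigonometric
  polynomials, on whose integrals the two measures agree.\<close>

lemma measure_eqI_zpow:
  fixes M N :: "complex measure"
  assumes M: "finite_measure M" "sets M = sets (restrict_space borel (sphere 0 1))"
    and N: "finite_measure N" "sets N = sets (restrict_space borel (sphere 0 1))"
    and eq: "\<And>k. (LINT x|M. zpow x k) = (LINT x|N. zpow x k)"
  shows "M = N"
proof -
  interpret M: finite_measure M by fact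
  interpret N: finite_measure N by fact
  have zi: "integrable M (\<lambda>x. zpow x k)" "integrable N (\<lambda>x. zpow x k)" for k
    by (rule M.integrable_const_bound[where B = 1] N.integrable_const_bound[where B = 1];
        auto simp: sphere_measurable[OF M(2)] sphere_measurable[OF N(2)] intro!: AE_I2)+
  have trig_eq: "(LINT x|M. p x) = (LINT x|N. p x)" if tp: "trig p" for p
  proof -
    obtain n c where p: "\<And>x. norm x = 1 \<Longrightarrow> p x = (\<Sum>k\<in>{- int n..int n}. c k * zpow x k)"
      using tp by (auto simp: trig_def)
    have "(LINT x|M. p x) = (LINT x|M. (\<Sum>k\<in>{- int n..int n}. c k * zpow x k))"
      by (intro Bochner_Integration.integral_cong) (auto simp: p sphere_measurable[OF M(2)])
    also have "\<dots> = (LINT x|N. (\<Sum>k\<in>{- int n..int n}. c k * zpow x k))"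
      using zi eq by (simp add: Bochner_Integration.integral_sum)
    also have "\<dots> = (LINT x|N. p x)"
      by (intro Bochner_Integration.integral_cong) (auto simp: p sphere_measurable[OF N(2)])
    finally show ?thesis .
  qed
  have closed_eq: "measure M (C \<inter> sphere 0 1) = measure N (C \<inter> sphere 0 1)" if C: "closed C" for C
  proof -
    obtain p :: "nat \<Rightarrow> complex \<Rightarrow> real" where p: "\<And>n. trig (\<lambda>x. complex_of_real (p n x))"
      "\<And>n x. norm x = 1 \<Longrightarrow> \<bar>p n x\<bar> \<le> 2" "\<And>x. norm x = 1 \<Longrightarrow> (\<lambda>n. p n x) \<longlonglongrightarrow> indicator C x"
      by (rule trig_approx_indicator[OF C]) (rule that, assumption+)
    have lim: "(\<lambda>n. LINT x|K. complex_of_real (p n x)) \<longlonglongrightarrow> complex_of_real (measure K (C \<inter> sphere 0 1))"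
      if K: "finite_measure K" "sets K = sets (restrict_space borel (sphere 0 1))" for K
    proof -
      interpret K: finite_measure K by fact
      have Cm: "(\<lambda>x. complex_of_real (indicator C x)) \<in> borel_measurable K"
        by (intro sphere_measurable(1)[OF K(2)] measurable_complex_indicator borel_closed C)
      have "(\<lambda>n. LINT x|K. complex_of_real (p n x)) \<longlonglongrightarrow> (LINT x|K. complex_of_real (indicator C x))"
      proof (rule integral_dominated_convergence[where w = "\<lambda>_. 2"])
        show "AE x in K. (\<lambda>n. complex_of_real (p n x)) \<longlonglongrightarrow> complex_of_real (indicator C x)"
          using p(3) by (intro AE_I2 tendsto_of_real) (simp add: sphere_measurable[OF K(2)])
        show "AE x in K. norm (complex_of_real (p n x)) \<le> 2" for n
          using p(2) by (intro AE_I2) (simp add: sphere_measurable[OF K(2)])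
        show "(\<lambda>x. complex_of_real (p n x)) \<in> borel_measurable K" for n
          using trig_bounded_measurable(1)[OF p(1)[of n]] by (simp add: measurable_cong_sets[OF K(2) refl] measurable_cong_sets[OF sets_circ refl])
      qed (use Cm in auto)
      also have "(LINT x|K. complex_of_real (indicator C x)) = complex_of_real (measure K (C \<inter> sphere 0 1))"
        by (simp add: sphere_measurable[OF K(2)])
      finally show ?thesis .
    qed
    have "(\<lambda>n. LINT x|M. complex_of_real (p n x)) = (\<lambda>n. LINT x|N. complex_of_real (p n x))"
      using trig_eq[OF p(1)] by simp
    then have "complex_of_real (measure M (C \<inter> sphere 0 1)) = complex_of_real (measure N (C \<inter> sphere 0 1))"
      using lim[OF M] lim[OF N] LIMSEQ_unique by metis
    then show ?thesis by simp
  qed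
  have "distr M borel (\<lambda>x. x) = distr N borel (\<lambda>x. x)"
  proof (rule measure_eqI_generator_eq[where E = "Collect closed" and \<Omega> = UNIV and A = "\<lambda>_. UNIV"])
    show "Int_stable (Collect closed)" by (auto simp: Int_stable_def)
    fix X :: "complex set" assume "X \<in> Collect closed"
    then have X: "closed X" by simp
    then show "emeasure (distr M borel (\<lambda>x. x)) X = emeasure (distr N borel (\<lambda>x. x)) X"
      using closed_eq[OF X] by (simp add: emeasure_distr sphere_measurable[OF M(2)] sphere_measurable[OF N(2)]
          M.emeasure_eq_measure N.emeasure_eq_measure)
  next
    show "emeasure (distr M borel (\<lambda>x. x)) UNIV \<noteq> \<infinity>"
      by (simp add: emeasure_distr sphere_measurable[OF M(2)] M.emeasure_eq_measure)
  qed (auto simp: borel_eq_closed)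
  then have d: "emeasure (distr M borel (\<lambda>x. x)) B = emeasure (distr N borel (\<lambda>x. x)) B" for B
    by (rule arg_cong)
  show "M = N"
  proof (rule measure_eqI)
    show "sets M = sets N" using M N by simp
    fix A assume "A \<in> sets M"
    then obtain B where B: "B \<in> sets borel" "A = sphere 0 1 \<inter> B"
      unfolding M(2) sets_restrict_space by auto
    then show "emeasure M A = emeasure N A"
      using d[of B] by (simp add: emeasure_distr sphere_measurable[OF M(2)] sphere_measurable[OF N(2)] Int_commute)
  qed
qed

text \<open>Inner regularity replaces a Borel set by a compact set, whose indicator is a bounded pointwise limit of
  trigonometric polynomials. Density in the whole space then follows by approximation with simple functions.\<close>

lemma trig_dense_indicator:
  assumes A: "A \<in> sets circ" and e: "0 < e"
  shows "\<exists>p. trig p \<and> l2_norm circ (\<lambda>x. complex_of_real (indicator A x) - p x) < e"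
proof -
  obtain B where B: "B \<in> sets borel" "A = sphere 0 1 \<inter> B"
    using A unfolding sets_circ sets_restrict_space by auto
  let ?M = "distr circ borel (\<lambda>x. x)"
  have id: "(\<lambda>x. x) \<in> circ \<rightarrow>\<^sub>M borel" by (rule sphere_measurable(3)) simp
  interpret D: prob_space ?M by (rule circ.prob_space_distr[OF id])
  have "emeasure ?M B = (SUP K \<in> {K. K \<subseteq> B \<and> compact K}. emeasure ?M K)"
    by (rule inner_regular) (use B D.emeasure_space_1 in auto)
  have "\<exists>K. K \<subseteq> B \<and> compact K \<and> measure ?M B < measure ?M K + (e / 2)\<^sup>2"
  proof (rule ccontr)
    assume neg: "\<not> ?thesis"
    have "emeasure ?M B \<le> ennreal (measure ?M B - (e / 2)\<^sup>2)"
      unfolding \<open>emeasure ?M B = _\<close>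
    proof (rule SUP_least)
      fix K assume "K \<in> {K. K \<subseteq> B \<and> compact K}"
      then have "measure ?M K \<le> measure ?M B - (e / 2)\<^sup>2" using neg by force
      then show "emeasure ?M K \<le> ennreal (measure ?M B - (e / 2)\<^sup>2)"
        by (simp add: D.emeasure_eq_measure ennreal_leI)
    qed
    moreover have "measure ?M {} \<le> measure ?M B - (e / 2)\<^sup>2"
      using neg compact_empty empty_subsetI[of B] by (metis not_le less_diff_eq add.commute diff_less_eq)
    ultimately have "measure ?M B \<le> measure ?M B - (e / 2)\<^sup>2"
      by (simp add: D.emeasure_eq_measure ennreal_le_iff)
    then show False using e by simp
  qed
  then obtain K where K: "K \<subseteq> B" "compact K" "measure ?M B < measure ?M K + (e / 2)\<^sup>2" by blast
  have Kb: "K \<in> sets borel" using K(2) by (simp add: borel_compact)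
  let ?d = "\<lambda>x. complex_of_real (indicator A x) - complex_of_real (indicator K x)"
  have im: "(\<lambda>x. complex_of_real (indicator A x)) \<in> borel_measurable circ" using A by measurable
  have km: "(\<lambda>x. complex_of_real (indicator K x)) \<in> borel_measurable circ"
    by (intro borel_measurable_circ measurable_complex_indicator Kb)
  have isq: "square_integrable circ (\<lambda>x. complex_of_real (indicator A x))"
    by (rule circ.square_integrable_bounded[OF im, of 1]) (simp add: indicator_def)
  have ks: "square_integrable circ (\<lambda>x. complex_of_real (indicator K x))"
    by (rule circ.square_integrable_bounded[OF km, of 1]) (simp add: indicator_def)
  have "(l2_norm circ ?d)\<^sup>2 = (LINT x|circ. indicator (B - K) x)"
    unfolding l2_norm_sq using B(2) K(1)
    by (intro Bochner_Integration.integral_cong) (auto simp: indicator_def)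
  also have "\<dots> = measure circ ((B - K) \<inter> sphere 0 1)" by simp
  also have "\<dots> = measure ?M (B - K)"
    using B(1) Kb by (subst measure_distr[OF id]) auto
  also have "\<dots> = measure ?M B - measure ?M K"
    using B(1) Kb K(1) by (intro D.finite_measure_Diff) auto
  also have "\<dots> < (e / 2)\<^sup>2" using K(3) by linarith
  finally have d: "l2_norm circ ?d < e / 2"
    by (rule power_less_imp_less_base) (use e in simp)
  obtain p :: "nat \<Rightarrow> complex \<Rightarrow> real" where p: "\<And>n. trig (\<lambda>x. complex_of_real (p n x))"
      "\<And>n x. norm x = 1 \<Longrightarrow> \<bar>p n x\<bar> \<le> 2" "\<And>x. norm x = 1 \<Longrightarrow> (\<lambda>n. p n x) \<longlonglongrightarrow> indicator K x"
    by (rule trig_approx_indicator[OF compact_imp_closed[OF K(2)]]) (rule that, assumption+)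
  have pm: "(\<lambda>x. complex_of_real (p n x)) \<in> borel_measurable circ" for n by (rule trig_bounded_measurable(1)[OF p(1)])
  have "(\<lambda>n. LINT x|circ. (norm (complex_of_real (indicator K x) - complex_of_real (p n x)))\<^sup>2) \<longlonglongrightarrow> (LINT x|circ. 0)"
  proof (rule integral_dominated_convergence[where w = "\<lambda>_. 3\<^sup>2"])
    show "AE x in circ. (\<lambda>n. (norm (complex_of_real (indicator K x) - complex_of_real (p n x)))\<^sup>2) \<longlonglongrightarrow> 0"
    proof (rule AE_I2)
      fix x assume "x \<in> space circ"
      then have "(\<lambda>n. p n x) \<longlonglongrightarrow> indicator K x" using p(3) by simp
      then have "(\<lambda>n. (norm (complex_of_real (indicator K x) - complex_of_real (p n x)))\<^sup>2) \<longlonglongrightarrow>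
         (norm (complex_of_real (indicator K x) - complex_of_real (indicator K x)))\<^sup>2"
        by (intro tendsto_power tendsto_norm tendsto_diff tendsto_of_real tendsto_const)
      then show "(\<lambda>n. (norm (complex_of_real (indicator K x) - complex_of_real (p n x)))\<^sup>2) \<longlonglongrightarrow> 0" by simp
    qed
    show "AE x in circ. norm ((norm (complex_of_real (indicator K x) - complex_of_real (p n x)))\<^sup>2) \<le> 3\<^sup>2" for n
    proof (rule AE_I2)
      fix x assume "x \<in> space circ"
      then have "norm (complex_of_real (p n x)) \<le> 2" using p(2) by simp
      moreover have "norm (complex_of_real (indicator K x)) \<le> 1" by (simp add: indicator_def)
      ultimately have "norm (complex_of_real (indicator K x) - complex_of_real (p n x)) \<le> 3"
        using norm_triangle_ineq4[of "complex_of_real (indicator K x)" "complex_of_real (p n x)"] by linarith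
      then show "norm ((norm (complex_of_real (indicator K x) - complex_of_real (p n x)))\<^sup>2) \<le> 3\<^sup>2"
        by (simp only: real_norm_def abs_power2) (rule power_mono, auto)
    qed
  qed (use km pm in auto)
  from tendsto_real_sqrt[OF this]
  have "(\<lambda>n. l2_norm circ (\<lambda>x. complex_of_real (indicator K x) - complex_of_real (p n x))) \<longlonglongrightarrow> 0"
    by (simp add: l2_norm_def)
  then have "\<forall>\<^sub>F n in sequentially. l2_norm circ (\<lambda>x. complex_of_real (indicator K x) - complex_of_real (p n x)) < e / 2"
    by (rule order_tendstoD(2)) (use e in simp)
  then obtain n where n: "l2_norm circ (\<lambda>x. complex_of_real (indicator K x) - complex_of_real (p n x)) < e / 2"
    by (auto simp: eventually_sequentially)
  have "l2_norm circ (\<lambda>x. complex_of_real (indicator A x) - complex_of_real (p n x)) =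
     l2_norm circ (\<lambda>x. ?d x + (complex_of_real (indicator K x) - complex_of_real (p n x)))"
    by simp
  also have "\<dots> \<le> l2_norm circ ?d + l2_norm circ (\<lambda>x. complex_of_real (indicator K x) - complex_of_real (p n x))"
    by (intro l2_norm_triangle square_integrable_diff isq ks square_integrable_trig p)
  also have "\<dots> < e" using d n by linarith
  finally show ?thesis using p(1)[of n] by blast
qed

lemma trig_dense:
  fixes f :: "complex \<Rightarrow> complex"
  assumes f: "square_integrable circ f" and e: "0 < e"
  shows "\<exists>p. trig p \<and> l2_norm circ (\<lambda>x. f x - p x) < e"
proof -
  note [measurable] = square_integrable_measurable[OF f]
  obtain s where "(\<forall>i. simple_function circ (s i)) \<and> (\<forall>x\<in>space circ. (\<lambda>i. s i x) \<longlonglongrightarrow> f x) \<and>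
      (\<forall>i. \<forall>x\<in>space circ. dist (s i x) 0 \<le> 2 * dist (f x) 0)"
    using borel_measurable_implies_sequence_metric[OF square_integrable_measurable[OF f], of 0] ..
  then have s: "simple_function circ (s i)" "x \<in> space circ \<Longrightarrow> (\<lambda>i. s i x) \<longlonglongrightarrow> f x"
    "x \<in> space circ \<Longrightarrow> dist (s i x) 0 \<le> 2 * dist (f x) 0" for i x
    by blast+
  note [measurable] = borel_measurable_simple_function[OF s(1)]
  have "(\<lambda>n. LINT x|circ. (norm (f x - s n x))\<^sup>2) \<longlonglongrightarrow> (LINT x|circ. 0)"
  proof (rule integral_dominated_convergence[where w = "\<lambda>x. 9 * (norm (f x))\<^sup>2"])
    show "AE x in circ. (\<lambda>n. (norm (f x - s n x))\<^sup>2) \<longlonglongrightarrow> 0"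
    proof (rule AE_I2)
      fix x assume "x \<in> space circ"
      from tendsto_power[OF tendsto_norm[OF tendsto_diff[OF tendsto_const s(2)[OF this]]], of "f x" 2]
      show "(\<lambda>n. (norm (f x - s n x))\<^sup>2) \<longlonglongrightarrow> 0" by simp
    qed
    show "AE x in circ. norm ((norm (f x - s n x))\<^sup>2) \<le> 9 * (norm (f x))\<^sup>2" for n
    proof (rule AE_I2)
      fix x assume "x \<in> space circ"
      then have "norm (f x - s n x) \<le> 3 * norm (f x)"
        using s(3)[of x n] norm_triangle_ineq4[of "f x" "s n x"] by simp
      then have "(norm (f x - s n x))\<^sup>2 \<le> (3 * norm (f x))\<^sup>2" by (rule power_mono) simp
      then show "norm ((norm (f x - s n x))\<^sup>2) \<le> 9 * (norm (f x))\<^sup>2" by (simp add: power_mult_distrib)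
    qed
    show "integrable circ (\<lambda>x. 9 * (norm (f x))\<^sup>2)" using square_integrable_sq[OF f] by simp
  qed auto
  from tendsto_real_sqrt[OF this] have "(\<lambda>n. l2_norm circ (\<lambda>x. f x - s n x)) \<longlonglongrightarrow> 0"
    by (simp add: l2_norm_def)
  then have "\<forall>\<^sub>F n in sequentially. l2_norm circ (\<lambda>x. f x - s n x) < e / 2"
    by (rule order_tendstoD(2)) (use e in simp)
  then obtain n where n: "l2_norm circ (\<lambda>x. f x - s n x) < e / 2"
    by (auto simp: eventually_sequentially)
  define Y where "Y = s n ` space circ"
  define A where "A y = s n -` {y} \<inter> space circ" for y
  have Y: "finite Y" using s(1)[of n] by (auto simp: Y_def simple_function_def)
  have A: "A y \<in> sets circ" for y
    using simple_functionD(2)[OF s(1)[of n], of "{y}"] by (simp add: A_def)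
  define d where "d = e / (2 * (\<Sum>y\<in>Y. norm y) + 2)"
  have sY: "0 \<le> (\<Sum>y\<in>Y. norm y)" by (simp add: sum_nonneg)
  have d: "0 < d" using e sY unfolding d_def by (intro divide_pos_pos) auto
  have "\<forall>y. \<exists>p. trig p \<and> l2_norm circ (\<lambda>x. complex_of_real (indicator (A y) x) - p x) < d"
    by (intro allI trig_dense_indicator A d)
  from choice[OF this] obtain q where "\<forall>y. trig (q y) \<and> l2_norm circ (\<lambda>x. complex_of_real (indicator (A y) x) - q y x) < d" ..
  then have q: "trig (q y)" "l2_norm circ (\<lambda>x. complex_of_real (indicator (A y) x) - q y x) < d" for y by simp_all
  have isq: "square_integrable circ (\<lambda>x. complex_of_real (indicator (A y) x))" for y
    by (rule circ.square_integrable_bounded[of _ 1]) (use A[of y] in \<open>auto simp: indicator_def\<close>)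
  let ?p = "\<lambda>x. \<Sum>y\<in>Y. y * q y x"
  have p: "trig ?p" by (intro trig_sum trig_cmult q)
  have "s n x = (\<Sum>y\<in>Y. y * complex_of_real (indicator (A y) x))" if x: "x \<in> space circ" for x
  proof -
    have "(\<Sum>y\<in>Y. y * complex_of_real (indicator (A y) x)) = (\<Sum>y\<in>Y. if y = s n x then y else 0)"
      using x by (intro sum.cong) (auto simp: A_def)
    also have "\<dots> = s n x" using Y x by (simp add: Y_def)
    finally show ?thesis ..
  qed
  then have "l2_norm circ (\<lambda>x. s n x - ?p x) = l2_norm circ (\<lambda>x. \<Sum>y\<in>Y. y * (complex_of_real (indicator (A y) x) - q y x))"
    by (intro l2_norm_cong) (simp add: sum_subtractf right_diff_distrib)
  also have "\<dots> \<le> (\<Sum>y\<in>Y. l2_norm circ (\<lambda>x. y * (complex_of_real (indicator (A y) x) - q y x)))"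
    by (intro l2_norm_sum square_integrable_cmult square_integrable_diff isq square_integrable_trig q)
  also have "\<dots> \<le> (\<Sum>y\<in>Y. norm y * d)"
    unfolding l2_norm_cmult by (intro sum_mono mult_left_mono order_less_imp_le[OF q(2)]) auto
  also have "\<dots> = (\<Sum>y\<in>Y. norm y) * d" by (simp add: sum_distrib_right)
  also have "\<dots> < e / 2"
    using e sY unfolding d_def by (simp add: field_simps)
  finally have sp: "l2_norm circ (\<lambda>x. s n x - ?p x) < e / 2" .
  have "\<exists>B. \<forall>x\<in>space circ. norm (s n x) \<le> B"
    using finite_imp_bounded[OF Y] by (auto simp: Y_def bounded_iff)
  then obtain B where B: "\<And>x. x \<in> space circ \<Longrightarrow> norm (s n x) \<le> B" by blast
  have ss: "square_integrable circ (s n)" by (rule circ.square_integrable_bounded[OF _ B]) simp_all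
  have "l2_norm circ (\<lambda>x. f x - ?p x) = l2_norm circ (\<lambda>x. (f x - s n x) + (s n x - ?p x))" by simp
  also have "\<dots> \<le> l2_norm circ (\<lambda>x. f x - s n x) + l2_norm circ (\<lambda>x. s n x - ?p x)"
    by (intro l2_norm_triangle square_integrable_diff f ss square_integrable_trig p)
  also have "\<dots> < e" using n sp by linarith
  finally show ?thesis using p by blast
qed

section \<open>Fourier coefficients\<close>

definition fourier :: "(complex \<Rightarrow> complex) \<Rightarrow> int \<Rightarrow> complex" where
  "fourier f k = (LINT x|circ. f x * zpow x (- k))"

definition fourier_sum :: "(complex \<Rightarrow> complex) \<Rightarrow> nat \<Rightarrow> complex \<Rightarrow> complex" where
  "fourier_sum f N x = (\<Sum>k\<in>{- int N..int N}. fourier f k * zpow x k)"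

lemma square_integrable_zpow: "square_integrable circ (\<lambda>x. zpow x k)"
  using square_integrable_trig[OF trig_monomial[of 1 k]] by simp

lemma integrable_mult_zpow: "square_integrable circ f \<Longrightarrow> integrable circ (\<lambda>x. f x * zpow x k)"
  by (rule integrable_mult_square_integrable[OF _ square_integrable_zpow])

lemma integral_zpow: "(LINT x|circ. zpow x k) = (if k = 0 then 1 else 0)"
proof -
  have "(LINT x|circ. zpow x k) = (LINT x|circ. complex_of_real (poisson 0 x) * zpow x k)"
    by (intro Bochner_Integration.integral_cong) (auto simp: poisson_def)
  also have "\<dots> = zpow 0 k" by (rule integral_poisson_zpow) simp
  also have "\<dots> = (if k = 0 then 1 else 0)" by (auto simp: zpow_def)
  finally show ?thesis .
qed

lemma fourier_zpow_sum:
  assumes "finite J"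
  shows "fourier (\<lambda>x. \<Sum>j\<in>J. c j * zpow x j) k = (if k \<in> J then c k else 0)"
proof -
  have "fourier (\<lambda>x. \<Sum>j\<in>J. c j * zpow x j) k = (LINT x|circ. (\<Sum>j\<in>J. c j * zpow x (j - k)))"
    unfolding fourier_def
  proof (rule Bochner_Integration.integral_cong)
    fix x assume "x \<in> space circ"
    then have "zpow x (j - k) = zpow x j * zpow x (- k)" for j
      using zpow_add[of x j "- k"] by simp
    then show "(\<Sum>j\<in>J. c j * zpow x j) * zpow x (- k) = (\<Sum>j\<in>J. c j * zpow x (j - k))"
      by (simp add: sum_distrib_right mult.assoc)
  qed simp
  also have "\<dots> = (\<Sum>j\<in>J. c j * (if j - k = 0 then 1 else 0))"
    using circ.integrable_square_integrable[OF square_integrable_zpow]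
    by (simp add: Bochner_Integration.integral_sum integral_zpow)
  also have "\<dots> = (\<Sum>j\<in>J. if j = k then c j else 0)" by (intro sum.cong) auto
  also have "\<dots> = (if k \<in> J then c k else 0)" using assms by simp
  finally show ?thesis .
qed

lemma fourier_cong: "(\<And>x. norm x = 1 \<Longrightarrow> f x = g x) \<Longrightarrow> fourier f k = fourier g k"
  unfolding fourier_def by (intro Bochner_Integration.integral_cong) auto

lemma fourier_diff:
  assumes "square_integrable circ f" "square_integrable circ g"
  shows "fourier (\<lambda>x. f x - g x) k = fourier f k - fourier g k"
  unfolding fourier_def using assms[THEN integrable_mult_zpow] by (simp add: left_diff_distrib)

lemma norm_fourier_le: "square_integrable circ f \<Longrightarrow> norm (fourier f k) \<le> l2_norm circ f"
proof -
  assume f: "square_integrable circ f"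
  have "norm (fourier f k) \<le> l2_norm circ f * l2_norm circ (\<lambda>x. zpow x (- k))"
    unfolding fourier_def by (rule Cauchy_Schwarz[OF f square_integrable_zpow])
  also have "\<dots> \<le> l2_norm circ f * 1"
    by (intro mult_left_mono circ.l2_norm_bound) auto
  finally show ?thesis by simp
qed

lemma square_integrable_zpow_sum: "square_integrable circ (\<lambda>x. \<Sum>k\<in>J. d k * zpow x k)"
  by (intro square_integrable_sum square_integrable_cmult square_integrable_zpow)

lemma trig_fourier_sum: "trig (fourier_sum f N)"
  unfolding fourier_sum_def by (intro trig_sum trig_monomial)

lemma square_integrable_fourier_sum: "square_integrable circ (fourier_sum f N)"
  by (rule square_integrable_trig[OF trig_fourier_sum])

lemma square_integrable_cnj:
  "square_integrable M g \<Longrightarrow> square_integrable M (\<lambda>x. cnj (g x))"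
  unfolding square_integrable_def
proof safe
  assume g: "g \<in> borel_measurable M" and i: "integrable M (\<lambda>x. (cmod (g x))\<^sup>2)"
  have "cnj \<in> borel_measurable borel" by (intro borel_measurable_continuous_onI continuous_intros)
  from measurable_compose[OF g this] show "(\<lambda>x. cnj (g x)) \<in> borel_measurable M" .
  show "integrable M (\<lambda>x. (cmod (cnj (g x)))\<^sup>2)" using i by simp
qed

lemma integral_mult_cnj_zpow_sum:
  assumes f: "square_integrable circ f"
  shows "(LINT x|circ. f x * cnj (\<Sum>k\<in>J. d k * zpow x k)) = (\<Sum>k\<in>J. cnj (d k) * fourier f k)"
proof -
  have "(LINT x|circ. f x * cnj (\<Sum>k\<in>J. d k * zpow x k)) = (LINT x|circ. (\<Sum>k\<in>J. cnj (d k) * (f x * zpow x (- k))))"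
    by (simp add: cnj_zpow sum_distrib_left mult_ac)
  also have "\<dots> = (\<Sum>k\<in>J. cnj (d k) * fourier f k)"
    unfolding fourier_def using integrable_mult_zpow[OF f] by (simp add: Bochner_Integration.integral_sum)
  finally show ?thesis .
qed

text \<open>
  Completing the square: the Fourier sum is the orthogonal projection.
\<close>

lemma l2_norm_diff_zpow_sum_sq:
  assumes f: "square_integrable circ f" and J: "finite J"
  shows "(l2_norm circ (\<lambda>x. f x - (\<Sum>k\<in>J. d k * zpow x k)))\<^sup>2 =
    (l2_norm circ f)\<^sup>2 - (\<Sum>k\<in>J. (norm (fourier f k))\<^sup>2) + (\<Sum>k\<in>J. (norm (fourier f k - d k))\<^sup>2)"
proof -
  let ?p = "\<lambda>x. \<Sum>k\<in>J. d k * zpow x k"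
  have p: "square_integrable circ ?p" by (rule square_integrable_zpow_sum)
  have i: "integrable circ (\<lambda>x. f x * cnj (f x))" "integrable circ (\<lambda>x. f x * cnj (?p x))"
     "integrable circ (\<lambda>x. ?p x * cnj (f x))" "integrable circ (\<lambda>x. ?p x * cnj (?p x))"
    by (intro integrable_mult_square_integrable square_integrable_cnj f p)+
  have sq: "complex_of_real ((l2_norm circ g)\<^sup>2) = (LINT x|circ. g x * cnj (g x))" for g
    unfolding l2_norm_sq complex_norm_square[symmetric] by (rule integral_complex_of_real[symmetric])
  have A: "(LINT x|circ. f x * cnj (?p x)) = (\<Sum>k\<in>J. cnj (d k) * fourier f k)"
    by (rule integral_mult_cnj_zpow_sum[OF f])
  have B: "(LINT x|circ. ?p x * cnj (f x)) = (\<Sum>k\<in>J. d k * cnj (fourier f k))"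
  proof -
    have "(LINT x|circ. ?p x * cnj (f x)) = (LINT x|circ. cnj (f x * cnj (?p x)))" by (simp add: mult.commute)
    also have "\<dots> = cnj (LINT x|circ. f x * cnj (?p x))" by (rule Bochner_Integration.integral_cnj)
    also have "\<dots> = (\<Sum>k\<in>J. d k * cnj (fourier f k))" unfolding A by simp
    finally show ?thesis .
  qed
  have C: "(LINT x|circ. ?p x * cnj (?p x)) = (\<Sum>k\<in>J. cnj (d k) * d k)"
    unfolding integral_mult_cnj_zpow_sum[OF p] using fourier_zpow_sum[OF J] by (intro sum.cong) auto
  have "complex_of_real ((l2_norm circ (\<lambda>x. f x - ?p x))\<^sup>2) =
     (LINT x|circ. f x * cnj (f x) - f x * cnj (?p x) - ?p x * cnj (f x) + ?p x * cnj (?p x))"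
    unfolding sq by (intro Bochner_Integration.integral_cong refl) (simp add: algebra_simps del: cnj_sum)
  also have "\<dots> = (LINT x|circ. f x * cnj (f x)) - (LINT x|circ. f x * cnj (?p x)) - (LINT x|circ. ?p x * cnj (f x)) + (LINT x|circ. ?p x * cnj (?p x))"
    using i by (simp del: cnj_sum)
  also have "\<dots> = complex_of_real ((l2_norm circ f)\<^sup>2) - (\<Sum>k\<in>J. cnj (d k) * fourier f k)
      - (\<Sum>k\<in>J. d k * cnj (fourier f k)) + (\<Sum>k\<in>J. cnj (d k) * d k)"
    by (simp only: sq A B C)
  also have "\<dots> = complex_of_real ((l2_norm circ f)\<^sup>2) - (\<Sum>k\<in>J. fourier f k * cnj (fourier f k))
      + (\<Sum>k\<in>J. (fourier f k - d k) * cnj (fourier f k - d k))"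
    by (simp add: algebra_simps sum.distrib sum_subtractf)
  also have "\<dots> = complex_of_real ((l2_norm circ f)\<^sup>2 - (\<Sum>k\<in>J. (norm (fourier f k))\<^sup>2) + (\<Sum>k\<in>J. (norm (fourier f k - d k))\<^sup>2))"
    by (simp only: complex_norm_square[symmetric] of_real_add of_real_diff of_real_sum)
  finally show ?thesis by (simp only: of_real_eq_iff)
qed

lemma Bessel:
  assumes f: "square_integrable circ f" and J: "finite J"
  shows "(\<Sum>k\<in>J. (norm (fourier f k))\<^sup>2) \<le> (l2_norm circ f)\<^sup>2"
  using l2_norm_diff_zpow_sum_sq[OF f J, of "fourier f"]
    zero_le_power2[of "l2_norm circ (\<lambda>x. f x - (\<Sum>k\<in>J. fourier f k * zpow x k))"] by simp

lemma l2_norm_zpow_sum_sq: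
  assumes J: "finite J"
  shows "(l2_norm circ (\<lambda>x. \<Sum>k\<in>J. d k * zpow x k))\<^sup>2 = (\<Sum>k\<in>J. (norm (d k))\<^sup>2)"
  using l2_norm_diff_zpow_sum_sq[OF square_integrable_zero J, of d]
  by (simp add: fourier_def l2_norm_minus) (simp add: l2_norm_def)

lemma l2_norm_diff_fourier_sum_sq:
  assumes f: "square_integrable circ f"
  shows "(l2_norm circ (\<lambda>x. f x - fourier_sum f N x))\<^sup>2 =
    (l2_norm circ f)\<^sup>2 - (\<Sum>k\<in>{- int N..int N}. (norm (fourier f k))\<^sup>2)"
  using l2_norm_diff_zpow_sum_sq[OF f, of "{- int N..int N}" "fourier f"] by (simp add: fourier_sum_def)

lemma fourier_sum_tendsto:
  assumes f: "square_integrable circ f"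
  shows "(\<lambda>N. l2_norm circ (\<lambda>x. f x - fourier_sum f N x)) \<longlonglongrightarrow> 0"
proof (rule LIMSEQ_I)
  fix e :: real assume e: "0 < e"
  obtain p where p: "trig p" "l2_norm circ (\<lambda>x. f x - p x) < e" using trig_dense[OF f e] by blast
  obtain N0 c where c: "\<And>x. norm x = 1 \<Longrightarrow> p x = (\<Sum>k\<in>{- int N0..int N0}. c k * zpow x k)"
    using p(1) by (auto simp: trig_def)
  have "norm (l2_norm circ (\<lambda>x. f x - fourier_sum f N x) - 0) < e" if "N0 \<le> N" for N
  proof -
    have "(l2_norm circ (\<lambda>x. f x - fourier_sum f N x))\<^sup>2 \<le> (l2_norm circ f)\<^sup>2 - (\<Sum>k\<in>{- int N0..int N0}. (norm (fourier f k))\<^sup>2)"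
      unfolding l2_norm_diff_fourier_sum_sq[OF f] using that by (intro diff_left_mono sum_mono2) auto
    also have "\<dots> \<le> (l2_norm circ (\<lambda>x. f x - (\<Sum>k\<in>{- int N0..int N0}. c k * zpow x k)))\<^sup>2"
      unfolding l2_norm_diff_zpow_sum_sq[OF f finite_atLeastAtMost_int] by (simp add: sum_nonneg)
    also have "l2_norm circ (\<lambda>x. f x - (\<Sum>k\<in>{- int N0..int N0}. c k * zpow x k)) = l2_norm circ (\<lambda>x. f x - p x)"
      by (intro l2_norm_cong) (simp add: c)
    finally have "l2_norm circ (\<lambda>x. f x - fourier_sum f N x) \<le> l2_norm circ (\<lambda>x. f x - p x)"
      by (rule power2_le_imp_le) simp
    then show ?thesis using p(2) by simp
  qed
  then show "\<exists>no. \<forall>N\<ge>no. norm (l2_norm circ (\<lambda>x. f x - fourier_sum f N x) - 0) < e" by blast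
qed

lemma Parseval:
  assumes f: "square_integrable circ f"
  shows "(\<lambda>N. \<Sum>k\<in>{- int N..int N}. (norm (fourier f k))\<^sup>2) \<longlonglongrightarrow> (l2_norm circ f)\<^sup>2"
proof -
  have "(\<lambda>N. (l2_norm circ f)\<^sup>2 - (l2_norm circ (\<lambda>x. f x - fourier_sum f N x))\<^sup>2) \<longlonglongrightarrow> (l2_norm circ f)\<^sup>2 - 0\<^sup>2"
    by (intro tendsto_diff tendsto_const tendsto_power fourier_sum_tendsto f)
  then show ?thesis by (simp add: l2_norm_diff_fourier_sum_sq[OF f])
qed

lemma Parseval_pairing:
  assumes f: "square_integrable circ f" and g: "square_integrable circ g"
  shows "(\<lambda>N. \<Sum>k\<in>{- int N..int N}. fourier f k * cnj (fourier g k)) \<longlonglongrightarrow> (LINT x|circ. f x * cnj (g x))"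
proof -
  have lim: "(\<lambda>N. l2_norm circ f * l2_norm circ (\<lambda>x. g x - fourier_sum g N x)) \<longlonglongrightarrow> 0"
    by (rule tendsto_mult_right_zero[OF fourier_sum_tendsto[OF g]])
  show ?thesis
  proof (rule Lim_null_comparison[OF _ lim, THEN Lim_null[THEN iffD2]], intro always_eventually allI)
    fix N
    note s = square_integrable_fourier_sum[of g N]
    have "(\<Sum>k\<in>{- int N..int N}. fourier f k * cnj (fourier g k)) = (LINT x|circ. f x * cnj (fourier_sum g N x))"
      unfolding fourier_sum_def integral_mult_cnj_zpow_sum[OF f] by (simp add: mult.commute)
    then have "(\<Sum>k\<in>{- int N..int N}. fourier f k * cnj (fourier g k)) - (LINT x|circ. f x * cnj (g x)) =
        - (LINT x|circ. f x * cnj (g x - fourier_sum g N x))"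
      using integrable_mult_square_integrable[OF f square_integrable_cnj[OF g]]
        integrable_mult_square_integrable[OF f square_integrable_cnj[OF s]]
      by (simp add: right_diff_distrib)
    also have "norm \<dots> \<le> l2_norm circ f * l2_norm circ (\<lambda>x. cnj (g x - fourier_sum g N x))"
      unfolding norm_minus_cancel by (intro Cauchy_Schwarz f square_integrable_cnj square_integrable_diff g s)
    also have "l2_norm circ (\<lambda>x. cnj (g x - fourier_sum g N x)) = l2_norm circ (\<lambda>x. g x - fourier_sum g N x)"
      by (simp only: l2_norm_def complex_mod_cnj)
    finally show "norm ((\<Sum>k\<in>{- int N..int N}. fourier f k * cnj (fourier g k)) - (LINT x|circ. f x * cnj (g x))) \<le>
        l2_norm circ f * l2_norm circ (\<lambda>x. g x - fourier_sum g N x)" .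
  qed
qed

definition harmonic_ext :: "(complex \<Rightarrow> complex) \<Rightarrow> complex \<Rightarrow> complex" where
  "harmonic_ext f z = (LINT x|circ. complex_of_real (poisson z x) * f x)"

lemma square_integrable_poisson:
  assumes z: "norm z < 1"
  shows "square_integrable circ (\<lambda>x. complex_of_real (poisson z x))"
    and "l2_norm circ (\<lambda>x. complex_of_real (poisson z x)) \<le> (1 + norm z) / (1 - norm z)"
proof -
  have m: "(\<lambda>x. complex_of_real (poisson z x)) \<in> borel_measurable circ"
    by (intro borel_measurable_circ borel_measurable_of_real) measurable
  have b: "norm (complex_of_real (poisson z x)) \<le> (1 + norm z) / (1 - norm z)" if "x \<in> space circ" for x
    using poisson_bounds(2,3)[OF _ z, of x] that by simp
  show "square_integrable circ (\<lambda>x. complex_of_real (poisson z x))"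
    by (rule circ.square_integrable_bounded[OF m b])
  show "l2_norm circ (\<lambda>x. complex_of_real (poisson z x)) \<le> (1 + norm z) / (1 - norm z)"
    by (rule circ.l2_norm_bound[OF m b]) (use z in auto)
qed

lemma norm_harmonic_ext_le:
  assumes f: "square_integrable circ f" and z: "norm z < 1"
  shows "norm (harmonic_ext f z) \<le> (1 + norm z) / (1 - norm z) * l2_norm circ f"
proof -
  have "norm (harmonic_ext f z) \<le> l2_norm circ (\<lambda>x. complex_of_real (poisson z x)) * l2_norm circ f"
    unfolding harmonic_ext_def by (intro Cauchy_Schwarz square_integrable_poisson f z)
  also have "\<dots> \<le> (1 + norm z) / (1 - norm z) * l2_norm circ f"
    by (intro mult_right_mono square_integrable_poisson z) simp
  finally show ?thesis .
qed

lemma harmonic_ext_diff: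
  assumes f: "square_integrable circ f" and g: "square_integrable circ g" and z: "norm z < 1"
  shows "harmonic_ext (\<lambda>x. f x - g x) z = harmonic_ext f z - harmonic_ext g z"
  unfolding harmonic_ext_def
  using integrable_mult_square_integrable[OF square_integrable_poisson(1)[OF z] f]
    integrable_mult_square_integrable[OF square_integrable_poisson(1)[OF z] g]
  by (simp add: right_diff_distrib)

lemma harmonic_ext_zpow_sum:
  assumes z: "norm z < 1"
  shows "harmonic_ext (\<lambda>x. \<Sum>k\<in>J. c k * zpow x k) z = (\<Sum>k\<in>J. c k * zpow z k)"
proof -
  have "harmonic_ext (\<lambda>x. \<Sum>k\<in>J. c k * zpow x k) z =
     (LINT x|circ. (\<Sum>k\<in>J. c k * (complex_of_real (poisson z x) * zpow x k)))"
    by (simp add: harmonic_ext_def sum_distrib_left mult_ac)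
  also have "\<dots> = (\<Sum>k\<in>J. c k * (LINT x|circ. complex_of_real (poisson z x) * zpow x k))"
    using integrable_mult_zpow[OF square_integrable_poisson(1)[OF z]] by (simp add: Bochner_Integration.integral_sum)
  finally show ?thesis by (simp add: integral_poisson_zpow[OF z])
qed

text \<open>On a smaller circle the Poisson integral of the Fourier sums converges uniformly, so that measurability and
  Fourier coefficients pass to the limit.\<close>

lemma harmonic_ext_circle_approx:
  assumes f: "square_integrable circ f" and r: "0 \<le> r" "r < 1" and x: "norm x = 1"
  shows "norm (harmonic_ext f (of_real r * x) - (\<Sum>k\<in>{- int N..int N}. (fourier f k * of_real (r ^ nat \<bar>k\<bar>)) * zpow x k)) \<le>
     (1 + r) / (1 - r) * l2_norm circ (\<lambda>x. f x - fourier_sum f N x)"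
proof -
  let ?z = "of_real r * x"
  have z: "norm ?z < 1" "norm ?z = r" using r x by (auto simp: norm_mult)
  have "harmonic_ext (fourier_sum f N) ?z = (\<Sum>k\<in>{- int N..int N}. (fourier f k * of_real (r ^ nat \<bar>k\<bar>)) * zpow x k)"
    using harmonic_ext_zpow_sum[OF z(1)] by (simp add: fourier_sum_def[abs_def] zpow_of_real_mult mult.assoc)
  then show ?thesis
    using norm_harmonic_ext_le[OF square_integrable_diff[OF f square_integrable_fourier_sum] z(1), of f N]
    unfolding z(2) harmonic_ext_diff[OF f square_integrable_fourier_sum z(1)] by simp
qed

lemma square_integrable_harmonic_ext:
  assumes f: "square_integrable circ f" and r: "0 \<le> r" "r < 1"
  shows "square_integrable circ (\<lambda>x. harmonic_ext f (of_real r * x))"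
proof -
  let ?S = "\<lambda>N x. (\<Sum>k\<in>{- int N..int N}. (fourier f k * of_real (r ^ nat \<bar>k\<bar>)) * zpow x k)"
  have lim: "(\<lambda>N. ?S N x) \<longlonglongrightarrow> harmonic_ext f (of_real r * x)" if "x \<in> space circ" for x
  proof -
    have x: "norm x = 1" using that by simp
    have l: "(\<lambda>N. (1 + r) / (1 - r) * l2_norm circ (\<lambda>x. f x - fourier_sum f N x)) \<longlonglongrightarrow> 0"
      by (rule tendsto_mult_right_zero[OF fourier_sum_tendsto[OF f]])
    show ?thesis
    proof (rule Lim_null_comparison[OF _ l, THEN Lim_null[THEN iffD2]], intro always_eventually allI)
      show "norm (?S N x - harmonic_ext f (of_real r * x)) \<le> (1 + r) / (1 - r) * l2_norm circ (\<lambda>x. f x - fourier_sum f N x)" for N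
        using harmonic_ext_circle_approx[OF f r x] by (subst norm_minus_commute)
    qed
  qed
  have m: "(\<lambda>x. harmonic_ext f (of_real r * x)) \<in> borel_measurable circ"
    by (rule borel_measurable_LIMSEQ_metric[OF _ lim]) (intro square_integrable_measurable square_integrable_zpow_sum)
  show ?thesis
  proof (rule circ.square_integrable_bounded[OF m])
    fix x assume "x \<in> space circ"
    then have "norm (of_real r * x) = r" using r by (simp add: norm_mult)
    then show "norm (harmonic_ext f (of_real r * x)) \<le> (1 + r) / (1 - r) * l2_norm circ f"
      using norm_harmonic_ext_le[OF f, of "of_real r * x"] r by simp
  qed
qed

lemma fourier_harmonic_ext:
  assumes f: "square_integrable circ f" and r: "0 \<le> r" "r < 1"
  shows "fourier (\<lambda>x. harmonic_ext f (of_real r * x)) k = of_real (r ^ nat \<bar>k\<bar>) * fourier f k"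
proof -
  let ?A = "\<lambda>x. harmonic_ext f (of_real r * x)"
  let ?S = "\<lambda>N x. (\<Sum>k\<in>{- int N..int N}. (fourier f k * of_real (r ^ nat \<bar>k\<bar>)) * zpow x k)"
  let ?e = "\<lambda>N. (1 + r) / (1 - r) * l2_norm circ (\<lambda>x. f x - fourier_sum f N x)"
  have A: "square_integrable circ ?A" by (rule square_integrable_harmonic_ext[OF f r])
  have S: "square_integrable circ (?S N)" for N by (rule square_integrable_zpow_sum)
  have le: "norm (fourier ?A k - of_real (r ^ nat \<bar>k\<bar>) * fourier f k) \<le> ?e N" if "nat \<bar>k\<bar> \<le> N" for N
  proof -
    have k: "k \<in> {- int N..int N}" using that by auto
    have "fourier (?S N) k = of_real (r ^ nat \<bar>k\<bar>) * fourier f k"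
      unfolding fourier_zpow_sum[OF finite_atLeastAtMost_int] using k by (simp add: mult.commute)
    then have "norm (fourier ?A k - of_real (r ^ nat \<bar>k\<bar>) * fourier f k) = norm (fourier (\<lambda>x. ?A x - ?S N x) k)"
      using fourier_diff[OF A S, of N k] by simp
    also have "\<dots> \<le> l2_norm circ (\<lambda>x. ?A x - ?S N x)"
      by (intro norm_fourier_le square_integrable_diff A S)
    also have "\<dots> \<le> ?e N"
    proof (rule circ.l2_norm_bound)
      show "(\<lambda>x. ?A x - ?S N x) \<in> borel_measurable circ"
        by (intro square_integrable_measurable square_integrable_diff A S)
      show "norm (?A x - ?S N x) \<le> ?e N" if "x \<in> space circ" for x
        using harmonic_ext_circle_approx[OF f r, of x N] that by simp
      show "0 \<le> ?e N" using r by simp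
    qed
    finally show ?thesis .
  qed
  have l: "?e \<longlonglongrightarrow> 0"
    by (rule tendsto_mult_right_zero[OF fourier_sum_tendsto[OF f]])
  have "norm (fourier ?A k - of_real (r ^ nat \<bar>k\<bar>) * fourier f k) \<le> 0"
    by (rule LIMSEQ_le_const[OF l]) (use le in blast)
  then show ?thesis by simp
qed

text \<open>The Dirichlet energy \<open>\<Sum> \<bar>k\<bar> * \<bar>f_k\<bar>^2\<close> is at most \<open>B\<close>. Bounding the partial sums includes the finiteness of the
  energy in the statement.\<close>

definition dirichlet_le :: "(complex \<Rightarrow> complex) \<Rightarrow> real \<Rightarrow> bool" where
  "dirichlet_le f B \<longleftrightarrow> (\<forall>N. (\<Sum>k\<in>{- int N..int N}. real (nat \<bar>k\<bar>) * (norm (fourier f k))\<^sup>2) \<le> B)"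

lemma dirichlet_le_trig:
  assumes "trig p"
  obtains B where "dirichlet_le p B"
proof -
  obtain N c where p: "\<And>x. norm x = 1 \<Longrightarrow> p x = (\<Sum>k\<in>{- int N..int N}. c k * zpow x k)"
    using assms by (auto simp: trig_def)
  let ?J = "{- int N..int N}"
  have f: "fourier p k = (if k \<in> ?J then c k else 0)" for k
    using fourier_cong[OF p] fourier_zpow_sum[of ?J c k] by simp
  have "dirichlet_le p (\<Sum>k\<in>?J. real (nat \<bar>k\<bar>) * (norm (c k))\<^sup>2)"
    unfolding dirichlet_le_def
  proof
    fix M
    let ?K = "{- int M..int M}"
    have "(\<Sum>k\<in>?K. real (nat \<bar>k\<bar>) * (norm (fourier p k))\<^sup>2) = (\<Sum>k\<in>?K \<inter> ?J. real (nat \<bar>k\<bar>) * (norm (c k))\<^sup>2)"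
      unfolding f by (rule sum.mono_neutral_cong_right) auto
    also have "\<dots> \<le> (\<Sum>k\<in>?J. real (nat \<bar>k\<bar>) * (norm (c k))\<^sup>2)"
      by (rule sum_mono2) auto
    finally show "(\<Sum>k\<in>?K. real (nat \<bar>k\<bar>) * (norm (fourier p k))\<^sup>2) \<le> (\<Sum>k\<in>?J. real (nat \<bar>k\<bar>) * (norm (c k))\<^sup>2)" .
  qed
  then show ?thesis by (rule that)
qed

lemma dirichlet_le_nonneg: "dirichlet_le f B \<Longrightarrow> 0 \<le> B"
  unfolding dirichlet_le_def by (drule spec[of _ 0]) simp

text \<open>The coefficients of the smoothed function carry the factor \<open>r ^ k\<close>, and \<open>k * r ^ k\<close> is at most the
  geometric sum \<open>1 / (1 - r)\<close>.\<close>

lemma dirichlet_le_harmonic_ext: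
  assumes f: "square_integrable circ f" and r: "0 \<le> r" "r < 1"
  shows "dirichlet_le (\<lambda>x. harmonic_ext f (of_real r * x)) ((l2_norm circ f)\<^sup>2 / (1 - r))"
  unfolding dirichlet_le_def
proof
  fix N
  have k: "real k * (r ^ k)\<^sup>2 \<le> 1 / (1 - r)" for k
  proof -
    have "real k * (r ^ k)\<^sup>2 \<le> real k * r ^ k"
      using r by (intro mult_left_mono) (auto simp: power2_eq_square intro!: mult_left_le power_le_one)
    also have "\<dots> = (\<Sum>j<k. r ^ k)" by simp
    also have "\<dots> \<le> (\<Sum>j<k. r ^ j)" using r by (intro sum_mono power_decreasing) auto
    also have "\<dots> = (1 - r ^ k) / (1 - r)" using r by (subst sum_gp_strict) auto
    also have "\<dots> \<le> 1 / (1 - r)" using r by (intro divide_right_mono) auto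
    finally show ?thesis .
  qed
  have "(\<Sum>k\<in>{- int N..int N}. real (nat \<bar>k\<bar>) * (norm (fourier (\<lambda>x. harmonic_ext f (of_real r * x)) k))\<^sup>2) =
    (\<Sum>k\<in>{- int N..int N}. (real (nat \<bar>k\<bar>) * (r ^ nat \<bar>k\<bar>)\<^sup>2) * (norm (fourier f k))\<^sup>2)"
    unfolding fourier_harmonic_ext[OF f r] using r by (simp add: norm_mult power_mult_distrib norm_power mult.assoc)
  also have "\<dots> \<le> (\<Sum>k\<in>{- int N..int N}. 1 / (1 - r) * (norm (fourier f k))\<^sup>2)"
    by (intro sum_mono mult_right_mono k) simp
  also have "\<dots> = (\<Sum>k\<in>{- int N..int N}. (norm (fourier f k))\<^sup>2) / (1 - r)"
    by (simp add: sum_divide_distrib)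
  also have "\<dots> \<le> (l2_norm circ f)\<^sup>2 / (1 - r)"
    using r by (intro divide_right_mono Bessel f) auto
  finally show "(\<Sum>k\<in>{- int N..int N}. real (nat \<bar>k\<bar>) * (norm (fourier (\<lambda>x. harmonic_ext f (of_real r * x)) k))\<^sup>2) \<le>
    (l2_norm circ f)\<^sup>2 / (1 - r)" .
qed

section \<open>Boundary dynamics of an inner function\<close>

locale nonrotation_inner =
  fixes F :: "complex \<Rightarrow> complex"
  assumes inner: "inner_function F" and F_0: "F 0 = 0" and not_rotation: "\<not> disk_rotation F"
begin

lemma F_holomorphic: "F holomorphic_on ball 0 1"
  and F_ball: "norm z < 1 \<Longrightarrow> norm (F z) < 1"
  using inner by (auto simp: inner_function_def Pi_iff)

lemma iterate_ball: "norm z < 1 \<Longrightarrow> norm ((F ^^ n) z) < 1"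
  by (induction n) (auto intro: F_ball)

lemma iterate_holomorphic: "(F ^^ n) holomorphic_on ball 0 1"
proof (induction n)
  case 0
  show ?case by (simp add: id_def)
next
  case (Suc n)
  have "F \<circ> (F ^^ n) holomorphic_on ball 0 1"
    by (rule holomorphic_on_compose_gen[OF Suc F_holomorphic]) (auto intro: iterate_ball)
  then show ?case by (simp only: funpow.simps)
qed

lemma iterate_0: "(F ^^ n) 0 = 0"
  by (induction n) (auto simp: F_0)

lemma holomorphic_scaled:
  assumes g: "g holomorphic_on ball 0 1" and r: "0 \<le> r" "r < 1"
  shows "(\<lambda>w. g (of_real r * w)) holomorphic_on ball 0 1" "continuous_on (cball 0 1) (\<lambda>w. g (of_real r * w))"
proof -
  have *: "of_real r * w \<in> ball 0 1" if "norm w \<le> 1" for w :: complex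
  proof -
    have "r * norm w \<le> r * 1" using that r by (intro mult_left_mono) auto
    then show ?thesis using r by (simp add: norm_mult)
  qed
  have "g \<circ> (\<lambda>w. of_real r * w) holomorphic_on ball 0 1"
    by (rule holomorphic_on_compose_gen[OF _ g]) (auto intro!: holomorphic_intros * simp del: mem_ball_0)
  then show "(\<lambda>w. g (of_real r * w)) holomorphic_on ball 0 1" by (simp add: comp_def)
  show "continuous_on (cball 0 1) (\<lambda>w. g (of_real r * w))"
    by (rule continuous_on_compose2[OF holomorphic_on_imp_continuous_on[OF g]]) (auto intro!: continuous_intros * simp del: mem_ball_0)
qed

definition radius :: "nat \<Rightarrow> real" where
  "radius n = 1 - inverse (real (Suc n))"

lemma radius: "0 \<le> radius n" "radius n < 1" "radius \<longlonglongrightarrow> 1"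
proof -
  show "0 \<le> radius n" "radius n < 1" by (auto simp: radius_def field_simps)
  have "(\<lambda>n. 1 - inverse (real (Suc n))) \<longlonglongrightarrow> 1 - 0"
    by (intro tendsto_diff tendsto_const LIMSEQ_inverse_real_of_nat)
  then show "radius \<longlonglongrightarrow> 1" by (simp add: radius_def[abs_def])
qed

text \<open>A Borel version of the boundary map that is defined everywhere on the circle: limits along one sequence of
  radii are measurable, and the default value \<open>1\<close> keeps the map on the circle.\<close>

definition T :: "complex \<Rightarrow> complex" where
  "T x = (if norm (lim (\<lambda>n. F (of_real (radius n) * x))) = 1 then lim (\<lambda>n. F (of_real (radius n) * x)) else 1)"

lemma norm_T [simp]: "norm (T x) = 1"
  by (simp add: T_def)

lemma radial_measurable: "(\<lambda>x. F (of_real (radius n) * x)) \<in> borel_measurable circ"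
  by (rule borel_measurable_circ_continuous)
    (rule continuous_on_subset[OF holomorphic_scaled(2)[OF F_holomorphic radius(1,2)]], auto)

lemma T_borel_measurable: "T \<in> borel_measurable circ"
proof -
  have [measurable]: "(\<lambda>x. lim (\<lambda>n. F (of_real (radius n) * x))) \<in> borel_measurable circ"
    by (intro borel_measurable_lim_metric radial_measurable)
  show ?thesis unfolding T_def by measurable
qed

lemma T_measurable_circ: "T \<in> circ \<rightarrow>\<^sub>M circ"
proof -
  have "T \<in> circ \<rightarrow>\<^sub>M restrict_space borel (sphere 0 1)"
    by (rule measurable_restrict_space2) (auto intro: T_borel_measurable)
  then show ?thesis by (simp add: measurable_cong_sets[OF refl sets_circ])
qed

lemma AE_radial_limit: "AE x in circ. ((\<lambda>r::real. F (of_real r * x)) \<longlongrightarrow> T x) (at_left 1)"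
proof -
  have "AE x in circ. \<exists>l. norm l = 1 \<and> ((\<lambda>r::real. F (of_real r * x)) \<longlongrightarrow> l) (at_left 1)"
    using inner unfolding inner_function_def circle_measure_eq AE_completion_iff by blast
  then show ?thesis
  proof eventually_elim
    fix x assume "\<exists>l. norm l = 1 \<and> ((\<lambda>r::real. F (of_real r * x)) \<longlongrightarrow> l) (at_left 1)"
    then obtain l where l: "norm l = 1" "((\<lambda>r::real. F (of_real r * x)) \<longlongrightarrow> l) (at_left 1)" by blast
    have "filterlim radius (at_left 1) sequentially"
      unfolding filterlim_at using radius by (auto intro!: always_eventually simp: less_imp_neq)
    from filterlim_compose[OF l(2) this] have "lim (\<lambda>n. F (of_real (radius n) * x)) = l"
      by (rule limI)
    then have "T x = l" using l(1) by (simp add: T_def)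
    then show "((\<lambda>r::real. F (of_real r * x)) \<longlongrightarrow> T x) (at_left 1)" using l(2) by simp
  qed
qed

lemma AE_boundary_map: "AE x in circ. boundary_map F x = T x"
  using AE_radial_limit
proof eventually_elim
  fix x assume "((\<lambda>r::real. F (of_real r * x)) \<longlongrightarrow> T x) (at_left 1)"
  then show "boundary_map F x = T x"
    unfolding boundary_map_def by (intro tendsto_Lim) auto
qed

lemma AE_radial_sequence: "AE x in circ. (\<lambda>n. F (of_real (radius n) * x)) \<longlonglongrightarrow> T x"
  using AE_radial_limit
proof eventually_elim
  fix x assume l: "((\<lambda>r::real. F (of_real r * x)) \<longlongrightarrow> T x) (at_left 1)"
  have "filterlim radius (at_left 1) sequentially"
    unfolding filterlim_at using radius by (auto intro!: always_eventually simp: less_imp_neq)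
  from filterlim_compose[OF l this] show "(\<lambda>n. F (of_real (radius n) * x)) \<longlonglongrightarrow> T x" .
qed

text \<open>Poisson's formula for \<open>F ^ k\<close> on smaller circles passes to the limit by dominated convergence.\<close>

lemma integral_poisson_T_power:
  assumes z: "norm z < 1"
  shows "(LINT x|circ. complex_of_real (poisson z x) * T x ^ k) = F z ^ k"
proof -
  have *: "(LINT x|circ. complex_of_real (poisson z x) * F (of_real (radius n) * x) ^ k) = F (of_real (radius n) * z) ^ k" for n
    by (rule integral_poisson[OF _ _ z])
      (intro continuous_intros holomorphic_intros holomorphic_scaled[OF F_holomorphic] radius)+
  have "(\<lambda>n. LINT x|circ. complex_of_real (poisson z x) * F (of_real (radius n) * x) ^ k) \<longlonglongrightarrow>
     (LINT x|circ. complex_of_real (poisson z x) * T x ^ k)"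
  proof (rule integral_dominated_convergence[where w = "poisson z"])
    show "(\<lambda>x. complex_of_real (poisson z x) * T x ^ k) \<in> borel_measurable circ"
      using T_borel_measurable by measurable
    show "(\<lambda>x. complex_of_real (poisson z x) * F (of_real (radius n) * x) ^ k) \<in> borel_measurable circ" for n
      using radial_measurable[of n] by measurable
    show "integrable circ (poisson z)" by (rule integrable_poisson[OF z])
    show "AE x in circ. (\<lambda>n. complex_of_real (poisson z x) * F (of_real (radius n) * x) ^ k) \<longlonglongrightarrow> complex_of_real (poisson z x) * T x ^ k"
      using AE_radial_sequence by eventually_elim (intro tendsto_intros)
    show "AE x in circ. norm (complex_of_real (poisson z x) * F (of_real (radius n) * x) ^ k) \<le> poisson z x" for n
    proof (rule AE_I2)
      fix x assume "x \<in> space circ"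
      then have "norm (F (of_real (radius n) * x)) < 1"
        using radius(1,2)[of n] by (intro F_ball) (simp add: norm_mult)
      then have "norm (F (of_real (radius n) * x)) ^ k \<le> 1" by (intro power_le_one) auto
      then show "norm (complex_of_real (poisson z x) * F (of_real (radius n) * x) ^ k) \<le> poisson z x"
        using poisson_nonneg[OF z, of x] by (simp add: norm_mult norm_power mult_left_le)
    qed
  qed
  moreover have "(\<lambda>n. F (of_real (radius n) * z) ^ k) \<longlonglongrightarrow> F (of_real 1 * z) ^ k"
  proof (intro tendsto_power)
    have "isCont F z"
      using holomorphic_on_imp_continuous_on[OF F_holomorphic] z by (simp add: continuous_on_eq_continuous_at)
    moreover have "(\<lambda>n. of_real (radius n) * z) \<longlonglongrightarrow> z"
      using tendsto_mult[OF tendsto_of_real[OF radius(3)] tendsto_const[of z]] by simp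
    ultimately have "(\<lambda>n. F (of_real (radius n) * z)) \<longlonglongrightarrow> F z"
      by (rule isCont_tendsto_compose)
    then show "(\<lambda>n. F (of_real (radius n) * z)) \<longlonglongrightarrow> F (of_real 1 * z)" by simp
  qed
  ultimately show ?thesis unfolding * using LIMSEQ_unique by fastforce
qed

lemma T_measurable_poisson: "T \<in> poisson_measure z \<rightarrow>\<^sub>M circ"
  using T_measurable_circ by (simp add: measurable_cong_sets[OF sets_poisson_measure refl] measurable_cong_sets[OF sets_circ refl])

text \<open>Both measures have the Fourier coefficients \<open>F z ^ k\<close> and their conjugates. This is the bridge between
  the dynamics on the circle and in the disk; at the fixed point \<open>0\<close> it says that arc length is invariant.\<close>

lemma distr_poisson_measure:
  assumes z: "norm z < 1"
  shows "distr (poisson_measure z) circ T = poisson_measure (F z)"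
proof (rule measure_eqI_zpow)
  interpret P: prob_space "poisson_measure z" by (rule prob_space_poisson_measure[OF z])
  show "finite_measure (distr (poisson_measure z) circ T)"
    by (intro P.finite_measure_distr T_measurable_poisson)
  show "finite_measure (poisson_measure (F z))"
    using prob_space_poisson_measure[OF F_ball[OF z]] by (rule prob_space.finite_measure)
  fix k :: int
  have m: "(\<lambda>x. zpow (T x) k) \<in> borel_measurable circ"
    by (rule measurable_compose[OF T_borel_measurable zpow_measurable])
  have "(LINT x|distr (poisson_measure z) circ T. zpow x k) = (LINT x|poisson_measure z. zpow (T x) k)"
    by (rule integral_distr[OF T_measurable_poisson]) measurable
  also have "\<dots> = (LINT x|circ. complex_of_real (poisson z x) * zpow (T x) k)"
    unfolding integral_poisson_measure[OF m z] by (simp add: scaleR_conv_of_real)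
  also have "\<dots> = zpow (F z) k"
  proof (cases "0 \<le> k")
    case True
    then show ?thesis using integral_poisson_T_power[OF z] by (simp add: zpow_def)
  next
    case False
    have "(LINT x|circ. complex_of_real (poisson z x) * zpow (T x) k) =
        (LINT x|circ. cnj (complex_of_real (poisson z x) * T x ^ nat (- k)))"
      using False by (simp add: zpow_def)
    also have "\<dots> = cnj (F z ^ nat (- k))"
      unfolding Bochner_Integration.integral_cnj integral_poisson_T_power[OF z] by (rule refl)
    finally show ?thesis using False by (simp add: zpow_def)
  qed
  also have "\<dots> = (LINT x|circ. complex_of_real (poisson (F z) x) * zpow x k)"
    by (rule integral_poisson_zpow[OF F_ball[OF z], symmetric])
  also have "\<dots> = (LINT x|poisson_measure (F z). zpow x k)"
    by (subst integral_poisson_measure[OF _ F_ball[OF z]]) (simp_all add: scaleR_conv_of_real)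
  finally show "(LINT x|distr (poisson_measure z) circ T. zpow x k) = (LINT x|poisson_measure (F z). zpow x k)" .
qed simp_all

sublocale measure_preserving circ T
proof
  show "T \<in> circ \<rightarrow>\<^sub>M circ" by (rule T_measurable_circ)
  show "distr circ circ T = circ"
    using distr_poisson_measure[of 0] by (simp add: poisson_measure_0 F_0)
qed

lemma iterate_measurable_poisson: "T ^^ n \<in> poisson_measure z \<rightarrow>\<^sub>M circ"
  using iterate_measurable[of n] by (simp add: measurable_cong_sets[OF sets_poisson_measure refl] measurable_cong_sets[OF sets_circ refl])

lemma distr_poisson_measure_iterate:
  assumes z: "norm z < 1"
  shows "distr (poisson_measure z) circ (T ^^ n) = poisson_measure ((F ^^ n) z)"
proof (induction n)
  case 0
  have "distr (poisson_measure z) circ (\<lambda>x. x) = distr (poisson_measure z) (poisson_measure z) (\<lambda>x. x)"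
    by (rule distr_cong) simp_all
  then show ?case by (simp add: id_def)
next
  case (Suc n)
  have "distr (poisson_measure z) circ (T ^^ Suc n) = distr (distr (poisson_measure z) circ (T ^^ n)) circ T"
    by (subst distr_distr) (auto simp: T_measurable_circ iterate_measurable_poisson)
  also have "\<dots> = poisson_measure ((F ^^ Suc n) z)"
    unfolding Suc using distr_poisson_measure[OF iterate_ball[OF z]] by simp
  finally show ?case .
qed

lemma harmonic_ext_poisson_measure:
  assumes "f \<in> borel_measurable circ" "norm z < 1"
  shows "harmonic_ext f z = (LINT x|poisson_measure z. f x)"
  unfolding harmonic_ext_def integral_poisson_measure[OF assms] by (simp add: scaleR_conv_of_real)

lemma harmonic_ext_iterate:
  assumes f: "f \<in> borel_measurable circ" and z: "norm z < 1"
  shows "harmonic_ext (\<lambda>x. f ((T ^^ n) x)) z = harmonic_ext f ((F ^^ n) z)"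
proof -
  have "harmonic_ext (\<lambda>x. f ((T ^^ n) x)) z = (LINT x|poisson_measure z. f ((T ^^ n) x))"
    by (rule harmonic_ext_poisson_measure[OF measurable_compose[OF iterate_measurable f] z])
  also have "\<dots> = (LINT x|distr (poisson_measure z) circ (T ^^ n). f x)"
    by (rule integral_distr[OF iterate_measurable_poisson f, symmetric])
  also have "\<dots> = harmonic_ext f ((F ^^ n) z)"
    unfolding distr_poisson_measure_iterate[OF z]
    by (rule harmonic_ext_poisson_measure[OF f iterate_ball[OF z], symmetric])
  finally show ?thesis .
qed

text \<open>
  Strict contraction towards the fixed point \<open>0\<close>, uniformly up to the circle: write
  \<open>F z = z * h z\<close> and apply Harnack's inequality to \<open>1 - Re (c * h)\<close>. The quantity \<open>x / (1 - x)\<close> is chosen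
  because one constant below one works for it on the whole disk, so that it can be iterated.
\<close>

lemma contraction:
  obtains \<kappa> where "0 < \<kappa>" "\<kappa> < 1"
    "\<And>z. norm z < 1 \<Longrightarrow> norm (F z) / (1 - norm (F z)) \<le> \<kappa> * (norm z / (1 - norm z))"
proof -
  obtain h where h: "h holomorphic_on ball 0 1" "\<And>z. norm z < 1 \<Longrightarrow> F z = z * h z" "deriv F 0 = h 0"
    using Schwarz3[OF F_holomorphic F_0] by blast
  have Sch: "norm (F z) \<le> norm z" "norm (deriv F 0) \<le> 1" if "norm z < 1" for z
    using Schwarz_Lemma[OF F_holomorphic F_0 F_ball that] by auto
  have h1: "norm (h z) \<le> 1" if z: "norm z < 1" for z
  proof (cases "z = 0")
    case True
    then show ?thesis using Sch(2)[of 0] h(3) by simp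
  next
    case False
    then show ?thesis using Sch(1)[OF z] h(2)[OF z] by (simp add: norm_mult)
  qed
  have h0: "norm (h 0) < 1"
  proof (rule ccontr)
    assume "\<not> norm (h 0) < 1"
    then have "norm (deriv F 0) = 1" using h1[of 0] h(3) by simp
    then have "\<exists>\<alpha>. (\<forall>z. norm z < 1 \<longrightarrow> F z = \<alpha> * z) \<and> norm \<alpha> = 1"
      using Schwarz_Lemma(3)[OF F_holomorphic F_0 F_ball, of 0] by auto
    then have "disk_rotation F" unfolding disk_rotation_def by auto
    then show False using not_rotation by simp
  qed
  define d where "d = (1 - norm (h 0)) / 4"
  have "0 < d" unfolding d_def using h0 by simp
  moreover have "(1 - n) / 4 \<le> 1" if "0 \<le> n" for n :: real using that by simp
  from this[OF norm_ge_zero] have "d \<le> 1" unfolding d_def .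
  ultimately have d: "0 < d" "d \<le> 1" .
  have harnack: "norm (h z) \<le> 1 - d * (1 - norm z)" if z: "norm z < 1" for z
  proof -
    let ?x = "norm z"
    \<comment> \<open>Harnack's inequality is applied on a disk between the point and the unit circle, where \<open>h\<close> is continuous up to the boundary.\<close>
    define s where "s = (1 + ?x) / 2"
    have s: "0 < s" "s < 1" "?x < s" using z by (auto simp: s_def field_simps add_pos_nonneg)
    \<comment> \<open>The rotation \<open>c\<close> makes \<open>c * h z\<close> real and nonnegative.\<close>
    define c where "c = (if h z = 0 then 1 else cnj (h z) / norm (h z))"
    have c: "norm c = 1" by (simp add: c_def norm_divide)
    have ch: "c * h z = norm (h z)"
      using complex_norm_square[of "h z"] by (simp add: c_def power2_eq_square field_simps)
    define w where "w = z / of_real s"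
    have w: "norm w < 1" "of_real s * w = z" "norm w = ?x / s" using s by (auto simp: w_def norm_divide)
    let ?g = "\<lambda>v. 1 - c * h (of_real s * v)"
    have g: "continuous_on (cball 0 1) ?g" "?g holomorphic_on ball 0 1"
      using holomorphic_scaled[OF h(1), of s] s by (auto intro!: continuous_intros holomorphic_intros)
    have gm: "?g \<in> borel_measurable circ"
      by (rule borel_measurable_circ_continuous[OF continuous_on_subset[OF g(1)]]) auto
    have hs: "norm (c * h (of_real s * x)) \<le> 1" if "x \<in> space circ" for x
      using h1[of "of_real s * x"] s c that by (simp add: norm_mult)
    have gs: "square_integrable circ ?g"
    proof (rule circ.square_integrable_bounded[OF gm])
      fix x assume "x \<in> space circ"
      then show "norm (?g x) \<le> 2" using hs norm_triangle_ineq4[of 1 "c * h (of_real s * x)"] by fastforce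
    qed
    have Re_g: "0 \<le> Re (?g x)" if "x \<in> space circ" for x
      using hs[OF that] complex_Re_le_cmod[of "c * h (of_real s * x)"] by simp
    have val: "(LINT x|circ. poisson v x * Re (?g x)) = Re (?g v)" if v: "norm v < 1" for v
    proof -
      have "(LINT x|circ. Re (complex_of_real (poisson v x) * ?g x)) = Re (LINT x|circ. complex_of_real (poisson v x) * ?g x)"
        by (rule integral_Re[OF integrable_mult_square_integrable[OF square_integrable_poisson(1)[OF v] gs]])
      then show ?thesis unfolding integral_poisson[OF g v] by simp
    qed
    have ig: "integrable circ (\<lambda>x. poisson v x * Re (?g x))" if v: "norm v < 1" for v
    proof -
      have "integrable circ (\<lambda>x. Re (complex_of_real (poisson v x) * ?g x))"
        by (rule integrable_Re[OF integrable_mult_square_integrable[OF square_integrable_poisson(1)[OF v] gs]])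
      then show ?thesis by simp
    qed
    have "(1 - norm w) / (1 + norm w) * Re (?g 0) = (LINT x|circ. (1 - norm w) / (1 + norm w) * (poisson 0 x * Re (?g x)))"
      using val[of 0] by simp
    also have "\<dots> \<le> (LINT x|circ. poisson w x * Re (?g x))"
    proof (rule integral_mono)
      fix x assume x: "x \<in> space circ"
      have "(1 - norm w) / (1 + norm w) * Re (?g x) \<le> poisson w x * Re (?g x)"
        using poisson_bounds(1)[OF _ w(1), of x] x Re_g[OF x] by (intro mult_right_mono) auto
      then show "(1 - norm w) / (1 + norm w) * (poisson 0 x * Re (?g x)) \<le> poisson w x * Re (?g x)"
        using x by (simp add: poisson_def)
    qed (use ig[of 0] ig[OF w(1)] in auto)
    also have "\<dots> = 1 - norm (h z)" using val[OF w(1)] w(2) ch by simp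
    finally have a: "(1 - norm w) / (1 + norm w) * Re (?g 0) \<le> 1 - norm (h z)" .
    have b: "1 - norm (h 0) \<le> Re (?g 0)"
      using complex_Re_le_cmod[of "c * h 0"] c by (simp add: norm_mult)
    have "(1 - ?x) / 4 \<le> (1 - norm w) / (1 + norm w)"
    proof -
      have halves: "(a / 2) / (b / 2) = a / b" for a b :: real by simp
      have "(1 - norm w) / (1 + norm w) = (s - ?x) / (s + ?x)"
        unfolding w(3) using s by (simp add: divide_simps)
      also have "s - ?x = (1 - ?x) / 2" unfolding s_def by (simp add: field_simps)
      also have "s + ?x = (1 + 3 * ?x) / 2" unfolding s_def by (simp add: field_simps)
      also have "((1 - ?x) / 2) / ((1 + 3 * ?x) / 2) = (1 - ?x) / (1 + 3 * ?x)" by (rule halves)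
      finally have eq: "(1 - norm w) / (1 + norm w) = (1 - ?x) / (1 + 3 * ?x)" .
      have "(1 - y) / 4 \<le> (1 - y) / (1 + 3 * y)" if "0 \<le> y" "y < 1" for y :: real
        using that by (intro divide_left_mono) auto
      from this[OF norm_ge_zero z] show ?thesis unfolding eq .
    qed
    then have "(1 - ?x) / 4 * (1 - norm (h 0)) \<le> (1 - norm w) / (1 + norm w) * Re (?g 0)"
      using b h0 z w(1) by (intro mult_mono) auto
    then have "(1 - ?x) / 4 * (1 - norm (h 0)) \<le> 1 - norm (h z)" by (rule order_trans[OF _ a])
    moreover have "(1 - ?x) / 4 * (1 - norm (h 0)) = d * (1 - ?x)" unfolding d_def by (simp add: mult.commute)
    ultimately show ?thesis by linarith
  qed
  define \<kappa> where "\<kappa> = 1 - d / 2"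
  have \<kappa>: "0 < \<kappa>" "\<kappa> < 1" using d by (auto simp: \<kappa>_def)
  show ?thesis
  proof (rule that[OF \<kappa>])
    fix z :: complex assume z: "norm z < 1"
    let ?x = "norm z" and ?y = "norm (h z)"
    have F: "norm (F z) = ?x * ?y" using h(2)[OF z] by (simp add: norm_mult)
    have Fl: "?x * ?y < 1" using F_ball[OF z] F by simp
    have key: "y * (1 - x) \<le> (1 - d / 2) * (1 - x * y)"
      if x: "0 \<le> x" "x < 1" and y: "y \<le> 1 - d * (1 - x)" for x y :: real
    proof -
      have dx: "d * x \<le> 1" using x d mult_le_one[of d x] by auto
      have "y * (1 - d / 2 * x) \<le> (1 - d * (1 - x)) * (1 - d / 2 * x)"
        using y dx by (intro mult_right_mono) auto
      also have "\<dots> = (1 - d / 2) - (1 - x) * (d / 2 * (1 - d * x))"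
        by (simp add: field_simps)
      also have "\<dots> \<le> 1 - d / 2"
        using d x dx by (auto intro!: mult_nonneg_nonneg)
      finally have 1: "y * (1 - d / 2 * x) \<le> 1 - d / 2" .
      have "y * (1 - x) \<le> (1 - e) * (1 - x * y)" if "y * (1 - e * x) \<le> 1 - e" for e
        using that by (simp add: algebra_simps)
      from this[OF 1] show ?thesis .
    qed
    from key[OF norm_ge_zero z harnack[OF z]]
    have "?y * (1 - ?x) \<le> \<kappa> * (1 - ?x * ?y)" unfolding \<kappa>_def .
    then have le: "?x * ?y * (1 - ?x) \<le> \<kappa> * ?x * (1 - ?x * ?y)"
      using mult_left_mono[OF _ norm_ge_zero[of z]] by (fastforce simp: mult_ac)
    have quot: "b / (1 - b) \<le> k * (x / (1 - x))" if "b < 1" "x < 1" "b * (1 - x) \<le> k * x * (1 - b)" for b k x :: real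
    proof -
      have "b \<le> k * x * (1 - b) / (1 - x)" using that by (simp add: pos_le_divide_eq)
      then show ?thesis using that by (simp add: pos_divide_le_eq)
    qed
    show "norm (F z) / (1 - norm (F z)) \<le> \<kappa> * (norm z / (1 - norm z))"
      unfolding F by (rule quot[OF Fl z le])
  qed
qed

end

section \<open>Decay of the Dirichlet energy under the transfer operator\<close>

lemma poisson_Re:
  assumes y: "norm y = 1" and v: "norm v < 1"
  shows "poisson v y = Re ((y + v) / (y - v))"
proof -
  have "Re ((y + v) / (y - v)) = Re ((y + v) * cnj (y - v)) / (norm (y - v))\<^sup>2"
    by (subst complex_div_cnj) (simp add: Re_divide_of_real flip: of_real_power)
  also have "Re ((y + v) * cnj (y - v)) = (norm y)\<^sup>2 - (norm v)\<^sup>2"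
    unfolding cmod_power2 by (simp add: algebra_simps power2_eq_square)
  finally show ?thesis using y by (simp add: poisson_def)
qed

text \<open>Jensen's inequality for harmonic measure at \<open>v\<close>.\<close>

lemma norm_harmonic_ext_sq_le:
  assumes f: "f \<in> borel_measurable circ" "\<And>x. norm x = 1 \<Longrightarrow> norm (f x) \<le> B" and v: "norm v < 1"
  shows "ennreal ((norm (harmonic_ext f v))\<^sup>2) \<le> (\<integral>\<^sup>+y. ennreal (poisson v y) * ennreal ((norm (f y))\<^sup>2) \<partial>circ)"
proof -
  interpret P: prob_space "poisson_measure v" by (rule prob_space_poisson_measure[OF v])
  note [measurable] = f(1)
  have fm: "f \<in> borel_measurable (poisson_measure v)"
    using f(1) by (simp add: measurable_cong_sets[OF sets_poisson_measure refl] measurable_cong_sets[OF sets_circ refl])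
  have fs: "square_integrable (poisson_measure v) f"
    by (rule P.square_integrable_bounded[OF fm]) (use f(2) in auto)
  have "harmonic_ext f v = (LINT x|poisson_measure v. f x)"
    unfolding harmonic_ext_def integral_poisson_measure[OF f(1) v] by (simp add: scaleR_conv_of_real)
  then have "norm (harmonic_ext f v) \<le> l2_norm (poisson_measure v) f"
    using P.norm_integral_le_l2_norm[OF fs] by simp
  then have "ennreal ((norm (harmonic_ext f v))\<^sup>2) \<le> ennreal ((l2_norm (poisson_measure v) f)\<^sup>2)"
    by (intro ennreal_leI power_mono) auto
  also have "\<dots> = (\<integral>\<^sup>+x. ennreal ((norm (f x))\<^sup>2) \<partial>poisson_measure v)"
    unfolding l2_norm_sq by (rule nn_integral_eq_integral[symmetric, OF square_integrable_sq[OF fs]]) simp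
  also have "\<dots> = (\<integral>\<^sup>+y. ennreal (poisson v y) * ennreal ((norm (f y))\<^sup>2) \<partial>circ)"
    unfolding poisson_measure_def by (intro nn_integral_density) measurable
  finally show ?thesis .
qed

text \<open>The kernel composed with \<open>\<phi>\<close> is the real part of a holomorphic function, whose mean is its value at \<open>0\<close>.\<close>

lemma nn_integral_poisson_holomorphic:
  assumes \<phi>: "continuous_on (cball 0 1) \<phi>" "\<phi> holomorphic_on ball 0 1" "\<And>x. norm x \<le> 1 \<Longrightarrow> norm (\<phi> x) < 1"
    "\<phi> 0 = 0" and y: "norm y = 1"
  shows "(\<integral>\<^sup>+x. ennreal (poisson (\<phi> x) y) \<partial>circ) = 1"
proof -
  let ?Q = "\<lambda>x. (y + \<phi> x) / (y - \<phi> x)"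
  have ne: "y \<noteq> \<phi> x" if "norm x \<le> 1" for x using \<phi>(3)[OF that] y by auto
  have Q: "continuous_on (cball 0 1) ?Q" "?Q holomorphic_on ball 0 1"
    using ne by (auto intro!: continuous_intros holomorphic_intros \<phi>)
  have Qc: "continuous_on (sphere 0 1) ?Q" by (rule continuous_on_subset[OF Q(1)]) auto
  obtain B where B: "\<forall>x\<in>sphere 0 1. norm (?Q x) \<le> B"
    using compact_imp_bounded[OF compact_continuous_image[OF Qc compact_sphere]] by (auto simp: bounded_iff)
  have Qs: "square_integrable circ ?Q"
    by (rule circ.square_integrable_bounded[OF borel_measurable_circ_continuous[OF Qc]]) (use B in auto)
  have "(LINT x|circ. ?Q x) = (LINT x|circ. complex_of_real (poisson 0 x) * ?Q x)"
    by (intro Bochner_Integration.integral_cong) (auto simp: poisson_def)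
  also have "\<dots> = ?Q 0" by (rule integral_poisson[OF Q]) simp
  also have "\<dots> = 1" using y \<phi>(4) by auto
  finally have Q1: "(LINT x|circ. ?Q x) = 1" .
  have Qi: "integrable circ ?Q" by (rule circ.integrable_square_integrable[OF Qs])
  have "(\<integral>\<^sup>+x. ennreal (poisson (\<phi> x) y) \<partial>circ) = (\<integral>\<^sup>+x. ennreal (Re (?Q x)) \<partial>circ)"
    using poisson_Re[OF y \<phi>(3)] by (intro nn_integral_cong) simp
  also have "\<dots> = ennreal (LINT x|circ. Re (?Q x))"
  proof (rule nn_integral_eq_integral[OF integrable_Re[OF Qi]], rule AE_I2)
    fix x assume "x \<in> space circ"
    then show "0 \<le> Re (?Q x)" using poisson_Re[OF y \<phi>(3), of x] poisson_nonneg[OF \<phi>(3), of x y] by simp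
  qed
  also have "(LINT x|circ. Re (?Q x)) = 1" unfolding integral_Re[OF Qi] Q1 by simp
  finally show ?thesis by simp
qed

text \<open>Integrate the hypothesis over \<open>r\<close>, with weight \<open>2 / r\<close> on the left and \<open>2 / r^2\<close> on the right. In terms of
  \<open>\<rho> = \<epsilon> * r / (1 - r + \<epsilon> * r)\<close> the right hand weight is \<open>2 * \<epsilon> / \<rho>^2\<close> times the derivative of \<open>\<rho>\<close>, which produces the
  factor \<open>\<epsilon>\<close>.\<close>

lemma weighted_sum_le_of_power_sum_le:
  fixes a b :: "int \<Rightarrow> real"
  assumes K: "finite K" "0 \<notin> K" and J: "finite J" "0 \<notin> J" and e: "0 < \<epsilon>"
    and a: "\<And>k. 0 \<le> a k" and b: "\<And>k. 0 \<le> b k"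
    and le: "\<And>r. 0 < r \<Longrightarrow> r < 1 \<Longrightarrow>
      (\<Sum>k\<in>K. a k * (r ^ nat \<bar>k\<bar>)\<^sup>2) \<le> (\<Sum>j\<in>J. b j * ((\<epsilon> * r / (1 - r + \<epsilon> * r)) ^ nat \<bar>j\<bar>)\<^sup>2)"
  shows "(\<Sum>k\<in>K. a k / real (nat \<bar>k\<bar>)) \<le> 2 * \<epsilon> * (\<Sum>j\<in>J. b j / real (nat \<bar>j\<bar>))"
proof -
  define m where "m k = nat \<bar>k\<bar> - 1" for k :: int
  have mK: "nat \<bar>k\<bar> = Suc (m k)" if "k \<in> K" for k using that K(2) by (cases "k = 0") (auto simp: m_def)
  have mJ: "nat \<bar>k\<bar> = Suc (m k)" if "k \<in> J" for k using that J(2) by (cases "k = 0") (auto simp: m_def)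
  define \<rho> where "\<rho> r = \<epsilon> * r / (1 - r + \<epsilon> * r)" for r
  \<comment> \<open>The difference of the two integrals from \<open>0\<close> to \<open>r\<close>; indices are shifted by one to avoid truncated subtraction.\<close>
  define D where "D r = (\<Sum>j\<in>J. 2 * \<epsilon> * b j * \<rho> r ^ (2 * m j + 1) / real (2 * m j + 1)) -
     (\<Sum>k\<in>K. a k * r ^ (2 * m k + 2) / real (m k + 1))" for r
  have den: "0 < 1 - r + \<epsilon> * r" if "0 \<le> r" "r \<le> 1" for r
    using that e by (cases "r = 1") (auto intro: add_pos_nonneg)
  have "D 0 \<le> D 1"
  proof (rule DERIV_nonneg_imp_increasing_open[of 0 1 D])
    show "continuous_on {0..1} D"
    proof -
      have "1 - r + \<epsilon> * r \<noteq> 0" if "r \<in> {0..1}" for r using den[of r] that by auto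
      then show ?thesis unfolding D_def \<rho>_def by (intro continuous_intros) auto
    qed
    fix r :: real assume r: "0 < r" "r < 1"
    then have d: "0 < 1 - r + \<epsilon> * r" by (intro den) auto
    let ?q = "\<epsilon> / (1 - r + \<epsilon> * r)\<^sup>2"
    have \<rho>': "(\<rho> has_real_derivative ?q) (at r)"
    proof -
      have "(\<rho> has_real_derivative ((\<epsilon> * (1 - r + \<epsilon> * r) - \<epsilon> * r * (\<epsilon> - 1)) / ((1 - r + \<epsilon> * r) * (1 - r + \<epsilon> * r)))) (at r)"
        unfolding \<rho>_def using d by (auto intro!: derivative_eq_intros)
      also have "(\<epsilon> * (1 - r + \<epsilon> * r) - \<epsilon> * r * (\<epsilon> - 1)) / ((1 - r + \<epsilon> * r) * (1 - r + \<epsilon> * r)) = ?q"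
        by (simp add: power2_eq_square algebra_simps)
      finally show ?thesis .
    qed
    have hJ: "((\<lambda>r. \<rho> r ^ (2 * m j + 1)) has_real_derivative (real (2 * m j + 1) * \<rho> r ^ (2 * m j) * ?q)) (at r)" for j
      using DERIV_chain2[OF DERIV_pow[of "2 * m j + 1"] \<rho>'] by (simp del: of_nat_add of_nat_mult of_nat_Suc)
    have hK: "((\<lambda>r. r ^ (2 * m k + 2)) has_real_derivative (real (2 * m k + 2) * r ^ (2 * m k + 1))) (at r)" for k
      using DERIV_pow[of "2 * m k + 2" r] by (simp del: of_nat_add of_nat_mult of_nat_Suc power_Suc)
    have D': "(D has_real_derivative ((\<Sum>j\<in>J. 2 * \<epsilon> * b j * (real (2 * m j + 1) * \<rho> r ^ (2 * m j) * ?q) / real (2 * m j + 1)) -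
       (\<Sum>k\<in>K. a k * (real (2 * m k + 2) * r ^ (2 * m k + 1)) / real (m k + 1)))) (at r)"
      unfolding D_def by (intro DERIV_diff DERIV_sum DERIV_cdivide DERIV_cmult hJ hK)
    have q: "\<epsilon> * ?q = (\<rho> r)\<^sup>2 / r\<^sup>2"
      using r d by (simp add: \<rho>_def power_divide power_mult_distrib) (simp add: power2_eq_square)
    have J': "(\<Sum>j\<in>J. 2 * \<epsilon> * b j * (real (2 * m j + 1) * \<rho> r ^ (2 * m j) * ?q) / real (2 * m j + 1)) =
       (2 / r\<^sup>2) * (\<Sum>j\<in>J. b j * (\<rho> r ^ nat \<bar>j\<bar>)\<^sup>2)"
      unfolding sum_distrib_left
    proof (rule sum.cong[OF refl])
      fix j assume j: "j \<in> J"
      have "2 * \<epsilon> * b j * (real (2 * m j + 1) * \<rho> r ^ (2 * m j) * ?q) / real (2 * m j + 1) =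
          2 * b j * \<rho> r ^ (2 * m j) * (\<epsilon> * ?q)"
        by (simp del: of_nat_add of_nat_mult of_nat_Suc)
      also have "\<dots> = 2 / r\<^sup>2 * (b j * (\<rho> r ^ nat \<bar>j\<bar>)\<^sup>2)"
      proof -
        have "\<rho> r ^ (2 * m j) * (\<rho> r)\<^sup>2 = (\<rho> r ^ nat \<bar>j\<bar>)\<^sup>2"
          unfolding mJ[OF j] power_mult[symmetric] power_add[symmetric]
          by (rule arg_cong[where f = "\<lambda>n. \<rho> r ^ n"]) simp
        then show ?thesis unfolding q by (metis (no_types, lifting) mult.assoc mult.commute times_divide_eq_left times_divide_eq_right)
      qed
      finally show "2 * \<epsilon> * b j * (real (2 * m j + 1) * \<rho> r ^ (2 * m j) * ?q) / real (2 * m j + 1) =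
         2 / r\<^sup>2 * (b j * (\<rho> r ^ nat \<bar>j\<bar>)\<^sup>2)" .
    qed
    have K': "(\<Sum>k\<in>K. a k * (real (2 * m k + 2) * r ^ (2 * m k + 1)) / real (m k + 1)) =
       (2 / r) * (\<Sum>k\<in>K. a k * (r ^ nat \<bar>k\<bar>)\<^sup>2)"
      unfolding sum_distrib_left
    proof (rule sum.cong[OF refl])
      fix k assume k: "k \<in> K"
      have "real (2 * m k + 2) = 2 * real (m k + 1)" by simp
      then have "a k * (real (2 * m k + 2) * r ^ (2 * m k + 1)) / real (m k + 1) = 2 * a k * r ^ (2 * m k + 1)"
        by (simp del: of_nat_add of_nat_mult of_nat_Suc)
      also have "\<dots> = 2 / r * (a k * r ^ (2 * m k + 2))"
        using r by (simp add: field_simps)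
      also have "r ^ (2 * m k + 2) = (r ^ nat \<bar>k\<bar>)\<^sup>2"
        unfolding mK[OF k] power_mult[symmetric] by (rule arg_cong[where f = "\<lambda>n. r ^ n"]) simp
      finally show "a k * (real (2 * m k + 2) * r ^ (2 * m k + 1)) / real (m k + 1) = 2 / r * (a k * (r ^ nat \<bar>k\<bar>)\<^sup>2)" .
    qed
    have "(2 / r) * (\<Sum>k\<in>K. a k * (r ^ nat \<bar>k\<bar>)\<^sup>2) \<le> (2 / r) * (\<Sum>j\<in>J. b j * (\<rho> r ^ nat \<bar>j\<bar>)\<^sup>2)"
      unfolding \<rho>_def using r le[OF r] by (intro mult_left_mono) auto
    also have "\<dots> \<le> (2 / r\<^sup>2) * (\<Sum>j\<in>J. b j * (\<rho> r ^ nat \<bar>j\<bar>)\<^sup>2)"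
      using r b by (intro mult_right_mono sum_nonneg) (auto simp: field_simps power2_eq_square)
    finally have le2: "(2 / r) * (\<Sum>k\<in>K. a k * (r ^ nat \<bar>k\<bar>)\<^sup>2) \<le> (2 / r\<^sup>2) * (\<Sum>j\<in>J. b j * (\<rho> r ^ nat \<bar>j\<bar>)\<^sup>2)" .
    show "\<exists>y. (D has_real_derivative y) (at r) \<and> 0 \<le> y"
      by (rule exI, rule conjI, rule D'[unfolded J' K']) (use le2 in simp)
  qed simp
  moreover have "D 0 = 0" by (simp add: D_def \<rho>_def)
  ultimately have "(\<Sum>k\<in>K. a k / real (m k + 1)) \<le> (\<Sum>j\<in>J. 2 * \<epsilon> * b j / real (2 * m j + 1))"
    using e by (simp add: D_def \<rho>_def)
  \<comment> \<open>Integration gave \<open>2 * j - 1\<close> in the denominator, which is at least \<open>j\<close>.\<close>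
  also have "\<dots> \<le> (\<Sum>j\<in>J. 2 * \<epsilon> * b j / real (m j + 1))"
    using b e by (intro sum_mono divide_left_mono mult_nonneg_nonneg) auto
  also have "\<dots> = 2 * \<epsilon> * (\<Sum>j\<in>J. b j / real (nat \<bar>j\<bar>))"
    unfolding sum_distrib_left by (intro sum.cong) (auto simp: mJ)
  also have "(\<Sum>k\<in>K. a k / real (m k + 1)) = (\<Sum>k\<in>K. a k / real (nat \<bar>k\<bar>))"
    by (intro sum.cong) (auto simp: mK)
  finally show ?thesis .
qed

context nonrotation_inner
begin

text \<open>Littlewood's subordination principle. On the circle of radius \<open>r\<close> the iterate takes values in the disk
  of radius \<open>\<rho>\<close>, so it is \<open>\<rho> * w\<close> there with a self-map \<open>w\<close> of the disk fixing \<open>0\<close>, and composition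
  with \<open>w\<close> does not increase mean squares of harmonic functions.\<close>

lemma subordination:
  assumes H: "\<And>z. z \<noteq> 0 \<Longrightarrow> norm z < 1 \<Longrightarrow>
      norm ((F ^^ n) z) / (1 - norm ((F ^^ n) z)) < \<epsilon> * (norm z / (1 - norm z))" and e: "0 < \<epsilon>"
    and J: "finite J" and K: "finite K" and r: "0 < r" "r < 1"
  shows "(\<Sum>k\<in>K. (norm (fourier (\<lambda>x. \<Sum>j\<in>J. c j * zpow ((T ^^ n) x) j) k))\<^sup>2 * (r ^ nat \<bar>k\<bar>)\<^sup>2) \<le>
    (\<Sum>j\<in>J. (norm (c j))\<^sup>2 * ((\<epsilon> * r / (1 - r + \<epsilon> * r)) ^ nat \<bar>j\<bar>)\<^sup>2)"
proof -
  define \<rho> where "\<rho> = \<epsilon> * r / (1 - r + \<epsilon> * r)"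
  have den: "0 < 1 - r + \<epsilon> * r" using r e by (intro add_pos_pos) auto
  have \<rho>: "0 < \<rho>" using den r e by (simp add: \<rho>_def)
  let ?g = "\<lambda>x. \<Sum>j\<in>J. c j * zpow x j"
  let ?G = "\<lambda>x. \<Sum>j\<in>J. c j * zpow ((T ^^ n) x) j"
  let ?u = "\<lambda>y. \<Sum>j\<in>J. (c j * of_real (\<rho> ^ nat \<bar>j\<bar>)) * zpow y j"
  have gs: "square_integrable circ ?g" by (rule square_integrable_zpow_sum)
  have Gs: "square_integrable circ ?G" using square_integrable_iterate[OF gs] .
  have us: "square_integrable circ ?u" by (rule square_integrable_zpow_sum)
  define w where "w x = (F ^^ n) (of_real r * x) / of_real \<rho>" for x
  have rx: "norm (of_real r * x) < 1" if "norm x \<le> 1" for x :: complex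
  proof -
    have "norm (of_real r * x) \<le> r" using that r by (simp add: norm_mult mult_left_le)
    then show ?thesis using r by linarith
  qed
  have w1: "norm (w x) < 1" if x: "norm x \<le> 1" for x
  proof (cases "x = 0")
    case True
    then show ?thesis by (simp add: w_def iterate_0)
  next
    case False
    let ?a = "norm ((F ^^ n) (of_real r * x))"
    have a1: "?a < 1" by (rule iterate_ball[OF rx[OF x]])
    have "?a / (1 - ?a) < \<epsilon> * (norm (of_real r * x) / (1 - norm (of_real r * x)))"
      by (rule H[OF _ rx[OF x]]) (use False r in simp)
    also have "\<dots> \<le> \<epsilon> * (r / (1 - r))"
    proof (intro mult_left_mono frac_le)
      have "r * norm x \<le> r * 1" using x r by (intro mult_left_mono) auto
      then show "norm (of_real r * x) \<le> r" "1 - r \<le> 1 - norm (of_real r * x)" using r by (simp_all add: norm_mult)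
    qed (use r e in auto)
    finally have "?a * (1 - r) < \<epsilon> * r * (1 - ?a)"
      using a1 r by (simp add: field_simps)
    then have "?a < \<rho>" using den by (simp add: \<rho>_def field_simps)
    then show ?thesis using \<rho> by (simp add: w_def norm_divide)
  qed
  have wh: "continuous_on (cball 0 1) w" "w holomorphic_on ball 0 1"
    unfolding w_def using \<rho> r holomorphic_scaled[OF iterate_holomorphic[of n], of r]
    by (auto intro!: continuous_intros holomorphic_intros)
  have w0: "w 0 = 0" by (simp add: w_def iterate_0)
  have wm: "w \<in> borel_measurable circ"
    by (rule borel_measurable_circ_continuous[OF continuous_on_subset[OF wh(1)]]) auto
  have ext: "harmonic_ext ?G (of_real r * x) = harmonic_ext ?u (w x)" if x: "norm x \<le> 1" for x
  proof -
    have z: "norm ((F ^^ n) (of_real r * x)) < 1" by (rule iterate_ball[OF rx[OF x]])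
    have eq: "(F ^^ n) (of_real r * x) = of_real \<rho> * w x" using \<rho> by (simp add: w_def)
    have "harmonic_ext ?G (of_real r * x) = harmonic_ext ?g ((F ^^ n) (of_real r * x))"
      using harmonic_ext_iterate[OF square_integrable_measurable[OF gs] rx[OF x]] .
    also have "\<dots> = (\<Sum>j\<in>J. c j * zpow (of_real \<rho> * w x) j)"
      unfolding harmonic_ext_zpow_sum[OF z] by (simp only: eq)
    also have "\<dots> = harmonic_ext ?u (w x)"
      unfolding harmonic_ext_zpow_sum[OF w1[OF x]] zpow_of_real_mult by (simp add: mult.assoc)
    finally show ?thesis .
  qed
  have "trig ?u" by (intro trig_sum trig_monomial)
  from trig_bounded_measurable(2)[OF this] obtain B where "\<forall>x\<in>sphere 0 1. norm (?u x) \<le> B" ..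
  then have B: "norm (?u x) \<le> B" if "norm x = 1" for x using that by auto
  let ?A = "\<lambda>x. harmonic_ext ?G (of_real r * x)"
  have As: "square_integrable circ ?A" by (rule square_integrable_harmonic_ext[OF Gs]) (use r in auto)
  have um: "?u \<in> borel_measurable circ" by (rule square_integrable_measurable[OF us])
  have pm: "(\<lambda>(x, y). poisson (w x) y) \<in> borel_measurable (circ \<Otimes>\<^sub>M circ)"
  proof -
    have 1: "(\<lambda>p. w (fst p)) \<in> borel_measurable (circ \<Otimes>\<^sub>M circ)"
      by (rule measurable_compose[OF measurable_fst wm])
    have "(\<lambda>x. x) \<in> circ \<rightarrow>\<^sub>M borel" by (rule sphere_measurable(3)) simp
    from measurable_compose[OF measurable_snd this]
    have 2: "(\<lambda>p. snd p) \<in> borel_measurable (circ \<Otimes>\<^sub>M circ)" .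
    from measurable_compose[OF measurable_Pair[OF 1 2] poisson_measurable]
    show ?thesis by (simp add: case_prod_beta)
  qed
  interpret C2: pair_sigma_finite circ circ ..
  have "ennreal ((l2_norm circ ?A)\<^sup>2) = (\<integral>\<^sup>+x. ennreal ((norm (?A x))\<^sup>2) \<partial>circ)"
    unfolding l2_norm_sq by (rule nn_integral_eq_integral[symmetric, OF square_integrable_sq[OF As]]) simp
  also have "\<dots> \<le> (\<integral>\<^sup>+x. \<integral>\<^sup>+y. ennreal (poisson (w x) y) * ennreal ((norm (?u y))\<^sup>2) \<partial>circ \<partial>circ)"
  proof (rule nn_integral_mono)
    fix x assume "x \<in> space circ"
    then have x: "norm x \<le> 1" by simp
    show "ennreal ((norm (?A x))\<^sup>2) \<le> (\<integral>\<^sup>+y. ennreal (poisson (w x) y) * ennreal ((norm (?u y))\<^sup>2) \<partial>circ)"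
      unfolding ext[OF x] by (rule norm_harmonic_ext_sq_le[OF um B w1[OF x]])
  qed
  also have "\<dots> = (\<integral>\<^sup>+y. \<integral>\<^sup>+x. ennreal (poisson (w x) y) * ennreal ((norm (?u y))\<^sup>2) \<partial>circ \<partial>circ)"
  proof (rule C2.Fubini'[symmetric])
    have [measurable]: "(\<lambda>p. poisson (w (fst p)) (snd p)) \<in> borel_measurable (circ \<Otimes>\<^sub>M circ)"
      using pm by (simp add: case_prod_beta)
    have [measurable]: "(\<lambda>p. ?u (snd p)) \<in> borel_measurable (circ \<Otimes>\<^sub>M circ)"
      by (rule measurable_compose[OF measurable_snd um])
    show "(\<lambda>(x, y). ennreal (poisson (w x) y) * ennreal ((norm (?u y))\<^sup>2)) \<in> borel_measurable (circ \<Otimes>\<^sub>M circ)"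
      unfolding case_prod_beta by measurable
  qed
  also have "\<dots> = (\<integral>\<^sup>+y. ennreal ((norm (?u y))\<^sup>2) \<partial>circ)"
  proof (rule nn_integral_cong)
    fix y assume "y \<in> space circ"
    then have y: "norm y = 1" by simp
    have inner1: "(\<integral>\<^sup>+x. ennreal (poisson (w x) y) \<partial>circ) = 1"
      by (rule nn_integral_poisson_holomorphic[OF wh _ w0 y]) (rule w1)
    have [measurable]: "(\<lambda>x. poisson (w x) y) \<in> borel_measurable circ"
      using measurable_compose[OF measurable_Pair[OF wm measurable_const[of y]] poisson_measurable] by simp
    have "(\<integral>\<^sup>+x. ennreal (poisson (w x) y) * ennreal ((norm (?u y))\<^sup>2) \<partial>circ) =
        (\<integral>\<^sup>+x. ennreal (poisson (w x) y) \<partial>circ) * ennreal ((norm (?u y))\<^sup>2)"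
      by (rule nn_integral_multc) measurable
    then show "(\<integral>\<^sup>+x. ennreal (poisson (w x) y) * ennreal ((norm (?u y))\<^sup>2) \<partial>circ) = ennreal ((norm (?u y))\<^sup>2)"
      unfolding inner1 mult_1 .
  qed
  also have "\<dots> = ennreal ((l2_norm circ ?u)\<^sup>2)"
    unfolding l2_norm_sq by (rule nn_integral_eq_integral[OF square_integrable_sq[OF us]]) simp
  finally have le: "(l2_norm circ ?A)\<^sup>2 \<le> (l2_norm circ ?u)\<^sup>2" by (simp add: ennreal_le_iff)
  have "(\<Sum>k\<in>K. (norm (fourier ?G k))\<^sup>2 * (r ^ nat \<bar>k\<bar>)\<^sup>2) = (\<Sum>k\<in>K. (norm (fourier ?A k))\<^sup>2)"
  proof (rule sum.cong[OF refl])
    fix k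
    show "(norm (fourier ?G k))\<^sup>2 * (r ^ nat \<bar>k\<bar>)\<^sup>2 = (norm (fourier ?A k))\<^sup>2"
      using fourier_harmonic_ext[OF Gs, of r k] r by (simp add: norm_mult power_mult_distrib norm_power)
  qed
  also have "\<dots> \<le> (l2_norm circ ?A)\<^sup>2" by (rule Bessel[OF As K])
  also note le
  also have "(l2_norm circ ?u)\<^sup>2 = (\<Sum>j\<in>J. (norm (c j))\<^sup>2 * (\<rho> ^ nat \<bar>j\<bar>)\<^sup>2)"
    unfolding l2_norm_zpow_sum_sq[OF J] using \<rho> by (intro sum.cong refl) (simp add: norm_mult power_mult_distrib norm_power)
  finally show ?thesis by (simp add: \<rho>_def)
qed

text \<open>Duality. The energy \<open>S\<close> of a partial Fourier sum of the transfer is a pairing of \<open>f\<close> with a trigonometric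
  polynomial composed with the iterate. Subordination, integrated over the radius, shows that composition
  shrinks the dual norm \<open>\<Sum> \<bar>g_k\<bar>^2 / \<bar>k\<bar>\<close> by \<open>2 * \<epsilon>\<close>, so that \<open>S^2 \<le> 2 * \<epsilon> * B * S\<close>.\<close>

lemma dirichlet_le_transfer_of_contraction:
  assumes H: "\<And>z. z \<noteq> 0 \<Longrightarrow> norm z < 1 \<Longrightarrow>
      norm ((F ^^ n) z) / (1 - norm ((F ^^ n) z)) < \<epsilon> * (norm z / (1 - norm z))" and e: "0 < \<epsilon>"
    and f: "square_integrable circ f" and B: "dirichlet_le (\<lambda>x. complex_of_real (f x)) B"
  shows "dirichlet_le (\<lambda>x. complex_of_real (transfer n f x)) (2 * \<epsilon> * B)"
  unfolding dirichlet_le_def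
proof
  fix N
  let ?f = "\<lambda>x. complex_of_real (f x)" and ?u = "\<lambda>x. complex_of_real (transfer n f x)"
  have fs: "square_integrable circ ?f" using f by (simp add: square_integrable_of_real)
  have us: "square_integrable circ ?u"
    using square_integrable_transfer[OF f] by (simp add: square_integrable_of_real)
  define J where "J = {- int N..int N} - {0}"
  have J: "finite J" "0 \<notin> J" by (auto simp: J_def)
  define c where "c k = complex_of_real (real (nat \<bar>k\<bar>)) * fourier ?u k" for k
  define S where "S = (\<Sum>k\<in>J. real (nat \<bar>k\<bar>) * (norm (fourier ?u k))\<^sup>2)"
  have SN: "(\<Sum>k\<in>{- int N..int N}. real (nat \<bar>k\<bar>) * (norm (fourier ?u k))\<^sup>2) = S"
    unfolding S_def J_def by (rule sum.mono_neutral_right) auto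
  let ?g = "\<lambda>x. \<Sum>k\<in>J. c k * zpow x k"
  let ?G = "\<lambda>x. \<Sum>k\<in>J. c k * zpow ((T ^^ n) x) k"
  have gs: "square_integrable circ ?g" by (rule square_integrable_zpow_sum)
  have Gs: "square_integrable circ ?G" using square_integrable_iterate[OF gs] .
  have "(LINT x|circ. ?f x * cnj (?G x)) = (LINT x|circ. ?u x * cnj (?g x))"
    using is_transfer_complex[OF is_transfer_transfer[OF f] f square_integrable_cnj[OF gs]] .
  also have "\<dots> = (\<Sum>k\<in>J. cnj (c k) * fourier ?u k)"
    by (rule integral_mult_cnj_zpow_sum[OF us])
  also have "\<dots> = complex_of_real S"
    unfolding S_def of_real_sum
  proof (rule sum.cong[OF refl])
    fix k
    show "cnj (c k) * fourier ?u k = complex_of_real (real (nat \<bar>k\<bar>) * (norm (fourier ?u k))\<^sup>2)"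
      unfolding of_real_mult complex_norm_square by (simp add: c_def mult_ac)
  qed
  finally have int: "(LINT x|circ. ?f x * cnj (?G x)) = complex_of_real S" .
  have G0: "fourier ?G 0 = 0"
  proof -
    have "fourier ?G 0 = (LINT x|circ. ?g x)"
      using integral_iterate[OF square_integrable_measurable[OF gs], of n] by (simp add: fourier_def)
    also have "\<dots> = fourier ?g 0" by (simp add: fourier_def)
    also have "\<dots> = 0" using fourier_zpow_sum[OF J(1), of c 0] J(2) by simp
    finally show ?thesis .
  qed
  have S0: "0 \<le> S" unfolding S_def by (intro sum_nonneg) auto
  have B0: "0 \<le> B" by (rule dirichlet_le_nonneg[OF B])
  have bound: "norm (\<Sum>k\<in>{- int M..int M}. fourier ?f k * cnj (fourier ?G k)) \<le> sqrt (B * (2 * \<epsilon> * S))" for M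
  proof (rule real_le_rsqrt)
    let ?K = "{- int M..int M} - {0}"
    let ?s = "\<lambda>k. sqrt (real (nat \<bar>k\<bar>))"
    have "(\<Sum>k\<in>{- int M..int M}. fourier ?f k * cnj (fourier ?G k)) = (\<Sum>k\<in>?K. fourier ?f k * cnj (fourier ?G k))"
      using G0 by (intro sum.mono_neutral_right) auto
    also have "norm \<dots> \<le> (\<Sum>k\<in>?K. (?s k * norm (fourier ?f k)) * (norm (fourier ?G k) / ?s k))"
      by (rule sum_norm_le) (auto simp: norm_mult)
    finally have "(norm (\<Sum>k\<in>{- int M..int M}. fourier ?f k * cnj (fourier ?G k)))\<^sup>2 \<le>
       (\<Sum>k\<in>?K. (?s k * norm (fourier ?f k)) * (norm (fourier ?G k) / ?s k))\<^sup>2"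
      by (rule power_mono) simp
    also have "\<dots> \<le> (\<Sum>k\<in>?K. (?s k * norm (fourier ?f k))\<^sup>2) * (\<Sum>k\<in>?K. (norm (fourier ?G k) / ?s k)\<^sup>2)"
      by (rule Cauchy_Schwarz_ineq_sum)
    also have "\<dots> \<le> B * (2 * \<epsilon> * S)"
    proof (intro mult_mono B0 sum_nonneg)
      have "(\<Sum>k\<in>?K. (?s k * norm (fourier ?f k))\<^sup>2) = (\<Sum>k\<in>?K. real (nat \<bar>k\<bar>) * (norm (fourier ?f k))\<^sup>2)"
        by (simp add: power_mult_distrib)
      also have "\<dots> \<le> (\<Sum>k\<in>{- int M..int M}. real (nat \<bar>k\<bar>) * (norm (fourier ?f k))\<^sup>2)"
        by (intro sum_mono2) auto
      also have "\<dots> \<le> B" using B by (simp add: dirichlet_le_def)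
      finally show "(\<Sum>k\<in>?K. (?s k * norm (fourier ?f k))\<^sup>2) \<le> B" .
      have "(\<Sum>k\<in>?K. (norm (fourier ?G k) / ?s k)\<^sup>2) = (\<Sum>k\<in>?K. (norm (fourier ?G k))\<^sup>2 / real (nat \<bar>k\<bar>))"
        by (simp add: power_divide)
      also have "\<dots> \<le> 2 * \<epsilon> * (\<Sum>j\<in>J. (norm (c j))\<^sup>2 / real (nat \<bar>j\<bar>))"
        by (rule weighted_sum_le_of_power_sum_le[OF _ _ J e]) (auto intro!: subordination[OF H e J(1)])
      also have "(\<Sum>j\<in>J. (norm (c j))\<^sup>2 / real (nat \<bar>j\<bar>)) = S"
        unfolding S_def
      proof (rule sum.cong[OF refl])
        fix j assume "j \<in> J"
        then have "j \<noteq> 0" using J by auto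
        then show "(norm (c j))\<^sup>2 / real (nat \<bar>j\<bar>) = real (nat \<bar>j\<bar>) * (norm (fourier ?u j))\<^sup>2"
          by (simp add: c_def norm_mult power_mult_distrib power2_eq_square)
      qed
      finally show "(\<Sum>k\<in>?K. (norm (fourier ?G k) / ?s k)\<^sup>2) \<le> 2 * \<epsilon> * S" .
    qed simp_all
    finally show "(norm (\<Sum>k\<in>{- int M..int M}. fourier ?f k * cnj (fourier ?G k)))\<^sup>2 \<le> B * (2 * \<epsilon> * S)" .
  qed
  have "norm (complex_of_real S) \<le> sqrt (B * (2 * \<epsilon> * S))"
    using tendsto_norm[OF Parseval_pairing[OF fs Gs]] unfolding int
    by (rule LIMSEQ_le_const2) (use bound in blast)
  then have "S\<^sup>2 \<le> (sqrt (B * (2 * \<epsilon> * S)))\<^sup>2"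
    using S0 by (intro power_mono) auto
  also have "\<dots> = 2 * \<epsilon> * B * S" using B0 S0 e by simp
  finally have "S * S \<le> 2 * \<epsilon> * B * S" by (simp add: power2_eq_square)
  moreover have "0 \<le> 2 * \<epsilon> * B" using e B0 by simp
  ultimately have "S \<le> 2 * \<epsilon> * B" using S0 by (cases "S = 0") auto
  then show "(\<Sum>k\<in>{- int N..int N}. real (nat \<bar>k\<bar>) * (norm (fourier ?u k))\<^sup>2) \<le> 2 * \<epsilon> * B"
    unfolding SN .
qed

theorem dirichlet_le_transfer:
  obtains \<kappa> where "0 < \<kappa>" "\<kappa> < 1"
    "\<And>n f B. square_integrable circ f \<Longrightarrow> dirichlet_le (\<lambda>x. complex_of_real (f x)) B \<Longrightarrow>
       dirichlet_le (\<lambda>x. complex_of_real (transfer n f x)) (4 * \<kappa> ^ n * B)"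
proof -
  obtain \<kappa> where \<kappa>: "0 < \<kappa>" "\<kappa> < 1"
    and c: "\<And>z. norm z < 1 \<Longrightarrow> norm (F z) / (1 - norm (F z)) \<le> \<kappa> * (norm z / (1 - norm z))"
    using contraction by metis
  have cn: "norm ((F ^^ n) z) / (1 - norm ((F ^^ n) z)) \<le> \<kappa> ^ n * (norm z / (1 - norm z))" if z: "norm z < 1" for n z
  proof (induction n)
    case (Suc n)
    have "norm ((F ^^ Suc n) z) / (1 - norm ((F ^^ Suc n) z)) \<le> \<kappa> * (norm ((F ^^ n) z) / (1 - norm ((F ^^ n) z)))"
      using c[OF iterate_ball[OF z]] by simp
    also have "\<dots> \<le> \<kappa> * (\<kappa> ^ n * (norm z / (1 - norm z)))"
      using Suc \<kappa> by (intro mult_left_mono) auto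
    finally show ?case by simp
  qed simp
  show ?thesis
  proof (rule that[OF \<kappa>])
    fix n f B assume f: "square_integrable circ f" "dirichlet_le (\<lambda>x. complex_of_real (f x)) B"
    \<comment> \<open>Doubling \<open>\<kappa> ^ n\<close> makes the contraction strict.\<close>
    have "dirichlet_le (\<lambda>x. complex_of_real (transfer n f x)) (2 * (2 * \<kappa> ^ n) * B)"
    proof (rule dirichlet_le_transfer_of_contraction[OF _ _ f])
      show "0 < 2 * \<kappa> ^ n" using \<kappa> by simp
      fix z :: complex assume z: "z \<noteq> 0" "norm z < 1"
      have "0 < \<kappa> ^ n * (norm z / (1 - norm z))" using \<kappa> z by simp
      then show "norm ((F ^^ n) z) / (1 - norm ((F ^^ n) z)) < 2 * \<kappa> ^ n * (norm z / (1 - norm z))"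
        using cn[OF z(2), of n] by linarith
    qed
    then show "dirichlet_le (\<lambda>x. complex_of_real (transfer n f x)) (4 * \<kappa> ^ n * B)" by simp
  qed
qed

end

section \<open>Mean oscillation with respect to harmonic measures\<close>

text \<open>Mean oscillation seen from \<open>z\<close>: the root mean square of \<open>f x - f y\<close> for independent points \<open>x\<close> and \<open>y\<close> distributed
  according to harmonic measure at \<open>z\<close>. Its supremum over \<open>z\<close> is Garsia's norm on functions of bounded mean
  oscillation.\<close>

definition osc :: "complex \<Rightarrow> (complex \<Rightarrow> complex) \<Rightarrow> real" where
  "osc z f = l2_norm (poisson_measure z \<Otimes>\<^sub>M poisson_measure z) (\<lambda>p. f (fst p) - f (snd p))"

lemma square_integrable_poisson_measure:
  fixes f :: "complex \<Rightarrow> complex"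
  assumes f: "square_integrable circ f" and z: "norm z < 1"
  shows "square_integrable (poisson_measure z) f"
    and "l2_norm (poisson_measure z) f \<le> sqrt ((1 + norm z) / (1 - norm z)) * l2_norm circ f"
proof -
  note fm [measurable] = square_integrable_measurable[OF f]
  define C where "C = (1 + norm z) / (1 - norm z)"
  have C: "0 \<le> C" unfolding C_def using z by auto
  have pC: "poisson z x \<le> C" "0 \<le> poisson z x" if "x \<in> space circ" for x
    unfolding C_def using poisson_bounds(2,3)[OF _ z, of x] that by auto
  have m: "(\<lambda>x. (norm (f x))\<^sup>2) \<in> borel_measurable circ" by measurable
  have i: "integrable circ (\<lambda>x. poisson z x *\<^sub>R (norm (f x))\<^sup>2)"
  proof (rule Bochner_Integration.integrable_bound[OF integrable_mult_right[OF square_integrable_sq[OF f], of C]])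
    show "AE x in circ. norm (poisson z x *\<^sub>R (norm (f x))\<^sup>2) \<le> norm (C * (norm (f x))\<^sup>2)"
    proof (rule AE_I2)
      fix x assume "x \<in> space circ"
      from pC[OF \<open>x \<in> space circ\<close>] have "poisson z x * (norm (f x))\<^sup>2 \<le> C * (norm (f x))\<^sup>2" by (intro mult_right_mono) auto
      then show "norm (poisson z x *\<^sub>R (norm (f x))\<^sup>2) \<le> norm (C * (norm (f x))\<^sup>2)"
        using pC(2)[OF \<open>x \<in> space circ\<close>] C by (simp add: abs_mult)
    qed
  qed measurable
  show "square_integrable (poisson_measure z) f"
    unfolding square_integrable_def
    using i integrable_poisson_measure[OF m z] fm
    by (simp add: measurable_cong_sets[OF sets_poisson_measure refl] measurable_cong_sets[OF sets_circ refl])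
  have "(l2_norm (poisson_measure z) f)\<^sup>2 = (LINT x|circ. poisson z x *\<^sub>R (norm (f x))\<^sup>2)"
    unfolding l2_norm_sq by (rule integral_poisson_measure[OF m z])
  also have "\<dots> \<le> (LINT x|circ. C * (norm (f x))\<^sup>2)"
  proof (rule integral_mono[OF i])
    fix x assume "x \<in> space circ"
    from pC(1)[OF this] have "poisson z x * (norm (f x))\<^sup>2 \<le> C * (norm (f x))\<^sup>2" by (intro mult_right_mono) auto
    then show "poisson z x *\<^sub>R (norm (f x))\<^sup>2 \<le> C * (norm (f x))\<^sup>2" by simp
  qed (intro integrable_mult_right square_integrable_sq f)
  also have "\<dots> = C * (l2_norm circ f)\<^sup>2" unfolding l2_norm_sq by (rule integral_mult_right_zero)
  also have "\<dots> = (sqrt C * l2_norm circ f)\<^sup>2" using C by (simp add: power_mult_distrib)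
  finally have "l2_norm (poisson_measure z) f \<le> sqrt C * l2_norm circ f"
    by (rule power2_le_imp_le) (use C in simp)
  then show "l2_norm (poisson_measure z) f \<le> sqrt ((1 + norm z) / (1 - norm z)) * l2_norm circ f"
    unfolding C_def .
qed

lemma (in prob_space) square_integrable_pair:
  fixes f :: "'a \<Rightarrow> complex"
  assumes f: "square_integrable M f"
  shows "square_integrable (M \<Otimes>\<^sub>M M) (\<lambda>p. f (fst p))" "square_integrable (M \<Otimes>\<^sub>M M) (\<lambda>p. f (snd p))"
    "l2_norm (M \<Otimes>\<^sub>M M) (\<lambda>p. f (fst p)) = l2_norm M f" "l2_norm (M \<Otimes>\<^sub>M M) (\<lambda>p. f (snd p)) = l2_norm M f"
proof -
  note m = square_integrable_measurable[OF f]
  have 1: "distr (M \<Otimes>\<^sub>M M) M fst = M" by (rule distr_pair_fst)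
  have 2: "distr (M \<Otimes>\<^sub>M M) M snd = M"
  proof -
    interpret PP: pair_sigma_finite M M ..
    have "distr (M \<Otimes>\<^sub>M M) M snd = distr (distr (M \<Otimes>\<^sub>M M) (M \<Otimes>\<^sub>M M) (\<lambda>(x, y). (y, x))) M snd"
      using PP.distr_pair_swap by simp
    also have "\<dots> = distr (M \<Otimes>\<^sub>M M) M (snd \<circ> (\<lambda>(x, y). (y, x)))"
      by (rule distr_distr) measurable
    also have "snd \<circ> (\<lambda>(x, y). (y, x)) = (fst :: 'a \<times> 'a \<Rightarrow> 'a)" by (auto simp: fun_eq_iff)
    finally show ?thesis using 1 by simp
  qed
  show "square_integrable (M \<Otimes>\<^sub>M M) (\<lambda>p. f (fst p))"
    using square_integrable_distr[OF measurable_fst m, of M] 1 f by simp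
  show "square_integrable (M \<Otimes>\<^sub>M M) (\<lambda>p. f (snd p))"
    using square_integrable_distr[OF measurable_snd m, of M] 2 f by simp
  show "l2_norm (M \<Otimes>\<^sub>M M) (\<lambda>p. f (fst p)) = l2_norm M f"
    using l2_norm_distr[OF measurable_fst m, of M] 1 by simp
  show "l2_norm (M \<Otimes>\<^sub>M M) (\<lambda>p. f (snd p)) = l2_norm M f"
    using l2_norm_distr[OF measurable_snd m, of M] 2 by simp
qed

lemma (in prob_space) l2_norm_pair_diff_sq:
  fixes f :: "'a \<Rightarrow> complex"
  assumes f: "square_integrable M f"
  shows "(l2_norm (M \<Otimes>\<^sub>M M) (\<lambda>p. f (fst p) - f (snd p)))\<^sup>2 = 2 * (l2_norm M f)\<^sup>2 - 2 * (norm (LINT x|M. f x))\<^sup>2"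
proof -
  interpret PP: pair_sigma_finite M M ..
  let ?P = "M \<Otimes>\<^sub>M M"
  note s = square_integrable_pair(1,2)[OF f]
  have i: "integrable ?P (\<lambda>p. f (fst p) * cnj (f (fst p)))" "integrable ?P (\<lambda>p. f (snd p) * cnj (f (snd p)))"
    "integrable ?P (\<lambda>p. f (fst p) * cnj (f (snd p)))" "integrable ?P (\<lambda>p. f (snd p) * cnj (f (fst p)))"
    by (intro integrable_mult_square_integrable square_integrable_cnj s)+
  have sq: "complex_of_real ((l2_norm N g)\<^sup>2) = (LINT x|N. g x * cnj (g x))" for N and g :: "'b \<Rightarrow> complex"
    unfolding l2_norm_sq complex_norm_square[symmetric] by (rule integral_complex_of_real[symmetric])
  have cross: "(LINT p|?P. f (fst p) * cnj (f (snd p))) = (LINT x|M. f x) * cnj (LINT x|M. f x)"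
  proof -
    have "(LINT p|?P. f (fst p) * cnj (f (snd p))) = (LINT x|M. LINT y|M. f x * cnj (f y))"
      using PP.integral_fst'[OF i(3)] by simp
    also have "\<dots> = (LINT x|M. f x * cnj (LINT y|M. f y))"
      by (simp only: integral_mult_right_zero Bochner_Integration.integral_cnj)
    also have "\<dots> = (LINT x|M. f x) * cnj (LINT x|M. f x)" by (rule integral_mult_left_zero)
    finally show ?thesis .
  qed
  have cross2: "(LINT p|?P. f (snd p) * cnj (f (fst p))) = (LINT x|M. f x) * cnj (LINT x|M. f x)"
  proof -
    have "(LINT p|?P. f (snd p) * cnj (f (fst p))) = (LINT p|?P. cnj (f (fst p) * cnj (f (snd p))))"
      by (simp add: mult.commute)
    also have "\<dots> = cnj (LINT p|?P. f (fst p) * cnj (f (snd p)))" by (rule Bochner_Integration.integral_cnj)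
    finally show ?thesis unfolding cross by (simp add: mult.commute)
  qed
  have "complex_of_real ((l2_norm ?P (\<lambda>p. f (fst p) - f (snd p)))\<^sup>2) =
    (LINT p|?P. f (fst p) * cnj (f (fst p)) - f (fst p) * cnj (f (snd p)) - f (snd p) * cnj (f (fst p)) + f (snd p) * cnj (f (snd p)))"
    unfolding sq by (simp add: algebra_simps)
  also have "\<dots> = (LINT p|?P. f (fst p) * cnj (f (fst p))) - (LINT p|?P. f (fst p) * cnj (f (snd p))) -
     (LINT p|?P. f (snd p) * cnj (f (fst p))) + (LINT p|?P. f (snd p) * cnj (f (snd p)))"
    using i by simp
  also have "\<dots> = complex_of_real ((l2_norm ?P (\<lambda>p. f (fst p)))\<^sup>2) - 2 * ((LINT x|M. f x) * cnj (LINT x|M. f x))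
      + complex_of_real ((l2_norm ?P (\<lambda>p. f (snd p)))\<^sup>2)"
    unfolding sq cross cross2 by simp
  also have "\<dots> = complex_of_real (2 * (l2_norm M f)\<^sup>2 - 2 * (norm (LINT x|M. f x))\<^sup>2)"
    unfolding square_integrable_pair(3,4)[OF f] complex_norm_square[symmetric] by simp
  finally show ?thesis by (simp only: of_real_eq_iff)
qed

context
  fixes z :: complex
  assumes z: "norm z < 1"
begin

interpretation P: prob_space "poisson_measure z" by (rule prob_space_poisson_measure[OF z])

lemma square_integrable_osc:
  fixes f :: "complex \<Rightarrow> complex"
  assumes f: "square_integrable circ f"
  shows "square_integrable (poisson_measure z \<Otimes>\<^sub>M poisson_measure z) (\<lambda>p. f (fst p) - f (snd p))"
  by (rule square_integrable_diff[OF P.square_integrable_pair(1)[OF square_integrable_poisson_measure(1)[OF f z]]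
        P.square_integrable_pair(2)[OF square_integrable_poisson_measure(1)[OF f z]]])

lemma osc_nonneg: "0 \<le> osc z f"
  by (simp add: osc_def)

lemma osc_add:
  assumes f: "square_integrable circ f" and g: "square_integrable circ g"
  shows "osc z (\<lambda>x. f x + g x) \<le> osc z f + osc z g"
proof -
  have "osc z (\<lambda>x. f x + g x) = l2_norm (poisson_measure z \<Otimes>\<^sub>M poisson_measure z)
      (\<lambda>p. (f (fst p) - f (snd p)) + (g (fst p) - g (snd p)))"
    unfolding osc_def by (intro l2_norm_cong) simp
  also have "\<dots> \<le> osc z f + osc z g"
    unfolding osc_def by (intro l2_norm_triangle square_integrable_osc f g)
  finally show ?thesis .
qed

lemma osc_cmult: "osc z (\<lambda>x. c * f x) = norm c * osc z f"
  unfolding osc_def by (simp add: right_diff_distrib[symmetric] l2_norm_cmult)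

lemma osc_minus: "osc z (\<lambda>x. - f x) = osc z f"
  using osc_cmult[of "-1" f] by simp

lemma osc_diff:
  assumes f: "square_integrable circ f" and g: "square_integrable circ g"
  shows "osc z (\<lambda>x. f x - g x) \<le> osc z f + osc z g"
  using osc_add[OF f square_integrable_minus[OF g]] by (simp add: osc_minus)

lemma osc_const: "osc z (\<lambda>x. c) = 0"
  by (simp add: osc_def l2_norm_def)

lemma osc_sum:
  assumes "\<And>i. i \<in> I \<Longrightarrow> square_integrable circ (f i)"
  shows "osc z (\<lambda>x. \<Sum>i\<in>I. f i x) \<le> (\<Sum>i\<in>I. osc z (f i))"
  using assms
proof (induction I rule: infinite_finite_induct)
  case (insert i I)
  have "osc z (\<lambda>x. f i x + (\<Sum>i\<in>I. f i x)) \<le> osc z (f i) + osc z (\<lambda>x. \<Sum>i\<in>I. f i x)"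
    by (intro osc_add square_integrable_sum insert) auto
  then show ?case using insert by fastforce
qed (auto simp: osc_const)

lemma osc_le_l2_norm_poisson:
  assumes f: "square_integrable circ f"
  shows "osc z f \<le> 2 * l2_norm (poisson_measure z) f"
proof -
  note s = square_integrable_poisson_measure(1)[OF f z]
  show ?thesis
    using l2_norm_diff_triangle[OF P.square_integrable_pair(1)[OF s] P.square_integrable_pair(2)[OF s]]
    unfolding P.square_integrable_pair(3)[OF s] P.square_integrable_pair(4)[OF s] osc_def[symmetric] by simp
qed

lemma osc_le_l2_norm:
  assumes f: "square_integrable circ f"
  shows "osc z f \<le> 2 * sqrt ((1 + norm z) / (1 - norm z)) * l2_norm circ f"
  using osc_le_l2_norm_poisson[OF f] square_integrable_poisson_measure(2)[OF f z] by linarith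

lemma osc_le_AE_bound:
  assumes f: "square_integrable circ f" and b: "AE x in circ. norm (f x) \<le> c" and c: "0 \<le> c"
  shows "osc z f \<le> 2 * c"
proof -
  note s = square_integrable_poisson_measure(1)[OF f z]
  have "AE x in poisson_measure z. norm (f x) \<le> c"
    unfolding poisson_measure_def by (subst AE_density) (use b in \<open>auto elim: eventually_mono\<close>)
  then have "AE x in poisson_measure z. (norm (f x))\<^sup>2 \<le> c\<^sup>2"
    by eventually_elim (intro power_mono, auto)
  then have "(LINT x|poisson_measure z. (norm (f x))\<^sup>2) \<le> (LINT x|poisson_measure z. c\<^sup>2)"
    by (intro integral_mono_AE square_integrable_sq s) auto
  then have "l2_norm (poisson_measure z) f \<le> c"
    using c unfolding l2_norm_def by (intro real_le_lsqrt) (auto simp: P.prob_space[unfolded space_poisson_measure])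
  then show ?thesis using osc_le_l2_norm_poisson[OF f] by linarith
qed

lemma osc_sq:
  assumes f: "square_integrable circ f"
  shows "(osc z f)\<^sup>2 = 2 * (l2_norm (poisson_measure z) f)\<^sup>2 - 2 * (norm (LINT x|poisson_measure z. f x))\<^sup>2"
  unfolding osc_def by (rule P.l2_norm_pair_diff_sq[OF square_integrable_poisson_measure(1)[OF f z]])

lemma osc_sq_nn_integral:
  assumes f: "square_integrable circ f"
  shows "ennreal ((osc z f)\<^sup>2) = (\<integral>\<^sup>+x. \<integral>\<^sup>+y. ennreal (poisson z x * poisson z y * (norm (f x - f y))\<^sup>2) \<partial>circ \<partial>circ)"
proof -
  have fm [measurable]: "f \<in> borel_measurable circ" by (rule square_integrable_measurable[OF f])
  have pm [measurable]: "poisson z \<in> borel_measurable circ" by (intro borel_measurable_circ) measurable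
  have sf: "sigma_finite_measure (poisson_measure z)" by unfold_locales
  have d: "poisson_measure z \<Otimes>\<^sub>M poisson_measure z = density (circ \<Otimes>\<^sub>M circ) (\<lambda>(x, y). ennreal (poisson z x) * ennreal (poisson z y))"
    unfolding poisson_measure_def
    by (rule pair_measure_density) (use sf in \<open>auto simp: poisson_measure_def intro: circ.sigma_finite_measure_axioms\<close>)
  have "ennreal ((osc z f)\<^sup>2) = (\<integral>\<^sup>+p. ennreal ((norm (f (fst p) - f (snd p)))\<^sup>2) \<partial>(poisson_measure z \<Otimes>\<^sub>M poisson_measure z))"
    unfolding osc_def l2_norm_sq
    by (rule nn_integral_eq_integral[symmetric, OF square_integrable_sq[OF square_integrable_osc[OF f]]]) simp
  also have "\<dots> = (\<integral>\<^sup>+p. (case p of (x, y) \<Rightarrow> ennreal (poisson z x) * ennreal (poisson z y)) * ennreal ((norm (f (fst p) - f (snd p)))\<^sup>2) \<partial>(circ \<Otimes>\<^sub>M circ))"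
    unfolding d by (rule nn_integral_density) measurable
  also have "\<dots> = (\<integral>\<^sup>+p. ennreal (poisson z (fst p) * poisson z (snd p) * (norm (f (fst p) - f (snd p)))\<^sup>2) \<partial>(circ \<Otimes>\<^sub>M circ))"
    by (intro nn_integral_cong) (simp add: case_prod_beta ennreal_mult' poisson_nonneg[OF z])
  also have "\<dots> = (\<integral>\<^sup>+x. \<integral>\<^sup>+y. ennreal (poisson z x * poisson z y * (norm (f x - f y))\<^sup>2) \<partial>circ \<partial>circ)"
    by (subst circ.nn_integral_fst[symmetric]) (simp_all, measurable)
  finally show ?thesis .
qed

text \<open>Harnack's inequality: harmonic measure at \<open>z\<close> has density at least \<open>(1 - norm z) / (1 + norm z)\<close>.\<close>

lemma osc_0_le:
  assumes f: "square_integrable circ f"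
  shows "(1 - norm z) / (1 + norm z) * osc 0 f \<le> osc z f"
proof -
  let ?c = "(1 - norm z) / (1 + norm z)"
  have c: "0 \<le> ?c" using z by auto
  have f0: "ennreal ((osc 0 f)\<^sup>2) = (\<integral>\<^sup>+x. \<integral>\<^sup>+y. ennreal ((norm (f x - f y))\<^sup>2) \<partial>circ \<partial>circ)"
  proof -
    interpret P0: pair_prob_space circ circ ..
    have fm [measurable]: "f \<in> borel_measurable circ" by (rule square_integrable_measurable[OF f])
    have "square_integrable (circ \<Otimes>\<^sub>M circ) (\<lambda>p. f (fst p) - f (snd p))"
      by (rule square_integrable_diff[OF circ.square_integrable_pair(1)[OF f] circ.square_integrable_pair(2)[OF f]])
    then have "ennreal ((osc 0 f)\<^sup>2) = (\<integral>\<^sup>+p. ennreal ((norm (f (fst p) - f (snd p)))\<^sup>2) \<partial>(circ \<Otimes>\<^sub>M circ))"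
      unfolding osc_def l2_norm_sq poisson_measure_0
      by (intro nn_integral_eq_integral[symmetric] square_integrable_sq) auto
    also have "\<dots> = (\<integral>\<^sup>+x. \<integral>\<^sup>+y. ennreal ((norm (f x - f y))\<^sup>2) \<partial>circ \<partial>circ)"
      by (subst circ.nn_integral_fst[symmetric]) (simp_all, measurable)
    finally show ?thesis .
  qed
  have "ennreal ((?c * osc 0 f)\<^sup>2) = ennreal (?c\<^sup>2) * (\<integral>\<^sup>+x. \<integral>\<^sup>+y. ennreal ((norm (f x - f y))\<^sup>2) \<partial>circ \<partial>circ)"
    unfolding f0[symmetric] power_mult_distrib by (rule ennreal_mult) auto
  also have "\<dots> = (\<integral>\<^sup>+x. \<integral>\<^sup>+y. ennreal (?c\<^sup>2) * ennreal ((norm (f x - f y))\<^sup>2) \<partial>circ \<partial>circ)"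
  proof -
    have fm [measurable]: "f \<in> borel_measurable circ" by (rule square_integrable_measurable[OF f])
    show ?thesis by (simp add: nn_integral_cmult del: power_divide)
  qed
  also have "\<dots> \<le> (\<integral>\<^sup>+x. \<integral>\<^sup>+y. ennreal (poisson z x * poisson z y * (norm (f x - f y))\<^sup>2) \<partial>circ \<partial>circ)"
  proof (intro nn_integral_mono)
    fix x y assume "x \<in> space circ" "y \<in> space circ"
    then have "?c * ?c \<le> poisson z x * poisson z y"
      using poisson_bounds(1)[OF _ z, of x] poisson_bounds(1)[OF _ z, of y] poisson_nonneg[OF z] c
      by (intro mult_mono) auto
    then have "?c\<^sup>2 * (norm (f x - f y))\<^sup>2 \<le> poisson z x * poisson z y * (norm (f x - f y))\<^sup>2"
      unfolding power2_eq_square[of ?c] by (intro mult_right_mono) auto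
    then show "ennreal (?c\<^sup>2) * ennreal ((norm (f x - f y))\<^sup>2) \<le> ennreal (poisson z x * poisson z y * (norm (f x - f y))\<^sup>2)"
      by (subst ennreal_mult[symmetric]) (auto intro!: ennreal_leI)
  qed
  also have "\<dots> = ennreal ((osc z f)\<^sup>2)" by (rule osc_sq_nn_integral[OF f, symmetric])
  finally have "(?c * osc 0 f)\<^sup>2 \<le> (osc z f)\<^sup>2" by (simp only: ennreal_le_iff zero_le_power2)
  then show ?thesis by (rule power2_le_imp_le) (rule osc_nonneg)
qed

end

lemma osc_0_sq:
  assumes f: "square_integrable circ f" and m: "(LINT x|circ. f x) = 0"
  shows "osc 0 f = sqrt 2 * l2_norm circ f"
proof -
  have "(osc 0 f)\<^sup>2 = 2 * (l2_norm circ f)\<^sup>2"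
    using osc_sq[of 0, OF _ f] m by (simp add: poisson_measure_0)
  then have "osc 0 f = sqrt (2 * (l2_norm circ f)\<^sup>2)"
    using osc_nonneg[of 0 f] by (metis norm_zero real_sqrt_unique zero_less_one)
  then show ?thesis by (simp add: real_sqrt_mult)
qed

lemma osc_zpow:
  assumes z: "norm z < 1"
  shows "(osc z (\<lambda>x. zpow x k))\<^sup>2 = 2 - 2 * (norm z ^ nat \<bar>k\<bar>)\<^sup>2"
proof -
  interpret P: prob_space "poisson_measure z" by (rule prob_space_poisson_measure[OF z])
  have "(LINT x|poisson_measure z. zpow x k) = zpow z k"
    using integral_poisson_zpow[OF z, of k] integral_poisson_measure[OF square_integrable_measurable[OF square_integrable_zpow[of k]] z]
    by (simp add: scaleR_conv_of_real)
  moreover have "(l2_norm (poisson_measure z) (\<lambda>x. zpow x k))\<^sup>2 = (LINT x|poisson_measure z. 1)"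
    unfolding l2_norm_sq by (intro Bochner_Integration.integral_cong) auto
  ultimately show ?thesis
    unfolding osc_sq[OF z square_integrable_zpow] by (simp add: norm_zpow P.prob_space[unfolded space_poisson_measure])
qed

context nonrotation_inner
begin

text \<open>The boundary map carries harmonic measure at \<open>z\<close> to harmonic measure at \<open>F z\<close>, hence also pairs of
  independent points.\<close>

lemma osc_compose_T:
  assumes z: "norm z < 1" and f: "f \<in> borel_measurable circ"
  shows "osc z (\<lambda>x. f (T x)) = osc (F z) f"
proof -
  let ?P = "poisson_measure z"
  have d: "poisson_measure (F z) \<Otimes>\<^sub>M poisson_measure (F z) = distr (?P \<Otimes>\<^sub>M ?P) (circ \<Otimes>\<^sub>M circ) (\<lambda>(x, y). (T x, T y))"
    unfolding distr_poisson_measure[OF z, symmetric]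
  proof (rule pair_measure_distr[OF T_measurable_poisson T_measurable_poisson])
    interpret Q: prob_space "poisson_measure (F z)" by (rule prob_space_poisson_measure[OF F_ball[OF z]])
    show "sigma_finite_measure (distr ?P circ T)"
      unfolding distr_poisson_measure[OF z] by unfold_locales
  qed
  have Tm: "(\<lambda>(x, y). (T x, T y)) \<in> ?P \<Otimes>\<^sub>M ?P \<rightarrow>\<^sub>M circ \<Otimes>\<^sub>M circ"
    unfolding case_prod_beta
    by (intro measurable_Pair measurable_compose[OF measurable_fst T_measurable_poisson] measurable_compose[OF measurable_snd T_measurable_poisson])
  have "(\<lambda>p. f (fst p) - f (snd p)) \<in> borel_measurable (circ \<Otimes>\<^sub>M circ)"
    using f by measurable
  from l2_norm_distr[OF Tm this]
  show ?thesis unfolding osc_def d by (simp add: case_prod_beta)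
qed

end

section \<open>Finite Dirichlet energy implies vanishing mean oscillation\<close>

lemma distr_rotation:
  assumes c: "norm c = 1"
  shows "distr circ circ (\<lambda>x. c * x) = circ"
proof (rule measure_eqI_zpow)
  have m: "(\<lambda>x. c * x) \<in> circ \<rightarrow>\<^sub>M circ"
  proof -
    have "(\<lambda>x. c * x) \<in> circ \<rightarrow>\<^sub>M restrict_space borel (sphere 0 1)"
    proof (rule measurable_restrict_space2)
      show "(\<lambda>x. c * x) \<in> borel_measurable circ" by (intro borel_measurable_circ_continuous continuous_intros)
    qed (use c in \<open>auto simp: norm_mult\<close>)
    then show ?thesis by (simp add: measurable_cong_sets[OF refl sets_circ])
  qed
  show "finite_measure (distr circ circ (\<lambda>x. c * x))" by (rule circ.finite_measure_distr[OF m])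
  show "finite_measure circ" by unfold_locales
  fix k
  have zc: "zpow (c * x) k = zpow c k * zpow x k" for x by (auto simp: zpow_def power_mult_distrib)
  have "(LINT x|distr circ circ (\<lambda>x. c * x). zpow x k) = (LINT x|circ. zpow (c * x) k)"
    by (rule integral_distr[OF m]) measurable
  also have "\<dots> = zpow c k * (LINT x|circ. zpow x k)" unfolding zc by (rule integral_mult_right_zero)
  also have "\<dots> = (LINT x|circ. zpow x k)" by (simp add: integral_zpow)
  finally show "(LINT x|distr circ circ (\<lambda>x. c * x). zpow x k) = (LINT x|circ. zpow x k)" .
qed simp_all

lemma rotation_measurable:
  assumes c: "norm c = 1"
  shows "(\<lambda>x. c * x) \<in> circ \<rightarrow>\<^sub>M circ"
proof -
  have "(\<lambda>x. c * x) \<in> circ \<rightarrow>\<^sub>M restrict_space borel (sphere 0 1)"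
  proof (rule measurable_restrict_space2)
    show "(\<lambda>x. c * x) \<in> borel_measurable circ" by (intro borel_measurable_circ_continuous continuous_intros)
  qed (use c in \<open>auto simp: norm_mult\<close>)
  then show ?thesis by (simp add: measurable_cong_sets[OF refl sets_circ])
qed

lemma nn_integral_rotation:
  assumes c: "norm c = 1" and g: "g \<in> borel_measurable circ"
  shows "(\<integral>\<^sup>+x. g (c * x) \<partial>circ) = (\<integral>\<^sup>+x. g x \<partial>circ)"
  using nn_integral_distr[OF rotation_measurable[OF c], of g] g distr_rotation[OF c] by simp

lemma square_integrable_rotation:
  assumes c: "norm c = 1" and f: "square_integrable circ f"
  shows "square_integrable circ (\<lambda>x. f (c * x))"
  using square_integrable_distr[OF rotation_measurable[OF c] square_integrable_measurable[OF f]] f distr_rotation[OF c] by simp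

lemma fourier_rotation:
  assumes c: "norm c = 1" and f: "square_integrable circ f"
  shows "fourier (\<lambda>x. f (c * x)) k = zpow c k * fourier f k"
proof -
  have fm [measurable]: "f \<in> borel_measurable circ" by (rule square_integrable_measurable[OF f])
  have z: "zpow (c * x) (- k) = cnj (zpow c k) * zpow x (- k)" for x by (auto simp: zpow_def power_mult_distrib)
  have cc: "zpow c k * cnj (zpow c k) = 1"
    using complex_norm_square[of "zpow c k"] c by simp
  have "fourier f k = (LINT x|distr circ circ (\<lambda>x. c * x). f x * zpow x (- k))"
    unfolding fourier_def distr_rotation[OF c] ..
  also have "\<dots> = (LINT x|circ. f (c * x) * zpow (c * x) (- k))"
    by (rule integral_distr[OF rotation_measurable[OF c]]) measurable
  also have "\<dots> = (LINT x|circ. cnj (zpow c k) * (f (c * x) * zpow x (- k)))"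
    unfolding z by (simp add: mult_ac)
  also have "\<dots> = cnj (zpow c k) * fourier (\<lambda>x. f (c * x)) k"
    unfolding fourier_def by (rule integral_mult_right_zero)
  finally have "zpow c k * fourier f k = (zpow c k * cnj (zpow c k)) * fourier (\<lambda>x. f (c * x)) k"
    by (simp add: mult.assoc)
  then show ?thesis unfolding cc by simp
qed

text \<open>By the triangle inequality through \<open>z\<close>, the squared distance cancels the denominator of one of the two
  kernels; the two numerators \<open>1 - (norm z)^2\<close> compensate the other denominator.\<close>

lemma poisson_product_le:
  assumes x: "norm x = 1" and y: "norm y = 1" and z: "norm z < 1"
  shows "poisson z x * poisson z y * (norm (x - y))\<^sup>2 \<le> 16"
proof -
  let ?a = "norm (x - z)" and ?b = "norm (y - z)" and ?s = "1 - (norm z)\<^sup>2"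
  have lo: "1 - norm z \<le> ?a" "1 - norm z \<le> ?b" using x y norm_triangle_ineq2[of x z] norm_triangle_ineq2[of y z] by simp_all
  then have ab: "0 < ?a" "0 < ?b" using z by linarith+
  have s: "?s = (1 - norm z) * (1 + norm z)" by (simp add: power2_eq_square algebra_simps)
  have s2: "?s \<le> 2 * t" if "1 - norm z \<le> t" for t
  proof -
    have "?s \<le> (1 - norm z) * 2" unfolding s using z by (intro mult_left_mono) auto
    moreover have "a \<le> 2 * t" if "a \<le> m * 2" "m \<le> t" for a m :: real using that by simp
    ultimately show ?thesis using that by blast
  qed
  have s0: "0 \<le> ?s" using z by (simp add: power_le_one)
  have q: "?s / t \<le> 2" if "1 - norm z \<le> t" "0 < t" for t
    using s2[OF that(1)] that(2) by (simp add: divide_le_eq)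
  have "(norm (x - y))\<^sup>2 \<le> (?a + ?b)\<^sup>2"
    using norm_triangle_ineq4[of "x - z" "y - z"] by (intro power_mono) auto
  also have "\<dots> \<le> 2 * ?a\<^sup>2 + 2 * ?b\<^sup>2"
    using sum_squares_bound[of ?a ?b] by (simp add: power2_sum)
  finally have "poisson z x * poisson z y * (norm (x - y))\<^sup>2 \<le> poisson z x * poisson z y * (2 * ?a\<^sup>2 + 2 * ?b\<^sup>2)"
    using poisson_nonneg[OF z] by (intro mult_left_mono) auto
  also have "\<dots> = 2 * (?s / ?b)\<^sup>2 + 2 * (?s / ?a)\<^sup>2"
    unfolding poisson_def using ab by (simp add: field_simps power2_eq_square)
  also have "\<dots> \<le> 2 * 2\<^sup>2 + 2 * 2\<^sup>2"
    using q[OF lo(1) ab(1)] q[OF lo(2) ab(2)] s0 ab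
    by (intro add_mono mult_left_mono power_mono divide_nonneg_pos) auto
  finally show ?thesis by simp
qed

text \<open>
  Douglas' formula, as an inequality. With \<open>y = w * x\<close>, Parseval's identity in \<open>x\<close> multiplies the \<open>k\<close>-th
  squared coefficient by the square of \<open>(1 - w ^ k) / (1 - w)\<close>, a geometric sum whose mean square over \<open>w\<close>
  is \<open>k\<close>. Fatou's lemma exchanges the limit in Parseval's identity with the integral over \<open>w\<close>.
\<close>

lemma Douglas_le:
  assumes f: "square_integrable circ f" and B: "dirichlet_le f B"
  shows "(\<integral>\<^sup>+x. \<integral>\<^sup>+y. ennreal ((norm (f x - f y))\<^sup>2 / (norm (x - y))\<^sup>2) \<partial>circ \<partial>circ) \<le> ennreal B"
proof -
  have fm [measurable]: "f \<in> borel_measurable circ" by (rule square_integrable_measurable[OF f])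
  have idm: "(\<lambda>x. x) \<in> circ \<rightarrow>\<^sub>M borel" by (rule sphere_measurable(3)) simp
  have m1: "(\<lambda>p. fst p) \<in> borel_measurable (circ \<Otimes>\<^sub>M circ)" by (rule measurable_compose[OF measurable_fst idm])
  have m2: "(\<lambda>p. snd p) \<in> borel_measurable (circ \<Otimes>\<^sub>M circ)" by (rule measurable_compose[OF measurable_snd idm])
  have mm: "(\<lambda>p. fst p * snd p) \<in> circ \<Otimes>\<^sub>M circ \<rightarrow>\<^sub>M circ"
  proof -
    have "(\<lambda>p. fst p * snd p) \<in> circ \<Otimes>\<^sub>M circ \<rightarrow>\<^sub>M restrict_space borel (sphere 0 1)"
    proof (rule measurable_restrict_space2)
      show "(\<lambda>p. fst p * snd p) \<in> borel_measurable (circ \<Otimes>\<^sub>M circ)" using m1 m2 by measurable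
    qed (auto simp: space_pair_measure norm_mult)
    then show ?thesis by (simp add: measurable_cong_sets[OF refl sets_circ])
  qed
  have fm1: "(\<lambda>p. f (fst p)) \<in> borel_measurable (circ \<Otimes>\<^sub>M circ)" by (rule measurable_compose[OF measurable_fst fm])
  have fm2: "(\<lambda>p. f (fst p * snd p)) \<in> borel_measurable (circ \<Otimes>\<^sub>M circ)" by (rule measurable_compose[OF mm fm])
  interpret C2: pair_sigma_finite circ circ ..
  let ?q = "\<lambda>x w. (norm (f x - f (w * x)))\<^sup>2 / (norm (1 - w))\<^sup>2"
  have "(\<integral>\<^sup>+x. \<integral>\<^sup>+y. ennreal ((norm (f x - f y))\<^sup>2 / (norm (x - y))\<^sup>2) \<partial>circ \<partial>circ) =
     (\<integral>\<^sup>+x. \<integral>\<^sup>+w. ennreal (?q x w) \<partial>circ \<partial>circ)"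
  proof (rule nn_integral_cong)
    fix x assume "x \<in> space circ"
    then have x: "norm x = 1" by simp
    have "(\<lambda>y. ennreal ((norm (f x - f y))\<^sup>2 / (norm (x - y))\<^sup>2)) \<in> borel_measurable circ"
      using idm by measurable
    from nn_integral_rotation[OF x this]
    have "(\<integral>\<^sup>+y. ennreal ((norm (f x - f y))\<^sup>2 / (norm (x - y))\<^sup>2) \<partial>circ) =
      (\<integral>\<^sup>+w. ennreal ((norm (f x - f (x * w)))\<^sup>2 / (norm (x - x * w))\<^sup>2) \<partial>circ)" by simp
    also have "\<dots> = (\<integral>\<^sup>+w. ennreal (?q x w) \<partial>circ)"
    proof (rule nn_integral_cong)
      fix w
      have "x - x * w = x * (1 - w)" by (simp add: algebra_simps)
      then have "norm (x - x * w) = norm (1 - w)" using x by (simp add: norm_mult)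
      then show "ennreal ((norm (f x - f (x * w)))\<^sup>2 / (norm (x - x * w))\<^sup>2) = ennreal (?q x w)"
        by (simp add: mult.commute)
    qed
    finally show "(\<integral>\<^sup>+y. ennreal ((norm (f x - f y))\<^sup>2 / (norm (x - y))\<^sup>2) \<partial>circ) = (\<integral>\<^sup>+w. ennreal (?q x w) \<partial>circ)" .
  qed
  also have "\<dots> = (\<integral>\<^sup>+w. \<integral>\<^sup>+x. ennreal (?q x w) \<partial>circ \<partial>circ)"
  proof (rule C2.Fubini'[symmetric])
    have "(\<lambda>p. ennreal ((norm (f (fst p) - f (fst p * snd p)))\<^sup>2 / (norm (1 - snd p))\<^sup>2)) \<in> borel_measurable (circ \<Otimes>\<^sub>M circ)"
      using fm1 fm2 m2 by measurable
    then show "(\<lambda>(x, w). ennreal (?q x w)) \<in> borel_measurable (circ \<Otimes>\<^sub>M circ)"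
      by (simp add: case_prod_beta mult.commute)
  qed
  also have "\<dots> \<le> (\<integral>\<^sup>+w. liminf (\<lambda>N. \<Sum>k\<in>{- int N..int N}. ennreal ((norm (fourier f k))\<^sup>2) * ennreal ((norm (\<Sum>j\<in>int ` {..<nat \<bar>k\<bar>}. 1 * zpow w j))\<^sup>2)) \<partial>circ)"
  proof (rule nn_integral_mono)
    fix w assume "w \<in> space circ"
    then have w: "norm w = 1" by simp
    let ?d = "\<lambda>x. f x - f (w * x)"
    have ds: "square_integrable circ ?d" by (intro square_integrable_diff f square_integrable_rotation w)
    have fd: "fourier ?d k = (1 - zpow w k) * fourier f k" for k
      unfolding fourier_diff[OF f square_integrable_rotation[OF w f]] fourier_rotation[OF w f] by (simp add: algebra_simps)
    have geo: "norm (1 - zpow w k) = norm (1 - w) * norm (\<Sum>j\<in>int ` {..<nat \<bar>k\<bar>}. 1 * zpow w j)" for k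
    proof -
      have sg: "(\<Sum>j\<in>int ` {..<m}. 1 * zpow w j) = (\<Sum>j<m. w ^ j)" for m
        by (subst sum.reindex) (auto simp: zpow_def)
      have "norm (1 - zpow w k) = norm (1 - w ^ nat \<bar>k\<bar>)"
      proof (cases "0 \<le> k")
        case False
        have "norm (1 - zpow w k) = norm (cnj (1 - w ^ nat (- k)))"
          using False by (simp only: complex_cnj_diff complex_cnj_one complex_cnj_power zpow_def if_False)
        then show ?thesis using False by (simp only: complex_mod_cnj) (simp add: abs_if)
      qed (simp add: zpow_def)
      also have "1 - w ^ nat \<bar>k\<bar> = (1 - w) * (\<Sum>j<nat \<bar>k\<bar>. w ^ j)"
        by (rule one_diff_power_eq)
      finally show ?thesis unfolding sg by (simp add: norm_mult)
    qed
    have "(\<integral>\<^sup>+x. ennreal (?q x w) \<partial>circ) = (\<integral>\<^sup>+x. ennreal ((norm (?d x))\<^sup>2) * ennreal (1 / (norm (1 - w))\<^sup>2) \<partial>circ)"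
      by (intro nn_integral_cong) (simp add: ennreal_mult'[symmetric])
    also have "\<dots> = (\<integral>\<^sup>+x. ennreal ((norm (?d x))\<^sup>2) \<partial>circ) * ennreal (1 / (norm (1 - w))\<^sup>2)"
      by (rule nn_integral_multc, rule measurable_compose[OF square_integrable_measurable[OF ds]]) measurable
    also have "(\<integral>\<^sup>+x. ennreal ((norm (?d x))\<^sup>2) \<partial>circ) = ennreal ((l2_norm circ ?d)\<^sup>2)"
      unfolding l2_norm_sq by (rule nn_integral_eq_integral[OF square_integrable_sq[OF ds]]) simp
    also have "ennreal ((l2_norm circ ?d)\<^sup>2) * ennreal (1 / (norm (1 - w))\<^sup>2) = ennreal ((l2_norm circ ?d)\<^sup>2 / (norm (1 - w))\<^sup>2)"
      by (simp add: ennreal_mult'[symmetric])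
    also have "\<dots> = liminf (\<lambda>N. ennreal ((\<Sum>k\<in>{- int N..int N}. (norm (fourier ?d k))\<^sup>2) / (norm (1 - w))\<^sup>2))"
    proof (rule lim_imp_Liminf[symmetric])
      have "(\<lambda>N. (\<Sum>k\<in>{- int N..int N}. (norm (fourier ?d k))\<^sup>2) * (1 / (norm (1 - w))\<^sup>2)) \<longlonglongrightarrow> (l2_norm circ ?d)\<^sup>2 * (1 / (norm (1 - w))\<^sup>2)"
        by (intro tendsto_mult tendsto_const Parseval ds)
      then show "(\<lambda>N. ennreal ((\<Sum>k\<in>{- int N..int N}. (norm (fourier ?d k))\<^sup>2) / (norm (1 - w))\<^sup>2)) \<longlonglongrightarrow> ennreal ((l2_norm circ ?d)\<^sup>2 / (norm (1 - w))\<^sup>2)"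
        by (intro tendsto_ennrealI) simp
    qed simp
    also have "\<dots> \<le> liminf (\<lambda>N. \<Sum>k\<in>{- int N..int N}. ennreal ((norm (fourier f k))\<^sup>2) * ennreal ((norm (\<Sum>j\<in>int ` {..<nat \<bar>k\<bar>}. 1 * zpow w j))\<^sup>2))"
    proof (intro Liminf_mono always_eventually allI)
      fix N
      have "(\<Sum>k\<in>{- int N..int N}. (norm (fourier ?d k))\<^sup>2) / (norm (1 - w))\<^sup>2 \<le>
         (\<Sum>k\<in>{- int N..int N}. (norm (fourier f k))\<^sup>2 * (norm (\<Sum>j\<in>int ` {..<nat \<bar>k\<bar>}. 1 * zpow w j))\<^sup>2)"
        unfolding sum_divide_distrib fd norm_mult geo power_mult_distrib
        by (intro sum_mono) (cases "norm (1 - w) = 0"; simp add: field_simps)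
      then have "ennreal ((\<Sum>k\<in>{- int N..int N}. (norm (fourier ?d k))\<^sup>2) / (norm (1 - w))\<^sup>2) \<le>
         ennreal (\<Sum>k\<in>{- int N..int N}. (norm (fourier f k))\<^sup>2 * (norm (\<Sum>j\<in>int ` {..<nat \<bar>k\<bar>}. 1 * zpow w j))\<^sup>2)"
        by (rule ennreal_leI)
      also have "\<dots> = (\<Sum>k\<in>{- int N..int N}. ennreal ((norm (fourier f k))\<^sup>2) * ennreal ((norm (\<Sum>j\<in>int ` {..<nat \<bar>k\<bar>}. 1 * zpow w j))\<^sup>2))"
        by (subst sum_ennreal[symmetric]) (auto intro!: sum.cong ennreal_mult simp del: sum_ennreal)
      finally show "ennreal ((\<Sum>k\<in>{- int N..int N}. (norm (fourier ?d k))\<^sup>2) / (norm (1 - w))\<^sup>2) \<le>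
         (\<Sum>k\<in>{- int N..int N}. ennreal ((norm (fourier f k))\<^sup>2) * ennreal ((norm (\<Sum>j\<in>int ` {..<nat \<bar>k\<bar>}. 1 * zpow w j))\<^sup>2))" .
    qed
    finally show "(\<integral>\<^sup>+x. ennreal (?q x w) \<partial>circ) \<le>
        liminf (\<lambda>N. \<Sum>k\<in>{- int N..int N}. ennreal ((norm (fourier f k))\<^sup>2) * ennreal ((norm (\<Sum>j\<in>int ` {..<nat \<bar>k\<bar>}. 1 * zpow w j))\<^sup>2))" .
  qed
  also have "\<dots> \<le> liminf (\<lambda>N. \<integral>\<^sup>+w. (\<Sum>k\<in>{- int N..int N}. ennreal ((norm (fourier f k))\<^sup>2) * ennreal ((norm (\<Sum>j\<in>int ` {..<nat \<bar>k\<bar>}. 1 * zpow w j))\<^sup>2)) \<partial>circ)"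
    by (rule nn_integral_liminf) (intro borel_measurable_circ, measurable)
  also have "\<dots> \<le> liminf (\<lambda>N. ennreal B)"
  proof (intro Liminf_mono always_eventually allI)
    fix N
    have zm: "(\<lambda>w. ennreal ((norm (\<Sum>j\<in>int ` {..<nat \<bar>k\<bar>}. 1 * zpow w j))\<^sup>2)) \<in> borel_measurable circ" for k
      by (intro borel_measurable_circ) measurable
    have "(\<integral>\<^sup>+w. (\<Sum>k\<in>{- int N..int N}. ennreal ((norm (fourier f k))\<^sup>2) * ennreal ((norm (\<Sum>j\<in>int ` {..<nat \<bar>k\<bar>}. 1 * zpow w j))\<^sup>2)) \<partial>circ) =
       (\<Sum>k\<in>{- int N..int N}. ennreal ((norm (fourier f k))\<^sup>2) * (\<integral>\<^sup>+w. ennreal ((norm (\<Sum>j\<in>int ` {..<nat \<bar>k\<bar>}. 1 * zpow w j))\<^sup>2) \<partial>circ))"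
      using zm by (subst nn_integral_sum) (auto intro!: sum.cong nn_integral_cmult)
    also have "\<dots> = (\<Sum>k\<in>{- int N..int N}. ennreal ((norm (fourier f k))\<^sup>2) * ennreal (real (nat \<bar>k\<bar>)))"
    proof (intro sum.cong refl arg_cong2[where f = "(*)"])
      fix k :: int
      let ?J = "int ` {..<nat \<bar>k\<bar>}"
      have s: "square_integrable circ (\<lambda>w. \<Sum>j\<in>?J. 1 * zpow w j)" by (rule square_integrable_zpow_sum)
      have "(\<integral>\<^sup>+w. ennreal ((norm (\<Sum>j\<in>?J. 1 * zpow w j))\<^sup>2) \<partial>circ) = ennreal ((l2_norm circ (\<lambda>w. \<Sum>j\<in>?J. 1 * zpow w j))\<^sup>2)"
        unfolding l2_norm_sq by (rule nn_integral_eq_integral[OF square_integrable_sq[OF s]]) simp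
      also have "(l2_norm circ (\<lambda>w. \<Sum>j\<in>?J. 1 * zpow w j))\<^sup>2 = (\<Sum>j\<in>?J. (norm (1::complex))\<^sup>2)"
        by (rule l2_norm_zpow_sum_sq) simp
      also have "\<dots> = real (nat \<bar>k\<bar>)" by (simp add: card_image)
      finally show "(\<integral>\<^sup>+w. ennreal ((norm (\<Sum>j\<in>?J. 1 * zpow w j))\<^sup>2) \<partial>circ) = ennreal (real (nat \<bar>k\<bar>))" .
    qed
    also have "\<dots> = ennreal (\<Sum>k\<in>{- int N..int N}. real (nat \<bar>k\<bar>) * (norm (fourier f k))\<^sup>2)"
      by (subst sum_ennreal[symmetric]) (auto intro!: sum.cong simp: ennreal_mult'[symmetric] mult.commute simp del: sum_ennreal)
    also have "\<dots> \<le> ennreal B" using B unfolding dirichlet_le_def by (intro ennreal_leI) blast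
    finally show "(\<integral>\<^sup>+w. (\<Sum>k\<in>{- int N..int N}. ennreal ((norm (fourier f k))\<^sup>2) * ennreal ((norm (\<Sum>j\<in>int ` {..<nat \<bar>k\<bar>}. 1 * zpow w j))\<^sup>2)) \<partial>circ) \<le> ennreal B" .
  qed
  also have "\<dots> = ennreal B" by (simp add: Liminf_const)
  finally show ?thesis .
qed

text \<open>The product of the two kernels is absorbed by the difference quotient in Douglas' formula, with a constant
  that does not depend on \<open>z\<close>.\<close>

lemma osc_le_dirichlet:
  assumes f: "square_integrable circ f" and B: "dirichlet_le f B" and z: "norm z < 1"
  shows "osc z f \<le> 4 * sqrt B"
proof -
  have fm [measurable]: "f \<in> borel_measurable circ" by (rule square_integrable_measurable[OF f])
  have idm: "(\<lambda>x. x) \<in> circ \<rightarrow>\<^sub>M borel" by (rule sphere_measurable(3)) simp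
  have m1 [measurable]: "(\<lambda>p. fst p) \<in> borel_measurable (circ \<Otimes>\<^sub>M circ)" by (rule measurable_compose[OF measurable_fst idm])
  have m2 [measurable]: "(\<lambda>p. snd p) \<in> borel_measurable (circ \<Otimes>\<^sub>M circ)" by (rule measurable_compose[OF measurable_snd idm])
  have B0: "0 \<le> B" by (rule dirichlet_le_nonneg[OF B])
  let ?q = "\<lambda>x y. (norm (f x - f y))\<^sup>2 / (norm (x - y))\<^sup>2"
  have "ennreal ((osc z f)\<^sup>2) = (\<integral>\<^sup>+x. \<integral>\<^sup>+y. ennreal (poisson z x * poisson z y * (norm (f x - f y))\<^sup>2) \<partial>circ \<partial>circ)"
    by (rule osc_sq_nn_integral[OF z f])
  also have "\<dots> \<le> (\<integral>\<^sup>+x. \<integral>\<^sup>+y. 16 * ennreal (?q x y) \<partial>circ \<partial>circ)"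
  proof (intro nn_integral_mono)
    fix x y assume xy: "x \<in> space circ" "y \<in> space circ"
    have "poisson z x * poisson z y * (norm (f x - f y))\<^sup>2 \<le> 16 * ?q x y"
    proof (cases "x = y")
      case False
      have "poisson z x * poisson z y * (norm (f x - f y))\<^sup>2 = poisson z x * poisson z y * (norm (x - y))\<^sup>2 * ?q x y"
        using False by simp
      also have "\<dots> \<le> 16 * ?q x y"
        using xy by (intro mult_right_mono poisson_product_le z) auto
      finally show ?thesis .
    qed simp
    then have "ennreal (poisson z x * poisson z y * (norm (f x - f y))\<^sup>2) \<le> ennreal (16 * ?q x y)" by (rule ennreal_leI)
    also have "\<dots> = 16 * ennreal (?q x y)" by (subst ennreal_mult) auto
    finally show "ennreal (poisson z x * poisson z y * (norm (f x - f y))\<^sup>2) \<le> 16 * ennreal (?q x y)" .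
  qed
  also have "\<dots> = 16 * (\<integral>\<^sup>+x. \<integral>\<^sup>+y. ennreal (?q x y) \<partial>circ \<partial>circ)"
  proof -
    have qm: "(\<lambda>(x, y). ennreal (?q x y)) \<in> borel_measurable (circ \<Otimes>\<^sub>M circ)"
      unfolding case_prod_beta by measurable
    have "(\<lambda>y. ennreal (?q x y)) \<in> borel_measurable circ" if "x \<in> space circ" for x
      using measurable_Pair2[OF qm that] by simp
    then have "(\<integral>\<^sup>+x. \<integral>\<^sup>+y. 16 * ennreal (?q x y) \<partial>circ \<partial>circ) = (\<integral>\<^sup>+x. 16 * (\<integral>\<^sup>+y. ennreal (?q x y) \<partial>circ) \<partial>circ)"
      by (intro nn_integral_cong nn_integral_cmult)
    also have "\<dots> = 16 * (\<integral>\<^sup>+x. \<integral>\<^sup>+y. ennreal (?q x y) \<partial>circ \<partial>circ)"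
      using circ.borel_measurable_nn_integral_fst[OF qm] by (intro nn_integral_cmult) simp
    finally show ?thesis .
  qed
  also have "\<dots> \<le> 16 * ennreal B" by (intro mult_left_mono Douglas_le f B) simp
  also have "\<dots> = ennreal ((4 * sqrt B)\<^sup>2)" using B0 by (simp add: power_mult_distrib ennreal_mult')
  finally have "(osc z f)\<^sup>2 \<le> (4 * sqrt B)\<^sup>2" by (simp only: ennreal_le_iff zero_le_power2)
  then show ?thesis by (rule power2_le_imp_le) (use B0 in simp)
qed

definition vanishing_osc :: "(complex \<Rightarrow> complex) \<Rightarrow> bool" where
  "vanishing_osc f \<longleftrightarrow> (\<forall>e>0. \<exists>r<1. \<forall>z. r < norm z \<and> norm z < 1 \<longrightarrow> osc z f < e)"

lemma vanishing_oscD: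
  assumes "vanishing_osc f" "0 < e"
  obtains r where "r < 1" "\<And>z. r < norm z \<Longrightarrow> norm z < 1 \<Longrightarrow> osc z f < e"
  using assms unfolding vanishing_osc_def by blast

lemma vanishing_osc_zpow: "vanishing_osc (\<lambda>x. zpow x k)"
  unfolding vanishing_osc_def
proof (intro allI impI)
  fix e :: real assume e: "0 < e"
  have "((\<lambda>r. 2 - 2 * (r ^ nat \<bar>k\<bar>)\<^sup>2) \<longlongrightarrow> 2 - 2 * (1 ^ nat \<bar>k\<bar>)\<^sup>2) (at_left (1::real))"
    by (intro tendsto_intros)
  then have "\<forall>\<^sub>F r in at_left 1. 2 - 2 * (r ^ nat \<bar>k\<bar>)\<^sup>2 < e\<^sup>2"
    by (rule order_tendstoD(2)) (use e in simp)
  then obtain r where r: "r < 1" "\<And>s. r < s \<Longrightarrow> s < 1 \<Longrightarrow> 2 - 2 * (s ^ nat \<bar>k\<bar>)\<^sup>2 < e\<^sup>2"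
    unfolding eventually_at_left_field by blast
  have "osc z (\<lambda>x. zpow x k) < e" if "r < norm z" "norm z < 1" for z
  proof (rule power_less_imp_less_base)
    show "(osc z (\<lambda>x. zpow x k))\<^sup>2 < e\<^sup>2" unfolding osc_zpow[OF that(2)] by (rule r(2)[OF that])
  qed (use e in simp)
  then show "\<exists>r<1. \<forall>z. r < norm z \<and> norm z < 1 \<longrightarrow> osc z (\<lambda>x. zpow x k) < e" using r(1) by blast
qed

lemma vanishing_osc_zero: "vanishing_osc (\<lambda>x. 0)"
  unfolding vanishing_osc_def by (auto simp: osc_def l2_norm_def intro!: exI[of _ 0])

lemma vanishing_osc_cmult:
  assumes f: "vanishing_osc f"
  shows "vanishing_osc (\<lambda>x. c * f x)"
  unfolding vanishing_osc_def
proof (intro allI impI)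
  fix e :: real assume e: "0 < e"
  have e': "0 < e / (norm c + 1)" using e by (intro divide_pos_pos add_nonneg_pos) auto
  obtain r where r: "r < 1" "\<And>z. r < norm z \<Longrightarrow> norm z < 1 \<Longrightarrow> osc z f < e / (norm c + 1)"
    using vanishing_oscD[OF f e'] by blast
  have "osc z (\<lambda>x. c * f x) < e" if "r < norm z" "norm z < 1" for z
  proof -
    have n: "0 < norm c + 1" by (intro add_nonneg_pos) auto
    have "osc z (\<lambda>x. c * f x) = norm c * osc z f" by (rule osc_cmult[OF that(2)])
    also have "\<dots> \<le> (norm c + 1) * osc z f"
      using osc_nonneg[OF that(2)] by (intro mult_right_mono) auto
    also have "\<dots> < e" using r(2)[OF that] n by (simp add: pos_less_divide_eq mult.commute)
    finally show ?thesis .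
  qed
  then show "\<exists>r<1. \<forall>z. r < norm z \<and> norm z < 1 \<longrightarrow> osc z (\<lambda>x. c * f x) < e" using r(1) by blast
qed

lemma vanishing_osc_add:
  assumes f: "vanishing_osc f" "square_integrable circ f" and g: "vanishing_osc g" "square_integrable circ g"
  shows "vanishing_osc (\<lambda>x. f x + g x)"
  unfolding vanishing_osc_def
proof (intro allI impI)
  fix e :: real assume e: "0 < e"
  then have e2: "0 < e / 2" by simp
  obtain r where r: "r < 1" "\<And>z. r < norm z \<Longrightarrow> norm z < 1 \<Longrightarrow> osc z f < e / 2"
    using vanishing_oscD[OF f(1) e2] by blast
  obtain s where s: "s < 1" "\<And>z. s < norm z \<Longrightarrow> norm z < 1 \<Longrightarrow> osc z g < e / 2"
    using vanishing_oscD[OF g(1) e2] by blast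
  have "osc z (\<lambda>x. f x + g x) < e" if "max r s < norm z" "norm z < 1" for z
    using osc_add[OF that(2) f(2) g(2)] r(2)[of z] s(2)[of z] that by simp
  then show "\<exists>r<1. \<forall>z. r < norm z \<and> norm z < 1 \<longrightarrow> osc z (\<lambda>x. f x + g x) < e"
    using r(1) s(1) by (intro exI[of _ "max r s"]) auto
qed

lemma vanishing_osc_zpow_sum: "vanishing_osc (\<lambda>x. \<Sum>k\<in>J. c k * zpow x k)"
proof (induction J rule: infinite_finite_induct)
  case (insert k J)
  then show ?case
    by (simp add: vanishing_osc_add vanishing_osc_cmult vanishing_osc_zpow square_integrable_zpow_sum
        square_integrable_cmult square_integrable_zpow)
qed (auto simp: vanishing_osc_zero)

lemma vanishing_osc_approx:
  assumes f: "square_integrable circ f"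
    and a: "\<And>e. 0 < e \<Longrightarrow> \<exists>g. square_integrable circ g \<and> vanishing_osc g \<and> (\<forall>z. norm z < 1 \<longrightarrow> osc z (\<lambda>x. f x - g x) \<le> e)"
  shows "vanishing_osc f"
  unfolding vanishing_osc_def
proof (intro allI impI)
  fix e :: real assume e: "0 < e"
  then have e2: "0 < e / 2" by simp
  obtain g where g: "square_integrable circ g" "vanishing_osc g" "\<And>z. norm z < 1 \<Longrightarrow> osc z (\<lambda>x. f x - g x) \<le> e / 2"
    using a[OF e2] by blast
  obtain r where r: "r < 1" "\<And>z. r < norm z \<Longrightarrow> norm z < 1 \<Longrightarrow> osc z g < e / 2"
    using vanishing_oscD[OF g(2) e2] by blast
  have "osc z f < e" if "r < norm z" "norm z < 1" for z
    using osc_add[OF that(2) square_integrable_diff[OF f g(1)] g(1)] g(3)[OF that(2)] r(2)[OF that] by simp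
  then show "\<exists>r<1. \<forall>z. r < norm z \<and> norm z < 1 \<longrightarrow> osc z f < e" using r(1) by blast
qed

text \<open>Tails of the Fourier series have small energy, hence small oscillation at all points simultaneously.\<close>

lemma vanishing_osc_dirichlet:
  assumes f: "square_integrable circ f" and B: "dirichlet_le f B"
  shows "vanishing_osc f"
proof (rule vanishing_osc_approx[OF f])
  fix e :: real assume e: "0 < e"
  define a where "a N = (\<Sum>k\<in>{- int N..int N}. real (nat \<bar>k\<bar>) * (norm (fourier f k))\<^sup>2)" for N
  have mono: "a M \<le> a N" if "M \<le> N" for M N
    unfolding a_def using that by (intro sum_mono2) auto
  have "incseq a" using mono by (auto simp: incseq_def)
  moreover have "a N \<le> B" for N using B by (simp add: a_def dirichlet_le_def)
  ultimately obtain L where L: "a \<longlonglongrightarrow> L" "\<And>N. a N \<le> L" using incseq_convergent[of a B] by auto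
  have "0 < (e / 4)\<^sup>2" using e by simp
  then have "\<forall>\<^sub>F N in sequentially. L - (e / 4)\<^sup>2 < a N"
    by (intro order_tendstoD(1)[OF L(1)]) simp
  then obtain N where N: "L - (e / 4)\<^sup>2 < a N" by (auto simp: eventually_sequentially)
  let ?g = "fourier_sum f N"
  let ?J = "{- int N..int N}"
  have gs: "square_integrable circ ?g" by (rule square_integrable_fourier_sum)
  have fk: "fourier (\<lambda>x. f x - ?g x) k = (if k \<in> ?J then 0 else fourier f k)" for k
    unfolding fourier_diff[OF f gs] using fourier_zpow_sum[of ?J "fourier f" k] by (simp add: fourier_sum_def[abs_def])
  have "dirichlet_le (\<lambda>x. f x - ?g x) ((e / 4)\<^sup>2)"
    unfolding dirichlet_le_def
  proof
    fix M
    let ?K = "{- int M..int M}"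
    have "(\<Sum>k\<in>?K. real (nat \<bar>k\<bar>) * (norm (fourier (\<lambda>x. f x - ?g x) k))\<^sup>2) \<le> (\<Sum>k\<in>{- int (max M N)..int (max M N)} - ?J. real (nat \<bar>k\<bar>) * (norm (fourier f k))\<^sup>2)"
    proof -
      have "(\<Sum>k\<in>?K. real (nat \<bar>k\<bar>) * (norm (fourier (\<lambda>x. f x - ?g x) k))\<^sup>2) = (\<Sum>k\<in>?K - ?J. real (nat \<bar>k\<bar>) * (norm (fourier f k))\<^sup>2)"
        unfolding fk by (rule sum.mono_neutral_cong_right) auto
      also have "\<dots> \<le> (\<Sum>k\<in>{- int (max M N)..int (max M N)} - ?J. real (nat \<bar>k\<bar>) * (norm (fourier f k))\<^sup>2)"
        by (rule sum_mono2) auto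
      finally show ?thesis .
    qed
    also have "\<dots> = a (max M N) - a N"
      unfolding a_def by (subst sum_diff) auto
    also have "\<dots> \<le> (e / 4)\<^sup>2" using L(2)[of "max M N"] N by linarith
    finally show "(\<Sum>k\<in>?K. real (nat \<bar>k\<bar>) * (norm (fourier (\<lambda>x. f x - ?g x) k))\<^sup>2) \<le> (e / 4)\<^sup>2" .
  qed
  from osc_le_dirichlet[OF square_integrable_diff[OF f gs] this]
  have "\<forall>z. norm z < 1 \<longrightarrow> osc z (\<lambda>x. f x - ?g x) \<le> e" using e by (simp add: real_sqrt_abs)
  moreover have "vanishing_osc ?g" unfolding fourier_sum_def[abs_def] by (rule vanishing_osc_zpow_sum)
  ultimately show "\<exists>g. square_integrable circ g \<and> vanishing_osc g \<and> (\<forall>z. norm z < 1 \<longrightarrow> osc z (\<lambda>x. f x - g x) \<le> e)"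
    using gs by blast
qed

section \<open>Inner functions that are not finite Blaschke products\<close>

text \<open>The boundary hypothesis is stated through limits from inside, because it is applied to quotients of a
  self-map of the disk by Blaschke products, which need not extend continuously.\<close>

lemma maximum_modulus_boundary:
  assumes f: "f holomorphic_on ball 0 1"
    and b: "\<And>e. 0 < e \<Longrightarrow> \<exists>r<1. \<forall>z. r < norm z \<and> norm z < 1 \<longrightarrow> norm (f z) \<le> 1 + e"
    and z: "norm z < 1"
  shows "norm (f z :: complex) \<le> 1"
proof (rule field_le_epsilon)
  fix e :: real assume "0 < e"
  from b[OF this] obtain r where r: "r < 1" "\<And>z. r < norm z \<and> norm z < 1 \<Longrightarrow> norm (f z) \<le> 1 + e" by blast
  obtain s where s: "max r (norm z) < s" "s < 1" using dense[of "max r (norm z)" 1] r z by auto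
  have s0: "0 < s" using s by (auto intro: le_less_trans[OF norm_ge_zero])
  show "norm (f z) \<le> 1 + e"
  proof (rule maximum_modulus_frontier[of f "cball 0 s"])
    show "f holomorphic_on interior (cball 0 s)" by (rule holomorphic_on_subset[OF f]) (use s in auto)
    show "continuous_on (closure (cball 0 s)) f"
      by (rule continuous_on_subset[OF holomorphic_on_imp_continuous_on[OF f]]) (use s in auto)
    show "z \<in> cball 0 s" using s by auto
    fix w :: complex assume "w \<in> frontier (cball 0 s)"
    then have "norm w = s" using s0 by auto
    then show "norm (f w) \<le> 1 + e" using r(2)[of w] s by auto
  qed simp
qed

lemma continuous_near_circle:
  fixes f :: "complex \<Rightarrow> real"
  assumes f: "continuous_on (cball 0 1) f" and one: "\<And>z. norm z = 1 \<Longrightarrow> f z = 1" and e: "0 < e"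
  shows "\<exists>r<1. \<forall>z. r < norm z \<and> norm z < 1 \<longrightarrow> 1 - e < f z"
proof -
  have "uniformly_continuous_on (cball 0 1) f" by (rule compact_uniformly_continuous[OF f]) simp
  then obtain d where d: "d > 0" "\<And>x y. \<lbrakk>x \<in> cball 0 1; y \<in> cball 0 1; dist y x < d\<rbrakk> \<Longrightarrow> dist (f y) (f x) < e"
    using e unfolding uniformly_continuous_on_def by blast
  show ?thesis
  proof (intro exI[of _ "max 0 (1 - d)"] conjI allI impI)
    fix z :: complex assume z: "max 0 (1 - d) < norm z \<and> norm z < 1"
    then have z0: "z \<noteq> 0" by auto
    define w where "w = sgn z"
    have w: "norm w = 1" using z0 by (simp add: w_def norm_sgn)
    have eq: "z - w = (of_real (norm z - 1)) * w"
      using z0 by (simp add: w_def sgn_div_norm scaleR_conv_of_real field_simps)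
    have "norm (z - w) = \<bar>norm z - 1\<bar>" unfolding eq by (simp add: norm_mult w del: of_real_diff)
    then have "dist z w < d" using z by (auto simp: dist_norm)
    from d(2)[OF _ _ this] have "dist (f z) (f w) < e" using z w by auto
    then show "1 - e < f z" using one[OF w] by (auto simp: dist_real_def)
  qed (use d in auto)
qed

definition blaschke :: "complex list \<Rightarrow> complex \<Rightarrow> complex" where
  "blaschke as z = (\<Prod>a\<leftarrow>as. (z - a) / (1 - cnj a * z))"

lemma blaschke_Cons: "blaschke (a # as) z = (z - a) / (1 - cnj a * z) * blaschke as z"
  by (simp add: blaschke_def)

lemma blaschke_denominator:
  assumes "norm a < 1" "norm z \<le> 1"
  shows "1 - cnj a * z \<noteq> 0"
proof
  assume "1 - cnj a * z = 0"
  then have "norm (cnj a * z) = 1" by (metis eq_iff_diff_eq_0 norm_one)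
  moreover have "norm (cnj a * z) \<le> norm a * 1" unfolding norm_mult using assms by (intro mult_mono) auto
  ultimately show False using assms by simp
qed

lemma continuous_on_blaschke: "set as \<subseteq> ball 0 1 \<Longrightarrow> continuous_on (cball 0 1) (blaschke as)"
  unfolding blaschke_def by (induction as) (auto intro!: continuous_intros simp: blaschke_denominator simp del: right_minus_eq)

lemma norm_blaschke_circle:
  assumes "set as \<subseteq> ball 0 1" and z: "norm z = 1"
  shows "norm (blaschke as z) = 1"
  using assms(1)
proof (induction as)
  case (Cons a as)
  then have a: "norm a < 1" by auto
  have "z * cnj z = 1" using complex_norm_square[of z] z by simp
  then have "1 - cnj a * z = z * cnj (z - a)" by (simp add: algebra_simps)
  then have "norm (1 - cnj a * z) = norm (z - a)" by (simp only: norm_mult z complex_mod_cnj)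
  moreover have "norm (1 - cnj a * z) \<noteq> 0" using blaschke_denominator[OF a, of z] z by simp
  ultimately have "norm ((z - a) / (1 - cnj a * z)) = 1" by (simp add: norm_divide)
  moreover have "norm (blaschke as z) = 1" using Cons by simp
  ultimately show ?case
    unfolding blaschke_Cons norm_mult by simp
qed (simp add: blaschke_def)

text \<open>Away from the zeros each Blaschke factor is bounded away from one, which is why a bounded
  function has room for only finitely many zeros in a compact part of the disk.\<close>

lemma norm_blaschke_factor_le:
  assumes a: "norm a \<le> r" and r: "r < 1" and z: "norm z < 1"
  shows "(norm ((z - a) / (1 - cnj a * z)))\<^sup>2 \<le> 1 - (1 - r\<^sup>2) * (1 - (norm z)\<^sup>2) / 4"
proof -
  have nz: "1 - cnj a * z \<noteq> 0" by (rule blaschke_denominator) (use a r z in auto)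
  have id: "(norm (1 - cnj a * z))\<^sup>2 - (norm (z - a))\<^sup>2 = (1 - (norm a)\<^sup>2) * (1 - (norm z)\<^sup>2)"
    unfolding cmod_power2 by (simp add: power2_eq_square algebra_simps)
  have "norm (1 - cnj a * z) \<le> 1 + norm a * norm z"
    using norm_triangle_ineq4[of 1 "cnj a * z"] by (simp add: norm_mult)
  also have "\<dots> \<le> 1 + 1 * 1" using a r z by (intro add_left_mono mult_mono) auto
  finally have "norm (1 - cnj a * z) \<le> 2" by simp
  then have d: "(norm (1 - cnj a * z))\<^sup>2 \<le> 4" using power_mono[of "norm (1 - cnj a * z)" 2 2] by simp
  have d0: "0 < (norm (1 - cnj a * z))\<^sup>2" using nz by simp
  have nn: "0 \<le> norm a" by simp
  have ar: "(norm a)\<^sup>2 \<le> r\<^sup>2" using a by (intro power_mono) auto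
  have r1: "r\<^sup>2 \<le> 1" using a r nn by (intro power_le_one) linarith+
  have z1: "(norm z)\<^sup>2 \<le> 1" using z by (intro power_le_one) auto
  have "(1 - r\<^sup>2) * (1 - (norm z)\<^sup>2) / 4 \<le> (1 - (norm a)\<^sup>2) * (1 - (norm z)\<^sup>2) / (norm (1 - cnj a * z))\<^sup>2"
    using d d0 ar r1 z1 by (intro frac_le mult_right_mono mult_nonneg_nonneg) auto
  also have "\<dots> = 1 - (norm (z - a))\<^sup>2 / (norm (1 - cnj a * z))\<^sup>2"
    unfolding id[symmetric] using d0 by (simp add: field_simps)
  finally show ?thesis by (simp add: norm_divide power_divide)
qed

lemma norm_blaschke_le:
  assumes "set as \<subseteq> cball 0 r" and r: "r < 1" and z: "norm z < 1"
  shows "(norm (blaschke as z))\<^sup>2 \<le> (1 - (1 - r\<^sup>2) * (1 - (norm z)\<^sup>2) / 4) ^ length as"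
  using assms(1)
proof (induction as)
  case (Cons a as)
  have "(norm (blaschke (a # as) z))\<^sup>2 = (norm ((z - a) / (1 - cnj a * z)))\<^sup>2 * (norm (blaschke as z))\<^sup>2"
    by (simp only: blaschke_Cons norm_mult power_mult_distrib)
  also have "\<dots> \<le> (1 - (1 - r\<^sup>2) * (1 - (norm z)\<^sup>2) / 4) * (1 - (1 - r\<^sup>2) * (1 - (norm z)\<^sup>2) / 4) ^ length as"
  proof (rule mult_mono)
    show 1: "(norm ((z - a) / (1 - cnj a * z)))\<^sup>2 \<le> 1 - (1 - r\<^sup>2) * (1 - (norm z)\<^sup>2) / 4"
      using Cons.prems by (intro norm_blaschke_factor_le r z) auto
    show "(norm (blaschke as z))\<^sup>2 \<le> (1 - (1 - r\<^sup>2) * (1 - (norm z)\<^sup>2) / 4) ^ length as"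
      using Cons by simp
    show "0 \<le> 1 - (1 - r\<^sup>2) * (1 - (norm z)\<^sup>2) / 4" by (rule order_trans[OF _ 1]) simp
  qed simp
  finally show ?case by simp
qed (simp add: blaschke_def)

text \<open>Dividing out zeros one at a time must stop; what remains is zero-free and, like its
  reciprocal, bounded by one by the maximum principle, hence a unimodular constant.\<close>

lemma finite_blaschke_productI:
  assumes F: "F holomorphic_on ball 0 1" and F1: "\<And>z. norm z < 1 \<Longrightarrow> norm (F z) < 1"
    and proper: "\<And>\<eta>. \<eta> < 1 \<Longrightarrow> \<exists>r<1. \<forall>z. r < norm z \<and> norm z < 1 \<longrightarrow> \<eta> < norm (F z)"
  shows "finite_blaschke_product F"
proof -
  define P where "P as \<longleftrightarrow> set as \<subseteq> ball 0 1 \<and>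
    (\<exists>G. G holomorphic_on ball 0 1 \<and> (\<forall>z. norm z < 1 \<longrightarrow> F z = blaschke as z * G z))" for as
  have near: "\<exists>r<1. \<forall>z. r < norm z \<and> norm z < 1 \<longrightarrow> \<eta> < norm (blaschke as z)"
    if "set as \<subseteq> ball 0 1" "\<eta> < 1" for as \<eta>
    using continuous_near_circle[of "\<lambda>z. norm (blaschke as z)" "1 - \<eta>"] that
    by (simp add: norm_blaschke_circle continuous_on_norm continuous_on_blaschke)
  obtain r0 where r0: "r0 < 1" "\<And>z. r0 < norm z \<and> norm z < 1 \<Longrightarrow> 0 < norm (F z)" using proper[of 0] by auto
  define r1 where "r1 = max 0 r0"
  have r1: "0 \<le> r1" "r1 < 1" using r0 by (auto simp: r1_def)
  define z0 :: complex where "z0 = of_real ((1 + r1) / 2)"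
  have nz0: "norm z0 = (1 + r1) / 2" unfolding z0_def norm_of_real using r1 by simp
  have z0: "norm z0 < 1" "r0 < norm z0" unfolding nz0 using r1 r0 by (auto simp: r1_def max_def)
  have Fz0: "0 < norm (F z0)" by (rule r0(2)) (use z0 in auto)
  define q where "q = 1 - (1 - r1\<^sup>2) * (1 - (norm z0)\<^sup>2) / 4"
  have "r1\<^sup>2 < 1" "(norm z0)\<^sup>2 < 1" using r1 z0 by (auto simp: power_less_one_iff abs_square_less_1)
  then have q: "q < 1" by (simp add: q_def)
  \<comment> \<open>At \<open>z0\<close> the function is too large to have more than \<open>n\<close> zeros.\<close>
  obtain n where n: "q ^ n < (norm (F z0))\<^sup>2" using real_arch_pow_inv[OF _ q, of "(norm (F z0))\<^sup>2"] Fz0 by auto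
  have G_le: "norm (G z) \<le> 1" if as: "set as \<subseteq> ball 0 1" and G: "G holomorphic_on ball 0 1"
    and FG: "\<And>z. norm z < 1 \<Longrightarrow> F z = blaschke as z * G z" and z: "norm z < 1" for as G z
  proof (rule maximum_modulus_boundary[OF G _ z])
    fix e :: real assume e: "0 < e"
    then have "inverse (1 + e) < 1" by (simp add: field_simps)
    from near[OF as this] obtain r where r: "r < 1"
      "\<And>z. r < norm z \<and> norm z < 1 \<Longrightarrow> inverse (1 + e) < norm (blaschke as z)" by blast
    show "\<exists>r<1. \<forall>z. r < norm z \<and> norm z < 1 \<longrightarrow> norm (G z) \<le> 1 + e"
    proof (intro exI[of _ r] conjI allI impI r(1))
      fix z :: complex assume z: "r < norm z \<and> norm z < 1"
      have "inverse (1 + e) * norm (G z) \<le> norm (blaschke as z) * norm (G z)"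
        using r(2)[OF z] by (intro mult_right_mono) auto
      also have "\<dots> = norm (F z)" using z FG by (simp add: norm_mult)
      also have "\<dots> \<le> 1" using F1[of z] z by auto
      finally show "norm (G z) \<le> 1 + e" using e by (simp add: field_simps)
    qed
  qed
  have "P []" unfolding P_def blaschke_def using F by (intro conjI exI[of _ F]) auto
  moreover have "length as \<le> n" if Pas: "P as" for as
  proof (rule ccontr)
    assume "\<not> length as \<le> n"
    obtain G where G: "G holomorphic_on ball 0 1" "\<And>z. norm z < 1 \<Longrightarrow> F z = blaschke as z * G z"
      and as: "set as \<subseteq> ball 0 1" using Pas unfolding P_def by blast
    have "a \<in> cball 0 r1" if "a \<in> set as" for a
    proof (rule ccontr)
      assume "a \<notin> cball 0 r1"
      moreover have "norm a < 1" using that as by auto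
      ultimately have "0 < norm (F a)" by (intro r0(2)) (auto simp: r1_def)
      moreover have "blaschke as a = 0" using that by (auto simp: blaschke_def prod_list_zero_iff)
      ultimately show False using G(2)[OF \<open>norm a < 1\<close>] by simp
    qed
    then have "(norm (blaschke as z0))\<^sup>2 \<le> q ^ length as"
      unfolding q_def by (intro norm_blaschke_le r1 z0) auto
    moreover have "q ^ length as \<le> q ^ n"
    proof (rule power_decreasing)
      have "(1 - r1\<^sup>2) * (1 - (norm z0)\<^sup>2) \<le> 1 * 1"
        using \<open>r1\<^sup>2 < 1\<close> \<open>(norm z0)\<^sup>2 < 1\<close> by (intro mult_mono) auto
      then show "0 \<le> q" by (simp add: q_def)
    qed (use \<open>\<not> length as \<le> n\<close> q in auto)
    moreover have "norm (F z0) \<le> norm (blaschke as z0)"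
      using G_le[OF as G z0(1)] G(2)[OF z0(1)] mult_left_mono[of "norm (G z0)" 1 "norm (blaschke as z0)"]
      by (simp add: norm_mult)
    then have "(norm (F z0))\<^sup>2 \<le> (norm (blaschke as z0))\<^sup>2" by (intro power_mono) auto
    ultimately show False using n by linarith
  qed
  ultimately obtain as where as: "P as" and max: "\<And>bs. P bs \<Longrightarrow> length bs \<le> length as"
    using ex_has_greatest_nat[of P "[]" length "Suc n"] by (auto simp: less_Suc_eq_le)
  obtain G where G: "G holomorphic_on ball 0 1" "\<And>z. norm z < 1 \<Longrightarrow> F z = blaschke as z * G z"
    and as1: "set as \<subseteq> ball 0 1" using as unfolding P_def by blast
  have G0: "G a \<noteq> 0" if a: "norm a < 1" for a
  proof
    assume Ga: "G a = 0"
    define Q where "Q z = (if z = a then deriv G a else (G z - G a) / (z - a))" for z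
    have Q: "Q holomorphic_on ball 0 1" unfolding Q_def[abs_def] by (rule pole_lemma_open[OF G(1)]) simp
    have "P (a # as)"
      unfolding P_def
    proof (intro conjI exI[of _ "\<lambda>z. Q z * (1 - cnj a * z)"] allI impI)
      show "set (a # as) \<subseteq> ball 0 1" using a as1 by auto
      show "(\<lambda>z. Q z * (1 - cnj a * z)) holomorphic_on ball 0 1" by (intro holomorphic_intros Q)
      fix z :: complex assume z: "norm z < 1"
      have "1 - cnj a * z \<noteq> 0" by (rule blaschke_denominator) (use a z in auto)
      moreover have "G z = (z - a) * Q z" by (simp add: Q_def Ga)
      ultimately show "F z = blaschke (a # as) z * (Q z * (1 - cnj a * z))"
        using G(2)[OF z] by (simp add: blaschke_def)
    qed
    from max[OF this] show False by simp
  qed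
  have inv_le: "norm (inverse (G z)) \<le> 1" if z: "norm z < 1" for z
  proof (rule maximum_modulus_boundary[OF _ _ z])
    show "(\<lambda>z. inverse (G z)) holomorphic_on ball 0 1" using G0 by (intro holomorphic_intros G) auto
    fix e :: real assume e: "0 < e"
    then have "inverse (1 + e) < 1" by (simp add: field_simps)
    from proper[OF this] obtain r where r: "r < 1"
      "\<And>z. r < norm z \<and> norm z < 1 \<Longrightarrow> inverse (1 + e) < norm (F z)" by blast
    show "\<exists>r<1. \<forall>z. r < norm z \<and> norm z < 1 \<longrightarrow> norm (inverse (G z)) \<le> 1 + e"
    proof (intro exI[of _ "max r 0"] conjI allI impI)
      fix z :: complex assume z: "max r 0 < norm z \<and> norm z < 1"
      then have z1: "norm z < 1" by simp
      have "norm (blaschke as z) \<le> 1"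
      proof (rule maximum_modulus_boundary[OF _ _ z1])
        show "blaschke as holomorphic_on ball 0 1"
          unfolding blaschke_def using as1
          by (induction as) (auto intro!: holomorphic_intros simp: blaschke_denominator simp del: right_minus_eq)
        fix e :: real assume "0 < e"
        have "\<exists>r<1. \<forall>z. r < norm z \<and> norm z < 1 \<longrightarrow> 1 - e < 2 - norm (blaschke as z)"
          by (rule continuous_near_circle)
            (use \<open>0 < e\<close> as1 in \<open>auto intro!: continuous_intros continuous_on_blaschke simp: norm_blaschke_circle\<close>)
        then show "\<exists>r<1. \<forall>z. r < norm z \<and> norm z < 1 \<longrightarrow> norm (blaschke as z) \<le> 1 + e"
          by (force intro: less_imp_le)
      qed
      then have "norm (F z) \<le> norm (G z)"
        using G(2)[OF z1] mult_right_mono[of "norm (blaschke as z)" 1 "norm (G z)"] by (simp add: norm_mult)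
      then have "inverse (1 + e) < norm (G z)" using r(2)[of z] z by simp
      then have "inverse (norm (G z)) < inverse (inverse (1 + e))" by (rule less_imp_inverse_less) (use e in auto)
      then show "norm (inverse (G z)) \<le> 1 + e" by (simp add: norm_inverse)
    qed (use r in auto)
  qed
  have G1: "norm (G z) = 1" if z: "norm z < 1" for z
  proof (rule antisym)
    show "norm (G z) \<le> 1" by (rule G_le[OF as1 G z])
    have "0 < norm (G z)" using G0[OF z] by simp
    then show "1 \<le> norm (G z)" using inv_le[OF z] one_le_inverse_iff[of "inverse (norm (G z))"] by (simp add: norm_inverse)
  qed
  have "G constant_on ball 0 1"
    by (rule maximum_modulus_principle[OF G(1), of "ball 0 1" 0]) (auto simp: G1)
  then obtain c where c: "\<And>z. norm z < 1 \<Longrightarrow> G z = c" unfolding constant_on_def by auto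
  have "norm c = 1" using G1[of 0] c[of 0] by simp
  show ?thesis
    unfolding finite_blaschke_product_def
  proof (intro exI[of _ c] exI[of _ as] conjI ballI)
    fix z :: complex assume "z \<in> ball 0 1"
    then show "F z = c * (\<Prod>a\<leftarrow>as. (z - a) / (1 - cnj a * z))"
      using G(2)[of z] c[of z] by (simp add: blaschke_def)
  qed fact+
qed

lemma (in nonrotation_inner) small_values_near_boundary:
  assumes "\<not> finite_blaschke_product F"
  obtains \<eta> where "0 \<le> \<eta>" "\<eta> < 1" "\<And>r. r < 1 \<Longrightarrow> \<exists>z. r < norm z \<and> norm z < 1 \<and> norm (F z) \<le> \<eta>"
proof -
  have "\<not> (\<forall>\<eta><1. \<exists>r<1. \<forall>z. r < norm z \<and> norm z < 1 \<longrightarrow> \<eta> < norm (F z))"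
    using finite_blaschke_productI[OF F_holomorphic F_ball] assms by blast
  then obtain \<eta> where \<eta>: "\<eta> < 1" "\<And>r. r < 1 \<Longrightarrow> \<exists>z. r < norm z \<and> norm z < 1 \<and> norm (F z) \<le> \<eta>"
    by (meson not_le)
  moreover have "0 \<le> \<eta>" using \<eta>(2)[of 0] by (auto intro: order_trans[OF norm_ge_zero])
  ultimately show ?thesis using that by blast
qed

section \<open>From oscillation decay to the limit theorem\<close>

lemma norm_Re_diff_le: "norm (complex_of_real a - complex_of_real (Re q)) \<le> norm (complex_of_real a - q)"
  using abs_Re_le_cmod[of "complex_of_real a - q"] by (simp flip: of_real_diff)

context nonrotation_inner
begin

lemma osc_transfer_decay:
  obtains \<rho> where "0 < \<rho>" "\<rho> < 1"
    "\<And>f B n z. square_integrable circ f \<Longrightarrow> dirichlet_le (\<lambda>x. complex_of_real (f x)) B \<Longrightarrow> norm z < 1 \<Longrightarrow>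
       osc z (\<lambda>x. complex_of_real (transfer n f x)) \<le> 8 * sqrt B * \<rho> ^ n"
    "\<And>f B n. square_integrable circ f \<Longrightarrow> dirichlet_le (\<lambda>x. complex_of_real (f x)) B \<Longrightarrow>
       vanishing_osc (\<lambda>x. complex_of_real (transfer n f x))"
proof -
  obtain \<kappa> where \<kappa>: "0 < \<kappa>" "\<kappa> < 1"
    and D: "\<And>n f B. square_integrable circ f \<Longrightarrow> dirichlet_le (\<lambda>x. complex_of_real (f x)) B \<Longrightarrow>
       dirichlet_le (\<lambda>x. complex_of_real (transfer n f x)) (4 * \<kappa> ^ n * B)"
    by (rule dirichlet_le_transfer) (rule that, assumption+)
  have s: "square_integrable circ (\<lambda>x. complex_of_real (transfer n f x))" if "square_integrable circ f" for n f
    using square_integrable_transfer[OF that] by (simp add: square_integrable_of_real)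
  have 1: "osc z (\<lambda>x. complex_of_real (transfer n f x)) \<le> 8 * sqrt B * sqrt \<kappa> ^ n"
    if f: "square_integrable circ f" and B: "dirichlet_le (\<lambda>x. complex_of_real (f x)) B" and z: "norm z < 1" for f B n z
  proof -
    have "osc z (\<lambda>x. complex_of_real (transfer n f x)) \<le> 4 * sqrt (4 * \<kappa> ^ n * B)"
      by (rule osc_le_dirichlet) (intro s f z D[OF f B])+
    also have "\<dots> = 8 * sqrt B * sqrt \<kappa> ^ n" by (simp add: real_sqrt_mult real_sqrt_power)
    finally show ?thesis .
  qed
  have 2: "vanishing_osc (\<lambda>x. complex_of_real (transfer n f x))"
    if f: "square_integrable circ f" and B: "dirichlet_le (\<lambda>x. complex_of_real (f x)) B" for f B n
    by (rule vanishing_osc_dirichlet[OF s[OF f] D[OF f B]])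
  show ?thesis by (rule that[of "sqrt \<kappa>"]) (use \<kappa> 1 2 in auto)
qed

lemma integral_transfer: "square_integrable circ f \<Longrightarrow> (LINT x|circ. transfer n f x) = (LINT x|circ. f x)"
  using is_transferD(2)[OF is_transfer_transfer, of f "\<lambda>x. 1" n] by simp

lemma l2_norm_le_osc:
  fixes f :: "complex \<Rightarrow> real"
  assumes f: "square_integrable circ f" and m: "(LINT x|circ. f x) = 0"
  shows "l2_norm circ f \<le> osc 0 (\<lambda>x. complex_of_real (f x))"
proof -
  have "osc 0 (\<lambda>x. complex_of_real (f x)) = sqrt 2 * l2_norm circ (\<lambda>x. complex_of_real (f x))"
    by (rule osc_0_sq) (use f m in \<open>simp_all add: square_integrable_of_real\<close>)
  moreover have "1 * l2_norm circ f \<le> sqrt 2 * l2_norm circ f"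
    by (intro mult_right_mono l2_norm_nonneg) simp
  ultimately show ?thesis by simp
qed

lemma transfer_le_osc:
  assumes "square_integrable circ f" "(LINT x|circ. f x) = 0"
  shows "l2_norm circ (transfer n f) \<le> osc 0 (\<lambda>x. complex_of_real (transfer n f x))"
  by (rule l2_norm_le_osc) (simp_all add: assms square_integrable_transfer integral_transfer)

text \<open>Real parts of trigonometric polynomials have finite energy; removing their mean makes the oscillation at \<open>0\<close>
  control the norm of their transfers.\<close>

lemma summable_transfer_dense:
  assumes f: "square_integrable circ f" and m: "(LINT x|circ. f x) = 0" and e: "0 < e"
  shows "\<exists>p. square_integrable circ p \<and> l2_norm circ (\<lambda>x. f x - p x) < e \<and> summable (\<lambda>n. l2_norm circ (transfer n p))"
proof -
  have fc: "square_integrable circ (\<lambda>x. complex_of_real (f x))" using f by (simp add: square_integrable_of_real)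
  have e2: "0 < e / 2" using e by simp
  obtain q where q: "trig q" "l2_norm circ (\<lambda>x. complex_of_real (f x) - q x) < e / 2"
    using trig_dense[OF fc e2] by blast
  define p0 where "p0 x = Re (q x)" for x
  have t0: "trig (\<lambda>x. complex_of_real (p0 x))" unfolding p0_def by (rule trig_Re[OF q(1)])
  have s0: "square_integrable circ p0" using square_integrable_trig[OF t0] by (simp add: square_integrable_of_real)
  have sd: "square_integrable circ (\<lambda>x. f x - p0 x)" by (rule square_integrable_diff[OF f s0])
  have d0: "l2_norm circ (\<lambda>x. f x - p0 x) < e / 2"
  proof -
    have "(l2_norm circ (\<lambda>x. f x - p0 x))\<^sup>2 \<le> (l2_norm circ (\<lambda>x. complex_of_real (f x) - q x))\<^sup>2"
      unfolding l2_norm_sq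
    proof (rule integral_mono)
      show "integrable circ (\<lambda>x. (norm (f x - p0 x))\<^sup>2)" by (rule square_integrable_sq[OF sd])
      show "integrable circ (\<lambda>x. (norm (complex_of_real (f x) - q x))\<^sup>2)"
        by (rule square_integrable_sq[OF square_integrable_diff[OF fc square_integrable_trig[OF q(1)]]])
      show "(norm (f x - p0 x))\<^sup>2 \<le> (norm (complex_of_real (f x) - q x))\<^sup>2" for x
        using norm_Re_diff_le[of "f x" "q x"] by (intro power_mono) (simp_all add: p0_def flip: of_real_diff)
    qed
    then have "l2_norm circ (\<lambda>x. f x - p0 x) \<le> l2_norm circ (\<lambda>x. complex_of_real (f x) - q x)"
      by (rule power2_le_imp_le) (rule l2_norm_nonneg)
    then show ?thesis using q(2) by linarith
  qed
  define c where "c = (LINT x|circ. p0 x)"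
  define p where "p x = p0 x - c" for x
  have s: "square_integrable circ p" unfolding p_def[abs_def] by (intro square_integrable_diff s0 circ.square_integrable_const)
  have mp: "(LINT x|circ. p x) = 0"
    unfolding p_def using circ.integrable_square_integrable[OF s0] circ.prob_space by (simp add: c_def)
  have "\<bar>c\<bar> < e / 2"
  proof -
    have "norm (LINT x|circ. f x - p0 x) \<le> l2_norm circ (\<lambda>x. f x - p0 x)" by (rule circ.norm_integral_le_l2_norm[OF sd])
    moreover have "(LINT x|circ. f x - p0 x) = - c"
      using circ.integrable_square_integrable[OF s0] circ.integrable_square_integrable[OF f] by (simp add: c_def m)
    ultimately show ?thesis using d0 by simp
  qed
  have "l2_norm circ (\<lambda>x. f x - p x) = l2_norm circ (\<lambda>x. (f x - p0 x) + c)" by (simp add: p_def algebra_simps)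
  also have "\<dots> \<le> l2_norm circ (\<lambda>x. f x - p0 x) + l2_norm circ (\<lambda>x. c)"
    by (intro l2_norm_triangle sd circ.square_integrable_const)
  also have "l2_norm circ (\<lambda>x. c) \<le> \<bar>c\<bar>" by (rule circ.l2_norm_bound) auto
  finally have d: "l2_norm circ (\<lambda>x. f x - p x) < e" using d0 \<open>\<bar>c\<bar> < e / 2\<close> by simp
  have "trig (\<lambda>x. complex_of_real (p x))"
    unfolding p_def of_real_diff by (intro trig_diff t0 trig_const)
  then obtain B where B: "dirichlet_le (\<lambda>x. complex_of_real (p x)) B" by (rule dirichlet_le_trig)
  obtain \<rho> where \<rho>: "0 < \<rho>" "\<rho> < 1"
    and D: "\<And>f B n z. square_integrable circ f \<Longrightarrow> dirichlet_le (\<lambda>x. complex_of_real (f x)) B \<Longrightarrow> norm z < 1 \<Longrightarrow>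
       osc z (\<lambda>x. complex_of_real (transfer n f x)) \<le> 8 * sqrt B * \<rho> ^ n"
    by (rule osc_transfer_decay) (rule that, assumption+)
  have "summable (\<lambda>n. l2_norm circ (transfer n p))"
  proof (rule summable_comparison_test'[where N = 0])
    show "summable (\<lambda>n. 8 * sqrt B * \<rho> ^ n)" using \<rho> by (intro summable_mult summable_geometric) auto
    show "norm (l2_norm circ (transfer n p)) \<le> 8 * sqrt B * \<rho> ^ n" for n
      using transfer_le_osc[OF s mp, of n] D[OF s B, of 0 n] by simp
  qed
  then show ?thesis using s d by blast
qed

lemma characteristic_function_limit:
  assumes h: "square_integrable circ h" and m: "(LINT x|circ. h x) = 0"
    and a: "summable a" "\<And>n z. norm z < 1 \<Longrightarrow> osc z (\<lambda>x. complex_of_real (transfer n h x)) \<le> a n"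
  obtains \<sigma> where "0 \<le> \<sigma>"
    "\<And>t. (\<lambda>n. LINT x|circ. iexp (t / sqrt (real n) * birkhoff h n x)) \<longlonglongrightarrow> exp (- (t\<^sup>2 * \<sigma>\<^sup>2 / 2))"
    "\<sigma> = 0 \<Longrightarrow> (\<lambda>N. l2_norm circ (gordin h N)) \<longlonglongrightarrow> 0"
proof -
  have s: "summable (\<lambda>n. l2_norm circ (transfer n h))"
  proof (rule summable_comparison_test'[where N = 0, OF a(1)])
    show "norm (l2_norm circ (transfer n h)) \<le> a n" for n
      using transfer_le_osc[OF h m, of n] a(2)[of 0 n] by simp
  qed
  show ?thesis
    by (rule gordin_CLT[OF h s summable_transfer_dense]) (assumption+, rule that, assumption+)
qed

end

lemma vanishing_osc_tendsto:
  assumes "vanishing_osc f"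
  shows "((\<lambda>z. osc z f) \<longlongrightarrow> 0) (filtercomap norm (at_left 1))"
proof (rule tendstoI)
  fix e :: real assume "0 < e"
  from vanishing_oscD[OF assms this] obtain r where
    r: "r < 1" "\<And>z. r < norm z \<Longrightarrow> norm z < 1 \<Longrightarrow> osc z f < e" by blast
  have "\<forall>\<^sub>F s in at_left 1. r < s \<and> s < (1::real)"
    using r(1) unfolding eventually_at_left_field by blast
  then show "\<forall>\<^sub>F z in filtercomap norm (at_left 1). dist (osc z f) 0 < e"
    unfolding eventually_filtercomap
    by (intro exI[of _ "\<lambda>s. r < s \<and> s < 1"] conjI) (auto simp: r osc_nonneg)
qed

text \<open>Finitely many terms vanish at the circle, and the tail is small uniformly in \<open>z\<close>.\<close>

lemma osc_sums_eventually_small: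
  assumes a: "summable a" and b: "\<And>n z. norm z < 1 \<Longrightarrow> osc z (f n) \<le> a n"
    and v: "\<And>n. vanishing_osc (f n)" and e: "0 < e"
  shows "\<exists>r<1. \<forall>z N. r < norm z \<and> norm z < 1 \<longrightarrow> (\<Sum>n<N. osc z (f n)) < e"
proof -
  have a0: "0 \<le> a n" for n using b[of 0 n] osc_nonneg[of 0 "f n"] by simp
  obtain M where M: "norm (\<Sum>i. a (i + M)) < e / 2"
    using suminf_exist_split[OF _ a, of "e / 2"] e by auto
  have "((\<lambda>z. \<Sum>n<M. osc z (f n)) \<longlongrightarrow> (\<Sum>n<M. 0)) (filtercomap norm (at_left 1))"
    by (intro tendsto_sum vanishing_osc_tendsto v)
  then have "\<forall>\<^sub>F z in filtercomap norm (at_left 1). (\<Sum>n<M. osc z (f n)) < e / 2"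
    by (rule order_tendstoD(2)) (use e in simp)
  then obtain r where r: "r < 1" "\<And>z. r < norm z \<Longrightarrow> norm z < 1 \<Longrightarrow> (\<Sum>n<M. osc z (f n)) < e / 2"
    unfolding eventually_filtercomap eventually_at_left_field by blast
  have "(\<Sum>n<N. osc z (f n)) < e" if z: "r < norm z \<and> norm z < 1" for z N
  proof -
    have z1: "norm z < 1" using z by simp
    have "(\<Sum>n<N. osc z (f n)) \<le> (\<Sum>n<M + N. osc z (f n))"
      by (rule sum_mono2) (auto simp: osc_nonneg[OF z1])
    also have "\<dots> = (\<Sum>n<M. osc z (f n)) + (\<Sum>i<N. osc z (f (i + M)))"
      by (induction N) (simp_all add: add.commute)
    also have "(\<Sum>i<N. osc z (f (i + M))) \<le> (\<Sum>i<N. a (i + M))" by (intro sum_mono b z1)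
    also have "\<dots> \<le> (\<Sum>i. a (i + M))"
      by (rule sum_le_suminf) (use a a0 in \<open>auto simp: summable_iff_shift\<close>)
    finally show ?thesis using r(2)[of z] z M by simp
  qed
  then show ?thesis using r(1) by blast
qed

context nonrotation_inner
begin

text \<open>If the variance vanishes, then \<open>h\<close> is the coboundary \<open>v \<circ> T - v\<close> up to small errors, where \<open>v\<close> is the sum of the
  transfers of \<open>h\<close>. Near the circle the oscillations of \<open>h\<close> and \<open>v\<close> vanish, hence so does that of \<open>v \<circ> T\<close>, which
  at \<open>z\<close> equals the oscillation of \<open>v\<close> at \<open>F z\<close>. If \<open>F\<close> is not a finite Blaschke product, points \<open>z\<close> near the circle
  can be chosen with \<open>F z\<close> in a fixed smaller disk, where the oscillation of \<open>v\<close> is comparable to its norm. So \<open>v\<close>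
  vanishes, and with it \<open>h\<close>.\<close>

lemma gordin_tendsto_zero_imp_zero:
  assumes h: "square_integrable circ h" and m: "(LINT x|circ. h x) = 0"
    and a: "summable a" "\<And>n z. norm z < 1 \<Longrightarrow> osc z (\<lambda>x. complex_of_real (transfer n h x)) \<le> a n"
    and v: "\<And>n. vanishing_osc (\<lambda>x. complex_of_real (transfer n h x))"
    and nb: "\<not> finite_blaschke_product F" and g0: "(\<lambda>N. l2_norm circ (gordin h N)) \<longlonglongrightarrow> 0"
  shows "l2_norm circ h = 0"
proof -
  let ?c = "\<lambda>f x. complex_of_real (f x)"
  let ?V = "\<lambda>N. transfer_sum h N" and ?W = "\<lambda>N. transfer (Suc N) h"
  note sT = square_integrable_T
  have sV: "square_integrable circ (?V N)" for N by (rule square_integrable_transfer_sum[OF h])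
  have sW: "square_integrable circ (transfer N h)" for N by (rule square_integrable_transfer[OF h])
  have sG: "square_integrable circ (gordin h N)" for N by (rule square_integrable_gordin[OF h])
  have w0: "(\<lambda>N. l2_norm circ (?W N)) \<longlonglongrightarrow> 0"
  proof (rule tendsto_sandwich[OF _ _ tendsto_const])
    show "(\<lambda>N. a (Suc N)) \<longlonglongrightarrow> 0" using summable_LIMSEQ_zero[OF a(1)] by (rule LIMSEQ_Suc)
    show "\<forall>\<^sub>F N in sequentially. l2_norm circ (?W N) \<le> a (Suc N)"
      using order_trans[OF transfer_le_osc[OF h m] a(2)[of 0]] by auto
  qed auto
  obtain \<eta> where \<eta>: "0 \<le> \<eta>" "\<eta> < 1" "\<And>r. r < 1 \<Longrightarrow> \<exists>z. r < norm z \<and> norm z < 1 \<and> norm (F z) \<le> \<eta>"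
    using small_values_near_boundary[OF nb] by metis
  define K where "K = (1 + \<eta>) / (1 - \<eta>)"
  have K: "0 < K" using \<eta> by (auto simp: K_def intro!: divide_pos_pos add_pos_nonneg)
  have v0: "(\<lambda>N. l2_norm circ (?V N)) \<longlonglongrightarrow> 0"
  proof (rule LIMSEQ_I)
    fix e :: real assume e: "0 < e"
    have e2: "0 < e / (2 * K)" using e K by simp
    obtain r where r: "r < 1" "\<And>z N. r < norm z \<Longrightarrow> norm z < 1 \<Longrightarrow> (\<Sum>n<N. osc z (?c (transfer n h))) < e / (2 * K)"
      using osc_sums_eventually_small[OF a v e2] by blast
    \<comment> \<open>The point \<open>z\<close> is fixed before \<open>N\<close>: the constants \<open>C\<close> and \<open>C'\<close> depend on it, but the norms that they multiply tend to zero.\<close>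
    obtain z where z: "r < norm z" "norm z < 1" "norm (F z) \<le> \<eta>" using \<eta>(3)[OF r(1)] by blast
    have Fz: "norm (F z) < 1" by (rule F_ball[OF z(2)])
    define C where "C = 2 * sqrt ((1 + norm z) / (1 - norm z))"
    define C' where "C' = 2 * sqrt ((1 + norm (F z)) / (1 - norm (F z)))"
    have Kc: "K * (inverse K * x) = x" for x using K by simp
    have main: "l2_norm circ (?V N) \<le> K * (e / (2 * K) + C * l2_norm circ (gordin h N) + C' * l2_norm circ (?W N))" for N
    proof -
      note sc = square_integrable_of_real[THEN iffD2]
      have mV: "(LINT x|circ. ?V N x) = 0"
        unfolding transfer_sum_def
        by (subst Bochner_Integration.integral_sum)
          (auto simp: integral_transfer[OF h] m intro: circ.integrable_square_integrable sW)
      have "osc (F z) (?c (?V N)) = osc z (\<lambda>x. ?c (?V N) (T x))"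
        by (rule osc_compose_T[OF z(2), symmetric]) (rule square_integrable_measurable[OF sc[OF sV]])
      also have "(\<lambda>x. ?c (?V N) (T x)) = (\<lambda>x. ((?c (transfer 0 h) x + ?c (?V N) x) - ?c (gordin h N) x) - ?c (?W N) (T x))"
        using gordin_decomposition[of h _ N] by (auto simp: fun_eq_iff simp flip: of_real_add of_real_diff)
      also have "osc z \<dots> \<le> osc z (\<lambda>x. (?c (transfer 0 h) x + ?c (?V N) x) - ?c (gordin h N) x) + osc z (\<lambda>x. ?c (?W N) (T x))"
        by (rule osc_diff[OF z(2)])
          (intro square_integrable_diff square_integrable_add sc sW sV sG sT)+
      also have "osc z (\<lambda>x. (?c (transfer 0 h) x + ?c (?V N) x) - ?c (gordin h N) x) \<le> osc z (\<lambda>x. ?c (transfer 0 h) x + ?c (?V N) x) + osc z (?c (gordin h N))"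
        by (rule osc_diff[OF z(2)]) (intro square_integrable_add sc sW sV sG)+
      also have "osc z (\<lambda>x. ?c (transfer 0 h) x + ?c (?V N) x) \<le> osc z (?c (transfer 0 h)) + osc z (?c (?V N))"
        by (rule osc_add[OF z(2)]) (intro sc sW sV)+
      also have "osc z (?c (?V N)) \<le> (\<Sum>j<N. osc z (?c (transfer (Suc j) h)))"
        unfolding transfer_sum_def of_real_sum by (rule osc_sum[OF z(2)]) (intro sc sW)
      also have "osc z (?c (transfer 0 h)) + (\<Sum>j<N. osc z (?c (transfer (Suc j) h))) = (\<Sum>j<Suc N. osc z (?c (transfer j h)))"
        unfolding sum.lessThan_Suc_shift by simp
      also have "\<dots> \<le> e / (2 * K)" using r(2)[OF z(1,2)] by (rule less_imp_le)
      also have "osc z (?c (gordin h N)) \<le> C * l2_norm circ (gordin h N)"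
        using osc_le_l2_norm[OF z(2) sc[OF sG]] by (simp add: C_def)
      also have "osc z (\<lambda>x. ?c (?W N) (T x)) = osc (F z) (?c (?W N))"
        by (rule osc_compose_T[OF z(2)]) (rule square_integrable_measurable[OF sc[OF sW]])
      also have "\<dots> \<le> C' * l2_norm circ (?W N)"
        using osc_le_l2_norm[OF Fz sc[OF sW]] by (simp add: C'_def)
      finally have u: "osc (F z) (?c (?V N)) \<le> e / (2 * K) + C * l2_norm circ (gordin h N) + C' * l2_norm circ (?W N)"
        by simp
      have "inverse K * osc 0 (?c (?V N)) \<le> (1 - norm (F z)) / (1 + norm (F z)) * osc 0 (?c (?V N))"
      proof (rule mult_right_mono)
        have "(1 - \<eta>) / (1 + \<eta>) \<le> (1 - x) / (1 + x)" if "0 \<le> x" "x \<le> \<eta>" for x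
          using that \<eta> by (intro frac_le) auto
        from this[OF norm_ge_zero z(3)]
        show "inverse K \<le> (1 - norm (F z)) / (1 + norm (F z))" by (simp add: K_def)
      qed (simp add: osc_nonneg)
      also have "\<dots> \<le> osc (F z) (?c (?V N))" by (rule osc_0_le[OF Fz sc[OF sV]])
      also note u
      finally have "K * (inverse K * osc 0 (?c (?V N))) \<le> K * (e / (2 * K) + C * l2_norm circ (gordin h N) + C' * l2_norm circ (?W N))"
        by (rule mult_left_mono) (use K in simp)
      then have "osc 0 (?c (?V N)) \<le> K * (e / (2 * K) + C * l2_norm circ (gordin h N) + C' * l2_norm circ (?W N))"
        unfolding Kc .
      then show ?thesis using l2_norm_le_osc[OF sV mV] by (rule order_trans[rotated])
    qed
    have "(\<lambda>N. K * (e / (2 * K) + C * l2_norm circ (gordin h N) + C' * l2_norm circ (?W N))) \<longlonglongrightarrow> K * (e / (2 * K) + C * 0 + C' * 0)"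
      by (intro tendsto_intros g0 w0)
    then have "\<forall>\<^sub>F N in sequentially. K * (e / (2 * K) + C * l2_norm circ (gordin h N) + C' * l2_norm circ (?W N)) < e"
      by (rule order_tendstoD(2)) (use K e in simp)
    then have "\<forall>\<^sub>F N in sequentially. norm (l2_norm circ (?V N) - 0) < e"
      by eventually_elim (use main in \<open>auto intro: le_less_trans\<close>)
    then show "\<exists>no. \<forall>n\<ge>no. norm (l2_norm circ (?V n) - 0) < e" by (simp only: eventually_sequentially)
  qed
  have le: "l2_norm circ h \<le> l2_norm circ (gordin h N) + (l2_norm circ (?V N) + l2_norm circ (?V N)) + l2_norm circ (?W N)" for N
  proof -
    have "h = (\<lambda>x. (gordin h N x + (?V N (T x) - ?V N x)) + ?W N (T x))"
      using gordin_decomposition[of h _ N] by (auto simp: fun_eq_iff)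
    then have "l2_norm circ h = l2_norm circ (\<lambda>x. (gordin h N x + (?V N (T x) - ?V N x)) + ?W N (T x))" by (rule arg_cong)
    also have "\<dots> \<le> l2_norm circ (\<lambda>x. gordin h N x + (?V N (T x) - ?V N x)) + l2_norm circ (\<lambda>x. ?W N (T x))"
      by (rule l2_norm_triangle) (intro square_integrable_add square_integrable_diff sG sT sV sW)+
    also have "l2_norm circ (\<lambda>x. gordin h N x + (?V N (T x) - ?V N x)) \<le> l2_norm circ (gordin h N) + l2_norm circ (\<lambda>x. ?V N (T x) - ?V N x)"
      by (rule l2_norm_triangle) (intro square_integrable_diff sG sT sV)+
    also have "l2_norm circ (\<lambda>x. ?V N (T x) - ?V N x) \<le> l2_norm circ (\<lambda>x. ?V N (T x)) + l2_norm circ (?V N)"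
      by (rule l2_norm_diff_triangle) (intro sT sV)+
    also have "l2_norm circ (\<lambda>x. ?V N (T x)) = l2_norm circ (?V N)" by (rule l2_norm_T[OF square_integrable_measurable[OF sV]])
    also have "l2_norm circ (\<lambda>x. ?W N (T x)) = l2_norm circ (?W N)" by (rule l2_norm_T[OF square_integrable_measurable[OF sW]])
    finally show ?thesis by simp
  qed
  have "(\<lambda>N. l2_norm circ (gordin h N) + (l2_norm circ (?V N) + l2_norm circ (?V N)) + l2_norm circ (?W N)) \<longlonglongrightarrow> 0 + (0 + 0) + 0"
    by (intro tendsto_add g0 v0 w0)
  then have "l2_norm circ h \<le> 0 + (0 + 0) + 0"
    by (rule LIMSEQ_le_const) (use le in blast)
  then show ?thesis using l2_norm_nonneg[of circ h] by linarith
qed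

end

section \<open>Hoelder continuous functions\<close>

text \<open>Replaces the power of the distance by a quadratic expression, which can be integrated against the Poisson
  kernel exactly.\<close>

lemma powr_le_quadratic:
  fixes d s \<beta> :: real
  assumes "0 \<le> d" "0 < s" "0 < \<beta>" "\<beta> \<le> 2"
  shows "d powr \<beta> \<le> s powr \<beta> * (1 + d\<^sup>2 / s\<^sup>2)"
proof (cases "d \<le> s")
  case True
  then have "d powr \<beta> \<le> s powr \<beta>" using assms by (intro powr_mono2) auto
  also have "\<dots> \<le> s powr \<beta> * (1 + d\<^sup>2 / s\<^sup>2)" by (simp add: mult_le_cancel_left1 zero_le_divide_iff)
  finally show ?thesis .
next
  case False
  then have ds: "1 \<le> d / s" using assms by simp
  have "d powr \<beta> = (s * (d / s)) powr \<beta>" using assms by simp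
  also have "\<dots> = s powr \<beta> * (d / s) powr \<beta>" by (rule powr_mult)
  also have "(d / s) powr \<beta> \<le> (d / s) powr 2" using ds assms by (intro powr_mono) auto
  also have "(d / s) powr 2 = d\<^sup>2 / s\<^sup>2" using ds assms False by (simp add: powr_numeral power_divide)
  finally show ?thesis by (simp add: mult_left_mono distrib_left add_increasing)
qed

text \<open>Distances on the circle are at most two, so exponents above one can be lowered to one.\<close>

lemma holder_on_circle:
  assumes "holder_on \<alpha> (sphere 0 1) h" "0 < \<alpha>"
  obtains \<beta> C where "0 < \<beta>" "\<beta> \<le> 1" "0 \<le> C"
    "\<And>x y. norm x = 1 \<Longrightarrow> norm y = 1 \<Longrightarrow> \<bar>h x - h y\<bar> \<le> C * dist x y powr \<beta>"
proof -
  obtain C where C0: "\<forall>x\<in>sphere 0 1. \<forall>y\<in>sphere 0 1. \<bar>h x - h y\<bar> \<le> C * dist x y powr \<alpha>"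
    using assms(1) unfolding holder_on_def by blast
  have C: "\<bar>h x - h y\<bar> \<le> C * dist x y powr \<alpha>" if "norm x = 1" "norm y = 1" for x y
    using C0 that by simp
  define \<beta> where "\<beta> = min \<alpha> 1"
  have "\<bar>h x - h y\<bar> \<le> (\<bar>C\<bar> * 2 powr (\<alpha> - \<beta>)) * dist x y powr \<beta>" if xy: "norm x = 1" "norm y = 1" for x y
  proof -
    have "dist x y \<le> 2" using norm_triangle_ineq4[of x y] xy by (simp add: dist_norm)
    then have d: "dist x y powr (\<alpha> - \<beta>) \<le> 2 powr (\<alpha> - \<beta>)" by (intro powr_mono2) (auto simp: \<beta>_def)
    have "\<bar>h x - h y\<bar> \<le> C * dist x y powr \<alpha>" by (rule C[OF xy])
    also have "\<dots> \<le> \<bar>C\<bar> * dist x y powr \<alpha>" by (intro mult_right_mono) auto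
    also have "dist x y powr \<alpha> = dist x y powr (\<alpha> - \<beta>) * dist x y powr \<beta>" by (simp flip: powr_add)
    also have "\<bar>C\<bar> * \<dots> \<le> \<bar>C\<bar> * (2 powr (\<alpha> - \<beta>) * dist x y powr \<beta>)"
      by (intro mult_left_mono mult_right_mono d) auto
    finally show ?thesis by (simp add: mult.assoc)
  qed
  then show ?thesis using assms(2) by (intro that[of \<beta> "\<bar>C\<bar> * 2 powr (\<alpha> - \<beta>)"]) (auto simp: \<beta>_def)
qed

locale holder_circle =
  fixes h :: "complex \<Rightarrow> real" and \<beta> C :: real
  assumes \<beta>: "0 < \<beta>" "\<beta> \<le> 1" and C: "0 \<le> C"
    and holder: "\<And>x y. norm x = 1 \<Longrightarrow> norm y = 1 \<Longrightarrow> \<bar>h x - h y\<bar> \<le> C * dist x y powr \<beta>"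
begin

lemma small_powr:
  assumes e: "0 < e" and K: "0 \<le> K"
  obtains \<delta> where "0 < \<delta>" "\<delta> < 1" "\<And>t. 0 \<le> t \<Longrightarrow> t \<le> \<delta> \<Longrightarrow> K * t powr \<beta> < e"
proof -
  define b where "b = e / (K + 1)"
  have b: "0 < b" using e K by (simp add: b_def)
  define \<delta> where "\<delta> = min (1 / 2) (b powr (1 / \<beta>))"
  have "K * t powr \<beta> < e" if t: "0 \<le> t" "t \<le> \<delta>" for t
  proof -
    have "t powr \<beta> \<le> (b powr (1 / \<beta>)) powr \<beta>" using t \<beta> by (intro powr_mono2) (auto simp: \<delta>_def)
    also have "\<dots> = b" using b \<beta> by (simp add: powr_powr)
    finally have "K * t powr \<beta> \<le> K * b" using K by (rule mult_left_mono)
    also have "\<dots> < (K + 1) * b" using b by (simp add: distrib_right)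
    also have "\<dots> = e" using K by (simp add: b_def)
    finally show ?thesis .
  qed
  then show ?thesis using b by (intro that[of \<delta>]) (auto simp: \<delta>_def)
qed

lemma continuous: "continuous_on (sphere 0 1) h"
  unfolding continuous_on_iff
proof (intro ballI allI impI)
  fix x :: complex and e :: real assume x: "x \<in> sphere 0 1" and e: "0 < e"
  obtain \<delta> where \<delta>: "0 < \<delta>" "\<And>t. 0 \<le> t \<Longrightarrow> t \<le> \<delta> \<Longrightarrow> C * t powr \<beta> < e"
    using small_powr[OF e C] by blast
  show "\<exists>d>0. \<forall>y\<in>sphere 0 1. dist y x < d \<longrightarrow> dist (h y) (h x) < e"
  proof (intro exI[of _ \<delta>] conjI ballI impI \<delta>(1))
    fix y :: complex assume y: "y \<in> sphere 0 1" "dist y x < \<delta>"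
    have "dist (h y) (h x) \<le> C * dist y x powr \<beta>" using holder[of y x] x y by (simp add: dist_real_def)
    also have "\<dots> < e" using y by (intro \<delta>(2)) auto
    finally show "dist (h y) (h x) < e" .
  qed
qed

lemma measurable_circ: "h \<in> borel_measurable circ"
  by (rule borel_measurable_circ_continuous[OF continuous])

lemma bounded: "\<exists>K. \<forall>x. norm x = 1 \<longrightarrow> \<bar>h x\<bar> \<le> K"
proof -
  have "compact (h ` sphere 0 1)" by (intro compact_continuous_image continuous) simp
  from compact_imp_bounded[OF this] obtain K where "\<forall>x\<in>sphere 0 1. \<bar>h x\<bar> \<le> K"
    by (auto simp: bounded_iff)
  then show ?thesis by (intro exI[of _ K]) simp
qed

lemma square_integrable: "square_integrable circ h"
proof -
  obtain K where "\<And>x. norm x = 1 \<Longrightarrow> \<bar>h x\<bar> \<le> K" using bounded by blast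
  then show ?thesis by (intro circ.square_integrable_bounded[OF measurable_circ, of K]) auto
qed

lemma square_integrable_complex: "square_integrable circ (\<lambda>x. complex_of_real (h x))"
  using square_integrable by (simp add: square_integrable_of_real)

text \<open>Poisson averages at the scale \<open>s\<close>: the point at distance \<open>s^2\<close> from the circle sees a mean squared
  distance of \<open>2 * s^2\<close> on the circle.\<close>

definition smoothing :: "real \<Rightarrow> complex \<Rightarrow> real" where
  "smoothing s x = (LINT y|circ. poisson (of_real (1 - s\<^sup>2) * x) y * h y)"

lemma smoothing_harmonic_ext:
  "complex_of_real (smoothing s x) = harmonic_ext (\<lambda>x. complex_of_real (h x)) (of_real (1 - s\<^sup>2) * x)"
  by (simp only: smoothing_def harmonic_ext_def integral_complex_of_real flip: of_real_mult)

lemma square_integrable_smoothing: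
  assumes s: "0 < s" "s \<le> 1"
  shows "square_integrable circ (smoothing s)"
proof -
  have "0 \<le> 1 - s\<^sup>2" "1 - s\<^sup>2 < 1" using s by (auto simp: power_le_one)
  from square_integrable_harmonic_ext[OF square_integrable_complex this]
  show ?thesis unfolding smoothing_harmonic_ext[symmetric] by (simp add: square_integrable_of_real)
qed

lemma dirichlet_le_smoothing:
  assumes s: "0 < s" "s \<le> 1"
  shows "dirichlet_le (\<lambda>x. complex_of_real (smoothing s x)) ((l2_norm circ h / s)\<^sup>2)"
proof -
  have "0 \<le> 1 - s\<^sup>2" "1 - s\<^sup>2 < 1" using s by (auto simp: power_le_one)
  from dirichlet_le_harmonic_ext[OF square_integrable_complex this]
  show ?thesis unfolding smoothing_harmonic_ext[symmetric] by (simp add: power_divide)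
qed

lemma integral_poisson_dist_sq:
  assumes x: "norm x = 1" and r: "0 \<le> r" "r < 1"
  shows "(LINT y|circ. poisson (of_real r * x) y * (dist x y)\<^sup>2) = 2 - 2 * r"
proof -
  let ?z = "of_real r * x"
  have z: "norm ?z < 1" using x r by (simp add: norm_mult)
  have i1: "integrable circ (poisson ?z)" by (rule integrable_poisson[OF z])
  have i: "integrable circ (\<lambda>y. complex_of_real (poisson ?z y) * y)"
  proof (rule Bochner_Integration.integrable_bound)
    show "integrable circ (\<lambda>y. poisson ?z y)" by (rule i1)
    have [measurable]: "(\<lambda>y. y) \<in> borel_measurable circ" by (intro borel_measurable_circ_continuous continuous_intros)
    show "(\<lambda>y. complex_of_real (poisson ?z y) * y) \<in> borel_measurable circ"
      using borel_measurable_integrable[OF i1] by measurable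
    show "AE y in circ. norm (complex_of_real (poisson ?z y) * y) \<le> norm (poisson ?z y)"
      by (rule AE_I2) (auto simp: norm_mult)
  qed
  have I: "(LINT y|circ. complex_of_real (poisson ?z y) * y) = ?z"
    by (rule integral_poisson[OF _ _ z]) (auto intro!: continuous_intros holomorphic_intros)
  have eq: "poisson ?z y * (dist x y)\<^sup>2 = 2 * poisson ?z y - 2 * Re (cnj x * (complex_of_real (poisson ?z y) * y))"
    if "norm y = 1" for y
  proof -
    have "(Re x)\<^sup>2 + (Im x)\<^sup>2 = 1" "(Re y)\<^sup>2 + (Im y)\<^sup>2 = 1" using x that by (simp_all flip: cmod_power2)
    then have d: "(dist x y)\<^sup>2 = 2 - 2 * (Re x * Re y + Im x * Im y)"
      unfolding dist_norm cmod_power2 by (simp add: power2_eq_square algebra_simps)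
    show ?thesis unfolding d by (simp add: algebra_simps)
  qed
  have "(LINT y|circ. poisson ?z y * (dist x y)\<^sup>2) = (LINT y|circ. 2 * poisson ?z y - 2 * Re (cnj x * (complex_of_real (poisson ?z y) * y)))"
    by (rule Bochner_Integration.integral_cong) (auto simp: eq)
  also have "\<dots> = 2 * (LINT y|circ. poisson ?z y) - 2 * Re (cnj x * (LINT y|circ. complex_of_real (poisson ?z y) * y))"
  proof -
    define W where "W y = cnj x * (complex_of_real (poisson ?z y) * y)" for y
    have iW: "integrable circ W" unfolding W_def by (intro integrable_mult_right i)
    have "(LINT y|circ. W y) = cnj x * (LINT y|circ. complex_of_real (poisson ?z y) * y)"
      unfolding W_def by (rule integral_mult_right_zero)
    then show ?thesis
      unfolding W_def[symmetric] using iW i1 by (simp add: integral_Re)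
  qed
  also have "\<dots> = 2 - 2 * Re (cnj x * ?z)" by (simp only: I integral_poisson_1[OF z])
  also have "cnj x * ?z = of_real r * (x * cnj x)" by (simp add: algebra_simps)
  also have "x * cnj x = 1" using complex_norm_square[of x] x by simp
  finally show ?thesis by simp
qed

lemma smoothing_approx:
  assumes x: "norm x = 1" and s: "0 < s" "s \<le> 1"
  shows "\<bar>h x - smoothing s x\<bar> \<le> 3 * C * s powr \<beta>"
proof -
  define r where "r = 1 - s\<^sup>2"
  have r: "0 \<le> r" "r < 1" using s by (auto simp: r_def power_le_one)
  let ?z = "of_real r * x"
  have z: "norm ?z < 1" using x r by (simp add: norm_mult)
  let ?P = "poisson ?z"
  have i1: "integrable circ ?P" by (rule integrable_poisson[OF z])
  note [measurable] = measurable_circ borel_measurable_integrable[OF i1]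
  obtain K where K: "\<And>x. norm x = 1 \<Longrightarrow> \<bar>h x\<bar> \<le> K" using bounded by blast
  have bounded_mult: "integrable circ (\<lambda>y. ?P y * f y)"
    if f [measurable]: "f \<in> borel_measurable circ" and K: "\<And>y. norm y = 1 \<Longrightarrow> \<bar>f y\<bar> \<le> K" for f and K :: real
  proof (rule Bochner_Integration.integrable_bound)
    show "integrable circ (\<lambda>y. ?P y * K)" using i1 by simp
    show "AE y in circ. norm (?P y * f y) \<le> norm (?P y * K)"
    proof (rule AE_I2)
      fix y assume "y \<in> space circ"
      then have "\<bar>f y\<bar> \<le> \<bar>K\<bar>" using K[of y] by auto
      then show "norm (?P y * f y) \<le> norm (?P y * K)" by (simp add: abs_mult mult_left_mono)
    qed
  qed measurable
  have [measurable]: "(\<lambda>y. dist x y) \<in> borel_measurable circ" by (intro borel_measurable_circ_continuous continuous_intros)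
  have ih: "integrable circ (\<lambda>y. ?P y * h y)" by (rule bounded_mult[OF _ K]) auto
  have id: "integrable circ (\<lambda>y. ?P y * (dist x y)\<^sup>2)"
  proof (rule bounded_mult)
    fix y :: complex assume "norm y = 1"
    then have "dist x y \<le> 2" using norm_triangle_ineq4[of x y] x by (simp add: dist_norm)
    then show "\<bar>(dist x y)\<^sup>2\<bar> \<le> 4" using power_mono[of "dist x y" 2 2] by simp
  qed measurable
  have "h x - smoothing s x = (LINT y|circ. ?P y * h x - ?P y * h y)"
    using i1 ih integral_poisson_1[OF z] by (simp add: smoothing_def r_def)
  also have "\<bar>\<dots>\<bar> \<le> (LINT y|circ. \<bar>?P y * h x - ?P y * h y\<bar>)"
    by (rule integral_abs_bound)
  also have "\<dots> \<le> (LINT y|circ. (C * s powr \<beta>) * (?P y + ?P y * (dist x y)\<^sup>2 / s\<^sup>2))"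
  proof (rule integral_mono)
    show "integrable circ (\<lambda>y. \<bar>?P y * h x - ?P y * h y\<bar>)" using i1 ih by simp
    show "integrable circ (\<lambda>y. (C * s powr \<beta>) * (?P y + ?P y * (dist x y)\<^sup>2 / s\<^sup>2))" using i1 id by simp
    fix y assume "y \<in> space circ"
    then have y: "norm y = 1" by simp
    have "\<bar>?P y * h x - ?P y * h y\<bar> = ?P y * \<bar>h x - h y\<bar>"
      using poisson_nonneg[OF z, of y] by (simp add: abs_mult flip: right_diff_distrib)
    also have "\<dots> \<le> ?P y * (C * (s powr \<beta> * (1 + (dist x y)\<^sup>2 / s\<^sup>2)))"
      using \<beta> s by (intro mult_left_mono poisson_nonneg[OF z] order_trans[OF holder[OF x y]] powr_le_quadratic C) auto
    finally show "\<bar>?P y * h x - ?P y * h y\<bar> \<le> (C * s powr \<beta>) * (?P y + ?P y * (dist x y)\<^sup>2 / s\<^sup>2)"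
      by (simp add: algebra_simps)
  qed
  also have "\<dots> = (C * s powr \<beta>) * (1 + (2 - 2 * r) / s\<^sup>2)"
    using i1 id by (simp add: integral_poisson_1[OF z] integral_poisson_dist_sq[OF x r])
  also have "\<dots> = 3 * C * s powr \<beta>" using s by (simp add: r_def)
  finally show ?thesis .
qed

text \<open>The Poisson averages are equal to \<open>c\<close>, and they converge to \<open>h\<close> at every point.\<close>

lemma AE_constant_imp_constant:
  assumes c: "AE x in circ. h x = c"
  shows "h constant_on sphere 0 1"
proof -
  have "h x = c" if x: "norm x = 1" for x
  proof (rule ccontr)
    assume "h x \<noteq> c"
    then have e: "0 < \<bar>h x - c\<bar>" by simp
    have C3: "0 \<le> 3 * C" using C by simp
    obtain \<delta> where \<delta>: "0 < \<delta>" "\<delta> < 1" "\<And>t. 0 \<le> t \<Longrightarrow> t \<le> \<delta> \<Longrightarrow> 3 * C * t powr \<beta> < \<bar>h x - c\<bar>"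
      by (rule small_powr[OF e C3]) (rule that, assumption+)
    have z: "norm (of_real (1 - \<delta>\<^sup>2) * x) < 1"
      using \<delta> x by (simp add: norm_mult abs_square_less_1 power_le_one abs_of_nonneg del: of_real_diff)
    have "smoothing \<delta> x = (LINT y|circ. poisson (of_real (1 - \<delta>\<^sup>2) * x) y * c)"
      unfolding smoothing_def
      by (rule integral_cong_AE)
        (use c borel_measurable_integrable[OF integrable_poisson[OF z]] measurable_circ in auto)
    also have "\<dots> = c" using integral_poisson_1[OF z] by simp
    finally show False using smoothing_approx[OF x, of \<delta>] \<delta>(3)[of \<delta>] \<delta>(1,2) by simp
  qed
  then show ?thesis by (auto simp: constant_on_def)
qed

end

context nonrotation_inner
begin

text \<open>Split \<open>h\<close> into its smoothing at scale \<open>s\<close> and the rest. The energy of the smoothing is at most of order \<open>1 / s^2\<close>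
  and its transfers decay; the rest is of order \<open>s powr \<beta>\<close> and transfers preserve this bound. A scale that is
  geometric in \<open>n\<close> balances the two.\<close>

lemma osc_transfer_holder:
  assumes "holder_circle h \<beta> C"
  obtains a where "summable a" "\<And>n z. norm z < 1 \<Longrightarrow> osc z (\<lambda>x. complex_of_real (transfer n h x)) \<le> a n"
    "\<And>n. vanishing_osc (\<lambda>x. complex_of_real (transfer n h x))"
proof -
  interpret H: holder_circle h \<beta> C by fact
  let ?c = "\<lambda>f x. complex_of_real (f x)"
  note sc = square_integrable_of_real[THEN iffD2]
  obtain \<rho> where \<rho>: "0 < \<rho>" "\<rho> < 1"
    and D: "\<And>f B n z. square_integrable circ f \<Longrightarrow> dirichlet_le (?c f) B \<Longrightarrow> norm z < 1 \<Longrightarrow>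
       osc z (?c (transfer n f)) \<le> 8 * sqrt B * \<rho> ^ n"
    and V: "\<And>f B n. square_integrable circ f \<Longrightarrow> dirichlet_le (?c f) B \<Longrightarrow> vanishing_osc (?c (transfer n f))"
    by (rule osc_transfer_decay) (rule that, assumption+)
  have sh: "square_integrable circ (transfer n h)" for n by (rule square_integrable_transfer[OF H.square_integrable])
  have sg: "square_integrable circ (transfer n (H.smoothing s))" if "0 < s" "s \<le> 1" for n s
    by (rule square_integrable_transfer[OF H.square_integrable_smoothing[OF that]])
  have diff: "osc z (\<lambda>x. ?c (transfer n h) x - ?c (transfer n (H.smoothing s)) x) \<le> 6 * C * s powr \<beta>"
    if z: "norm z < 1" and s: "0 < s" "s \<le> 1" for z n s
  proof -
    have t: "is_transfer n (\<lambda>x. h x - H.smoothing s x) (\<lambda>x. transfer n h x - transfer n (H.smoothing s) x)"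
      by (intro is_transfer_diff is_transfer_transfer H.square_integrable H.square_integrable_smoothing s)
    have "AE x in circ. \<bar>transfer n h x - transfer n (H.smoothing s) x\<bar> \<le> 3 * C * s powr \<beta>"
      by (rule is_transfer_bounded_AE[OF t square_integrable_diff[OF H.square_integrable H.square_integrable_smoothing[OF s]]])
        (use H.smoothing_approx s in auto)
    then have "AE x in circ. norm (?c (transfer n h) x - ?c (transfer n (H.smoothing s)) x) \<le> 3 * C * s powr \<beta>"
      by (simp flip: of_real_diff)
    from osc_le_AE_bound[OF z square_integrable_diff[OF sc[OF sh] sc[OF sg[OF s]]] this]
    show ?thesis using H.C by simp
  qed
  have bound: "osc z (?c (transfer n h)) \<le> 8 * (l2_norm circ h / s) * \<rho> ^ n + 6 * C * s powr \<beta>"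
    if z: "norm z < 1" and s: "0 < s" "s \<le> 1" for z n s
  proof -
    have "osc z (?c (transfer n h)) = osc z (\<lambda>x. (?c (transfer n h) x - ?c (transfer n (H.smoothing s)) x) + ?c (transfer n (H.smoothing s)) x)"
      by simp
    also have "\<dots> \<le> osc z (\<lambda>x. ?c (transfer n h) x - ?c (transfer n (H.smoothing s)) x) + osc z (?c (transfer n (H.smoothing s)))"
      by (rule osc_add[OF z]) (intro square_integrable_diff sc sh sg s)+
    also note diff[OF z s]
    also have "osc z (?c (transfer n (H.smoothing s))) \<le> 8 * sqrt ((l2_norm circ h / s)\<^sup>2) * \<rho> ^ n"
      by (rule D[OF H.square_integrable_smoothing[OF s] H.dirichlet_le_smoothing[OF s] z])
    also have "sqrt ((l2_norm circ h / s)\<^sup>2) = l2_norm circ h / s" using s by (simp add: l2_norm_nonneg)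
    finally show ?thesis by simp
  qed
  define q where "q = sqrt \<rho>"
  have q: "0 < q" "q < 1" "q * q = \<rho>" using \<rho> by (auto simp: q_def)
  \<comment> \<open>The two error terms at the scale \<open>s = q ^ n\<close>.\<close>
  define a where "a n = 8 * l2_norm circ h * q ^ n + 6 * C * (q powr \<beta>) ^ n" for n
  have "q powr \<beta> < 1" using powr_less_mono2[of \<beta> q 1] q H.\<beta> by simp
  then have "summable a"
    unfolding a_def using q by (intro summable_add summable_mult summable_geometric) auto
  moreover have "osc z (?c (transfer n h)) \<le> a n" if z: "norm z < 1" for n z
  proof -
    have "8 * (l2_norm circ h / q ^ n) * \<rho> ^ n = 8 * l2_norm circ h * (\<rho> ^ n / q ^ n)" by simp
    also have "\<rho> ^ n / q ^ n = q ^ n" using q by (simp flip: q(3) add: power_mult_distrib)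
    finally have "8 * (l2_norm circ h / q ^ n) * \<rho> ^ n = 8 * l2_norm circ h * q ^ n" .
    moreover have "(q ^ n) powr \<beta> = (q powr \<beta>) ^ n"
      using q by (simp add: powr_powr mult.commute flip: powr_realpow)
    ultimately show ?thesis
      using bound[OF z, of "q ^ n" n] q(1,2) by (simp only: a_def power_le_one less_imp_le zero_less_power)
  qed
  moreover have "vanishing_osc (?c (transfer n h))" for n
  proof (rule vanishing_osc_approx[OF sc[OF sh]])
    fix e :: real assume e: "0 < e"
    have C6: "0 \<le> 6 * C" using H.C by simp
    obtain \<delta> where \<delta>: "0 < \<delta>" "\<delta> < 1" "\<And>t. 0 \<le> t \<Longrightarrow> t \<le> \<delta> \<Longrightarrow> 6 * C * t powr \<beta> < e"
      by (rule H.small_powr[OF e C6]) (rule that, assumption+)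
    have d: "0 < \<delta>" "\<delta> \<le> 1" using \<delta> by auto
    show "\<exists>g. square_integrable circ g \<and> vanishing_osc g \<and> (\<forall>z. norm z < 1 \<longrightarrow> osc z (\<lambda>x. ?c (transfer n h) x - g x) \<le> e)"
    proof (intro exI[of _ "?c (transfer n (H.smoothing \<delta>))"] conjI allI impI sc sg d)
      show "vanishing_osc (?c (transfer n (H.smoothing \<delta>)))"
        by (rule V[OF H.square_integrable_smoothing[OF d] H.dirichlet_le_smoothing[OF d]])
      fix z :: complex assume "norm z < 1"
      from diff[OF this d] show "osc z (\<lambda>x. ?c (transfer n h) x - ?c (transfer n (H.smoothing \<delta>)) x) \<le> e"
        using \<delta>(3)[of \<delta>] \<delta>(1) by (auto intro: order_trans less_imp_le)
    qed
  qed
  ultimately show ?thesis by (rule that)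
qed

end

section \<open>Lebesgue measurable observables and convergence in distribution\<close>

lemma borel_measurable_completion_AE:
  assumes f: "f \<in> borel_measurable (completion M)" and e: "AE x in M. f x = g x"
  shows "g \<in> borel_measurable (completion M)"
proof (rule measurableI)
  fix A :: "'b set" assume A: "A \<in> sets borel"
  show "g -` A \<inter> space (completion M) \<in> sets (completion M)"
  proof (rule completion.in_sets_AE)
    show "f -` A \<inter> space (completion M) \<in> sets (completion M)" by (rule measurable_sets[OF f A])
    show "AE x in completion M. x \<in> f -` A \<inter> space (completion M) \<longleftrightarrow> x \<in> g -` A \<inter> space (completion M)"
      using AE_completion[OF e] by eventually_elim auto
  qed simp
qed simp

lemma borel_measurable_circle_measureI:
  assumes "f \<in> borel_measurable circ" "AE x in circ. g x = f x"
  shows "g \<in> borel_measurable circle_measure"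
proof -
  have "AE x in circ. f x = g x" using assms(2) by eventually_elim simp
  from borel_measurable_completion_AE[OF measurable_completion[OF assms(1)] this]
  show ?thesis by (simp add: circle_measure_eq)
qed

lemma AE_circle_measureI: "AE x in circ. P x \<Longrightarrow> AE x in circle_measure. P x"
  unfolding circle_measure_eq by (rule AE_completion)

lemma integral_circle_measure:
  fixes f g :: "complex \<Rightarrow> 'b::{banach,second_countable_topology}"
  assumes f: "f \<in> borel_measurable circ" and e: "AE x in circ. g x = f x"
  shows "(LINT x|circle_measure. g x) = (LINT x|circ. f x)"
proof -
  have "(LINT x|circle_measure. g x) = (LINT x|circle_measure. f x)"
    by (rule integral_cong_AE)
      (use borel_measurable_circle_measureI[OF f e] borel_measurable_circle_measureI[OF f AE_I2[of circ "\<lambda>x. f x = f x"]]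
        AE_circle_measureI[OF e] in auto)
  also have "\<dots> = (LINT x|circ. f x)" unfolding circle_measure_eq by (rule integral_completion[OF f])
  finally show ?thesis .
qed

lemma integrable_circle_measure:
  fixes f g :: "complex \<Rightarrow> 'b::{banach,second_countable_topology}"
  assumes f: "f \<in> borel_measurable circ" and e: "AE x in circ. g x = f x"
  shows "integrable circle_measure g \<longleftrightarrow> integrable circ f"
proof -
  have "integrable circle_measure g \<longleftrightarrow> integrable circle_measure f"
    by (rule integrable_cong_AE)
      (use borel_measurable_circle_measureI[OF f e] borel_measurable_circle_measureI[OF f AE_I2[of circ "\<lambda>x. f x = f x"]]
        AE_circle_measureI[OF e] in auto)
  also have "\<dots> \<longleftrightarrow> integrable circ f" unfolding circle_measure_eq by (rule integrable_completion[OF f])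
  finally show ?thesis .
qed

lemma prob_space_circle_measure: "prob_space circle_measure"
proof
  have "emeasure (completion circ) (space circ) = emeasure circ (space circ)"
    by (subst emeasure_completion) (simp_all only: sets_completionI_sets sets.top main_part)
  then show "emeasure circle_measure (space circle_measure) = 1"
    by (simp only: circle_measure_eq space_completion circ.emeasure_space_1)
qed

lemma std_normal_scaled:
  assumes "0 < \<sigma>"
  shows "distr std_normal_distribution borel (\<lambda>x. \<sigma> * x) = density lborel (\<lambda>x. ennreal (normal_density 0 \<sigma> x))"
proof -
  interpret N: prob_space std_normal_distribution by (intro prob_space_normal_density) simp
  have "distributed std_normal_distribution lborel (\<lambda>x. x) (\<lambda>x. ennreal (normal_density 0 1 x))"
    by (simp add: distributed_def distr_id2)
  from N.normal_density_affine[OF this, of \<sigma> 0] assms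
  have "distr std_normal_distribution lborel (\<lambda>x. \<sigma> * x) = density lborel (\<lambda>x. ennreal (normal_density 0 \<sigma> x))"
    by (simp add: distributed_def)
  moreover have "distr std_normal_distribution borel (\<lambda>x. \<sigma> * x) = distr std_normal_distribution lborel (\<lambda>x. \<sigma> * x)"
    by (rule distr_cong) simp_all
  ultimately show ?thesis by simp
qed

lemma centered_gaussian_eq_distr:
  assumes "0 \<le> v"
  shows "centered_gaussian v = distr std_normal_distribution borel (\<lambda>x. sqrt v * x)"
proof (cases "v = 0")
  case True
  interpret N: prob_space std_normal_distribution by (intro prob_space_normal_density) simp
  have "distr std_normal_distribution borel (\<lambda>x. 0 :: real) = return borel 0"
    by (rule N.distr_const) simp
  then show ?thesis using True by (simp add: centered_gaussian_def)
next
  case False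
  then show ?thesis using std_normal_scaled[of "sqrt v"] assms by (simp add: centered_gaussian_def)
qed

lemma real_distribution_centered_gaussian:
  assumes "0 \<le> v"
  shows "real_distribution (centered_gaussian v)"
proof -
  interpret N: prob_space std_normal_distribution by (intro prob_space_normal_density) simp
  show ?thesis unfolding centered_gaussian_eq_distr[OF assms] by (rule N.real_distribution_distr) simp
qed

lemma char_centered_gaussian:
  assumes "0 \<le> v"
  shows "char (centered_gaussian v) t = exp (- (t\<^sup>2 * v / 2))"
proof -
  have "char (centered_gaussian v) t = char std_normal_distribution (t * sqrt v)"
    unfolding centered_gaussian_eq_distr[OF assms] char_def
    by (subst integral_distr) (simp_all add: mult_ac)
  also have "\<dots> = complex_of_real (exp (- (t\<^sup>2 * v / 2)))"
    unfolding char_std_normal_distribution using assms by (simp only: power_mult_distrib real_sqrt_pow2 minus_divide_left)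
  finally show ?thesis by (simp only: exp_of_real)
qed

context nonrotation_inner
begin

lemma AE_iterates: "AE x in circ. \<forall>k. (boundary_map F ^^ k) x = (T ^^ k) x"
proof -
  have "AE x in circ. \<forall>k. boundary_map F ((T ^^ k) x) = T ((T ^^ k) x)"
    unfolding AE_all_countable by (intro allI AE_iterate AE_boundary_map)
  then show ?thesis
  proof eventually_elim
    case (elim x)
    have "(boundary_map F ^^ k) x = (T ^^ k) x" for k
      by (induction k) (use elim in auto)
    then show ?case ..
  qed
qed

lemma AE_birkhoff_sum:
  assumes "AE x in circ. h x = h0 x"
  shows "AE x in circ. birkhoff_sum F h n x = birkhoff h0 n x"
proof -
  have "AE x in circ. \<forall>k. h ((T ^^ k) x) = h0 ((T ^^ k) x)"
    unfolding AE_all_countable by (intro allI AE_iterate assms)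
  then show ?thesis using AE_iterates
    by eventually_elim (simp add: birkhoff_sum_def birkhoff_def)
qed

text \<open>Levy's continuity theorem, after replacing the boundary map and the observable by their Borel versions.\<close>

lemma CLT_with_varianceI:
  assumes h0: "square_integrable circ h0" and e: "AE x in circ. h x = h0 x" and v: "0 \<le> v"
    and lim: "\<And>t. (\<lambda>n. LINT x|circ. iexp (t / sqrt (real n) * birkhoff (\<lambda>x. h0 x - (LINT y|circ. h0 y)) n x))
       \<longlonglongrightarrow> exp (- (t\<^sup>2 * v / 2))"
  shows "CLT_with_variance F h v"
proof -
  note h0m [measurable] = square_integrable_measurable[OF h0]
  interpret C: prob_space circle_measure by (rule prob_space_circle_measure)
  define m where "m = (LINT y|circ. h0 y)"
  have m: "(LINT y|circle_measure. h y) = m" unfolding m_def by (rule integral_circle_measure[OF h0m e])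
  have i: "integrable circle_measure h"
    using integrable_circle_measure[OF h0m e] circ.integrable_square_integrable[OF h0] by simp
  have bm [measurable]: "birkhoff h0 n \<in> borel_measurable circ" for n
    by (rule square_integrable_measurable[OF square_integrable_birkhoff[OF h0]])
  have meas [measurable]: "birkhoff_sum F h n \<in> borel_measurable circle_measure" for n
    by (rule borel_measurable_circle_measureI[OF bm AE_birkhoff_sum[OF e]])
  let ?X = "\<lambda>n x. (birkhoff_sum F h n x - real n * (LINT y|circle_measure. h y)) / sqrt (real n)"
  have char: "char (distr circle_measure borel (?X n)) t = (LINT x|circ. iexp (t / sqrt (real n) * birkhoff (\<lambda>x. h0 x - m) n x))" for n t
  proof -
    have "char (distr circle_measure borel (?X n)) t = (LINT x|circle_measure. iexp (t * ?X n x))"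
      unfolding char_def by (subst integral_distr) auto
    also have "\<dots> = (LINT x|circ. iexp (t / sqrt (real n) * birkhoff (\<lambda>x. h0 x - m) n x))"
    proof (rule integral_circle_measure)
      have eq: "birkhoff (\<lambda>x. h0 x - m) n x = birkhoff h0 n x - real n * m" for x
        by (simp add: birkhoff_def sum_subtractf)
      show "(\<lambda>x. iexp (t / sqrt (real n) * birkhoff (\<lambda>x. h0 x - m) n x)) \<in> borel_measurable circ"
        unfolding eq by measurable
      show "AE x in circ. iexp (t * ?X n x) = iexp (t / sqrt (real n) * birkhoff (\<lambda>x. h0 x - m) n x)"
        using AE_birkhoff_sum[OF e, of n] unfolding m by eventually_elim (simp add: eq)
    qed
    finally show ?thesis .
  qed
  have "weak_conv_m (\<lambda>n. distr circle_measure borel (?X n)) (centered_gaussian v)"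
  proof (rule levy_continuity)
    show "real_distribution (distr circle_measure borel (?X n))" for n
      by (rule C.real_distribution_distr) measurable
    show "real_distribution (centered_gaussian v)" by (rule real_distribution_centered_gaussian[OF v])
    show "(\<lambda>n. char (distr circle_measure borel (?X n)) t) \<longlonglongrightarrow> char (centered_gaussian v) t" for t
      unfolding char char_centered_gaussian[OF v] using lim[of t] by (simp add: m_def)
  qed
  then show ?thesis using i meas v by (simp add: CLT_with_variance_def)
qed

end

text \<open>The characteristic function at one argument already determines the variance.\<close>

lemma CLT_variance_unique:
  assumes 1: "CLT_with_variance F h v" and 2: "CLT_with_variance F h w"
  shows "v = w"
proof -
  interpret C: prob_space circle_measure by (rule prob_space_circle_measure)
  let ?X = "\<lambda>n x. (birkhoff_sum F h n x - real n * (LINT y|circle_measure. h y)) / sqrt (real n)"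
  have [measurable]: "birkhoff_sum F h n \<in> borel_measurable circle_measure" for n
    using 1 by (simp add: CLT_with_variance_def)
  have lim: "(\<lambda>n. char (distr circle_measure borel (?X n)) 1) \<longlonglongrightarrow> exp (- (1\<^sup>2 * u / 2))"
    if "CLT_with_variance F h u" for u
  proof -
    have u: "0 \<le> u" and conv: "weak_conv_m (\<lambda>n. distr circle_measure borel (?X n)) (centered_gaussian u)"
      using that by (simp_all add: CLT_with_variance_def)
    show ?thesis
      unfolding char_centered_gaussian[OF u, symmetric]
      by (rule levy_continuity1[OF _ real_distribution_centered_gaussian[OF u] conv])
        (rule C.real_distribution_distr, measurable)
  qed
  from LIMSEQ_unique[OF lim[OF 1] lim[OF 2]]
  have "complex_of_real (exp (- (1\<^sup>2 * v / 2))) = complex_of_real (exp (- (1\<^sup>2 * w / 2)))" by (simp only: exp_of_real)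
  then show ?thesis by (simp only: of_real_eq_iff exp_inj_iff) simp
qed

section \<open>The limit theorem for multipliers and for Hoelder functions\<close>

context nonrotation_inner
begin

lemma CLT_from_oscillation:
  assumes h0: "square_integrable circ h0" and e: "AE x in circ. h x = h0 x"
    and m: "m = (LINT x|circ. h0 x)"
    and a: "summable a" "\<And>n z. norm z < 1 \<Longrightarrow> osc z (\<lambda>x. complex_of_real (transfer n (\<lambda>x. h0 x - m) x)) \<le> a n"
    and v: "\<And>n. vanishing_osc (\<lambda>x. complex_of_real (transfer n (\<lambda>x. h0 x - m) x))"
  shows "CLT_holds F h"
    and "\<not> finite_blaschke_product F \<Longrightarrow> \<not> (AE x in circ. h0 x = m) \<Longrightarrow> CLT_with_variance F h w \<Longrightarrow> w \<noteq> 0"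
proof -
  let ?g = "\<lambda>x. h0 x - m"
  have g: "square_integrable circ ?g" by (intro square_integrable_diff h0 circ.square_integrable_const)
  have mg: "(LINT x|circ. ?g x) = 0"
    using circ.integrable_square_integrable[OF h0] circ.prob_space by (simp add: m)
  obtain \<sigma> where \<sigma>: "0 \<le> \<sigma>"
    and lim: "\<And>t. (\<lambda>n. LINT x|circ. iexp (t / sqrt (real n) * birkhoff ?g n x)) \<longlonglongrightarrow> exp (- (t\<^sup>2 * \<sigma>\<^sup>2 / 2))"
    and deg: "\<sigma> = 0 \<Longrightarrow> (\<lambda>N. l2_norm circ (gordin ?g N)) \<longlonglongrightarrow> 0"
    by (rule characteristic_function_limit[OF g mg a]) (assumption, rule that, assumption+)
  have clt: "CLT_with_variance F h (\<sigma>\<^sup>2)"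
    by (rule CLT_with_varianceI[OF h0 e]) (use lim in \<open>simp_all add: m\<close>)
  then show "CLT_holds F h" unfolding CLT_holds_def ..
  assume nb: "\<not> finite_blaschke_product F" and nc: "\<not> (AE x in circ. h0 x = m)"
    and w: "CLT_with_variance F h w"
  show "w \<noteq> 0"
  proof
    assume "w = 0"
    then have "\<sigma> = 0" using CLT_variance_unique[OF w clt] by simp
    from deg[OF this] have "l2_norm circ ?g = 0"
      by (intro gordin_tendsto_zero_imp_zero[OF g mg a(1) _ _ nb]) (rule a(2), assumption, rule v)
    then have "(LINT x|circ. (norm (?g x))\<^sup>2) = 0" by (subst l2_norm_sq[symmetric]) simp
    then have "AE x in circ. (norm (?g x))\<^sup>2 = 0"
      using integral_nonneg_eq_0_iff_AE[OF square_integrable_sq[OF g]] by simp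
    then have "AE x in circ. h0 x = m" by eventually_elim simp
    with nc show False ..
  qed
qed

end

text \<open>A multiplier lies in the space itself, since constants do.\<close>

lemma sobolev_multiplier_in_sobolev_half:
  assumes "\<gamma> \<in> sobolev_multipliers"
  shows "\<gamma> \<in> sobolev_half"
proof -
  interpret C: prob_space circle_measure by (rule prob_space_circle_measure)
  have "fourier_coefficient (\<lambda>x. 1) n = (if n = 0 then 1 else 0)" for n
  proof -
    have "fourier_coefficient (\<lambda>x. 1) n = (LINT x|circ. zpow x (- n))"
      unfolding fourier_coefficient_def
      by (rule integral_circle_measure)
        (use square_integrable_measurable[OF square_integrable_zpow] in \<open>auto simp: zpow_circle intro!: AE_I2\<close>)
    also have "\<dots> = fourier (\<lambda>x. \<Sum>j\<in>{0}. 1 * zpow x j) n"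
      unfolding fourier_def by (simp add: zpow_def)
    also have "\<dots> = (if n = 0 then 1 else 0)" by (subst fourier_zpow_sum) auto
    finally show ?thesis .
  qed
  then have "(\<lambda>n::int. \<bar>of_int n\<bar> * (norm (fourier_coefficient (\<lambda>x. 1) n))\<^sup>2) = (\<lambda>n. 0 :: real)"
    by (auto simp: fun_eq_iff)
  then have "(\<lambda>x. 1) \<in> sobolev_half"
    by (simp add: sobolev_half_def circle_L2_def)
  moreover have "\<forall>g\<in>sobolev_half. (\<lambda>x. g x * \<gamma> x) \<in> sobolev_half"
    using assms by (simp add: sobolev_multipliers_def)
  ultimately have "(\<lambda>x. 1 * \<gamma> x) \<in> sobolev_half" by (rule bspec[rotated])
  then show ?thesis by simp
qed

lemma sobolev_half_dirichlet:
  fixes h :: "complex \<Rightarrow> real"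
  assumes "(\<lambda>x. complex_of_real (h x)) \<in> sobolev_half"
  obtains h0 B where "square_integrable circ h0" "AE x in circ. h x = h0 x" "dirichlet_le (\<lambda>x. complex_of_real (h0 x)) B"
proof -
  let ?h = "\<lambda>x. complex_of_real (h x)"
  have hm: "?h \<in> borel_measurable circle_measure" and hi: "integrable circle_measure (\<lambda>x. (norm (?h x))\<^sup>2)"
    and hs: "(\<lambda>n::int. \<bar>of_int n\<bar> * (norm (fourier_coefficient ?h n))\<^sup>2) summable_on UNIV"
    using assms by (simp_all add: sobolev_half_def circle_L2_def)
  have "(\<lambda>x. Re (?h x)) \<in> borel_measurable (completion circ)"
    using hm by (intro measurable_compose[OF _ borel_measurable_Re]) (simp add: circle_measure_eq)
  then have "h \<in> borel_measurable (completion circ)" by simp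
  then obtain h0 where h0 [measurable]: "h0 \<in> borel_measurable circ" and e: "AE x in circ. h x = h0 x"
    using completion_ex_borel_measurable_real by blast
  have "integrable circ (\<lambda>x. (norm (complex_of_real (h0 x)))\<^sup>2)"
  proof (rule integrable_circle_measure[THEN iffD1, OF _ _ hi])
    show "AE x in circ. (norm (?h x))\<^sup>2 = (norm (complex_of_real (h0 x)))\<^sup>2" using e by eventually_elim simp
  qed measurable
  then have s: "square_integrable circ h0" by (simp add: square_integrable_def h0)
  have "fourier_coefficient ?h k = fourier (\<lambda>x. complex_of_real (h0 x)) k" for k
    unfolding fourier_coefficient_def fourier_def
  proof (rule integral_circle_measure)
    have [measurable]: "(\<lambda>x. zpow x (- k)) \<in> borel_measurable circ"
      by (rule square_integrable_measurable[OF square_integrable_zpow])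
    show "(\<lambda>x. complex_of_real (h0 x) * zpow x (- k)) \<in> borel_measurable circ" by measurable
    have "AE x in circ. norm x = 1" by (rule AE_I2) simp
    with e show "AE x in circ. ?h x * x powi - k = complex_of_real (h0 x) * zpow x (- k)"
      by eventually_elim (simp add: zpow_circle)
  qed
  then have hs: "(\<lambda>n::int. \<bar>of_int n\<bar> * (norm (fourier (\<lambda>x. complex_of_real (h0 x)) n))\<^sup>2) summable_on UNIV"
    using hs by simp
  have "dirichlet_le (\<lambda>x. complex_of_real (h0 x)) (infsum (\<lambda>n::int. \<bar>of_int n\<bar> * (norm (fourier (\<lambda>x. complex_of_real (h0 x)) n))\<^sup>2) UNIV)"
    unfolding dirichlet_le_def
  proof
    fix N
    have "(\<Sum>k = - int N..int N. real (nat \<bar>k\<bar>) * (norm (fourier (\<lambda>x. complex_of_real (h0 x)) k))\<^sup>2) =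
      (\<Sum>k = - int N..int N. \<bar>of_int k\<bar> * (norm (fourier (\<lambda>x. complex_of_real (h0 x)) k))\<^sup>2)"
      by (intro sum.cong) auto
    also have "\<dots> \<le> infsum (\<lambda>n::int. \<bar>of_int n\<bar> * (norm (fourier (\<lambda>x. complex_of_real (h0 x)) n))\<^sup>2) UNIV"
      by (rule finite_sum_le_infsum[OF hs]) auto
    finally show "(\<Sum>k = - int N..int N. real (nat \<bar>k\<bar>) * (norm (fourier (\<lambda>x. complex_of_real (h0 x)) k))\<^sup>2) \<le>
      infsum (\<lambda>n::int. \<bar>of_int n\<bar> * (norm (fourier (\<lambda>x. complex_of_real (h0 x)) n))\<^sup>2) UNIV" .
  qed
  then show ?thesis by (rule that[OF s e])
qed

lemma dirichlet_le_diff_const: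
  assumes f: "square_integrable circ f" and B: "dirichlet_le f B"
  shows "dirichlet_le (\<lambda>x. f x - c) B"
proof -
  have "fourier (\<lambda>x. c) k = 0" if "k \<noteq> 0" for k
  proof -
    have "fourier (\<lambda>x. \<Sum>j\<in>{0}. c * zpow x j) k = 0" using that by (subst fourier_zpow_sum) auto
    then show ?thesis by (simp add: zpow_def)
  qed
  then have eq: "real (nat \<bar>k\<bar>) * (norm (fourier (\<lambda>x. f x - c) k))\<^sup>2 = real (nat \<bar>k\<bar>) * (norm (fourier f k))\<^sup>2" for k
    by (cases "k = 0") (simp_all add: fourier_diff[OF f circ.square_integrable_const])
  show ?thesis using B unfolding dirichlet_le_def eq .
qed

context nonrotation_inner
begin

lemma CLT_sobolev:
  assumes "(\<lambda>x. complex_of_real (h x)) \<in> sobolev_half"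
  shows "CLT_holds F h"
    and "\<not> finite_blaschke_product F \<Longrightarrow> \<not> (\<exists>c. AE x in circle_measure. h x = c) \<Longrightarrow> CLT_with_variance F h w \<Longrightarrow> w \<noteq> 0"
proof -
  obtain h0 B where h0: "square_integrable circ h0" and e: "AE x in circ. h x = h0 x"
    and B: "dirichlet_le (\<lambda>x. complex_of_real (h0 x)) B"
    by (rule sobolev_half_dirichlet[OF assms])
  define m where "m = (LINT x|circ. h0 x)"
  have g: "square_integrable circ (\<lambda>x. h0 x - m)" by (intro square_integrable_diff h0 circ.square_integrable_const)
  have Bg: "dirichlet_le (\<lambda>x. complex_of_real (h0 x - m)) B"
    unfolding of_real_diff by (rule dirichlet_le_diff_const[OF _ B]) (simp add: square_integrable_of_real h0)
  obtain \<rho> where \<rho>: "0 < \<rho>" "\<rho> < 1"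
    and D: "\<And>f B n z. square_integrable circ f \<Longrightarrow> dirichlet_le (\<lambda>x. complex_of_real (f x)) B \<Longrightarrow> norm z < 1 \<Longrightarrow>
       osc z (\<lambda>x. complex_of_real (transfer n f x)) \<le> 8 * sqrt B * \<rho> ^ n"
    and V: "\<And>f B n. square_integrable circ f \<Longrightarrow> dirichlet_le (\<lambda>x. complex_of_real (f x)) B \<Longrightarrow>
       vanishing_osc (\<lambda>x. complex_of_real (transfer n f x))"
    by (rule osc_transfer_decay) (rule that, assumption+)
  have s: "summable (\<lambda>n. 8 * sqrt B * \<rho> ^ n)" using \<rho> by (intro summable_mult summable_geometric) auto
  show "CLT_holds F h"
    by (rule CLT_from_oscillation(1)[OF h0 e m_def s]) (rule D[OF g Bg], assumption, rule V[OF g Bg])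
  assume nb: "\<not> finite_blaschke_product F" and nc: "\<not> (\<exists>c. AE x in circle_measure. h x = c)" and w: "CLT_with_variance F h w"
  have "\<not> (AE x in circ. h0 x = m)"
  proof
    assume "AE x in circ. h0 x = m"
    with e have "AE x in circ. h x = m" by eventually_elim simp
    from AE_circle_measureI[OF this] nc show False by blast
  qed
  then show "w \<noteq> 0"
    by (rule CLT_from_oscillation(2)[OF h0 e m_def s _ _ nb _ w, rotated 2]) (rule D[OF g Bg], assumption, rule V[OF g Bg])
qed

lemma CLT_holder:
  assumes "0 < \<alpha>" "holder_on \<alpha> (sphere 0 1) h"
  shows "CLT_holds F h"
    and "\<not> finite_blaschke_product F \<Longrightarrow> \<not> h constant_on sphere 0 1 \<Longrightarrow> CLT_with_variance F h w \<Longrightarrow> w \<noteq> 0"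
proof -
  obtain \<beta> C where bC: "0 < \<beta>" "\<beta> \<le> 1" "0 \<le> C"
    "\<And>x y. norm x = 1 \<Longrightarrow> norm y = 1 \<Longrightarrow> \<bar>h x - h y\<bar> \<le> C * dist x y powr \<beta>"
    by (rule holder_on_circle[OF assms(2,1)]) (rule that, assumption+)
  interpret H: holder_circle h \<beta> C by unfold_locales (use bC in auto)
  define m where "m = (LINT x|circ. h x)"
  have "holder_circle (\<lambda>x. h x - m) \<beta> C" by unfold_locales (use bC in auto)
  then obtain a where a: "summable a" "\<And>n z. norm z < 1 \<Longrightarrow> osc z (\<lambda>x. complex_of_real (transfer n (\<lambda>x. h x - m) x)) \<le> a n"
    "\<And>n. vanishing_osc (\<lambda>x. complex_of_real (transfer n (\<lambda>x. h x - m) x))"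
    by (rule osc_transfer_holder) (rule that, assumption+)
  have e: "AE x in circ. h x = h x" by simp
  show "CLT_holds F h"
    by (rule CLT_from_oscillation(1)[OF H.square_integrable e m_def a(1)]) (rule a(2), assumption, rule a(3))
  assume nb: "\<not> finite_blaschke_product F" and nc: "\<not> h constant_on sphere 0 1" and w: "CLT_with_variance F h w"
  from nc have "\<not> (AE x in circ. h x = m)" using H.AE_constant_imp_constant by blast
  then show "w \<noteq> 0"
    by (rule CLT_from_oscillation(2)[OF H.square_integrable e m_def a(1) _ _ nb _ w, rotated 2]) (rule a(2), assumption, rule a(3))
qed

end

theorem theorem1p2:
  fixes F :: "complex \<Rightarrow> complex"
  assumes "inner_function F" and "F 0 = 0" and "\<not> disk_rotation F"
  shows "(\<forall>h :: complex \<Rightarrow> real.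
            (\<lambda>x. complex_of_real (h x)) \<in> sobolev_multipliers \<longrightarrow>
              CLT_holds F h \<and>
              (\<not> finite_blaschke_product F \<and> \<not> (\<exists>c. AE x in circle_measure. h x = c) \<longrightarrow>
                 (\<forall>v. CLT_with_variance F h v \<longrightarrow> v \<noteq> 0))) \<and>
         (\<forall>(h :: complex \<Rightarrow> real) \<alpha>. \<alpha> > 0 \<and> holder_on \<alpha> (sphere 0 1) h \<longrightarrow>
              CLT_holds F h \<and>
              (\<not> finite_blaschke_product F \<and> \<not> h constant_on sphere 0 1 \<longrightarrow>
                 (\<forall>v. CLT_with_variance F h v \<longrightarrow> v \<noteq> 0)))"
proof -
  have F: "nonrotation_inner F" by (rule nonrotation_inner.intro[OF assms])
  note sobolev = nonrotation_inner.CLT_sobolev[OF F sobolev_multiplier_in_sobolev_half]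
  note holder = nonrotation_inner.CLT_holder[OF F]
  show ?thesis
  proof (intro conjI allI impI)
    fix h :: "complex \<Rightarrow> real" and v
    assume h: "(\<lambda>x. complex_of_real (h x)) \<in> sobolev_multipliers"
    show "CLT_holds F h" by (rule sobolev(1)[OF h])
    assume "\<not> finite_blaschke_product F \<and> \<not> (\<exists>c. AE x in circle_measure. h x = c)" "CLT_with_variance F h v"
    then show "v \<noteq> 0" by (elim conjE) (rule sobolev(2)[OF h])
  next
    fix h :: "complex \<Rightarrow> real" and \<alpha> v :: real
    assume h: "0 < \<alpha> \<and> holder_on \<alpha> (sphere 0 1) h"
    show "CLT_holds F h" by (rule holder(1)[OF conjunct1[OF h] conjunct2[OF h]])
    assume "\<not> finite_blaschke_product F \<and> \<not> h constant_on sphere 0 1" "CLT_with_variance F h v"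
    then show "v \<noteq> 0" by (elim conjE) (rule holder(2)[OF conjunct1[OF h] conjunct2[OF h]])
  qed
qed

end
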